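(* Let $\{x_i,\widetilde V_i\}_{i=1}^N$ be an almost uniform Spherical Centroidal Voronoi-Delaunay decomposition (SCVT) of $\mathbb{S}^2$ with mesh size $h$. Let $f\in H^1_0(\mathbb{S}^2)$ and let $u\in H^2(\mathbb{S}^2)\cap H^1_0(\mathbb{S}^2)$ be the unique zero-mean solution of $-\Delta_s u=f$ on $\mathbb{S}^2$. Let $u_h\in\widetilde U_h$ be the unique solution of the discrete finite volume problem $$\overline{\mathcal A}_h(u_h,\widetilde I_h v_h)=(f,\widetilde I_h v_h)\quad\text{for all } v_h\in\widetilde U_h .$$ Then there exists a positive constant $C$, independent of $h$, such that $$\|u-u_h\|_{L^2(\mathbb{S}^2)}\le C h^2\left(\|u\|_{H^2(\mathbb{S}^2)}+\|f\|_{H^1(\mathbb{S}^2)}\right).$$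
   Context: Sphere and spaces. $\mathbb{S}^2=\{x\in\mathbb{R}^3:\|x\|=1\}$, with surface measure $ds$, geodesic distance $d(x,y)=\arccos\langle x,y\rangle$; $m_a$ and $m_l$ denote area and curve length. $\nabla_s u=\nabla u-(\nabla u\cdot \vec n)\vec n$ is the tangential gradient ($\vec n$ the outer unit normal of $\mathbb{S}^2$), $\Delta_s=\nabla_s\cdot\nabla_s$. $L^p(\mathbb{S}^2)$, $W^{k,p}(\mathbb{S}^2)$, $H^k=W^{k,2}$ are the usual Sobolev spaces on the sphere, $(u,v)=\int_{\mathbb{S}^2}uv\,ds$, and here $H^1_0(\mathbb{S}^2)=\{u\in H^1(\mathbb{S}^2):\int_{\mathbb{S}^2}u\,ds=0\}$. Voronoi-Delaunay decomposition. Given distinct points (vertices) $x_1,\dots,x_N\in\mathbb{S}^2$, the Voronoi cells are $\widetilde V_i=\{x\in\mathbb{S}^2: d(x,x_i)<d(x,x_j)\ \forall j\ne i\}$. The Voronoi edge is $\widetilde\Gamma_{ij}=\mathrm{cl}(\widetilde V_i)\cap\mathrm{cl}(\widetilde V_j)$ and $\Lambda(i)=\{j\neq i: m_l(\widetilde\Gamma_{ij})>0\}$ is the set of neighbors of $i$, so $\partial\widetilde V_i=\bigcup_{j\in\Lambda(i)}\widetilde\Gamma_{ij}$. The dual Delaunay decomposition $\widetilde{\mathcal T}_h$ consists of geodesic triangles $\widetilde T_{ijk}$ with mutually neighboring vertices $x_i,x_j,x_k$, and these triangles tile $\mathbb{S}^2$. The mesh size is $h=\max_i\max_{x\in\widetilde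 V_i}d(x_i,x)$. The decomposition is almost uniform if there are positive constants $C_0,C_1$ independent of $h$ with $h/C_0\le m_l(\widetilde\Gamma_{ij})\le C_0h$ and $h^2/C_1\le m_a(\widetilde V_i)\le C_1h^2$ for all $i$ and $j\in\Lambda(i)$. Constants "independent of $h$" may depend on these uniformity constants, but not on the decomposition otherwise nor on the functions involved. SCVT. The decomposition is an SCVT if each vertex $x_i$ is the constrained centroid of its cell $\widetilde V_i$, i.e. the minimizer over $x\in\mathbb{S}^2$ of $F(x)=\int_{\widetilde V_i}\|y-x\|^2\,ds(y)$. Discrete spaces. Let $T_{ijk}$ be the planar triangle with the same vertices as $\widetilde T_{ijk}$, $\mathbf S_h=\bigcup T_{ijk}$ the resulting polyhedral surface, and $\mathcal P:\mathbf S_h\to\mathbb{S}^2$, $\mathcal P(x^* )=x^*/\|x^*\|$, the (bijective) radial projection. $\widetilde U_h$ is the space of functions $u_h=\bar u_h\circ\mathcal P^{-1}$ with $\bar u_h$ continuous on $\mathbf S_h$ and affine on each $T_{ijk}$, such that $\int_{\mathbb{S}^2}u_h\,ds=0$. For $v_h\in\widetilde U_h$, $\widetilde I_hv_h$ is the piecewise constant function equal to $v_h(x_i)$ on $\widetilde V_i$. Finite volume form. $\overline{\mathcal F}_{ij}(u_h)=-m_l(\widetilde\Gamma_{ij})\dfrac{u_h(x_j)-u_h(x_i)}{\|x_j-x_i\|}$ and $\overline{\mathcal A}_h(u_h,\widetilde I_hv_h)=\sum_{i=1}^N v_h(x_i)\sum_{j\in\Lambda(i)}\overline{\mathcal F}_{ij}(u_h)$.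 *)

theory Defs
  imports "HOL-Analysis.Analysis"
begin

section \<open>Measures on the unit sphere of \<open>\<real>\<^sup>3\<close>\<close>

abbreviation S2 :: "(real^3) set" where
  "S2 \<equiv> sphere 0 1"

(* Surface measure in polar coordinates: the area of A is three times the volume of the
   cone { r y | y in A, 0 < r <= 1 }.  On nonzero vectors, sgn y = y / norm y. *)
definition surf :: "(real^3) measure" where
  "surf = scale_measure 3
     (distr (restrict_space lborel (cball 0 1 - {0})) (restrict_space borel S2) sgn)"

abbreviation area :: "(real^3) set \<Rightarrow> real" where
  "area A \<equiv> measure surf A"

definition geodist :: "real^3 \<Rightarrow> real^3 \<Rightarrow> real" where
  "geodist x y = arccos (x \<bullet> y)"

definition hausdorff1_pre :: "real \<Rightarrow> 'a::metric_space set \<Rightarrow> ennreal" where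
  "hausdorff1_pre \<delta> A =
     (INF U \<in> {U :: nat \<Rightarrow> 'a set. A \<subseteq> (\<Union>n. U n) \<and> (\<forall>n. bounded (U n) \<and> diameter (U n) \<le> \<delta>)}.
        \<Sum>n. ennreal (diameter (U n)))"

definition hausdorff1 :: "'a::metric_space set \<Rightarrow> ennreal" where
  "hausdorff1 A = (SUP \<delta> \<in> {0<..}. hausdorff1_pre \<delta> A)"

(* Only applied to Voronoi edges; these lie on great circles and have finite length. *)
definition curve_length :: "'a::metric_space set \<Rightarrow> real" where
  "curve_length A = enn2real (hausdorff1 A)"


section \<open>Sobolev spaces on the sphere\<close>

text \<open>
  Functions on the sphere are functions on \<open>\<real>\<^sup>3\<close> of which only the values on \<open>S2\<close> matter;
  elements of \<open>L\<^sup>2\<close> and of the Sobolev spaces are represented by Borel functions,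
  not by classes of almost everywhere equal functions.
\<close>

definition L2_sphere :: "(real^3 \<Rightarrow> real) set" where
  "L2_sphere = {u \<in> borel_measurable surf. integrable surf (\<lambda>y. (u y)\<^sup>2)}"

definition L2_norm :: "(real^3 \<Rightarrow> real) \<Rightarrow> real" where
  "L2_norm u = sqrt (\<integral>y. (u y)\<^sup>2 \<partial>surf)"

(* Tangential part at y of a vector; the outer unit normal of the sphere at y is y itself. *)
definition tangential :: "real^3 \<Rightarrow> real^3 \<Rightarrow> real^3" where
  "tangential y v = v - (v \<bullet> y) *\<^sub>R y"

(* Integration by parts on the closed surface S2, whose normal y has divergence 2:
   the integral of grad_s (u phi) equals the integral of 2 u phi y, componentwise.
   Every C^1 function on S2 extends to a C^1 function phi on R^3. *)
definition has_weak_gradient :: "(real^3 \<Rightarrow> real) \<Rightarrow> (real^3 \<Rightarrow> real^3) \<Rightarrow> bool" where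
  "has_weak_gradient u g \<longleftrightarrow> integrable surf u \<and> integrable surf g \<and>
     (\<forall>\<phi> G. (\<forall>y. GDERIV \<phi> y :> G y) \<and> continuous_on UNIV G \<longrightarrow>
        (\<integral>y. \<phi> y *\<^sub>R g y \<partial>surf) =
        (\<integral>y. (2 * u y * \<phi> y) *\<^sub>R y - u y *\<^sub>R tangential y (G y) \<partial>surf))"

(* A weak gradient is unique up to null sets, which no notion below can see. *)
definition grad_s :: "(real^3 \<Rightarrow> real) \<Rightarrow> real^3 \<Rightarrow> real^3" where
  "grad_s u = (SOME g. has_weak_gradient u g)"

(* H^k: all iterated tangential partial derivatives (components of grad_s) up to order k
   exist weakly and lie in L^2. *)
primrec in_sobolev :: "nat \<Rightarrow> (real^3 \<Rightarrow> real) \<Rightarrow> bool" where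
  "in_sobolev 0 u \<longleftrightarrow> u \<in> L2_sphere"
| "in_sobolev (Suc k) u \<longleftrightarrow> u \<in> L2_sphere \<and>
     (\<exists>g. has_weak_gradient u g \<and> (\<forall>m. in_sobolev k (\<lambda>y. g y $ m)))"

definition sobolev :: "nat \<Rightarrow> (real^3 \<Rightarrow> real) set" where
  "sobolev k = {u. in_sobolev k u}"

(* Unfolds to the square root of the sum of the squared L^2 norms of all iterated
   derivatives of order at most k. *)
primrec sobolev_norm :: "nat \<Rightarrow> (real^3 \<Rightarrow> real) \<Rightarrow> real" where
  "sobolev_norm 0 u = L2_norm u"
| "sobolev_norm (Suc k) u =
     sqrt ((L2_norm u)\<^sup>2 + (\<Sum>m\<in>UNIV. (sobolev_norm k (\<lambda>y. grad_s u y $ m))\<^sup>2))"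

definition zero_mean :: "(real^3 \<Rightarrow> real) \<Rightarrow> bool" where
  "zero_mean u \<longleftrightarrow> integrable surf u \<and> (\<integral>y. u y \<partial>surf) = 0"

definition H1_0 :: "(real^3 \<Rightarrow> real) set" where
  "H1_0 = {u \<in> sobolev 1. zero_mean u}"

definition laplace_s :: "(real^3 \<Rightarrow> real) \<Rightarrow> real^3 \<Rightarrow> real" where
  "laplace_s u y = (\<Sum>m\<in>UNIV. grad_s (\<lambda>z. grad_s u z $ m) y $ m)"


section \<open>Voronoi-Delaunay decompositions\<close>

text \<open>The vertices are \<open>x 1, \<dots>, x N\<close>; other values of \<open>x\<close> are irrelevant.\<close>

definition voronoi_cell :: "nat \<Rightarrow> (nat \<Rightarrow> real^3) \<Rightarrow> nat \<Rightarrow> (real^3) set" where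
  "voronoi_cell N x i =
     {y \<in> S2. \<forall>j\<in>{1..N} - {i}. geodist y (x i) < geodist y (x j)}"

definition voronoi_edge :: "nat \<Rightarrow> (nat \<Rightarrow> real^3) \<Rightarrow> nat \<Rightarrow> nat \<Rightarrow> (real^3) set" where
  "voronoi_edge N x i j = closure (voronoi_cell N x i) \<inter> closure (voronoi_cell N x j)"

definition neighbors :: "nat \<Rightarrow> (nat \<Rightarrow> real^3) \<Rightarrow> nat \<Rightarrow> nat set" where
  "neighbors N x i = {j \<in> {1..N} - {i}. curve_length (voronoi_edge N x i j) > 0}"

(* A triangle is given by the set of its three indices.  Duality requires the three mutually
   neighboring cells to meet in a Voronoi vertex: the three neighbors of a vertex with exactly
   three neighbors may be mutually neighboring without spanning a Delaunay triangle. *)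
definition delaunay :: "nat \<Rightarrow> (nat \<Rightarrow> real^3) \<Rightarrow> nat set set" where
  "delaunay N x = {t. t \<subseteq> {1..N} \<and> card t = 3 \<and>
     (\<forall>i\<in>t. \<forall>j\<in>t. i \<noteq> j \<longrightarrow> j \<in> neighbors N x i) \<and>
     (\<Inter>i\<in>t. closure (voronoi_cell N x i)) \<noteq> {}}"

definition planar_triangle :: "(nat \<Rightarrow> real^3) \<Rightarrow> nat set \<Rightarrow> (real^3) set" where
  "planar_triangle x t = convex hull (x ` t)"

(* The radial projection is sgn. *)
definition geodesic_triangle :: "(nat \<Rightarrow> real^3) \<Rightarrow> nat set \<Rightarrow> (real^3) set" where
  "geodesic_triangle x t = sgn ` planar_triangle x t"

definition tiles_sphere :: "(real^3) set set \<Rightarrow> bool" where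
  "tiles_sphere \<T> \<longleftrightarrow> \<Union>\<T> = S2 \<and>
     (\<forall>A\<in>\<T>. \<forall>B\<in>\<T>. A \<noteq> B \<longrightarrow>
        (top_of_set S2 interior_of A) \<inter> (top_of_set S2 interior_of B) = {})"

definition voronoi_delaunay :: "nat \<Rightarrow> (nat \<Rightarrow> real^3) \<Rightarrow> bool" where
  "voronoi_delaunay N x \<longleftrightarrow> x ` {1..N} \<subseteq> S2 \<and> inj_on x {1..N} \<and>
     tiles_sphere (geodesic_triangle x ` delaunay N x)"

definition mesh_size :: "nat \<Rightarrow> (nat \<Rightarrow> real^3) \<Rightarrow> real" where
  "mesh_size N x = Max ((\<lambda>i. SUP y\<in>voronoi_cell N x i. geodist (x i) y) ` {1..N})"

definition almost_uniform :: "real \<Rightarrow> real \<Rightarrow> nat \<Rightarrow> (nat \<Rightarrow> real^3) \<Rightarrow> bool" where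
  "almost_uniform C0 C1 N x \<longleftrightarrow>
     (let h = mesh_size N x in
        (\<forall>i\<in>{1..N}. \<forall>j\<in>neighbors N x i.
           h / C0 \<le> curve_length (voronoi_edge N x i j) \<and>
           curve_length (voronoi_edge N x i j) \<le> C0 * h) \<and>
        (\<forall>i\<in>{1..N}.
           h\<^sup>2 / C1 \<le> area (voronoi_cell N x i) \<and>
           area (voronoi_cell N x i) \<le> C1 * h\<^sup>2))"

definition centroid_energy :: "(real^3) set \<Rightarrow> real^3 \<Rightarrow> real" where
  "centroid_energy V z = (\<integral>y. indicator V y * (norm (y - z))\<^sup>2 \<partial>surf)"

definition scvt :: "nat \<Rightarrow> (nat \<Rightarrow> real^3) \<Rightarrow> bool" where
  "scvt N x \<longleftrightarrow> (\<forall>i\<in>{1..N}.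
     is_arg_min (centroid_energy (voronoi_cell N x i)) (\<lambda>z. z \<in> S2) (x i))"


section \<open>The finite volume scheme\<close>

definition polyhedral_surface :: "nat \<Rightarrow> (nat \<Rightarrow> real^3) \<Rightarrow> (real^3) set" where
  "polyhedral_surface N x = (\<Union>t\<in>delaunay N x. planar_triangle x t)"

definition affine_on :: "(real^3) set \<Rightarrow> (real^3 \<Rightarrow> real) \<Rightarrow> bool" where
  "affine_on T w \<longleftrightarrow> (\<exists>a b. \<forall>y\<in>T. w y = a \<bullet> y + b)"

definition fe_space :: "nat \<Rightarrow> (nat \<Rightarrow> real^3) \<Rightarrow> (real^3 \<Rightarrow> real) set" where
  "fe_space N x = {u. zero_mean u \<and>
     (\<exists>w. continuous_on (polyhedral_surface N x) w \<and>
          (\<forall>t\<in>delaunay N x. affine_on (planar_triangle x t) w) \<and>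
          (\<forall>y\<in>S2. u y = w (inv_into (polyhedral_surface N x) sgn y)))}"

(* The cells are pairwise disjoint, so this equals v (x i) on the i-th cell. *)
definition pw_const :: "nat \<Rightarrow> (nat \<Rightarrow> real^3) \<Rightarrow> (real^3 \<Rightarrow> real) \<Rightarrow> real^3 \<Rightarrow> real" where
  "pw_const N x v y = (\<Sum>i\<in>{1..N}. v (x i) * indicator (voronoi_cell N x i) y)"

definition flux :: "nat \<Rightarrow> (nat \<Rightarrow> real^3) \<Rightarrow> (real^3 \<Rightarrow> real) \<Rightarrow> nat \<Rightarrow> nat \<Rightarrow> real" where
  "flux N x u i j =
     - curve_length (voronoi_edge N x i j) * ((u (x j) - u (x i)) / norm (x j - x i))"

(* The second argument is a piecewise constant function w, evaluated at the vertices;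
   pw_const N x v takes the value v (x i) at x i. *)
definition fv_form ::
  "nat \<Rightarrow> (nat \<Rightarrow> real^3) \<Rightarrow> (real^3 \<Rightarrow> real) \<Rightarrow> (real^3 \<Rightarrow> real) \<Rightarrow> real" where
  "fv_form N x u w = (\<Sum>i\<in>{1..N}. w (x i) * (\<Sum>j\<in>neighbors N x i. flux N x u i j))"

definition fv_solution ::
  "nat \<Rightarrow> (nat \<Rightarrow> real^3) \<Rightarrow> (real^3 \<Rightarrow> real) \<Rightarrow> (real^3 \<Rightarrow> real) \<Rightarrow> bool" where
  "fv_solution N x f u \<longleftrightarrow> u \<in> fe_space N x \<and>
     (\<forall>v\<in>fe_space N x.
        fv_form N x u (pw_const N x v) = (\<integral>y. f y * pw_const N x v y \<partial>surf))"

end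

(* All test functions are polynomials on R^3: they are dense in L^2, Poisson's equation with a polynomial
   right-hand side of mean zero has a polynomial solution w (solve on homogeneous polynomials of each degree), and the
   rotational derivatives L_k, the components of y x grad, commute with the spherical Laplacian L_1^2 + L_2^2 + L_3^2
   and are antisymmetric for the surface integral.  This replaces elliptic regularity.

   With om the cotangent weight, the Voronoi edge between x_i and x_j splits along its two Delaunay triangles into arcs of
   length arctan (d om / c), where d = |x_i - x_j| and c is the distance of the plane of the triangle from the origin.
   On a fine mesh the finite volume form is thus, up to a relative error of order h^2, the Dirichlet form of the discrete
   function on the sphere.

   The L^2 error is tested against p = - Laplacian w (Aubin-Nitsche).  What remains beyond standard finite element
   estimates is the pairing of f with the sampling error of w at the generators: there the centroid property removes the
   first order Taylor term up to the oscillation of f grad w over a cell (Poincare inequality), which gives h^2 at the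
   expense of one derivative of f.  The centroid property also keeps generators apart: a neighbour too close to x_i would
   cut the cell to one side of x_i, which then is not the centroid.  This bounds the shape of the triangles.

   Meshes with h bounded below have boundedly many cells, and the discrete solution is bounded through the
   connectivity of the neighbour graph. *)
theory Submission
 imports Defs
begin

text \<open>Rotations preserve the surface measure, so integration by parts along a rotation is the
  invariance of an integral under a substitution. One of the two factors has only to be Lipschitz
  with a derivative almost everywhere; hence the formula holds for piecewise linear functions across
  all triangles at once, with no jump terms on the edges.

  Functions on the sphere are extended to be constant on rays. Surface integrals become Lebesgue
  integrals over cones in R^3, where triangles and Voronoi cells are convex, Taylor expansions and
  Poincare inequalities run along straight segments, and every change of variables is affine.

  The obstacle is that \<open>f\<close> and \<open>u\<close> have only weak derivatives and no point
  values. Neither is sampled: \<open>u\<close> enters through its pairing with Laplacians of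
  polynomials, and \<open>f\<close> is replaced by a polynomial \<open>g\<close> at L^2 distance of
  order h. The solution of Poisson's equation for \<open>g\<close> is a polynomial and can be
  sampled, and the first order error that this leaves in the discrete solution meets a second factor
  h in the duality argument.\<close>

notation inner (infixl ".*" 70)
notation abs ("|_|")
notation scaleR (infixr "*R" 75)
abbreviation (input) surf_integral :: "(real^3 => 'b::{banach,second_countable_topology}) => 'b" (binder "SI " 10) where "surf_integral == integral\<^sup>L surf"
abbreviation (input) lborel_nn_integral :: "('a::euclidean_space => ennreal) => ennreal" (binder "NI " 10) where "lborel_nn_integral == integral\<^sup>N lborel"
abbreviation (input) ind :: "'a set => 'a => 'b::zero_neq_one" where "ind == indicator"
lemmas LI_cong = Bochner_Integration.integral_cong and LI_sum = Bochner_Integration.integral_sum and LI_diff = Bochner_Integration.integral_diff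
 and LI_bound = Bochner_Integration.integrable_bound and LI_nonneg = Bochner_Integration.integral_nonneg

section \<open>The surface measure\<close>

text \<open>Lebesgue measure is recognised by its values on boxes, and the preimage of a box is its
  image under the inverse map. The formula is applied to scalings, rotations, orthonormal frames and
  contractions of a cone towards a ray.\<close>

lemma nn_integral_linear_change:
 fixes M :: "real^3 => real^3" and G :: "real^3 => ennreal"
 assumes lin: "linear M" and det: "det (matrix M) ~= 0" and G[measurable]: "G \<in> borel_measurable borel"
 shows "(NI y. G y) = ennreal |det (matrix M)| * (NI y. G (M y))"
proof -
 have contM: "continuous_on UNIV M" using lin by (simp add: linear_continuous_on linear_conv_bounded_linear)
 have M[measurable]: "M \<in> borel \<rightarrow>\<^sub>M borel"
  using contM by (rule borel_measurable_continuous_onI)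
 have inj: "inj M" using lin det by (simp add: det_nz_iff_inj)
 then obtain M' where lin': "linear M'" and inv1: "!!y. M (M' y) = y" and inv2: "!!y. M' (M y) = y"
  using linear_injective_isomorphism[OF lin] by blast
 have d1: "det (matrix M') * det (matrix M) = 1"
 proof -
  have "matrix (M' \<circ> M) = matrix M' ** matrix M" by (rule matrix_compose[OF lin lin'])
  moreover have "M' \<circ> M = id" using inv2 by auto
  ultimately show ?thesis by (metis det_mul det_I matrix_id_mat_1)
 qed
 have "lborel = density (distr lborel borel M) (%_. ennreal |det (matrix M)| )"
 proof (rule lborel_eqI)
  fix l u :: "real^3" assume le: "!!b. b \<in> Basis ==> l .* b <= u .* b"
  have img: "M -` box l u = M' ` box l u"
   using inv1 inv2 by (auto simp: image_iff) (metis)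
  have bb: "bounded (M' ` box l u)"
   using lin' by (intro bounded_linear_image) (auto simp: linear_conv_bounded_linear)
  have ms: "M -` box l u \<in> sets borel"
   using measurable_sets[OF M, of "box l u"] by simp
  have "measure lebesgue (M' ` box l u) = |det (matrix M')| * measure lebesgue (box l u)"
   by (rule measure_lebesgue_linear_transformation) (auto simp: lin')
  hence "measure lborel (M -` box l u) = |det (matrix M')| * measure lborel (box l u)"
   using ms img by (simp add: measure_completion)
  moreover have "emeasure lborel (M -` box l u) = ennreal (measure lborel (M -` box l u))"
   using emeasure_bounded_finite[OF bb] img by (simp add: emeasure_eq_ennreal_measure top.not_eq_extremum)
  ultimately have "emeasure lborel (M -` box l u) = ennreal ( |det (matrix M')| * measure lborel (box l u))"
   by simp
  hence "ennreal |det (matrix M)| * emeasure lborel (M -` box l u)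
    = ennreal ( |det (matrix M)| * ( |det (matrix M')| * measure lborel (box l u)))"
   by (simp add: ennreal_mult)
  also have "|det (matrix M)| * ( |det (matrix M')| * measure lborel (box l u)) = measure lborel (box l u)"
  proof -
   have "|det (matrix M)| * |det (matrix M')| = 1"
    using d1 by (simp add: abs_mult[symmetric] mult.commute)
   thus ?thesis by (simp only: mult.assoc[symmetric] mult_1)
  qed
  also have "ennreal (measure lborel (box l u)) = (\<Prod>b\<in>Basis. (u - l) .* b)"
   using le by (simp add: measure_lborel_box)
  finally show "emeasure (density (distr lborel borel M) (%_. ennreal |det (matrix M)| )) (box l u) =
   ennreal (\<Prod>b\<in>Basis. (u - l) .* b)"
   by (simp add: emeasure_density nn_integral_cmult emeasure_distr)
 qed simp
 hence "(NI y. G y) = (\<integral>\<^sup>+y. G y \<partial>density (distr lborel borel M) (%_. ennreal |det (matrix M)| ))"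
  by simp
 also have "... = ennreal |det (matrix M)| * (NI y. G (M y))"
  by (simp add: nn_integral_density nn_integral_distr nn_integral_cmult)
 finally show ?thesis .
qed

lemma borel_measurable_sgn_vec [measurable]: "(sgn :: real^3 => real^3) \<in> borel_measurable borel"
 unfolding sgn_div_norm[abs_def] by measurable

lemma space_surf [simp]: "space surf = S2"
 by (simp add: surf_def space_scale_measure space_restrict_space)

lemma sets_surf: "sets surf = sets (restrict_space borel S2)"
 by (simp add: surf_def sets_scale_measure)

lemma measurable_surf_cong [measurable_cong]: "sets surf = sets (restrict_space borel S2)"
 by (rule sets_surf)

lemma measurable_surfI: "f \<in> measurable borel M ==> f \<in> measurable surf M"
 using measurable_restrict_space1 measurable_cong_sets[OF sets_surf refl] by blast

lemma borel_measurable_surf_continuous: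
 fixes f :: "real^3 => 'b::topological_space"
 shows "continuous_on S2 f ==> f \<in> borel_measurable surf"
 using borel_measurable_continuous_on_restrict measurable_cong_sets[OF sets_surf refl] by blast

lemma sets_surfI: "A \<in> sets borel ==> A <= S2 ==> A \<in> sets surf"
 unfolding sets_surf sets_restrict_space by auto

lemma sets_surf_borel: "A \<in> sets surf ==> A \<in> sets borel"
 unfolding sets_surf sets_restrict_space by auto

lemma nn_integral_surf:
 assumes [measurable]: "F \<in> borel_measurable borel"
 shows "(\<integral>\<^sup>+y. F y \<partial>surf) = 3 * (NI y. F (sgn y) * ind (cball 0 1 - {0}) y)"
proof -
 have m: "sgn \<in> restrict_space lborel (cball 0 1 - {0::real^3}) \<rightarrow>\<^sub>M restrict_space borel S2"
  by (rule measurable_restrict_space2) (auto simp: norm_sgn space_restrict_space intro!: measurable_restrict_space1)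
 have "(\<integral>\<^sup>+y. F y \<partial>surf) = 3 * (\<integral>\<^sup>+y. F (sgn y) \<partial>restrict_space lborel (cball 0 1 - {0}))"
  unfolding surf_def
  by (subst nn_integral_scale_measure, measurable, rule measurable_restrict_space1, measurable,
    subst nn_integral_distr[OF m]) (auto intro: measurable_restrict_space1)
 also have "(\<integral>\<^sup>+y. F (sgn y) \<partial>restrict_space lborel (cball 0 1 - {0})) =
  (NI y. F (sgn y) * ind (cball 0 1 - {0}) y)"
  by (rule nn_integral_restrict_space) simp
 finally show ?thesis .
qed

lemma emeasure_surf:
 assumes "A \<in> sets borel" "A <= S2"
 shows "emeasure surf A = 3 * emeasure lborel {y. sgn y \<in> A & norm y <= 1}"
proof -
 have [measurable]: "A \<in> sets borel" by fact
 have "emeasure surf A = (\<integral>\<^sup>+y. ind A y \<partial>surf)"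
  using sets_surfI[OF assms] by simp
 also have "... = 3 * (NI y. ind A (sgn y) * ind (cball 0 1 - {0}) y)"
  by (rule nn_integral_surf) measurable
 also have "(%y. ind A (sgn y) * ind (cball 0 1 - {0}) y :: ennreal) = ind {y. sgn y \<in> A & norm y <= 1}"
  using assms(2) by (auto simp: indicator_def fun_eq_iff)
 also have "(NI y. ind {y. sgn y \<in> A & norm y <= 1} y) = emeasure lborel {y. sgn y \<in> A & norm y <= 1}"
  by (rule nn_integral_indicator) (measurable)
 finally show ?thesis .
qed

text \<open>\<open>sgn\<close> is constant on rays, so scaling the unit ball to radius r contributes
  only the determinant r^3.\<close>

lemma nn_integral_ball_sgn:
 assumes [measurable]: "F \<in> borel_measurable borel" and r: "r > 0"
 shows "3 * (NI y. F (sgn y) * ind {y. 0 < norm y & norm y <= r} y)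
   = ennreal (r^3) * (\<integral>\<^sup>+y. F y \<partial>surf)"
proof -
 let ?M = "%y::real^3. r *R y"
 have lin: "linear ?M" by (simp add: linear_iff algebra_simps)
 have d: "det (matrix ?M) = r^3"
  unfolding matrix_def by (simp add: det_3 axis_def power3_eq_cube)
 have "(NI y. F (sgn y) * ind {y. 0 < norm y & norm y <= r} y) =
  ennreal |r^3| * (NI y. F (sgn (?M y)) * ind {y. 0 < norm y & norm y <= r} (?M y))"
  unfolding d[symmetric] by (rule nn_integral_linear_change[OF lin]) (use r d in auto)
 also have "(%y. F (sgn (?M y)) * ind {y. 0 < norm y & norm y <= r} (?M y)) =
  (%y. F (sgn y) * ind (cball 0 1 - {0}) y)"
  using r by (auto simp: fun_eq_iff indicator_def sgn_scaleR)
 finally show ?thesis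
  using nn_integral_surf[of F] r by (simp add: mult.left_commute)
qed

text \<open>The difference of two balls; finiteness of the surface integral permits the cancellation
  in \<open>ennreal\<close>.\<close>

lemma nn_integral_shell:
 assumes [measurable]: "F \<in> borel_measurable borel" and a: "0 < a" "a <= b"
  and fin: "(\<integral>\<^sup>+y. F y \<partial>surf) < \<infinity>"
 shows "3 * (NI y. F (sgn y) * ind {y. a < norm y & norm y <= b} y)
   = ennreal (b^3 - a^3) * (\<integral>\<^sup>+y. F y \<partial>surf)"
proof -
 define X where "X = (\<integral>\<^sup>+y. F y \<partial>surf)"
 define S where "S = (NI y. F (sgn y) * ind {y. a < norm y & norm y <= b} y)"
 have ab: "a^3 <= b^3" using a by (intro power_mono) auto
 have "(NI y. F (sgn y) * ind {y. 0 < norm y & norm y <= b} y) =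
  (NI y. F (sgn y) * ind {y. 0 < norm y & norm y <= a} y +
    F (sgn y) * ind {y. a < norm y & norm y <= b} y)"
  using a by (intro nn_integral_cong) (auto simp: indicator_def)
 also have "... = (NI y. F (sgn y) * ind {y. 0 < norm y & norm y <= a} y) + S"
  unfolding S_def by (rule nn_integral_add) measurable
 finally have "ennreal (b^3) * X = ennreal (a^3) * X + 3 * S"
  using nn_integral_ball_sgn[of F a] nn_integral_ball_sgn[of F b] a
  by (simp add: X_def distrib_left)
 moreover have "ennreal (b^3) * X = ennreal (a^3) * X + ennreal (b^3 - a^3) * X"
  using ab a by (simp add: distrib_right[symmetric] ennreal_plus[symmetric] del: ennreal_plus)
 moreover have "ennreal (a^3) * X < \<infinity>" using fin by (simp add: X_def ennreal_mult_less_top)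
 ultimately have "3 * S = ennreal (b^3 - a^3) * X"
  by (metis ennreal_add_left_cancel infinity_ennreal_def less_irrefl)
 thus ?thesis by (simp add: S_def X_def)
qed

text \<open>An orthogonal map commutes with \<open>sgn\<close> and has a determinant of modulus one,
  so it respects the solid cones that define \<open>surf\<close>. All integration by parts rests on
  this invariance.\<close>

lemma surf_orthogonal_distr:
 fixes R :: "real^3 => real^3"
 assumes R: "orthogonal_transformation R"
 shows "distr surf surf R = surf"
proof (rule measure_eqI)
 have lin: "linear R" using R by (simp add: orthogonal_transformation_linear)
 have contR: "continuous_on UNIV R" using lin by (simp add: linear_continuous_on linear_conv_bounded_linear)
 have Rb: "R \<in> borel \<rightarrow>\<^sub>M borel"
  using contR by (rule borel_measurable_continuous_onI)
 have nR: "!!y. norm (R y) = norm y" using R by (simp add: orthogonal_transformation_norm)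
 have Rs: "R \<in> surf \<rightarrow>\<^sub>M surf"
  unfolding measurable_cong_sets[OF sets_surf sets_surf]
  by (rule measurable_restrict_space2) (auto simp: nR space_restrict_space intro!: measurable_restrict_space1 Rb)
 have "|det (matrix R)| = 1" using R
  using det_orthogonal_matrix orthogonal_transformation_matrix by (metis abs_1 abs_neg_one)
 fix A assume "A \<in> sets (distr surf surf R)"
 hence A: "A \<in> sets surf" by simp
 hence Ab[measurable]: "A \<in> sets borel" and AS: "A <= S2"
  using sets_surf_borel sets.sets_into_space[OF A] by auto
 have sg: "sgn (R y) = R (sgn y)" for y
  using lin by (simp add: sgn_div_norm nR linear_scale)
 have "emeasure surf A = (\<integral>\<^sup>+y. ind A y \<partial>surf)" using A by simp
 also have "... = 3 * (NI y. ind A (sgn y) * ind (cball 0 1 - {0}) y)"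
  by (rule nn_integral_surf) measurable
 also have "(NI y. ind A (sgn y) * ind (cball 0 1 - {0}) y) =
   ennreal |det (matrix R)| * (NI y. ind A (sgn (R y)) * ind (cball 0 1 - {0}) (R y))"
  proof (rule nn_integral_linear_change[OF lin])
   show "det (matrix R) ~= 0" using `|det (matrix R)| = 1` by auto
   have [measurable]: "cball 0 1 - {0::real^3} \<in> sets borel" by simp
   show "(%y. ind A (sgn y) * ind (cball 0 1 - {0}) y :: ennreal) \<in> borel_measurable borel"
    by measurable
  qed
 also have "(%y. ind A (sgn (R y)) * ind (cball 0 1 - {0}) (R y) :: ennreal) =
  (%y. ind A (R (sgn y)) * ind (cball 0 1 - {0}) y)"
  using nR linear_0[OF lin] by (auto simp: sg fun_eq_iff indicator_def) (metis norm_eq_zero)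
 also have "3 * (ennreal |det (matrix R)| * (NI y. ind A (R (sgn y)) * ind (cball 0 1 - {0}) y))
  = (\<integral>\<^sup>+y. ind A (R y) \<partial>surf)"
  using Rb `|det (matrix R)| = 1` by (subst nn_integral_surf[of "%y. ind A (R y)"]) auto
 also have "... = (\<integral>\<^sup>+y. ind A y \<partial>distr surf surf R)"
  using Rs A by (subst nn_integral_distr) auto
 also have "... = emeasure (distr surf surf R) A" using A by (intro nn_integral_indicator) simp
 finally show "emeasure (distr surf surf R) A = emeasure surf A" ..
qed simp

text \<open>The solid cone over a great circle lies in a plane. Thus the sides of triangles and the
  edges of cells can be ignored under integrals.\<close>

lemma surf_hyperplane_null:
 assumes "a ~= 0"
 shows "AE y in surf. a .* y ~= 0"
proof -
 have n: "{y. a .* y = 0} \<in> null_sets lborel"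
  using negligible_hyperplane[of a 0] assms
  by (auto simp: negligible_iff_null_sets null_sets_completion_iff)
 have "{y\<in>S2. a .* y = 0} = S2 Int {y. a .* y = 0}" by auto
 hence b: "{y\<in>S2. a .* y = 0} \<in> sets borel"
  by (simp only:) (intro borel_closed closed_Int closed_hyperplane closed_sphere)
 have 1: "emeasure surf {y\<in>S2. a .* y = 0} = 3 * emeasure lborel {y. sgn y \<in> {y\<in>S2. a .* y = 0} & norm y <= 1}"
  by (rule emeasure_surf[OF b]) auto
 have "emeasure lborel {y. sgn y \<in> {y\<in>S2. a .* y = 0} & norm y <= 1} <= emeasure lborel {y. a .* y = 0}"
  using n by (intro emeasure_mono) (auto simp: sgn_div_norm)
 also have "... = 0" using n by auto
 finally have "emeasure surf {y\<in>S2. a .* y = 0} = 0" unfolding 1 by simp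
 hence "{y\<in>S2. a .* y = 0} \<in> null_sets surf" proof (rule null_setsI)
  have "{y\<in>S2. a .* y = 0} <= S2" by blast
  thus "{y\<in>S2. a .* y = 0} \<in> sets surf" by (rule sets_surfI[OF b])
 qed
 thus ?thesis by (intro AE_I'[of _ surf]) auto
qed

lemma prod3: "prod f (UNIV :: 3 set) = f 1 * f 2 * f 3" for f :: "3 => real"
 unfolding UNIV_3 by (simp add: mult.assoc)

text \<open>Because a, c <= 0 <= b, d, the bounds survive multiplication by a radius at most 1, so
  the solid cone over \<open>A\<close> lies in a box of height 2 in the frame of \<open>e\<close>,
  \<open>g\<close> and their cross product. The factor 6 is 3, from cone volume to area, times this
  height.\<close>

lemma emeasure_surf_box:
 assumes "norm e = 1" "norm g = 1" "e .* g = 0"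
  and "a <= 0" "0 <= b" "c <= 0" "0 <= d" and A: "A \<in> sets borel" "A <= S2"
  and sub: "!!y. y \<in> A ==> a <= e .* y & e .* y <= b & c <= g .* y & g .* y <= d"
 shows "emeasure surf A <= ennreal (6 * (b - a) * (d - c))"
proof -
 define k where "k = cross3 e g"
 have e2: "e .* e = 1" and g2: "g .* g = 1" using assms by (simp_all add: norm_eq_1)
 have nk: "norm k = 1"
 proof -
  have "(norm k)^2 = 1" unfolding k_def using norm_cross[of e g] assms(1-3) by simp
  thus ?thesis using norm_ge_zero[of k] by (auto simp: power2_eq_1_iff)
 qed
 define M :: "real^3 => real^3" where "M y = vector [e .* y, g .* y, k .* y]" for y
 have lin: "linear M" unfolding M_def by (auto simp: linear_iff vec_eq_iff forall_3 inner_add_right)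
 have "matrix M = vector [e, g, k]"
  by (simp add: matrix_def M_def vec_eq_iff forall_3 inner_axis)
 hence "det (matrix M) = k .* k"
  unfolding k_def by (simp add: det_3 cross3_def inner_vec_def sum_3 algebra_simps)
 hence det: "det (matrix M) = 1" using nk by (simp add: norm_eq_1)
 have C: "{y. sgn y \<in> A & norm y <= 1} <= {y. M y \<in> cbox (vector [a, c, -1]) (vector [b, d, 1])}" (is "?L <= ?R")
 proof
  fix y assume y: "y \<in> ?L"
  let ?r = "norm y"
  have yr: "y = ?r *R sgn y" by (cases "y = 0") (simp_all add: sgn_div_norm)
  have r: "0 <= ?r" "?r <= 1" using y by auto
  have s: "a <= e .* sgn y" "e .* sgn y <= b" "c <= g .* sgn y" "g .* sgn y <= d" using sub y by auto
  have 1: "a <= e .* y" "c <= g .* y"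
   using mult_left_mono[OF s(1) r(1)] mult_left_mono[OF s(3) r(1)] r assms(4,6)
    mult_right_mono_neg[OF r(2), of a] mult_right_mono_neg[OF r(2), of c]
   by (subst yr, simp)+
  have 2: "e .* y <= b" "g .* y <= d"
   using mult_left_mono[OF s(2) r(1)] mult_left_mono[OF s(4) r(1)] r assms(5,7)
    mult_right_mono[OF r(2), of b] mult_right_mono[OF r(2), of d]
   by (subst yr, simp)+
  have "|k .* y| <= 1" using Cauchy_Schwarz_ineq2[of k y] nk r by simp
  thus "y \<in> ?R" using 1 2 by (auto simp: M_def mem_box_cart forall_3)
 qed
 have mR: "M \<in> borel \<rightarrow>\<^sub>M borel"
  using lin by (intro borel_measurable_continuous_onI) (simp add: linear_continuous_on linear_conv_bounded_linear)
 let ?B = "cbox (vector [a, c, -1]) (vector [b, d, 1]) :: (real^3) set"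
 have "emeasure lborel ?R = (NI y. ind ?B (M y))"
 proof -
  have "?R \<in> sets lborel" using measurable_sets[OF mR, of ?B] by (simp add: vimage_def)
  hence "emeasure lborel ?R = (NI y. ind ?R y)" by (rule nn_integral_indicator[symmetric])
  also have "... = (NI y. ind ?B (M y))" by (rule nn_integral_cong) (simp add: indicator_def)
  finally show ?thesis .
 qed
 also have "... = emeasure lborel ?B"
  using nn_integral_linear_change[OF lin, of "ind ?B"] det by simp
 also have "... = ennreal (2 * (b - a) * (d - c))"
 proof -
  have "?B ~= {}" using assms(4-7) by (simp add: interval_ne_empty_cart forall_3)
  hence "measure lborel ?B = 2 * (b - a) * (d - c)" unfolding content_cbox_cart[OF `?B ~= {}`] prod3 by simp
  moreover have "emeasure lborel ?B ~= \<infinity>" using emeasure_lborel_cbox_finite by (metis less_irrefl infinity_ennreal_def)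
  ultimately show ?thesis using emeasure_eq_ennreal_measure by (metis infinity_ennreal_def)
 qed
 finally have R: "emeasure lborel ?R = ennreal (2 * (b - a) * (d - c))" .
 have "emeasure surf A = 3 * emeasure lborel ?L" by (rule emeasure_surf[OF A])
 also have "... <= 3 * emeasure lborel ?R"
  using measurable_sets[OF mR, of ?B] C by (intro mult_left_mono emeasure_mono) (auto simp: vimage_def)
 also have "... = ennreal (6 * (b - a) * (d - c))"
  unfolding R using assms(4-7) by (subst ennreal_numeral[symmetric], subst ennreal_mult[symmetric]) (auto simp: mult.assoc)
 finally show ?thesis .
qed

text \<open>24 = 6 * 2 * 2 is a crude substitute for 4 pi.\<close>

lemma emeasure_surf_le: "emeasure surf S2 <= 24"
proof -
 have "emeasure surf S2 <= ennreal (6 * (1 - (-1)) * (1 - (-1)))"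
 proof (rule emeasure_surf_box[of "axis 1 1" "axis 2 1"])
  fix y :: "real^3" assume "y \<in> S2"
  thus "-1 <= axis 1 1 .* y & axis 1 1 .* y <= 1 & -1 <= axis 2 1 .* y & axis 2 1 .* y <= 1"
   using component_le_norm_cart[of y 1] component_le_norm_cart[of y 2] by (simp add: inner_axis' abs_le_iff)
 qed (auto simp: norm_axis_1 inner_axis_axis)
 thus ?thesis by simp
qed

interpretation surf: finite_measure surf
proof
 show "emeasure surf (space surf) ~= \<infinity>" using emeasure_surf_le
  by (metis space_surf ennreal_numeral_less_top infinity_ennreal_def linorder_not_less)
qed

lemma measure_surf_le: "measure surf A <= 24"
proof -
 have "measure surf A <= measure surf S2" using surf.bounded_measure[of A] by simp
 also have "... <= 24" using emeasure_surf_le by (metis surf.emeasure_eq_measure ennreal_le_iff ennreal_numeral zero_le_numeral)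
 finally show ?thesis .
qed

section \<open>Polynomials and their rotational derivatives\<close>

text \<open>Polynomials are formal expressions, so that derivatives are again expressions and can be
  iterated. Different expressions may have equal values; the congruence rules below transfer
  equality of values to derivatives.\<close>

datatype pexp = PC real | PV "3" | PAdd pexp pexp | PMul pexp pexp

primrec ev :: "pexp => real^3 => real" where
 "ev (PC c) y = c"
| "ev (PV k) y = y $ k"
| "ev (PAdd a b) y = ev a y + ev b y"
| "ev (PMul a b) y = ev a y * ev b y"

primrec pd :: "3 => pexp => pexp" where
 "pd k (PC c) = PC 0"
| "pd k (PV m) = PC (if m = k then 1 else 0)"
| "pd k (PAdd a b) = PAdd (pd k a) (pd k b)"
| "pd k (PMul a b) = PAdd (PMul (pd k a) b) (PMul a (pd k b))"

definition gr :: "pexp => real^3 => real^3" where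
 "gr e y = (\<chi> k. ev (pd k e) y)"

(* The rotational derivatives: the components of y \<times> grad e. *)
definition L :: "3 => pexp => pexp" where
 "L k e = (if k = 1 then PAdd (PMul (PV 2) (pd 3 e)) (PMul (PC (-1)) (PMul (PV 3) (pd 2 e)))
  else if k = 2 then PAdd (PMul (PV 3) (pd 1 e)) (PMul (PC (-1)) (PMul (PV 1) (pd 3 e)))
  else PAdd (PMul (PV 1) (pd 2 e)) (PMul (PC (-1)) (PMul (PV 2) (pd 1 e))))"

definition Lv :: "pexp => real^3 => real^3" where
 "Lv e y = (\<chi> k. ev (L k e) y)"

definition LB :: "pexp => pexp" where
 "LB e = PAdd (L 1 (L 1 e)) (PAdd (L 2 (L 2 e)) (L 3 (L 3 e)))"

lemma has_derivative_ev: "(ev e has_derivative (%v. gr e y .* v)) (at y)"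
proof (induction e)
 case (PV k)
 have "gr (PV k) y = axis k 1" by (simp add: gr_def axis_def vec_eq_iff)
 hence "(%v. gr (PV k) y .* v) = (%v. v $ k)" by (simp add: inner_axis')
 thus ?case by (auto simp: fun_eq_iff intro!: derivative_eq_intros bounded_linear_imp_has_derivative)
next
 case (PAdd a b)
 have "gr (PAdd a b) y = gr a y + gr b y" by (simp add: gr_def vec_eq_iff)
 with has_derivative_add[OF PAdd] show ?case by (simp add: inner_add_left fun_eq_iff)
next
 case (PMul a b)
 have "gr (PMul a b) y = ev b y *R gr a y + ev a y *R gr b y" by (simp add: gr_def vec_eq_iff algebra_simps)
 with has_derivative_mult[OF PMul] show ?case by (simp add: inner_add_left fun_eq_iff algebra_simps)
qed (auto simp: gr_def inner_vec_def)

lemma continuous_on_ev [continuous_intros]: "continuous_on A f ==> continuous_on A (%x. ev e (f x))"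
 by (induction e) (auto intro!: continuous_intros)

lemma borel_measurable_ev [measurable]: "ev e \<in> borel_measurable borel"
 by (rule borel_measurable_continuous_onI) (auto intro!: continuous_intros)

lemma continuous_on_gr [continuous_intros]: "continuous_on A f ==> continuous_on A (%x. gr e (f x))"
 unfolding gr_def by (intro continuous_intros)

lemma continuous_on_Lv [continuous_intros]: "continuous_on A f ==> continuous_on A (%x. Lv e (f x))"
 unfolding Lv_def by (intro continuous_intros)

lemma borel_measurable_Lv [measurable]: "Lv e \<in> borel_measurable borel"
 by (rule borel_measurable_continuous_onI) (auto intro!: continuous_intros)

lemma gr_nth [simp]: "gr e y $ k = ev (pd k e) y" by (simp add: gr_def)
lemma Lv_nth [simp]: "Lv e y $ k = ev (L k e) y" by (simp add: Lv_def)

lemma Lv_cross: "Lv e y = cross3 y (gr e y)"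
 by (simp add: vec_eq_iff forall_3 L_def cross3_def)

lemma pd_commute: "ev (pd i (pd j e)) y = ev (pd j (pd i e)) y"
 by (induction e) (auto simp: algebra_simps)

text \<open>\<open>pd\<close> acts on expressions, but it represents the true derivative, which
  depends on the function alone.\<close>

lemma gr_cong: assumes "!!y. ev a y = ev b y" shows "gr a y = gr b y"
proof -
 have "ev a = ev b" using assms by blast
 hence "(%v. gr a y .* v) = (%v. gr b y .* v)"
  using has_derivative_ev[of a y] has_derivative_ev[of b y] by (auto intro: has_derivative_unique)
 hence "gr a y .* (gr a y - gr b y) = gr b y .* (gr a y - gr b y)" by (rule fun_cong)
 hence "(gr a y - gr b y) .* (gr a y - gr b y) = 0" by (simp add: inner_diff_left)
 thus ?thesis by simp
qed

lemma pd_cong: "(!!y. ev a y = ev b y) ==> ev (pd k a) y = ev (pd k b) y"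
 using gr_cong[of a b y] by (metis gr_nth)

lemma L_cong: "(!!y. ev a y = ev b y) ==> ev (L k a) y = ev (L k b) y"
 using gr_cong[of a b y] by (metis Lv_cross Lv_nth)

lemma three_neq: "(1::3) ~= 2" "(1::3) ~= 3" "(2::3) ~= 3" "(2::3) ~= 1" "(3::3) ~= 1" "(3::3) ~= 2"
 by simp_all

lemma L_123:
 "L 1 e = PAdd (PMul (PV 2) (pd 3 e)) (PMul (PC (-1)) (PMul (PV 3) (pd 2 e)))"
 "L 2 e = PAdd (PMul (PV 3) (pd 1 e)) (PMul (PC (-1)) (PMul (PV 1) (pd 3 e)))"
 "L 3 e = PAdd (PMul (PV 1) (pd 2 e)) (PMul (PC (-1)) (PMul (PV 2) (pd 1 e)))"
 unfolding L_def by (simp_all only: three_neq if_False if_True refl)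

lemma ev_L_simps [simp]:
 "ev (L k (PAdd a b)) y = ev (L k a) y + ev (L k b) y"
 "ev (L k (PMul a b)) y = ev (L k a) y * ev b y + ev a y * ev (L k b) y"
 "ev (L k (PC c)) y = 0"
proof -
 consider "k = 1" | "k = 2" | "k = 3" using exhaust_3 by blast
 thus "ev (L k (PAdd a b)) y = ev (L k a) y + ev (L k b) y"
  by cases (simp_all only: L_123 pd.simps ev.simps algebra_simps)
 consider "k = 1" | "k = 2" | "k = 3" using exhaust_3 by blast
 thus "ev (L k (PMul a b)) y = ev (L k a) y * ev b y + ev a y * ev (L k b) y"
  by cases (simp_all only: L_123 pd.simps ev.simps algebra_simps)
 consider "k = 1" | "k = 2" | "k = 3" using exhaust_3 by blast
 thus "ev (L k (PC c)) y = 0"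
  by cases (simp_all add: L_123)
qed

lemma ev_LB: "ev (LB e) y = (SUM k:UNIV. ev (L k (L k e)) y)"
 unfolding LB_def sum_3 by simp

text \<open>The commutation relations of so(3). After expansion they follow from the symmetry of
  second derivatives.\<close>

lemma L_commutator:
 "ev (L 1 (L 2 e)) y = ev (L 2 (L 1 e)) y - ev (L 3 e) y"
 "ev (L 2 (L 3 e)) y = ev (L 3 (L 2 e)) y - ev (L 1 e) y"
 "ev (L 3 (L 1 e)) y = ev (L 1 (L 3 e)) y - ev (L 2 e) y"
 unfolding L_123 pd.simps ev.simps pd_commute[of 1 2] pd_commute[of 1 3] pd_commute[of 2 3]
 by (simp_all add: algebra_simps)

text \<open>\<open>LB\<close> is the Casimir element of so(3): the commutators of \<open>L k\<close>
  with the squares of the two other operators cancel each other.\<close>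

lemma L_LB_commute: "ev (L k (LB e)) y = ev (LB (L k e)) y"
proof -
 let ?m = "%a b. PAdd a (PMul (PC (-1)) b)"
 have c12: "ev (L 1 (L 2 a)) z = ev (?m (L 2 (L 1 a)) (L 3 a)) z"
 and c23: "ev (L 2 (L 3 a)) z = ev (?m (L 3 (L 2 a)) (L 1 a)) z"
 and c31: "ev (L 3 (L 1 a)) z = ev (?m (L 1 (L 3 a)) (L 2 a)) z" for a z
  using L_commutator[of a z] by simp_all
 \<comment> \<open>The commutation relations hold for values at every point, so they may be
   differentiated once more through \<open>L_cong\<close>.\<close>
 have d12: "ev (L j (L 1 (L 2 a))) z = ev (L j (L 2 (L 1 a))) z - ev (L j (L 3 a)) z"
 and d23: "ev (L j (L 2 (L 3 a))) z = ev (L j (L 3 (L 2 a))) z - ev (L j (L 1 a)) z"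
 and d31: "ev (L j (L 3 (L 1 a))) z = ev (L j (L 1 (L 3 a))) z - ev (L j (L 2 a)) z" for j a z
  using L_cong[OF c12, of j a z] L_cong[OF c23, of j a z] L_cong[OF c31, of j a z] by simp_all
 note [simp del] = ev_L_simps
 have LBs: "ev (L j (LB a)) z = ev (L j (L 1 (L 1 a))) z + ev (L j (L 2 (L 2 a))) z + ev (L j (L 3 (L 3 a))) z" for j a z
  by (simp add: LB_def ev_L_simps)
 consider "k = 1" | "k = 2" | "k = 3" using exhaust_3 by blast
 thus ?thesis
 proof cases
  case 1
  show ?thesis unfolding 1 LBs using L_commutator[of "L 2 e" y] L_commutator[of "L 3 e" y] L_commutator[of "L 1 e" y]
    d12[of 2 e y] d31[of 3 e y] L_commutator[of e y]
   by (simp add: LB_def)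
 next
  case 2
  show ?thesis unfolding 2 LBs using L_commutator[of "L 2 e" y] L_commutator[of "L 3 e" y] L_commutator[of "L 1 e" y]
    d12[of 1 e y] d23[of 3 e y] L_commutator[of e y]
   by (simp add: LB_def)
 next
  case 3
  show ?thesis unfolding 3 LBs using L_commutator[of "L 2 e" y] L_commutator[of "L 3 e" y] L_commutator[of "L 1 e" y]
    d23[of 2 e y] d31[of 1 e y] L_commutator[of e y]
   by (simp add: LB_def)
 qed
qed

subsection \<open>Poisson's equation for polynomials\<close>

definition lap :: "pexp => pexp" where
 "lap e = PAdd (pd 1 (pd 1 e)) (PAdd (pd 2 (pd 2 e)) (pd 3 (pd 3 e)))"

text \<open>Only positive t are used, so degree 0 means constant on rays; continuity at the origin
  then makes such a polynomial constant.\<close>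

definition homog :: "nat => pexp => bool" where
 "homog n e \<longleftrightarrow> (\<forall>y t. t > 0 --> ev e (t *R y) = t^n * ev e y)"

text \<open>The splitting of the Euclidean Laplacian into angular and radial parts; the middle sum
  is the second derivative y^T (Hess e) y in the radial direction.\<close>

lemma LB_expand:
 "ev (LB e) y = (y .* y) * ev (lap e) y - (SUM k:UNIV. y $ k * (gr (pd k e) y .* y)) - 2 * (gr e y .* y)"
 unfolding LB_def L_123 lap_def inner_vec_def sum_3 gr_nth pd.simps ev.simps pd_commute[of 1 2] pd_commute[of 1 3] pd_commute[of 2 3]
 by (simp add: algebra_simps)

lemma homog_euler: assumes "homog n e" shows "gr e y .* y = n * ev e y"
proof -
 have 1: "((%t. ev e (t *R y)) has_derivative (%s. gr e (1 *R y) .* (s *R y))) (at 1)"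
  by (rule has_derivative_compose[of "%t. t *R y" "%s. s *R y", OF _ has_derivative_ev])
   (auto intro!: derivative_eq_intros)
 have 2: "((%t. t^n * ev e y) has_derivative (%s. s * (n * ev e y))) (at 1)"
  by (auto intro!: derivative_eq_intros)
 have ne: "\<forall>\<^sub>F t in at (1::real). ev e (t *R y) = t^n * ev e y"
 proof -
  have "\<forall>\<^sub>F t in at (1::real). 0 < t" using order_tendstoD(1)[OF tendsto_ident_at, of 0 "1::real" UNIV] by simp
  thus ?thesis by (rule eventually_mono) (use assms in "simp add: homog_def")
 qed
 have "((%t. ev e (t *R y)) has_derivative (%s. s * (n * ev e y))) (at 1)"
  using assms by (intro has_derivative_transform_eventually[OF 2]) (use ne in "auto simp: eq_commute homog_def")
 from has_derivative_unique[OF 1 this] have "gr e (1 *R y) .* (1 *R y) = 1 * (n * ev e y)" by meson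
 thus ?thesis by simp
qed

lemma homog_gr: assumes "homog (Suc n) e" "t > 0" shows "gr e (t *R y) = t^n *R gr e y"
proof -
 have 1: "((%z. ev e (t *R z)) has_derivative (%v. gr e (t *R y) .* (t *R v))) (at y)"
  by (rule has_derivative_compose[OF _ has_derivative_ev]) (auto intro!: derivative_eq_intros)
 have 2: "((%z. t^Suc n * ev e z) has_derivative (%v. t^Suc n * (gr e y .* v))) (at y)"
  by (rule has_derivative_mult_right[OF has_derivative_ev])
 have "(%z. ev e (t *R z)) = (%z. t^Suc n * ev e z)" using assms by (auto simp: homog_def)
 with 1 2 have "(%v. gr e (t *R y) .* (t *R v)) = (%v. t^Suc n * (gr e y .* v))"
  using has_derivative_unique by metis
 hence "t * (gr e (t *R y) .* v) = t * ((t^n *R gr e y) .* v)" for v by (metis inner_scaleR_left inner_scaleR_right mult.assoc power_Suc)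
 hence "gr e (t *R y) .* v = (t^n *R gr e y) .* v" for v using assms(2) by (metis mult_left_cancel order_less_irrefl)
 thus ?thesis by (metis vector_eq_rdot inner_commute)
qed

lemma homog_pd: assumes "homog (Suc n) e" shows "homog n (pd k e)"
 unfolding homog_def using homog_gr[OF assms] by (metis gr_nth vector_scaleR_component real_scaleR_def)

lemma homog_0: assumes "homog 0 e" shows "ev e y = ev e 0"
proof -
 have "((%t::real. ev e (t *R y)) \<longlongrightarrow> ev e (0 *R y)) (at_right 0)"
 proof -
  have "continuous_on UNIV (%t::real. ev e (t *R y))" by (intro continuous_intros)
  hence "isCont (%t::real. ev e (t *R y)) 0" by (simp add: continuous_on_eq_continuous_at)
  thus ?thesis unfolding isCont_def by (metis filterlim_at_split)
 qed
 moreover have "\<forall>\<^sub>F t::real in at_right 0. ev e (t *R y) = ev e y"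
  using assms eventually_at_right_less[of "0::real"] by (auto simp: homog_def elim!: eventually_mono)
 ultimately have "((%t::real. ev e y) \<longlongrightarrow> ev e (0 *R y)) (at_right 0)"
  by (rule Lim_transform_eventually)
 thus ?thesis by (simp add: tendsto_const_iff)
qed

lemma homog_0_pd: assumes "homog 0 e" shows "ev (pd k e) y = 0"
proof -
 have "!!y. ev e y = ev (PC (ev e 0)) y" using homog_0[OF assms] by simp
 from pd_cong[OF this, of k y] show ?thesis by simp
qed

lemma LB_homog: assumes "homog n e" "norm y = 1" shows "ev (LB e) y = ev (lap e) y - real n * (real n + 1) * ev e y"
proof -
 have eu: "gr e y .* y = n * ev e y" by (rule homog_euler[OF assms(1)])
 have "(SUM k:UNIV. y $ k * (gr (pd k e) y .* y)) = real n * (real n - 1) * ev e y"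
 proof (cases n)
  case 0
  have "gr (pd k e) y = 0" for k
  proof -
   have "!!y. ev (pd k e) y = ev (PC 0) y" using homog_0_pd assms(1) 0 by simp
   from gr_cong[OF this, of y] show ?thesis by (simp add: vec_eq_iff)
  qed
  thus ?thesis using 0 by simp
 next
  case (Suc m)
  have "gr (pd k e) y .* y = real m * ev (pd k e) y" for k
   using homog_euler[OF homog_pd] assms(1) Suc by simp
  hence "(SUM k:UNIV. y $ k * (gr (pd k e) y .* y)) = real m * (gr e y .* y)"
   by (simp add: inner_vec_def sum_distrib_left mult_ac)
  thus ?thesis using eu Suc by simp
 qed
 moreover have "y .* y = 1" using assms(2) by (simp add: norm_eq_1)
 ultimately show ?thesis unfolding LB_expand eu by (simp add: algebra_simps)
qed

lemma ev_LB_linear: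
 "ev (LB (PAdd a b)) y = ev (LB a) y + ev (LB b) y"
 "ev (LB (PMul (PC c) a)) y = c * ev (LB a) y"
proof -
 have 1: "ev (L k (L k (PAdd a b))) y = ev (L k (PAdd (L k a) (L k b))) y" for k
  by (rule L_cong) simp
 have 2: "ev (L k (L k (PMul (PC c) a))) y = ev (L k (PMul (PC c) (L k a))) y" for k
  by (rule L_cong) simp
 show "ev (LB (PAdd a b)) y = ev (LB a) y + ev (LB b) y" using 1 by (simp add: LB_def)
 show "ev (LB (PMul (PC c) a)) y = c * ev (LB a) y" using 2 by (simp add: LB_def algebra_simps)
qed

text \<open>On the sphere \<open>LB e\<close> is \<open>lap e\<close> minus n (n + 1) e, and
  \<open>lap e\<close> is homogeneous of degree n - 2. If w' solves the problem for
  \<open>lap e\<close>, then (w' - e) / (n (n + 1)) solves it for e. The recursion ends in a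
  constant, which remains as \<open>c\<close>.\<close>

lemma poisson_homog: "homog n e ==> \<exists>w c. \<forall>y\<in>S2. ev (LB w) y = ev e y - c"
proof (induction n arbitrary: e rule: less_induct)
 case (less n)
 show ?case
 proof (cases "n = 0")
  case True
  hence "\<forall>y\<in>S2. ev (LB (PC 0)) y = ev e y - ev e 0"
   using homog_0[of e] less.prems by (simp add: LB_def L_123)
  thus ?thesis by blast
 next
  case False
  have "\<exists>w' c'. \<forall>y\<in>S2. ev (LB w') y = ev (lap e) y - c'"
  proof (cases "n = 1")
   case True
   hence "homog 0 (pd k e)" for k using homog_pd[of 0 e] less.prems by simp
   hence "ev (lap e) y = 0" for y by (simp add: lap_def homog_0_pd)
   hence "\<forall>y\<in>S2. ev (LB (PC 0)) y = ev (lap e) y - 0" by (auto simp: LB_def L_123)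
   thus ?thesis by blast
  next
   case f: False
   obtain m where m: "n = Suc (Suc m)" using False f by (metis One_nat_def not0_implies_Suc)
   hence "homog m (pd k (pd k e))" for k using homog_pd less.prems by blast
   hence "homog m (lap e)" by (simp add: homog_def lap_def algebra_simps)
   thus ?thesis using less.IH[of m "lap e"] m by simp
  qed
  then obtain w' c' where w': "\<forall>y\<in>S2. ev (LB w') y = ev (lap e) y - c'" by blast
  define q where "q = real n * (real n + 1)"
  have q: "q ~= 0" using False by (simp add: q_def)
  let ?w = "PMul (PC (1/q)) (PAdd w' (PMul (PC (-1)) e))"
  have "\<forall>y\<in>S2. ev (LB ?w) y = ev e y - c' / q"
  proof
   fix y :: "real^3" assume y: "y \<in> S2"
   have "ev (LB ?w) y = 1/q * (ev (LB w') y - ev (LB e) y)"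
    by (simp only: ev_LB_linear) simp
   also have "... = 1/q * (q * ev e y - c')"
    using w' y LB_homog[OF less.prems, of y] by (simp add: q_def)
   finally show "ev (LB ?w) y = ev e y - c' / q" using q by (simp add: field_simps)
  qed
  thus ?thesis by blast
 qed
qed

lemma sum_list_product: fixes f :: "'a => real" shows
 "(\<Sum>p\<leftarrow>xs. f p) * (\<Sum>q\<leftarrow>ys. g q) = (\<Sum>z\<leftarrow>List.product xs ys. f (fst z) * g (snd z))"
 by (induction xs) (simp_all add: algebra_simps sum_list_const_mult[symmetric] comp_def)

text \<open>Equal degrees are not collected in the list: Poisson's equation is linear and is solved
  summand by summand.\<close>

lemma homog_decomposition:
 "\<exists>l. (\<forall>(n,p)\<in>set l. homog n p) & (\<forall>y. ev e y = (\<Sum>p\<leftarrow>map snd l. ev p y))"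
proof (induction e)
 case (PC c)
 show ?case by (rule exI[of _ "[(0, PC c)]"]) (simp add: homog_def)
next
 case (PV k)
 show ?case by (rule exI[of _ "[(1, PV k)]"]) (simp add: homog_def)
next
 case (PAdd a b)
 then obtain l l' where "(\<forall>(n,p)\<in>set l. homog n p) & (\<forall>y. ev a y = (\<Sum>p\<leftarrow>map snd l. ev p y))"
  "(\<forall>(n,p)\<in>set l'. homog n p) & (\<forall>y. ev b y = (\<Sum>p\<leftarrow>map snd l'. ev p y))" by auto
 thus ?case by (intro exI[of _ "l @ l'"]) auto
next
 case (PMul a b)
 then obtain l l' where l: "(\<forall>(n,p)\<in>set l. homog n p)" "(\<forall>y. ev a y = (\<Sum>p\<leftarrow>map snd l. ev p y))"
  "(\<forall>(n,p)\<in>set l'. homog n p)" "(\<forall>y. ev b y = (\<Sum>p\<leftarrow>map snd l'. ev p y))" by auto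
 let ?l = "map (%(u,v). (fst u + fst v, PMul (snd u) (snd v))) (List.product l l')"
 have "\<forall>(n,p)\<in>set ?l. homog n p"
  using l(1,3) by (fastforce simp: homog_def power_add)
 moreover have "ev (PMul a b) y = (\<Sum>p\<leftarrow>map snd ?l. ev p y)" for y
  using l(2,4) sum_list_product[of "%u. ev (snd u) y" l "%u. ev (snd u) y" l']
  by (simp add: comp_def case_prod_beta)
 ultimately show ?case by blast
qed

lemma poisson_poly: "\<exists>w c. \<forall>y\<in>S2. ev (LB w) y = ev e y - c"
proof -
 obtain l where l: "\<forall>(n,p)\<in>set l. homog n p" "\<forall>y. ev e y = (\<Sum>p\<leftarrow>map snd l. ev p y)"
  using homog_decomposition by blast
 have "(\<forall>(n,p)\<in>set l. homog n p) ==> \<exists>w c. \<forall>y\<in>S2. ev (LB w) y = (\<Sum>p\<leftarrow>map snd l. ev p y) - c" for l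
 proof (induction l)
  case Nil
  show ?case by (intro exI[of _ "PC 0"] exI[of _ 0]) (simp add: LB_def L_123)
 next
  case (Cons a l)
  obtain n p where a: "a = (n,p)" by fastforce
  obtain w c where w: "\<forall>y\<in>S2. ev (LB w) y = (\<Sum>p\<leftarrow>map snd l. ev p y) - c" using Cons by auto
  obtain w' c' where w': "\<forall>y\<in>S2. ev (LB w') y = ev p y - c'" using poisson_homog[of n p] Cons.prems a by auto
  have "\<forall>y\<in>S2. ev (LB (PAdd w' w)) y = (\<Sum>p\<leftarrow>map snd (a # l). ev p y) - (c' + c)"
   using w w' a by (simp add: ev_LB_linear)
  thus ?case by blast
 qed
 from this[OF l(1)] l(2) show ?thesis by simp
qed

subsection \<open>Approximation by polynomials\<close>

lemma real_polynomial_function_ev: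
 fixes p :: "real^3 => real"
 shows "real_polynomial_function p ==> \<exists>e. \<forall>y. ev e y = p y"
proof (induction rule: real_polynomial_function.induct)
 case (linear f)
 then interpret bounded_linear f .
 have "ev (PAdd (PMul (PC (f (axis 1 1))) (PV 1)) (PAdd (PMul (PC (f (axis 2 1))) (PV 2)) (PMul (PC (f (axis 3 1))) (PV 3)))) y = f y" for y
 proof -
  have "y = (y$1) *R axis 1 1 + (y$2) *R axis 2 1 + (y$3) *R axis 3 1"
   by (simp add: vec_eq_iff forall_3 axis_def)
  hence "f y = f ((y$1) *R axis 1 1 + (y$2) *R axis 2 1 + (y$3) *R axis 3 1)" by simp
  thus ?thesis by (simp add: add scaleR mult.commute)
 qed
 thus ?case by blast
next
 case (const c)
 show ?case by (rule exI[of _ "PC c"]) simp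
next
 case (add f g)
 then obtain a b where "\<forall>y. ev a y = f y" "\<forall>y. ev b y = g y" by auto
 thus ?case by (intro exI[of _ "PAdd a b"]) simp
next
 case (mult f g)
 then obtain a b where "\<forall>y. ev a y = f y" "\<forall>y. ev b y = g y" by auto
 thus ?case by (intro exI[of _ "PMul a b"]) simp
qed

lemma poly_uniform_approx:
 assumes "continuous_on S2 g" "ep > 0"
 shows "\<exists>e. \<forall>y\<in>S2. |g y - ev e y| < ep"
proof -
 obtain p where p: "real_polynomial_function p" "!!y. y \<in> S2 ==> |g y - p y| < ep"
  using Stone_Weierstrass_real_polynomial_function[OF _ assms] by auto
 thus ?thesis using real_polynomial_function_ev[OF p(1)] by metis
qed

lemma ev_bounded: "\<exists>B\<ge>0. \<forall>y\<in>S2. |ev e y| <= B"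
proof -
 have "bounded (ev e ` S2)"
  by (intro compact_imp_bounded compact_continuous_image continuous_intros) auto
 then obtain B where "\<forall>y\<in>S2. |ev e y| <= B" by (auto simp: bounded_iff)
 thus ?thesis by (intro exI[of _ "max B 0"]) auto
qed

section \<open>Square integrable functions and density of polynomials\<close>

lemma Cauchy_Schwarz_integral:
 fixes f g :: "'a => real"
 assumes f[measurable]: "f \<in> borel_measurable M" and g[measurable]: "g \<in> borel_measurable M"
  and f2: "integrable M (%y. (f y)^2)" and g2: "integrable M (%y. (g y)^2)"
 shows "integrable M (%y. f y * g y)"
  and "|\<integral>y. f y * g y \<partial>M| <= sqrt (\<integral>y. (f y)^2 \<partial>M) * sqrt (\<integral>y. (g y)^2 \<partial>M)"
proof -
 show i: "integrable M (%y. f y * g y)"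
 proof (rule LI_bound[OF Bochner_Integration.integrable_add[OF f2 g2]])
  show "AE y in M. norm (f y * g y) <= norm ((f y)^2 + (g y)^2)"
  proof (rule AE_I2)
   fix y
   have "2 * ( |f y| * |g y| ) <= |f y|^2 + |g y|^2" using sum_squares_bound[of "|f y|" "|g y|"] by simp
   moreover have "0 <= |f y| * |g y|" by (intro mult_nonneg_nonneg) auto
   ultimately show "norm (f y * g y) <= norm ((f y)^2 + (g y)^2)" unfolding real_norm_def abs_mult power2_abs by linarith
  qed
 qed measurable
 define a b c where "a = (\<integral>y. (f y)^2 \<partial>M)" and "b = (\<integral>y. f y * g y \<partial>M)" and "c = (\<integral>y. (g y)^2 \<partial>M)"
 have nn: "a >= 0" "c >= 0" by (auto simp: a_def c_def)
 have q: "0 <= s^2 * a + 2 * s * t * b + t^2 * c" for s t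
 proof -
  have "0 <= (\<integral>y. (s * f y + t * g y)^2 \<partial>M)" by simp
  also have "(%y. (s * f y + t * g y)^2) = (%y. s^2 * (f y)^2 + (2 * s * t) * (f y * g y) + t^2 * (g y)^2)"
   by (simp add: fun_eq_iff power2_eq_square algebra_simps)
  also have "(\<integral>y. s^2 * (f y)^2 + (2 * s * t) * (f y * g y) + t^2 * (g y)^2 \<partial>M) = s^2 * a + (2 * s * t) * b + t^2 * c"
   unfolding a_def b_def c_def using i f2 g2 by simp
  finally show ?thesis .
 qed
 have "b^2 <= a * c"
 proof (cases "c = 0")
  case True
  have "b = 0"
  proof (rule ccontr)
   assume "b ~= 0"
   \<comment> \<open>For c = 0 the quadratic form is affine in t, and this t gives it the value
     -1.\<close>
   from q[of 1 "- (a + 1) / (2 * b)"] True have "0 <= a + 2 * (- (a + 1) / (2 * b)) * b" by simp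
   also have "... = -1" using `b ~= 0` by (simp add: field_simps)
   finally show False by simp
  qed
  thus ?thesis using nn by simp
 next
  case False
  from q[of c "- b"] have "0 <= c * (a * c - b^2)" by (simp add: power2_eq_square algebra_simps)
  thus ?thesis using False nn by (simp add: zero_le_mult_iff)
 qed
 hence "sqrt (b^2) <= sqrt (a * c)" by (rule real_sqrt_le_mono)
 thus "|\<integral>y. f y * g y \<partial>M| <= sqrt (\<integral>y. (f y)^2 \<partial>M) * sqrt (\<integral>y. (g y)^2 \<partial>M)"
  by (simp add: a_def b_def c_def real_sqrt_mult)
qed

definition sqi :: "'a measure => ('a => real) => bool" where
 "sqi M f \<longleftrightarrow> f \<in> borel_measurable M & integrable M (%y. (f y)^2)"

definition nrm :: "'a measure => ('a => real) => real" where
 "nrm M f = sqrt (\<integral>y. (f y)^2 \<partial>M)"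

lemma nrm_nonneg [simp]: "0 <= nrm M f" by (simp add: nrm_def)

lemma nrm_power2: "(nrm M f)^2 = (\<integral>y. (f y)^2 \<partial>M)" by (simp add: nrm_def)

lemma L2_sphere_sqi: "f \<in> L2_sphere \<longleftrightarrow> sqi surf f" by (simp add: L2_sphere_def sqi_def)
lemma L2_norm_nrm: "L2_norm f = nrm surf f" by (simp add: L2_norm_def nrm_def)

lemma sqi_measurable [measurable_dest]: "sqi M f ==> f \<in> borel_measurable M" by (simp add: sqi_def)

lemma sqi_mult: "sqi M f ==> sqi M g ==> integrable M (%y. f y * g y)"
 using Cauchy_Schwarz_integral(1) by (auto simp: sqi_def)

lemma sqi_power2: "sqi M f ==> integrable M (%y. (f y)^2)" by (simp add: sqi_def)

lemma ip_le: "sqi M f ==> sqi M g ==> |\<integral>y. f y * g y \<partial>M| <= nrm M f * nrm M g"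
 using Cauchy_Schwarz_integral(2) by (auto simp: sqi_def nrm_def)

lemma sqi_add: assumes "sqi M f" "sqi M g" shows "sqi M (%y. f y + g y)"
proof -
 have "integrable M (%y. (f y)^2 + 2 * (f y * g y) + (g y)^2)"
  using sqi_mult[OF assms] assms by (intro Bochner_Integration.integrable_add) (auto simp: sqi_def)
 moreover have "(%y. (f y + g y)^2) = (%y. (f y)^2 + 2 * (f y * g y) + (g y)^2)"
  by (simp add: fun_eq_iff power2_eq_square algebra_simps)
 ultimately show ?thesis using assms unfolding sqi_def by (auto intro: borel_measurable_add)
qed

lemma sqi_cmult: "sqi M f ==> sqi M (%y. c * f y)"
 unfolding sqi_def power_mult_distrib by (auto intro: borel_measurable_times)

lemma sqi_diff: "sqi M f ==> sqi M g ==> sqi M (%y. f y - g y)"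
 using sqi_add[of M f "%y. (-1) * g y"] sqi_cmult[of M g "-1"] by simp

lemma nrm_triangle: assumes "sqi M f" "sqi M g" shows "nrm M (%y. f y + g y) <= nrm M f + nrm M g"
proof -
 have "(nrm M (%y. f y + g y))^2 = (\<integral>y. (f y)^2 + 2 * (f y * g y) + (g y)^2 \<partial>M)"
  unfolding nrm_power2 by (intro LI_cong) (simp_all add: power2_eq_square algebra_simps)
 also have "... = (nrm M f)^2 + 2 * (\<integral>y. f y * g y \<partial>M) + (nrm M g)^2"
  using sqi_mult[OF assms] assms by (simp add: nrm_power2 sqi_def)
 also have "... <= (nrm M f)^2 + 2 * (nrm M f * nrm M g) + (nrm M g)^2"
  using ip_le[OF assms] by linarith
 also have "... = (nrm M f + nrm M g)^2" by (simp add: power2_eq_square algebra_simps)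
 finally show ?thesis by (rule power2_le_imp_le) simp
qed

lemma nrm_cmult: "nrm M (%y. c * f y) = |c| * nrm M f"
 by (simp add: nrm_def power_mult_distrib real_sqrt_mult)

lemma nrm_diff: assumes "sqi M f" "sqi M g" shows "nrm M (%y. f y - g y) <= nrm M f + nrm M g"
 using nrm_triangle[OF assms(1) sqi_cmult[OF assms(2), of "-1"]] nrm_cmult[of M "-1" g] by simp

lemma (in finite_measure) sqi_bounded:
 assumes "f \<in> borel_measurable M" "!!y. y \<in> space M ==> |f y| <= B" shows "sqi M f"
proof -
 have "integrable M (%y. (f y)^2)"
 proof (rule integrable_const_bound[of _ "B^2"])
  show "AE y in M. norm ((f y)^2) <= B^2"
   using assms(2) by (intro AE_I2) (simp, metis abs_ge_zero power2_abs power_mono)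
 qed (use assms(1) in measurable)
 thus ?thesis using assms(1) by (simp add: sqi_def)
qed

lemma (in finite_measure) sqi_integrable: assumes "sqi M f" shows "integrable M f"
 using sqi_mult[OF assms sqi_bounded[of "%_. 1" 1]] by simp

lemma (in finite_measure) sqi_const: "sqi M (%_. c)"
 by (rule sqi_bounded[of _ "|c|"]) auto

lemma (in finite_measure) nrm_le_bound:
 assumes "sqi M f" "!!y. y \<in> space M ==> |f y| <= B" "0 <= B"
 shows "nrm M f <= B * sqrt (measure M (space M))"
proof -
 have "(\<integral>y. (f y)^2 \<partial>M) <= (\<integral>y. B^2 \<partial>M)"
  using assms by (intro integral_mono) (auto simp: sqi_def abs_le_square_iff[symmetric])
 hence "nrm M f <= sqrt (B^2 * measure M (space M))" by (simp add: nrm_def mult.commute)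
 thus ?thesis using assms(3) by (simp add: real_sqrt_mult)
qed

section \<open>Density of polynomials in L^2 of a finite measure on the sphere\<close>

definition poly_approx :: "(real^3) measure => (real^3 => real) => bool" where
 "poly_approx M f \<longleftrightarrow> sqi M f & (\<forall>ep>0. \<exists>e. nrm M (%y. f y - ev e y) < ep)"

text \<open>Density is needed for \<open>surf\<close> and also for a weighted measure with density 1
  + |d|, so it is proved for every finite Borel measure on the sphere.\<close>

locale sphere_measure = finite_measure M for M :: "(real^3) measure" +
 assumes sets_M: "sets M = sets (restrict_space borel S2)"
begin

lemma space_M [simp]: "space M = S2"
 using sets_eq_imp_space_eq[OF sets_M] by (simp add: space_restrict_space)

lemma measurable_M: "f \<in> measurable borel N ==> f \<in> measurable M N"
 using measurable_restrict_space1 measurable_cong_sets[OF sets_M refl] by blast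

lemma sqi_ev: "sqi M (ev e)"
proof -
 obtain B where "\<forall>y\<in>S2. |ev e y| <= B" using ev_bounded by blast
 thus ?thesis by (intro sqi_bounded[of _ B] measurable_M) auto
qed

lemma poly_approx_add: assumes "poly_approx M f" "poly_approx M g" shows "poly_approx M (%y. f y + g y)"
 unfolding poly_approx_def
proof (intro conjI allI impI)
 show s: "sqi M (%y. f y + g y)" using assms by (auto simp: poly_approx_def intro: sqi_add)
 fix ep :: real assume "ep > 0"
 then obtain a b where ab: "nrm M (%y. f y - ev a y) < ep/2" "nrm M (%y. g y - ev b y) < ep/2"
  using assms unfolding poly_approx_def by (metis half_gt_zero)
 have "nrm M (%y. (f y - ev a y) + (g y - ev b y)) <= nrm M (%y. f y - ev a y) + nrm M (%y. g y - ev b y)"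
  using assms by (intro nrm_triangle sqi_diff sqi_ev) (auto simp: poly_approx_def)
 also have "... < ep" using ab by simp
 finally have "nrm M (%y. (f y + g y) - ev (PAdd a b) y) < ep" by (simp add: algebra_simps)
 thus "\<exists>e. nrm M (%y. (f y + g y) - ev e y) < ep" by blast
qed

lemma poly_approx_cmult: assumes "poly_approx M f" shows "poly_approx M (%y. c * f y)"
 unfolding poly_approx_def
proof (intro conjI allI impI)
 show s: "sqi M (%y. c * f y)" using assms by (auto simp: poly_approx_def intro: sqi_cmult)
 fix ep :: real assume e: "ep > 0"
 have "ep / ( |c| + 1) > 0" using e by simp
 then obtain a where a: "nrm M (%y. f y - ev a y) < ep / ( |c| + 1)"
  using assms unfolding poly_approx_def by metis
 have "nrm M (%y. c * f y - ev (PMul (PC c) a) y) = |c| * nrm M (%y. f y - ev a y)"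
  using nrm_cmult[of M c "%y. f y - ev a y"] by (simp add: algebra_simps)
 also have "... <= ( |c| + 1) * nrm M (%y. f y - ev a y)" by (intro mult_right_mono) auto
 also have "... < ep" using a by (simp add: field_simps)
 finally show "\<exists>e. nrm M (%y. c * f y - ev e y) < ep" by blast
qed

lemma poly_approx_sum: "finite I ==> (!!i. i \<in> I ==> poly_approx M (f i)) ==> poly_approx M (%y. SUM i:I. f i y)"
proof (induction I rule: finite_induct)
 case empty
 have "nrm M (%y. 0 - ev (PC 0) y) = 0" by (simp add: nrm_def)
 thus ?case by (auto simp: poly_approx_def sqi_def intro: exI[of _ "PC 0"])
next
 case (insert i I)
 thus ?case using poly_approx_add[of "f i" "%y. SUM i:I. f i y"] by simp
qed

lemma poly_approx_limit:
 assumes "sqi M f" "!!ep. ep > 0 ==> \<exists>g. poly_approx M g & nrm M (%y. f y - g y) < ep"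
 shows "poly_approx M f"
 unfolding poly_approx_def
proof (intro conjI allI impI)
 fix ep :: real assume "ep > 0"
 then obtain g where g: "poly_approx M g" "nrm M (%y. f y - g y) < ep/2" using assms(2) by (metis half_gt_zero)
 then obtain a where a: "nrm M (%y. g y - ev a y) < ep/2" using `ep > 0` unfolding poly_approx_def by (metis half_gt_zero)
 have "nrm M (%y. (f y - g y) + (g y - ev a y)) <= nrm M (%y. f y - g y) + nrm M (%y. g y - ev a y)"
  using assms(1) g(1) by (intro nrm_triangle sqi_diff sqi_ev) (auto simp: poly_approx_def)
 also have "... < ep" using a g by simp
 finally show "\<exists>e. nrm M (%y. f y - ev e y) < ep" by auto
qed (fact assms)

lemma nrm_dominated:
 assumes "!!n. sqi M (g n)" "sqi M f" "sqi M w"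
  and "!!y. y \<in> S2 ==> (%n. g n y) \<longlonglongrightarrow> f y"
  and "!!n y. y \<in> S2 ==> |f y - g n y| <= w y"
  and "ep > 0"
 shows "\<exists>n. nrm M (%y. f y - g n y) < ep"
proof -
 have "(%n. \<integral>y. (f y - g n y)^2 \<partial>M) \<longlonglongrightarrow> (\<integral>y. 0 \<partial>M)"
 proof (rule integral_dominated_convergence[where w="%y. (w y)^2"])
  show "AE y in M. (%n. (f y - g n y)^2) \<longlonglongrightarrow> 0"
  proof (rule AE_I2)
   fix y assume "y \<in> space M"
   hence "(%n. (f y - g n y)^2) \<longlonglongrightarrow> (f y - f y)^2" by (intro tendsto_intros assms) simp
   thus "(%n. (f y - g n y)^2) \<longlonglongrightarrow> 0" by simp
  qed
  show "AE y in M. norm ((f y - g n y)^2) <= (w y)^2" for n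
   using assms(5)[of _ n] by (intro AE_I2) (simp, metis abs_ge_zero power2_abs power_mono)
  show "(%y. (f y - g n y)^2) \<in> borel_measurable M" for n
   using sqi_diff[OF assms(2,1)] by (intro borel_measurable_power) (simp add: sqi_def)
 qed (use assms in "auto simp: sqi_def")
 hence "(%n. nrm M (%y. f y - g n y)) \<longlonglongrightarrow> sqrt 0"
  unfolding nrm_def by (intro tendsto_real_sqrt) simp
 hence "\<forall>\<^sub>F n in sequentially. nrm M (%y. f y - g n y) < ep"
  using `ep > 0` by (intro order_tendstoD(2)) auto
 thus ?thesis by (auto simp: eventually_sequentially)
qed

lemma poly_approx_continuous:
 assumes "continuous_on S2 g" shows "poly_approx M g"
proof -
 have meas: "g \<in> borel_measurable M"
  using borel_measurable_continuous_on_restrict[OF assms] measurable_cong_sets[OF sets_M refl] by blast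
 have "bounded (g ` S2)" using assms by (intro compact_imp_bounded compact_continuous_image) auto
 then obtain B where "\<forall>y\<in>S2. |g y| <= B" by (auto simp: bounded_iff)
 hence s: "sqi M g" using meas by (intro sqi_bounded[of _ B]) auto
 show ?thesis unfolding poly_approx_def
 proof (intro conjI allI impI)
  fix ep :: real assume e: "ep > 0"
  define d where "d = ep / (sqrt (measure M (space M)) + 1)"
  have d: "d > 0" using e by (simp add: d_def add_nonneg_pos)
  obtain p where p: "\<forall>y\<in>S2. |g y - ev p y| < d" using poly_uniform_approx[OF assms d] by blast
  have "nrm M (%y. g y - ev p y) <= d * sqrt (measure M (space M))"
   using p d by (intro nrm_le_bound sqi_diff s sqi_ev) (auto intro: less_imp_le)
  also have "... < d * (sqrt (measure M (space M)) + 1)" using d by simp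
  also have "... = ep"
   unfolding d_def by (simp add: add_nonneg_eq_0_iff)
  finally show "\<exists>p. nrm M (%y. g y - ev p y) < ep" by blast
 qed (fact s)
qed

text \<open>Tents of slope n around the closed set decrease pointwise to its indicator.\<close>

lemma poly_approx_closed:
 assumes "closed A" shows "poly_approx M (ind A)"
proof (cases "A = {}")
 case True
 thus ?thesis using poly_approx_continuous[of "%_. 0"] by (simp add: indicator_def[abs_def])
next
 case False
 define g where "g n y = max 0 (1 - real n * infdist y A)" for n y
 have c: "continuous_on S2 (g n)" for n unfolding g_def by (intro continuous_intros)
 have pa: "poly_approx M (g n)" for n by (rule poly_approx_continuous[OF c])
 have ind: "sqi M (ind A)"
  using assms by (intro sqi_bounded[of _ 1] measurable_M) (auto simp: indicator_def)
 show ?thesis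
 proof (rule poly_approx_limit[OF ind])
  fix ep :: real assume "ep > 0"
  have "\<exists>n. nrm M (%y. ind A y - g n y) < ep"
  proof (rule nrm_dominated[OF _ ind sqi_const[of 2] _ _ `ep > 0`])
   show "sqi M (g n)" for n using pa by (simp add: poly_approx_def)
   show "(%n. g n y) \<longlonglongrightarrow> ind A y" for y
   proof (cases "y \<in> A")
    case True thus ?thesis by (simp add: g_def)
   next
    case f: False
    hence pos: "infdist y A > 0" using assms False in_closed_iff_infdist_zero infdist_nonneg by (metis order_le_less)
    obtain m :: nat where m: "1 / infdist y A < real m" using reals_Archimedean2 by blast
    have "g n y = 0" if "n >= m" for n
    proof -
     have "1 / infdist y A < real n" using m that by linarith
     hence "1 < real n * infdist y A" using pos by (simp add: field_simps)
     thus ?thesis by (simp add: g_def)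
    qed
    hence "\<forall>\<^sub>F n in sequentially. g n y = 0" by (auto simp: eventually_sequentially)
    thus ?thesis using f by (simp add: tendsto_eventually)
   qed
   show "|ind A y - g n y| <= 2" for n y
   proof -
    have "0 <= real n * infdist y A" by (simp add: infdist_nonneg)
    hence "0 <= g n y" "g n y <= 1" by (auto simp: g_def)
    thus ?thesis by (auto simp: indicator_def)
   qed
  qed
  thus "\<exists>g. poly_approx M g & nrm M (%y. ind A y - g y) < ep" using pa by blast
 qed
qed

lemma poly_approx_indicator:
 assumes "A \<in> sets M" shows "poly_approx M (ind A)"
proof (rule poly_approx_limit)
 have AS: "A <= S2" using sets.sets_into_space[OF assms] by simp
 show sA: "sqi M (ind A)"
  using assms by (intro sqi_bounded[of _ 1]) (auto simp: indicator_def)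
 fix ep :: real assume e: "ep > 0"
 let ?N = "distr M borel (%x. x)"
 have idm: "(%x. x) \<in> M \<rightarrow>\<^sub>M borel" by (rule measurable_M) simp
 have Ab: "A \<in> sets borel" using assms unfolding sets_M sets_restrict_space by auto
 have em: "emeasure ?N B = emeasure M (B Int S2)" if "B \<in> sets borel" for B
  using that idm by (simp add: emeasure_distr)
 have inner: "emeasure ?N A = (SUP K \<in> {K. K <= A & compact K}. emeasure ?N K)"
  by (rule inner_regular) (use Ab em[of UNIV] in auto)
 \<comment> \<open>The L^2 distance of two nested indicators is the square root of the measure of
   the difference, hence \<open>ep^2\<close>. A negative level is split off because
   \<open>ennreal\<close> truncates it to 0.\<close>
 obtain K where K: "K <= A" "compact K" and eK: "measure M A - ep^2 < measure M K"
 proof (cases "measure M A - ep^2 < 0")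
  case True
  thus thesis using that[of "{}"] by simp
 next
  case False
  hence "ennreal (measure M A - ep^2) < emeasure ?N A"
   using em[OF Ab] e AS by (simp add: Int_absorb2 emeasure_eq_measure ennreal_less_iff)
  hence "\<exists>K\<in>{K. K <= A & compact K}. ennreal (measure M A - ep^2) < emeasure ?N K"
   unfolding inner by (simp only: less_SUP_iff)
  then obtain K where K: "K <= A" "compact K" "ennreal (measure M A - ep^2) < emeasure ?N K"
   by blast
  have "emeasure ?N K = ennreal (measure M K)"
  proof -
   have "K Int S2 = K" using K(1) AS by blast
   moreover have "K \<in> sets borel" using K(2) by (simp add: compact_imp_closed)
   ultimately show ?thesis using em[of K] emeasure_eq_measure by metis
  qed
  with K False have "measure M A - ep^2 < measure M K" by (simp add: ennreal_less_iff)
  with K show thesis using that by blast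
 qed
 have Kb: "K \<in> sets borel" using K by (simp add: compact_imp_closed)
 have KM: "K \<in> sets M" using Kb K AS unfolding sets_M sets_restrict_space by auto
 have m: "measure M (A - K) < ep^2" using finite_measure_Diff[OF assms KM K(1)] eK by simp
 have "(nrm M (%y. ind A y - ind K y))^2 = (\<integral>y. ind (A - K) y \<partial>M)"
  unfolding nrm_power2 using K(1) by (intro LI_cong) (auto simp: indicator_def)
 also have "... = measure M (A - K)" using assms KM by (simp add: sets.Int_space_eq2[of "A - K" M, simplified])
 finally have "(nrm M (%y. ind A y - ind K y))^2 < ep^2" using m by simp
 hence "nrm M (%y. ind A y - ind K y) < ep" using e by (simp add: power2_less_imp_less)
 thus "\<exists>g. poly_approx M g & nrm M (%y. ind A y - g y) < ep"
  using poly_approx_closed K(2) compact_imp_closed by blast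
qed

lemma poly_approx_cong:
 assumes fg: "!!y. y \<in> S2 ==> f y = g y" and "f \<in> borel_measurable M" "poly_approx M g"
 shows "poly_approx M f"
proof -
 have "integrable M (%y. (f y)^2) \<longleftrightarrow> integrable M (%y. (g y)^2)"
  by (rule Bochner_Integration.integrable_cong) (use fg in auto)
 hence "sqi M f" using assms(2,3) by (simp add: sqi_def poly_approx_def)
 moreover have "nrm M (%y. f y - ev e y) = nrm M (%y. g y - ev e y)" for e
  unfolding nrm_def by (intro arg_cong[where f=sqrt] LI_cong) (use fg in auto)
 ultimately show ?thesis using assms(3) by (simp add: poly_approx_def)
qed

lemma poly_approx_simple:
 assumes "simple_function M F" shows "poly_approx M F"
proof -
 have "poly_approx M (%y. SUM v:F ` space M. v * ind (F -` {v} Int space M) y)"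
  using assms simple_functionD[OF assms]
  by (intro poly_approx_sum poly_approx_cmult poly_approx_indicator) auto
 moreover have eq: "F y = (SUM v:F ` space M. v * ind (F -` {v} Int space M) y)" if "y \<in> S2" for y
 proof -
  have "(SUM v:F ` space M. v * ind (F -` {v} Int space M) y) = (SUM v:F ` space M. if v = F y then v else 0)"
   using that by (intro sum.cong) (auto simp: indicator_def)
  also have "... = F y" using that simple_functionD(1)[OF assms] by (simp add: sum.delta)
  finally show ?thesis ..
 qed
 moreover have "F \<in> borel_measurable M" using assms by (rule borel_measurable_simple_function)
 ultimately show ?thesis using poly_approx_cong[of F "%y. SUM v:F ` space M. v * ind (F -` {v} Int space M) y"] by blast
qed

theorem poly_dense:
 assumes "sqi M f" shows "poly_approx M f"
proof -
 have fm: "f \<in> borel_measurable M" using assms by (simp add: sqi_def)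
 obtain F where F: "\<forall>i. simple_function M (F i)" "\<forall>y\<in>space M. (%i. F i y) \<longlonglongrightarrow> f y"
  "\<forall>i. \<forall>y\<in>space M. dist (F i y) 0 <= 2 * dist (f y) 0"
  using borel_measurable_implies_sequence_metric[OF fm, of 0] by blast
 have pa: "poly_approx M (F i)" for i using F(1) poly_approx_simple by blast
 show ?thesis
 proof (rule poly_approx_limit[OF assms])
  fix ep :: real assume "ep > 0"
  have sw: "sqi M (%y. 3 * |f y| )" using assms by (intro sqi_cmult) (auto simp: sqi_def intro: borel_measurable_abs)
  have "\<exists>n. nrm M (%y. f y - F n y) < ep"
  proof (rule nrm_dominated[OF _ assms sw _ _ `ep > 0`])
   show "sqi M (F n)" for n using pa by (simp add: poly_approx_def)
   fix n y assume "y \<in> S2"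
   hence "|F n y| <= 2 * |f y|" using F(3) by (simp add: dist_real_def)
   thus "|f y - F n y| <= 3 * |f y|" by linarith
  qed (use F(2) in auto)
  thus "\<exists>g. poly_approx M g & nrm M (%y. f y - g y) < ep" using pa by blast
 qed
qed

end

interpretation surf: sphere_measure surf
 by unfold_locales (rule sets_surf)

(* d / (1 + |d|) is bounded and the measure (1 + |d|) ds is finite, which reduces the
 L^1 statement to L^2 density. *)
lemma integrable_orthogonal_poly_zero:
 assumes d: "integrable surf d" and o: "!!e. (SI y. ev e y * d y) = 0"
 shows "AE y in surf. d y = 0"
proof -
 have [measurable]: "d \<in> borel_measurable surf" using d by simp
 define N where "N = density surf (%y. ennreal (1 + |d y| ))"
 have i1: "integrable surf (%y. 1 + |d y| )" using d by simp
 interpret N: sphere_measure N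
 proof (rule sphere_measure.intro[OF finite_measureI sphere_measure_axioms.intro])
  have "emeasure N (space N) = (\<integral>\<^sup>+y. ennreal (1 + |d y| ) \<partial>surf)"
  proof -
   have "emeasure N (space surf) = (\<integral>\<^sup>+y. ennreal (1 + |d y| ) * ind (space surf) y \<partial>surf)"
    unfolding N_def by (rule emeasure_density) (use sets.top[of surf] in "simp_all del: space_surf")
   also have "... = (\<integral>\<^sup>+y. ennreal (1 + |d y| ) \<partial>surf)" by (rule nn_integral_cong) simp
   finally show ?thesis by (simp add: N_def)
  qed
  also have "... = ennreal (SI y. 1 + |d y| )" by (rule nn_integral_eq_integral[OF i1]) auto
  finally show "emeasure N (space N) ~= \<infinity>" by simp
  show "sets N = sets (restrict_space borel S2)" by (simp add: N_def sets_surf)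
 qed
 define q where "q y = d y / (1 + |d y| )" for y
 have qm: "q \<in> borel_measurable N" unfolding q_def N_def by measurable
 have "|q y| <= 1" for y by (simp add: q_def abs_divide)
 hence q: "sqi N q" using qm by (intro N.sqi_bounded[of _ 1]) auto
 have orth: "(\<integral>y. ev e y * q y \<partial>N) = 0" for e
 proof -
  have [measurable]: "ev e \<in> borel_measurable surf" "q \<in> borel_measurable surf"
   using qm by (auto simp: N_def intro: measurable_surfI)
  have "(\<integral>y. ev e y * q y \<partial>N) = (SI y. (1 + |d y| ) *R (ev e y * q y))"
   unfolding N_def by (rule integral_density) auto
  also have "... = (SI y. ev e y * d y)"
  proof (rule LI_cong[OF refl])
   fix y
   have "1 + |d y| ~= 0" using abs_ge_zero[of "d y"] by linarith
   thus "(1 + |d y| ) *R (ev e y * q y) = ev e y * d y" by (simp add: q_def)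
  qed
  finally show ?thesis using o by simp
 qed
 have small: "(nrm N q)^2 <= nrm N q * ep" if "ep > 0" for ep
 proof -
  obtain p where p: "nrm N (%y. q y - ev p y) < ep"
   using N.poly_dense[OF q] `ep > 0` unfolding poly_approx_def by blast
  have "(nrm N q)^2 = (\<integral>y. q y * (q y - ev p y) + ev p y * q y \<partial>N)"
   unfolding nrm_power2 by (simp add: power2_eq_square algebra_simps)
  also have "... = (\<integral>y. q y * (q y - ev p y) \<partial>N) + (\<integral>y. ev p y * q y \<partial>N)"
   by (intro Bochner_Integration.integral_add sqi_mult sqi_diff q N.sqi_ev)
  also have "... <= nrm N q * nrm N (%y. q y - ev p y)"
   using ip_le[OF q sqi_diff[OF q N.sqi_ev[of p]]] orth[of p] by simp
  also have "... <= nrm N q * ep" using p by (intro mult_left_mono) auto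
  finally show ?thesis .
 qed
 have "nrm N q = 0"
 proof (rule ccontr)
  assume "nrm N q ~= 0"
  hence "nrm N q > 0" using nrm_nonneg[of N q] by linarith
  thus False using small[of "nrm N q / 2"] by (simp add: power2_eq_square)
 qed
 hence "(\<integral>y. (q y)^2 \<partial>N) = 0" using nrm_power2[of N q] by simp
 hence "AE y in N. (q y)^2 = 0" using q by (subst (asm) integral_nonneg_eq_0_iff_AE) (auto simp: sqi_def)
 hence "AE y in surf. ennreal (1 + |d y| ) > 0 --> (q y)^2 = 0"
  unfolding N_def by (subst (asm) AE_density) auto
 thus ?thesis
 proof (rule AE_mp, intro AE_I2 impI)
  fix y assume "ennreal (1 + |d y| ) > 0 --> (q y)^2 = 0"
  moreover have "1 + |d y| > 0" using abs_ge_zero[of "d y"] by linarith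
  moreover from this have "ennreal (1 + |d y| ) > 0" by (simp only: ennreal_less_zero_iff)
  ultimately have "q y = 0" by simp
  thus "d y = 0" using `1 + |d y| > 0` by (simp add: q_def)
 qed
qed

section \<open>Integration by parts through rotations\<close>

text \<open>Rodrigues' formula for the rotation by the angle t about the unit axis a.\<close>

definition rot :: "real^3 => real => real^3 => real^3" where
 "rot a t y = cos t *R y + sin t *R cross3 a y + ((1 - cos t) * (a .* y)) *R a"

lemma linear_rot: "linear (rot a t)"
 by (rule linearI) (simp_all add: rot_def cross_add_right cross_mult_right inner_add_right algebra_simps)

lemma norm_rot: assumes "norm a = 1" shows "norm (rot a t y) = norm y"
proof -
 have aa: "a .* a = 1" using assms by (simp add: norm_eq_1)
 have cc: "cross3 a y .* cross3 a y = y .* y - (a .* y)^2"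
  using norm_cross[of a y] assms by (simp add: power2_norm_eq_inner)
 have sc: "sin t * sin t = 1 - cos t * cos t" using sin_cos_squared_add[of t] by (simp add: power2_eq_square)
 define k where "k = (1 - cos t) * (a .* y)"
 have "rot a t y .* rot a t y = cos t * cos t * (y .* y) + sin t * sin t * (cross3 a y .* cross3 a y) + k * k * (a .* a) + 2 * (cos t * k * (a .* y))"
  unfolding rot_def k_def[symmetric]
  by (simp add: inner_add_left inner_add_right inner_commute[of y a] inner_commute[of y "cross3 a y"] inner_commute[of a "cross3 a y"] dot_cross_self algebra_simps)
 also have "... = y .* y" unfolding cc sc aa k_def by (simp add: power2_eq_square algebra_simps)
 finally show ?thesis by (simp add: norm_eq_sqrt_inner)
qed

lemma orthogonal_rot: "norm a = 1 ==> orthogonal_transformation (rot a t)"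
 unfolding orthogonal_transformation using linear_rot norm_rot by blast

lemma rot_0 [simp]: "rot a 0 y = y" by (simp add: rot_def)

lemma rot_inverse: assumes "norm a = 1" shows "rot a (- t) (rot a t y) = y"
proof -
 have aa: "a .* a = 1" using assms by (simp add: norm_eq_1)
 have ca: "cross3 a (cross3 a y) = (a .* y) *R a - y"
  by (subst Lagrange) (simp add: aa)
 have sc: "sin t * sin t = 1 - cos t * cos t" using sin_cos_squared_add[of t] by (simp add: power2_eq_square)
 define d where "d = a .* y"
 have ay: "a .* rot a t y = d"
  by (simp add: rot_def inner_add_right dot_cross_self aa d_def algebra_simps)
 have cr: "cross3 a (rot a t y) = cos t *R cross3 a y + sin t *R (d *R a - y)"
  by (simp add: rot_def cross_add_right cross_mult_right ca d_def)
 have "rot a (- t) (rot a t y) = cos t *R rot a t y - sin t *R cross3 a (rot a t y) + ((1 - cos t) * d) *R a"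
  by (simp add: rot_def[of a "- t"] ay)
 also have "... = (cos t * cos t) *R y + (sin t * sin t) *R y + (cos t * ((1 - cos t) * d) - sin t * sin t * d + (1 - cos t) * d) *R a"
  unfolding cr by (simp add: rot_def d_def[symmetric] algebra_simps)
 finally have r: "rot a (- t) (rot a t y) = ..." .
 have e1: "cos t * cos t + sin t * sin t = 1" using sc by simp
 have e2: "cos t * ((1 - cos t) * d) - sin t * sin t * d + (1 - cos t) * d = 0" unfolding sc by (simp add: algebra_simps)
 show ?thesis unfolding r e2 scaleR_left.add[symmetric] e1 by simp
qed

lemma rot_has_derivative:
 assumes "norm a = 1"
 shows "((%t. rot a t y) has_vector_derivative (cross3 a (rot a t y))) (at t)"
proof -
 have aa: "a .* a = 1" using assms by (simp add: norm_eq_1)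
 have ca: "cross3 a (cross3 a y) = (a .* y) *R a - y"
  by (subst Lagrange) (simp add: aa)
 have d: "((%t. cos t *R y + sin t *R cross3 a y + ((1 - cos t) * (a .* y)) *R a) has_derivative
  (%s. (s * - sin t) *R y + (s * cos t) *R cross3 a y + (s * sin t * (a .* y)) *R a)) (at t)"
  by (auto intro!: derivative_eq_intros)
 have cr: "cross3 a (rot a t y) = cos t *R cross3 a y + sin t *R ((a .* y) *R a - y)"
  by (simp add: rot_def cross_add_right cross_mult_right ca)
 have "(%s. (s * - sin t) *R y + (s * cos t) *R cross3 a y + (s * sin t * (a .* y)) *R a) = (%s. s *R cross3 a (rot a t y))"
  unfolding cr by (simp add: fun_eq_iff algebra_simps)
 with d show ?thesis unfolding has_vector_derivative_def rot_def[abs_def] by simp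
qed

text \<open>The velocity of the rotation is a x y, and grad e . (a x y) = a . (y x grad e). The
  single vector \<open>Lv e\<close> thus encodes the derivatives along all rotations.\<close>

lemma ev_rot_derivative:
 assumes "norm a = 1"
 shows "((%t. ev e (rot a t y)) has_real_derivative (a .* Lv e (rot a t y))) (at t)"
proof -
 have "((%t. ev e (rot a t y)) has_derivative (%s. gr e (rot a t y) .* (s *R cross3 a (rot a t y)))) (at t)"
  using rot_has_derivative[OF assms, of y t] unfolding has_vector_derivative_def
  by (rule has_derivative_compose[OF _ has_derivative_ev])
 moreover have "(%s. gr e (rot a t y) .* (s *R cross3 a (rot a t y))) = (*) (a .* Lv e (rot a t y))"
 proof
  fix s
  have "gr e (rot a t y) .* cross3 a (rot a t y) = a .* cross3 (rot a t y) (gr e (rot a t y))"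
   by (simp add: cross3_def inner_vec_def sum_3 algebra_simps)
  thus "gr e (rot a t y) .* (s *R cross3 a (rot a t y)) = (a .* Lv e (rot a t y)) * s"
   unfolding Lv_cross by simp
 qed
 ultimately show ?thesis by (simp add: has_field_derivative_def)
qed

text \<open>Dominated convergence is applied to sequences, so difference quotients are taken along
  the increments c / (n + 1), with c = 1 for one factor and c = -1 for the other.\<close>

lemma deriv_seq:
 assumes "(f has_real_derivative D) (at 0)" "c ~= 0"
 shows "(%n. (f (c / real (Suc n)) - f 0) * real (Suc n)) \<longlonglongrightarrow> c * D"
proof -
 have lim0: "(%n. c / real (Suc n)) \<longlonglongrightarrow> 0"
  using tendsto_mult[OF tendsto_const[of c] LIMSEQ_inverse_real_of_nat] by (simp add: divide_inverse)
 have f: "filterlim (%n. c / real (Suc n)) (at 0) sequentially"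
  using lim0 assms(2) by (auto simp: filterlim_at)
 have "((%h. (f (0 + h) - f 0) / h) \<longlongrightarrow> D) (at 0)" using assms(1) by (simp add: DERIV_def)
 from filterlim_compose[OF this f] have "(%n. c * ((f (c / real (Suc n)) - f 0) / (c / real (Suc n)))) \<longlonglongrightarrow> c * D"
  by (intro tendsto_intros) simp
 moreover have "c * ((f (c / real (Suc n)) - f 0) / (c / real (Suc n))) = (f (c / real (Suc n)) - f 0) * real (Suc n)" for n
  using assms(2) by (simp del: of_nat_Suc)
 ultimately show ?thesis by simp
qed

lemma Lv_bounded: "\<exists>B\<ge>0. \<forall>y\<in>S2. norm (Lv e y) <= B"
proof -
 have "bounded (Lv e ` S2)"
  by (intro compact_imp_bounded compact_continuous_image continuous_intros) auto
 then obtain B where "\<forall>y\<in>S2. norm (Lv e y) <= B" by (auto simp: bounded_iff)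
 thus ?thesis by (intro exI[of _ "max B 0"]) auto
qed

lemma measurable_rot_surf: assumes "norm a = 1" shows "rot a t \<in> surf \<rightarrow>\<^sub>M surf"
proof -
 have "continuous_on UNIV (rot a t)" using linear_rot by (simp add: linear_continuous_on linear_conv_bounded_linear)
 hence Rb: "rot a t \<in> borel \<rightarrow>\<^sub>M borel" by (rule borel_measurable_continuous_onI)
 show ?thesis
  unfolding measurable_cong_sets[OF sets_surf sets_surf]
  by (rule measurable_restrict_space2) (auto simp: norm_rot[OF assms] space_restrict_space intro!: measurable_restrict_space1 Rb)
qed

lemma ev_rot_lipschitz:
 assumes "norm a = 1" "\<forall>y\<in>S2. norm (Lv e y) <= B" "y \<in> S2"
 shows "|ev e (rot a t y) - ev e y| <= B * |t|"
proof -
 have "norm (ev e (rot a t y) - ev e (rot a 0 y)) <= B * norm (t - 0)"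
 proof (rule field_differentiable_bound[of UNIV])
  fix s :: real
  show "((%t. ev e (rot a t y)) has_field_derivative (a .* Lv e (rot a s y))) (at s within UNIV)"
   using ev_rot_derivative[OF assms(1)] by simp
  have "norm (rot a s y) = 1" using norm_rot[OF assms(1)] assms(3) by simp
  hence "norm (Lv e (rot a s y)) <= B" using assms(2) by simp
  thus "norm (a .* Lv e (rot a s y)) <= B"
   using Cauchy_Schwarz_ineq2[of a "Lv e (rot a s y)"] assms(1) by simp
 qed auto
 thus ?thesis by simp
qed

text \<open>Invariance of the surface measure moves the rotation from \<open>ph\<close> to
  \<open>ev e\<close>, with the opposite angle; the difference quotients on both sides then pass to
  the limit by dominated convergence. \<open>ph\<close> is asked only to be Lipschitz along
  rotations and differentiable almost everywhere, as piecewise linear functions are.\<close>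

lemma flow_parts:
 assumes a: "norm a = 1" and phim: "ph \<in> borel_measurable surf" and B: "!!y. y \<in> S2 ==> |ph y| <= B"
  and lip: "!!y t. y \<in> S2 ==> 0 < t ==> t <= 1 ==> |ph (rot a t y) - ph y| <= K * t"
  and psim: "\<psi> \<in> borel_measurable surf"
  and der: "AE y in surf. ((%t. ph (rot a t y)) has_real_derivative \<psi> y) (at 0)"
 shows "(SI y. \<psi> y * ev e y) = - (SI y. ph y * (a .* Lv e y))"
proof -
 obtain C where C: "\<forall>y\<in>S2. |ev e y| <= C" "C >= 0" using ev_bounded by blast
 obtain D where D: "\<forall>y\<in>S2. norm (Lv e y) <= D" "D >= 0" using Lv_bounded by blast
 have evm: "ev e \<in> borel_measurable surf" by (rule measurable_surfI) simp
 define t where "t n = 1 / real (Suc n)" for n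
 have t: "0 < t n" "t n <= 1" "t n * real (Suc n) = 1" for n by (auto simp: t_def)
 note rm = measurable_rot_surf[OF a]
 have phir: "(%y. ph (rot a s y)) \<in> borel_measurable surf" for s
  using measurable_compose[OF rm phim] .
 have evr: "(%y. ev e (rot a s y)) \<in> borel_measurable surf" for s
  using measurable_compose[OF rm evm] .
 have rS: "rot a s y \<in> S2" if "y \<in> S2" for s y using that norm_rot[OF a] by simp
 have inv: "rot a (- s) (rot a s y) = y" for s y by (rule rot_inverse[OF a])
 have Kn: "K >= 0"
 proof -
  have "axis 1 1 \<in> S2" by (simp add: norm_axis_1)
  from lip[OF this, of 1] show ?thesis by simp
 qed
 let ?p = "%n y. (ph (rot a (t n) y) - ph y) * real (Suc n) * ev e y"
 let ?q = "%n y. ph y * ((ev e (rot a (- t n) y) - ev e y) * real (Suc n))"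
 define I where "I n = (SI y. ?p n y)" for n
 have l1: "I \<longlonglongrightarrow> (SI y. \<psi> y * ev e y)"
  unfolding I_def
 proof (rule integral_dominated_convergence[where w="%_. K * C"])
  show "AE y in surf. (%n. ?p n y) \<longlonglongrightarrow> \<psi> y * ev e y" using der
  proof eventually_elim
   case (elim y)
   show ?case using tendsto_mult[OF deriv_seq[OF elim, of 1] tendsto_const[of "ev e y"]] by (simp add: t_def del: of_nat_Suc)
  qed
  show "AE y in surf. norm (?p n y) <= K * C" for n
  proof (rule AE_I2)
   fix y assume "y \<in> space surf"
   hence y: "y \<in> S2" by simp
   have "|ph (rot a (t n) y) - ph y| * real (Suc n) <= (K * t n) * real (Suc n)"
    using lip[OF y t(1,2)] by (intro mult_right_mono) auto
   also have "... = K" using t(3) by (simp add: mult.assoc del: of_nat_Suc)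
   finally have "|ph (rot a (t n) y) - ph y| * real (Suc n) <= K" .
   thus "norm (?p n y) <= K * C"
    using C(1) y Kn unfolding real_norm_def abs_mult by (intro mult_mono) auto
  qed
 qed (use phim psim evm phir in "auto intro!: borel_measurable_times borel_measurable_diff")
 have I2: "I n = (SI y. ?q n y)" for n
 proof -
  have s1: "sqi surf ph" using B phim by (intro surf.sqi_bounded[of _ B]) auto
  have s2: "sqi surf (%y. ph (rot a s y))" for s using B rS phir by (intro surf.sqi_bounded[of _ B]) auto
  have s3: "sqi surf (%y. ev e (rot a s y))" for s using C rS evr by (intro surf.sqi_bounded[of _ C]) auto
  have s4: "sqi surf (ev e)" by (rule surf.sqi_ev)
  have "I n = real (Suc n) * (SI y. ph (rot a (t n) y) * ev e y - ph y * ev e y)"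
   unfolding I_def by (subst Bochner_Integration.integral_mult_right_zero[symmetric]) (simp add: algebra_simps)
  also have "(SI y. ph (rot a (t n) y) * ev e y - ph y * ev e y) =
   (SI y. ph (rot a (t n) y) * ev e y) - (SI y. ph y * ev e y)"
   by (intro LI_diff sqi_mult s1 s2 s4)
  \<comment> \<open>Writing y as the backward rotation of its image prepares the substitution z =
    rot a (t n) y.\<close>
  also have "(SI y. ph (rot a (t n) y) * ev e y) = (SI y. ph (rot a (t n) y) * ev e (rot a (- t n) (rot a (t n) y)))"
   by (simp add: inv)
  also have "... = (\<integral>z. ph z * ev e (rot a (- t n) z) \<partial>distr surf surf (rot a (t n)))"
   using phim evr by (intro integral_distr[symmetric] rm) auto
  also have "... = (SI z. ph z * ev e (rot a (- t n) z))"
   by (simp add: surf_orthogonal_distr[OF orthogonal_rot[OF a]])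
  also have "(SI z. ph z * ev e (rot a (- t n) z)) - (SI y. ph y * ev e y) =
   (SI z. ph z * ev e (rot a (- t n) z) - ph z * ev e z)"
   by (intro LI_diff[symmetric] sqi_mult s1 s3 s4)
  also have "real (Suc n) * ... = (SI y. ?q n y)"
   by (subst Bochner_Integration.integral_mult_right_zero[symmetric]) (simp add: algebra_simps)
  finally show ?thesis .
 qed
 have l2: "I \<longlonglongrightarrow> (SI y. ph y * ((-1) * (a .* Lv e y)))"
  unfolding I2
 proof (rule integral_dominated_convergence[where w="%_. B * D"])
  show "AE y in surf. (%n. ?q n y) \<longlonglongrightarrow> ph y * ((-1) * (a .* Lv e y))"
  proof (rule AE_I2, goal_cases)
   case (1 y)
   have d: "((%t. ev e (rot a t y)) has_real_derivative (a .* Lv e y)) (at 0)"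
    using ev_rot_derivative[OF a, of e y 0] by simp
   show ?case using tendsto_mult[OF tendsto_const[of "ph y"] deriv_seq[OF d, of "-1"]] by (simp add: t_def del: of_nat_Suc)
  qed
  show "AE y in surf. norm (?q n y) <= B * D" for n
  proof (rule AE_I2)
   fix y assume "y \<in> space surf"
   hence y: "y \<in> S2" by simp
   have "|ev e (rot a (- t n) y) - ev e y| * real (Suc n) <= (D * t n) * real (Suc n)"
    using ev_rot_lipschitz[OF a D(1) y, of "- t n"] t(1)[of n] by (intro mult_right_mono) auto
   also have "... = D" using t(3) by (simp add: mult.assoc del: of_nat_Suc)
   finally have "|ev e (rot a (- t n) y) - ev e y| * real (Suc n) <= D" .
   moreover have "0 <= B" using B[OF y] by linarith
   ultimately show "norm (?q n y) <= B * D"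
    using B[OF y] unfolding real_norm_def abs_mult by (intro mult_mono) auto
  qed
  have "Lv e \<in> borel_measurable surf" by (rule measurable_surfI) simp
  thus "(%y. ph y * ((-1) * (a .* Lv e y))) \<in> borel_measurable surf"
   using phim by (intro borel_measurable_times borel_measurable_inner) auto
 qed (use phim psim evm evr in "auto intro!: borel_measurable_times borel_measurable_diff")
 from LIMSEQ_unique[OF l1 l2] show ?thesis by simp
qed

text \<open>\<open>LB w\<close> is the sum of the \<open>L k (L k w)\<close>; the flow identity
  about the k-th axis, tested with \<open>L k w\<close>, handles each summand.\<close>

lemma parts_LB:
 fixes \<Psi> :: "real^3 => real^3"
 assumes phim: "ph \<in> borel_measurable surf" and B: "!!y. y \<in> S2 ==> |ph y| <= B"
  and lip: "!!a y t. norm a = 1 ==> y \<in> S2 ==> 0 < t ==> t <= 1 ==> |ph (rot a t y) - ph y| <= K * t"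
  and psim: "\<Psi> \<in> borel_measurable surf" and PB: "!!y. y \<in> S2 ==> norm (\<Psi> y) <= B'"
  and der: "AE y in surf. \<forall>a. norm a = 1 --> ((%t. ph (rot a t y)) has_real_derivative (a .* \<Psi> y)) (at 0)"
 shows "(SI y. ph y * ev (LB w) y) = - (SI y. \<Psi> y .* Lv w y)"
proof -
 have psk: "(%y. \<Psi> y $ k) \<in> borel_measurable surf" for k
  using borel_measurable_inner[OF psim borel_measurable_const[of "axis k 1"]] by (simp add: inner_axis)
 have sk: "sqi surf (%y. \<Psi> y $ k)" for k
  using PB component_le_norm_cart psk by (intro surf.sqi_bounded[of _ B']) (auto intro: order_trans)
 have sp: "sqi surf ph" using B phim by (intro surf.sqi_bounded[of _ B]) auto
 have k: "(SI y. \<Psi> y $ k * ev (L k w) y) = - (SI y. ph y * ev (L k (L k w)) y)" for k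
 proof -
  have n: "norm (axis k 1 :: real^3) = 1" by (simp add: norm_axis_1)
  have "(SI y. \<Psi> y $ k * ev (L k w) y) = - (SI y. ph y * (axis k 1 .* Lv (L k w) y))"
   by (rule flow_parts[OF n phim B lip[OF n] psk]) (assumption+, rule AE_mp[OF der], rule AE_I2, rule impI, drule spec[of _ "axis k 1"], use n in "simp add: inner_axis'")
  thus ?thesis by (simp add: inner_axis')
 qed
 have "(SI y. ph y * ev (LB w) y) = (SI y. (SUM k:UNIV. ph y * ev (L k (L k w)) y))"
  by (simp add: ev_LB sum_distrib_left)
 also have "... = (SUM k:UNIV. (SI y. ph y * ev (L k (L k w)) y))"
  by (intro LI_sum sqi_mult sp surf.sqi_ev)
 also have "... = - (SUM k:UNIV. (SI y. \<Psi> y $ k * ev (L k w) y))"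
  unfolding k by (simp add: sum_negf)
 also have "(SUM k:UNIV. (SI y. \<Psi> y $ k * ev (L k w) y)) = (SI y. (SUM k:UNIV. \<Psi> y $ k * ev (L k w) y))"
  by (intro LI_sum[symmetric] sqi_mult sk surf.sqi_ev)
 also have "... = (SI y. \<Psi> y .* Lv w y)" by (simp add: inner_vec_def)
 finally show ?thesis .
qed

lemma parts_poly: "(SI y. ev z y * ev (LB w) y) = - (SI y. Lv z y .* Lv w y)"
proof -
 obtain C where C: "\<forall>y\<in>S2. |ev z y| <= C" using ev_bounded by blast
 obtain D where D: "\<forall>y\<in>S2. norm (Lv z y) <= D" using Lv_bounded by blast
 show ?thesis
 proof (rule parts_LB[of _ C D _ D])
  show "AE y in surf. \<forall>a. norm a = 1 --> ((%t. ev z (rot a t y)) has_real_derivative a .* Lv z y) (at 0)"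
  proof (intro AE_I2 allI impI)
   fix y a :: "real^3" assume "norm a = 1"
   from ev_rot_derivative[OF this, of z y 0] show "((%t. ev z (rot a t y)) has_real_derivative a .* Lv z y) (at 0)" by simp
  qed
  show "|ev z (rot a t y) - ev z y| <= D * t" if "norm a = 1" "y \<in> S2" "0 < t" for a y t
   using ev_rot_lipschitz[OF that(1) D that(2), of t] that(3) by simp
 qed (use C D in "auto intro: measurable_surfI")
qed

lemma parts_poly_k: "(SI y. ev (L k z) y * ev e y) = - (SI y. ev z y * ev (L k e) y)"
proof -
 obtain C where C: "\<forall>y\<in>S2. |ev z y| <= C" using ev_bounded by blast
 obtain D where D: "\<forall>y\<in>S2. norm (Lv z y) <= D" using Lv_bounded by blast
 have n: "norm (axis k 1 :: real^3) = 1" by (simp add: norm_axis_1)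
 have "(SI y. ev (L k z) y * ev e y) = - (SI y. ev z y * (axis k 1 .* Lv e y))"
 proof (rule flow_parts[OF n _ _ _ _ ])
  show "AE y in surf. ((%t. ev z (rot (axis k 1) t y)) has_real_derivative ev (L k z) y) (at 0)"
   using ev_rot_derivative[OF n, of z _ 0] by (intro AE_I2) (simp add: inner_axis')
  show "|ev z (rot (axis k 1) t y) - ev z y| <= D * t" if "y \<in> S2" "0 < t" for y t
   using ev_rot_lipschitz[OF n D that(1), of t] that(2) by simp
  show "!!y. y \<in> S2 ==> |ev z y| <= C" using C by blast
 qed (auto intro: measurable_surfI)
 thus ?thesis by (simp add: inner_axis')
qed

section \<open>Sobolev seminorms of polynomials and the dual problem\<close>

text \<open>On the sphere y x grad w is the tangential gradient turned by a right angle, so this is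
  the usual H^1 seminorm.\<close>

definition H1s :: "pexp => real" where
 "H1s w = nrm surf (%y. norm (Lv w y))"

definition H2s :: "pexp => real" where
 "H2s w = sqrt (SUM k:UNIV. (nrm surf (%y. norm (Lv (L k w) y)))^2)"

lemma H1s_nonneg [simp]: "0 <= H1s w" by (simp add: H1s_def)
lemma H2s_nonneg [simp]: "0 <= H2s w" by (simp add: H2s_def sum_nonneg)

lemma measurable_surf_Lv [measurable]: "Lv w \<in> borel_measurable surf" by (rule measurable_surfI) simp

lemma sqi_norm_Lv: "sqi surf (%y. norm (Lv w y))"
proof -
 obtain D where D: "\<forall>y\<in>S2. norm (Lv w y) <= D" using Lv_bounded by blast
 thus ?thesis by (intro surf.sqi_bounded[of _ D] borel_measurable_norm measurable_surf_Lv) auto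
qed

lemma vip_le:
 fixes F G :: "'a => real^3"
 assumes [measurable]: "F \<in> borel_measurable M" "G \<in> borel_measurable M"
  and FG: "sqi M (%y. norm (F y))" "sqi M (%y. norm (G y))"
 shows "|\<integral>y. F y .* G y \<partial>M| <= nrm M (%y. norm (F y)) * nrm M (%y. norm (G y))" "integrable M (%y. F y .* G y)"
proof -
 have i: "integrable M (%y. norm (F y) * norm (G y))" by (rule sqi_mult[OF FG])
 show i2: "integrable M (%y. F y .* G y)"
  by (rule LI_bound[OF i]) (auto intro!: AE_I2 Cauchy_Schwarz_ineq2)
 have "|\<integral>y. F y .* G y \<partial>M| <= (\<integral>y. |F y .* G y| \<partial>M)" using integral_norm_bound[of M "%y. F y .* G y"] by simp
 also have "... <= (\<integral>y. norm (F y) * norm (G y) \<partial>M)"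
  using i i2 by (intro integral_mono) (auto intro!: Cauchy_Schwarz_ineq2)
 also have "... <= nrm M (%y. norm (F y)) * nrm M (%y. norm (G y))" using ip_le[OF FG] by linarith
 finally show "|\<integral>y. F y .* G y \<partial>M| <= nrm M (%y. norm (F y)) * nrm M (%y. norm (G y))" .
qed

lemma H1s_power2: "(H1s w)^2 = - (SI y. ev w y * ev (LB w) y)"
 unfolding H1s_def nrm_power2 parts_poly by (simp add: power2_norm_eq_inner)

lemma H2s_power2: "(H2s w)^2 = (SUM k:UNIV. (H1s (L k w))^2)"
 by (simp add: H2s_def H1s_def sum_nonneg)

text \<open>Antisymmetry of the operators \<open>L k\<close> and their commutation with
  \<open>LB\<close> turn the sum of the integrals of |Lv (L k w)|^2 into the integral of (LB w)^2:
  the second derivatives are controlled by the Laplacian with constant 1.\<close>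

lemma H2s_eq: "H2s w = nrm surf (ev (LB w))"
proof -
 have "(H2s w)^2 = (SUM k:UNIV. \<integral>y. ev (L k (L k w)) y * ev (LB w) y \<partial>surf)"
  unfolding H2s_power2 H1s_power2
  by (rule sum.cong) (simp_all add: L_LB_commute[symmetric] parts_poly_k[of _ "L _ w"])
 also have "... = (SI y. (SUM k:UNIV. ev (L k (L k w)) y * ev (LB w) y))"
  by (intro LI_sum[symmetric] sqi_mult surf.sqi_ev)
 also have "... = (nrm surf (ev (LB w)))^2"
  unfolding nrm_power2 by (simp only: ev_LB power2_eq_square sum_distrib_right)
 finally show ?thesis using power2_eq_imp_eq H2s_nonneg nrm_nonneg by blast
qed

(* Each L_k is a commutator of two others. *)
lemma H1s_le_H2s: "H1s w <= 2 * H2s w"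
proof -
 have p: "norm (Lv w y) ^ 2 <= 2 * (SUM k:UNIV. (norm (Lv (L k w) y))^2)" for y
 proof -
  have d: "(a - b)^2 <= 2 * a^2 + 2 * b^2" for a b :: real
   using sum_squares_ge_zero[of "a + b" 0] by (simp add: power2_eq_square algebra_simps)
  have c: "ev (L 3 w) y = ev (L 2 (L 1 w)) y - ev (L 1 (L 2 w)) y"
   "ev (L 1 w) y = ev (L 3 (L 2 w)) y - ev (L 2 (L 3 w)) y"
   "ev (L 2 w) y = ev (L 1 (L 3 w)) y - ev (L 3 (L 1 w)) y"
   using L_commutator[of w y] by simp_all
  have six: "A1 + A2 + A3 <= 2 * (p + q + r + s + u + v)"
   if "A3 <= 2 * p + 2 * q" "A1 <= 2 * r + 2 * s" "A2 <= 2 * u + 2 * v" for A1 A2 A3 p q r s u v :: real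
   using that by (simp add: distrib_left)
  have "(ev (L 3 w) y)^2 <= 2 * (ev (L 2 (L 1 w)) y)^2 + 2 * (ev (L 1 (L 2 w)) y)^2"
   "(ev (L 1 w) y)^2 <= 2 * (ev (L 3 (L 2 w)) y)^2 + 2 * (ev (L 2 (L 3 w)) y)^2"
   "(ev (L 2 w) y)^2 <= 2 * (ev (L 1 (L 3 w)) y)^2 + 2 * (ev (L 3 (L 1 w)) y)^2"
   unfolding c by (rule d)+
  then
  have "(ev (L 1 w) y)^2 + (ev (L 2 w) y)^2 + (ev (L 3 w) y)^2 <=
   2 * ((ev (L 2 (L 1 w)) y)^2 + (ev (L 1 (L 2 w)) y)^2 + (ev (L 3 (L 2 w)) y)^2 + (ev (L 2 (L 3 w)) y)^2
   + (ev (L 1 (L 3 w)) y)^2 + (ev (L 3 (L 1 w)) y)^2)" by (rule six)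
  also have "... <= 2 * (SUM k:UNIV. (norm (Lv (L k w) y))^2)"
   unfolding power2_norm_eq_inner inner_vec_def sum_3 Lv_nth inner_real_def
   using zero_le_square[of "ev (L 1 (L 1 w)) y"] zero_le_square[of "ev (L 2 (L 2 w)) y"] zero_le_square[of "ev (L 3 (L 3 w)) y"]
   by (simp add: power2_eq_square)
  finally show ?thesis unfolding power2_norm_eq_inner[of "Lv w y"] inner_vec_def sum_3 by (simp add: power2_eq_square)
 qed
 have sq: "integrable surf (%y. (norm (Lv v y))^2)" for v using sqi_norm_Lv[of v] by (simp add: sqi_def)
 have "(H1s w)^2 <= (SI y. 2 * (SUM k:UNIV. (norm (Lv (L k w) y))^2))"
  unfolding H1s_def nrm_power2 using sq p
  by (intro integral_mono Bochner_Integration.integrable_mult_right Bochner_Integration.integrable_sum) auto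
 also have "... = 2 * (H2s w)^2"
  unfolding H2s_power2 H1s_def nrm_power2 using sq by (simp add: LI_sum)
 also have "... <= (2 * H2s w)^2" by (simp add: power_mult_distrib)
 finally show ?thesis by (rule power2_le_imp_le) simp
qed

lemma area_S2_pos: "measure surf S2 > 0"
proof -
 have S: "S2 \<in> sets surf" using sets.top[of surf] by simp
 have "{y::real^3. sgn y \<in> S2 & norm y <= 1} = cball 0 1 - {0}" by (auto simp: norm_sgn split: if_splits)
 hence "emeasure surf S2 = 3 * emeasure lborel (cball 0 1 - {0::real^3})"
  using emeasure_surf[of S2] by simp
 also have "emeasure lborel (cball 0 1 - {0::real^3}) = emeasure lborel (cball 0 (1::real) :: (real^3) set)"
  by (rule emeasure_Diff_null_set) auto
 finally have e: "emeasure surf S2 = 3 * emeasure lborel (cball 0 (1::real) :: (real^3) set)" .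
 have "measure lborel (cball 0 (1::real) :: (real^3) set) > 0" by simp
 hence "emeasure lborel (cball 0 (1::real) :: (real^3) set) ~= 0" by (metis less_irrefl measure_eq_0_null_sets null_setsI sets_lborel borel_closed closed_cball)
 hence "emeasure surf S2 ~= 0" unfolding e by simp
 hence "measure surf S2 ~= 0" by (simp add: surf.emeasure_eq_measure)
 thus ?thesis using measure_nonneg[of surf S2] by linarith
qed

lemma integral_LB: "(SI y. ev (LB w) y) = 0"
proof -
 have "Lv (PC 1) y = 0" for y by (simp add: vec_eq_iff)
 thus ?thesis using parts_poly[of "PC 1" w] by simp
qed

text \<open>\<open>LB w\<close> has mean zero, and so has \<open>p\<close>; hence the constant left
  over by \<open>poisson_poly\<close> vanishes.\<close>

lemma poisson_dual:
 assumes "(SI y. ev p y) = 0"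
 shows "\<exists>w. (\<forall>y\<in>S2. ev (LB w) y = - ev p y) & H2s w = nrm surf (ev p) & H1s w <= 2 * nrm surf (ev p)"
proof -
 obtain w c where w: "\<forall>y\<in>S2. ev (LB w) y = ev (PMul (PC (-1)) p) y - c" using poisson_poly by blast
 have "0 = (SI y. ev (LB w) y)" using integral_LB by simp
 also have "... = (SI y. - ev p y - c)" by (rule LI_cong) (use w in auto)
 also have "... = - (SI y. ev p y) - c * measure surf S2"
  using surf.sqi_integrable[OF surf.sqi_ev] by simp
 finally have "c = 0" using assms area_S2_pos by simp
 hence w2: "\<forall>y\<in>S2. ev (LB w) y = - ev p y" using w by simp
 have "nrm surf (ev (LB w)) = nrm surf (ev p)"
  unfolding nrm_def by (intro arg_cong[where f=sqrt] LI_cong) (use w2 in auto)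
 hence "H2s w = nrm surf (ev p)" by (simp add: H2s_eq)
 thus ?thesis using w2 H1s_le_H2s[of w] by metis
qed

text \<open>By duality: z is tested against the solution w of - LB w = z, whose seminorm is at most
  twice the norm of z.\<close>

lemma poincare_poly:
 assumes "(SI y. ev z y) = 0"
 shows "nrm surf (ev z) <= 2 * H1s z"
proof -
 obtain w where w: "\<forall>y\<in>S2. ev (LB w) y = - ev z y" "H1s w <= 2 * nrm surf (ev z)"
  using poisson_dual[OF assms] by blast
 have "(nrm surf (ev z))^2 = - (SI y. ev z y * ev (LB w) y)"
  unfolding nrm_power2 Bochner_Integration.integral_minus[symmetric]
  by (rule LI_cong) (use w(1) in "auto simp: power2_eq_square")
 also have "... = (SI y. Lv z y .* Lv w y)" by (simp add: parts_poly)
 also have "... <= H1s z * H1s w"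
  using vip_le(1)[OF measurable_surf_Lv measurable_surf_Lv sqi_norm_Lv sqi_norm_Lv, of z w] by (simp add: H1s_def)
 also have "... <= H1s z * (2 * nrm surf (ev z))" using w(2) by (intro mult_left_mono) auto
 finally have "nrm surf (ev z) * nrm surf (ev z) <= (2 * H1s z) * nrm surf (ev z)" by (simp add: power2_eq_square algebra_simps)
 thus ?thesis using nrm_nonneg[of surf "ev z"] by (cases "nrm surf (ev z) = 0") (auto simp: mult_le_cancel_right)
qed

text \<open>As f has mean zero, the mean of an approximation is bounded by the approximation error;
  subtracting it at most doubles the error.\<close>

lemma zero_mean_approx:
 assumes f: "sqi surf f" and m: "(SI y. f y) = 0" and e: "ep > 0"
 shows "\<exists>p. (SI y. ev p y) = 0 & nrm surf (%y. f y - ev p y) < ep"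
proof -
 obtain q where q: "nrm surf (%y. f y - ev q y) < ep / 2"
  using surf.poly_dense[OF f] e unfolding poly_approx_def by (metis half_gt_zero)
 let ?A = "measure surf S2"
 define c where "c = (SI y. ev q y) / ?A"
 let ?p = "PAdd q (PC (- c))"
 have i: "integrable surf (ev q)" "integrable surf f" using surf.sqi_integrable surf.sqi_ev f by auto
 have z: "(SI y. ev ?p y) = 0" using i area_S2_pos by (simp add: c_def)
 have "|\<integral>y. 1 * (f y - ev q y) \<partial>surf| <= nrm surf (%_. 1) * nrm surf (%y. f y - ev q y)"
  by (intro ip_le surf.sqi_const sqi_diff f surf.sqi_ev)
 moreover have "(SI y. 1 * (f y - ev q y)) = - (c * ?A)" using i m area_S2_pos by (simp add: c_def)
 moreover have n1: "nrm surf (%_. 1) = sqrt ?A" by (simp add: nrm_def)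
 moreover have "sqrt ?A * nrm surf (%y. f y - ev q y) <= sqrt ?A * (ep / 2)"
  using q by (intro mult_left_mono) auto
 ultimately have "|c| * ?A <= sqrt ?A * (ep / 2)" by (simp add: abs_mult)
 moreover have "( |c| * sqrt ?A) * sqrt ?A = |c| * ?A" by simp
 ultimately have "( |c| * sqrt ?A) * sqrt ?A <= (ep / 2) * sqrt ?A" by (simp only: mult.commute)
 hence c: "|c| * sqrt ?A <= ep / 2"
  using area_S2_pos mult_le_cancel_right_pos[of "sqrt ?A" "|c| * sqrt ?A" "ep / 2"] by simp
 have "nrm surf (%y. (f y - ev q y) + c) <= nrm surf (%y. f y - ev q y) + nrm surf (%_. c)"
  by (intro nrm_triangle sqi_diff f surf.sqi_ev surf.sqi_const)
 also have "nrm surf (%_. c) = |c| * sqrt ?A" using nrm_cmult[of surf c "%_. 1"] n1 by simp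
 finally have "nrm surf (%y. f y - ev ?p y) < ep" using q c by (simp add: algebra_simps)
 thus ?thesis using z by blast
qed

text \<open>A polynomial p of mean zero close to f turns the bound for (f, p) into one for (f, f),
  up to an arbitrarily small error.\<close>

lemma dual_norm_bound:
 assumes f: "sqi surf f" and m: "(SI y. f y) = 0" and K: "K >= 0"
  and b: "!!p. (SI y. ev p y) = 0 ==> (SI y. f y * ev p y) <= K * nrm surf (ev p)"
 shows "nrm surf f <= K"
proof -
 let ?n = "nrm surf f"
 have e: "?n^2 <= K * ?n + ep * (?n + K)" if "ep > 0" for ep
 proof -
  obtain p where p: "(SI y. ev p y) = 0" "nrm surf (%y. f y - ev p y) < ep"
   using zero_mean_approx[OF f m `ep > 0`] by blast
  have "nrm surf (%y. f y - (f y - ev p y)) <= ?n + nrm surf (%y. f y - ev p y)"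
   by (intro nrm_diff sqi_diff f surf.sqi_ev)
  hence np: "nrm surf (ev p) <= ?n + ep" using p(2) by simp
  have "?n^2 = (SI y. f y * (f y - ev p y) + f y * ev p y)"
   unfolding nrm_power2 by (simp add: power2_eq_square algebra_simps)
  also have "... = (SI y. f y * (f y - ev p y)) + (SI y. f y * ev p y)"
   by (intro Bochner_Integration.integral_add sqi_mult sqi_diff f surf.sqi_ev)
  also have "... <= ?n * nrm surf (%y. f y - ev p y) + K * nrm surf (ev p)"
   using ip_le[OF f sqi_diff[OF f surf.sqi_ev[of p]]] b[OF p(1)] by linarith
  also have "... <= ?n * ep + K * (?n + ep)"
   using p(2) np K by (intro add_mono mult_left_mono) auto
  finally show ?thesis by (simp add: algebra_simps)
 qed
 have "?n^2 <= K * ?n"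
 proof (rule field_le_epsilon)
  fix d :: real assume d: "d > 0"
  have pos: "?n + K + 1 > 0" using K nrm_nonneg[of surf f] by linarith
  have "?n^2 <= K * ?n + (d / (?n + K + 1)) * (?n + K)" using e[of "d / (?n + K + 1)"] d pos by simp
  also have "(d / (?n + K + 1)) * (?n + K) <= d" using d pos by (simp add: field_simps)
  finally show "?n^2 <= K * ?n + d" by simp
 qed
 thus ?thesis using nrm_nonneg[of surf f] K by (cases "?n = 0") (auto simp: power2_eq_square mult_le_cancel_right)
qed

section \<open>Weak gradients tested with polynomials\<close>

lemma GDERIV_ev: "GDERIV (ev e) y :> gr e y"
 using has_derivative_ev[of e y] unfolding gderiv_def by (simp add: inner_commute)

definition radial :: "pexp => pexp" where
 "radial e = PAdd (PMul (PV 1) (pd 1 e)) (PAdd (PMul (PV 2) (pd 2 e)) (PMul (PV 3) (pd 3 e)))"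

text \<open>A polynomial extension of the m-th component of the tangential gradient; being an
  expression, it can serve as a test function and be differentiated again.\<close>

definition tang :: "3 => pexp => pexp" where
 "tang m e = PAdd (pd m e) (PMul (PC (-1)) (PMul (radial e) (PV m)))"

lemma ev_radial: "ev (radial e) y = gr e y .* y"
 by (simp add: radial_def inner_vec_def sum_3 algebra_simps)

lemma ev_tang: "ev (tang m e) y = tangential y (gr e y) $ m"
 by (simp add: tang_def ev_radial tangential_def)

text \<open>The tangential gradient and y x grad e differ by a right angle, hence have equal
  length.\<close>

lemma norm_tang_le: assumes "norm y = 1" shows "|ev (tang m e) y| <= norm (Lv e y)"
proof -
 let ?g = "gr e y"
 have y: "y .* y = 1" using assms by (simp add: norm_eq_1)
 have "tangential y ?g .* tangential y ?g = ?g .* ?g - (?g .* y)^2"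
  by (simp add: tangential_def inner_diff_left inner_diff_right y inner_commute power2_eq_square algebra_simps)
 also have "... = (norm (Lv e y))^2"
  unfolding Lv_cross norm_cross assms by (simp add: power2_norm_eq_inner inner_commute)
 finally have "(norm (tangential y ?g))^2 = (norm (Lv e y))^2" by (simp only: power2_norm_eq_inner)
 hence "norm (tangential y ?g) = norm (Lv e y)" by simp
 thus ?thesis unfolding ev_tang using component_le_norm_cart[of "tangential y ?g" m] by simp
qed

lemma nrm_tang_le: "nrm surf (ev (tang m e)) <= H1s e"
 unfolding H1s_def nrm_def
proof (rule real_sqrt_le_mono, rule integral_mono)
 show "integrable surf (%y. (ev (tang m e) y)^2)" using surf.sqi_ev by (simp add: sqi_def)
 show "integrable surf (%y. (norm (Lv e y))^2)" using sqi_norm_Lv by (simp add: sqi_def)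
 fix y assume "y \<in> space surf"
 hence "|ev (tang m e) y| <= norm (Lv e y)" by (intro norm_tang_le) simp
 thus "(ev (tang m e) y)^2 <= (norm (Lv e y))^2" by (metis abs_ge_zero power2_abs power_mono)
qed

lemma ev_pd_radial: "ev (pd m (radial e)) y = ev (pd m e) y + gr (pd m e) y .* y"
proof -
 have "ev (pd m (radial e)) y = (ev (PC (if 1 = m then 1 else 0)) y * ev (pd 1 e) y + ev (PC (if 2 = m then 1 else 0)) y * ev (pd 2 e) y + ev (PC (if 3 = m then 1 else 0)) y * ev (pd 3 e) y)
  + (y$1 * ev (pd m (pd 1 e)) y + y$2 * ev (pd m (pd 2 e)) y + y$3 * ev (pd m (pd 3 e)) y)"
  unfolding radial_def pd.simps ev.simps by (simp only: algebra_simps)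
 also have "ev (PC (if 1 = m then 1 else 0)) y * ev (pd 1 e) y + ev (PC (if 2 = m then 1 else 0)) y * ev (pd 2 e) y + ev (PC (if 3 = m then 1 else 0)) y * ev (pd 3 e) y = ev (pd m e) y"
 proof -
  consider "m = 1" | "m = 2" | "m = 3" using exhaust_3 by blast
  thus ?thesis by cases (simp_all add: three_neq)
 qed
 also have "y$1 * ev (pd m (pd 1 e)) y + y$2 * ev (pd m (pd 2 e)) y + y$3 * ev (pd m (pd 3 e)) y = gr (pd m e) y .* y"
  unfolding inner_vec_def sum_3 gr_nth pd_commute[of m] by simp
 finally show ?thesis .
qed

text \<open>Expanding both sides into ambient derivatives up to order two links the componentwise
  form of the Laplacian, which \<open>laplace_s\<close> uses, to the rotational one.\<close>

lemma sum_tang_tang: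
 assumes "norm y = 1" shows "(SUM m:UNIV. ev (tang m (tang m e)) y) = ev (LB e) y"
proof -
 have y: "y .* y = 1" using assms by (simp add: norm_eq_1)
 define r where "r = gr e y .* y"
 define q where "q = (SUM k:UNIV. y $ k * (gr (pd k e) y .* y))"
 define d where "d = ev (lap e) y"
 have rr: "gr (radial e) y .* y = r + q"
  unfolding inner_vec_def[of "gr (radial e) y"] gr_nth ev_pd_radial r_def q_def inner_vec_def[of "gr e y"]
  by (simp add: algebra_simps sum.distrib)
 have gt: "gr (tang m e) y = gr (pd m e) y - (y $ m) *R gr (radial e) y - r *R axis m 1" for m
 unfolding vec_eq_iff
 proof
  fix k
  have "ev (pd k (tang m e)) y = ev (pd k (pd m e)) y - (ev (pd k (radial e)) y * y $ m + r * (if m = k then 1 else 0))"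
   by (simp add: tang_def ev_radial r_def)
  thus "gr (tang m e) y $ k = (gr (pd m e) y - (y $ m) *R gr (radial e) y - r *R axis m 1) $ k"
   by (simp add: axis_def)
 qed
 have tm: "ev (tang m (tang m e)) y = ev (pd m (pd m e)) y - y$m * (ev (pd m e) y + gr (pd m e) y .* y) - r - (gr (pd m e) y .* y) * y$m + (y$m * y$m) * (r + q) + r * (y$m * y$m)" for m
 proof -
  have "ev (tang m (tang m e)) y = gr (tang m e) y $ m - (gr (tang m e) y .* y) * y $ m"
   by (simp add: tang_def[of m "tang m e"] ev_radial)
  also have "gr (tang m e) y .* y = gr (pd m e) y .* y - y$m * (r + q) - r * y$m"
   unfolding gt by (simp add: inner_diff_left rr inner_axis')
  also have "gr (tang m e) y $ m = ev (pd m (pd m e)) y - y$m * (ev (pd m e) y + gr (pd m e) y .* y) - r"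
   unfolding gt by (simp add: ev_pd_radial)
  finally show ?thesis by (simp add: algebra_simps)
 qed
 have "(SUM m:UNIV. ev (tang m (tang m e)) y) =
  (SUM m:UNIV. ev (pd m (pd m e)) y) - (SUM m:UNIV. y$m * ev (pd m e) y) - 2 * (SUM m:UNIV. y$m * (gr (pd m e) y .* y)) - 3 * r
   + (y .* y) * (r + q) + r * (y .* y)"
  unfolding tm inner_vec_def[of y y] sum_3 inner_real_def by (simp only: algebra_simps)
 also have "(SUM m:UNIV. ev (pd m (pd m e)) y) = d" by (simp add: d_def lap_def sum_3)
 also have "(SUM m:UNIV. y$m * ev (pd m e) y) = r" by (simp add: r_def inner_vec_def mult.commute)
 also have "(SUM m:UNIV. y$m * (gr (pd m e) y .* y)) = q" by (simp add: q_def)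
 finally show ?thesis unfolding LB_expand y d_def[symmetric] q_def[symmetric] r_def[symmetric] by simp
qed

lemma sum_tang_coord:
 assumes "norm y = 1" shows "(SUM m:UNIV. ev (tang m e) y * y $ m) = 0"
proof -
 have y: "y .* y = 1" using assms by (simp add: norm_eq_1)
 have "(SUM m:UNIV. ev (tang m e) y * y $ m) = tangential y (gr e y) .* y"
  by (simp add: ev_tang inner_vec_def)
 also have "... = 0" by (simp add: tangential_def inner_diff_left y)
 finally show ?thesis .
qed

text \<open>The tangential divergence of the normal field e y: y itself has divergence 2, and the
  tangential gradient of e is orthogonal to y.\<close>

lemma sum_tang_mult:
 assumes "norm y = 1" shows "(SUM m:UNIV. ev (tang m (PMul e (PV m))) y) = 2 * ev e y"
proof -
 have y: "y .* y = 1" using assms by (simp add: norm_eq_1)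
 have g: "gr (PMul e (PV m)) y = (y$m) *R gr e y + ev e y *R axis m 1" for m
  unfolding vec_eq_iff by (simp add: axis_def)
 have tm: "ev (tang m (PMul e (PV m))) y = y$m * ev (pd m e) y + ev e y - (y$m * y$m) * (gr e y .* y) - ev e y * (y$m * y$m)" for m
  unfolding ev_tang tangential_def g by (simp add: inner_add_left inner_axis' algebra_simps)
 have "(SUM m:UNIV. ev (tang m (PMul e (PV m))) y) = (gr e y .* y) + 3 * ev e y - (y .* y) * (gr e y .* y) - ev e y * (y .* y)"
  unfolding tm inner_vec_def sum_3 inner_real_def gr_nth by (simp only: algebra_simps)
 thus ?thesis by (simp add: y)
qed

lemma integrable_mult_ev: assumes "integrable surf u" shows "integrable surf (%y. u y * ev e y)"
proof -
 obtain C where C: "\<forall>y\<in>S2. |ev e y| <= C" "C >= 0" using ev_bounded by blast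
 have em: "ev e \<in> borel_measurable surf" by (rule measurable_surfI) simp
 show ?thesis
 proof (rule LI_bound[of surf "%y. C * u y"])
  show "AE y in surf. norm (u y * ev e y) <= norm (C * u y)"
  proof (rule AE_I2)
   fix y assume "y \<in> space surf"
   hence "|u y| * |ev e y| <= |u y| * C" using C by (intro mult_left_mono) auto
   thus "norm (u y * ev e y) <= norm (C * u y)" using C by (simp add: abs_mult mult.commute)
  qed
 qed (use assms em in "auto intro!: borel_measurable_times")
qed

lemma weak_gradient_component:
 assumes "has_weak_gradient u g"
 shows "(SI y. g y $ m * ev e y) = (SI y. u y * (2 * ev e y * y $ m - ev (tang m e) y))"
  and "integrable surf (%y. g y $ m)"
proof -
 have iu: "integrable surf u" and ig: "integrable surf g" using assms by (auto simp: has_weak_gradient_def)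
 have bl: "bounded_linear (%v::real^3. v $ m)" by (rule bounded_linear_vec_nth)
 show igm: "integrable surf (%y. g y $ m)" using integrable_bounded_linear[OF bl ig] .
 have eq: "(SI y. ev e y *R g y) = (SI y. (2 * u y * ev e y) *R y - u y *R tangential y (gr e y))"
 proof -
  have "continuous_on UNIV (gr e)" using continuous_on_gr[OF continuous_on_id] by simp
  thus ?thesis using assms GDERIV_ev[of e] unfolding has_weak_gradient_def by blast
 qed
 obtain C where C: "\<forall>y\<in>S2. |ev e y| <= C" "C >= 0" using ev_bounded by blast
 have em: "ev e \<in> borel_measurable surf" by (rule measurable_surfI) simp
 have i1: "integrable surf (%y. ev e y *R g y)"
 proof (rule LI_bound[of surf "%y. C *R g y"])
  show "AE y in surf. norm (ev e y *R g y) <= norm (C *R g y)"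
   using C by (intro AE_I2) (auto intro!: mult_right_mono)
 qed (use ig em in "auto intro!: borel_measurable_scaleR")
 have i2: "integrable surf (%y. (2 * u y * ev e y) *R y - u y *R tangential y (gr e y))"
 proof (intro Bochner_Integration.integrable_diff)
  have idm: "(%y::real^3. y) \<in> borel_measurable surf" by (rule measurable_surfI) simp
  show "integrable surf (%y. (2 * u y * ev e y) *R y)"
   by (rule LI_bound[OF integrable_mult_ev[OF iu, of "PMul (PC 2) e"]])
    (use iu em idm in "auto intro!: borel_measurable_scaleR borel_measurable_times AE_I2")
  have "continuous_on S2 (%y. tangential y (gr e y))"
   unfolding tangential_def by (intro continuous_intros)
  hence tm: "(%y. tangential y (gr e y)) \<in> borel_measurable surf"
   by (rule borel_measurable_surf_continuous)
  have "compact ((%y. tangential y (gr e y)) ` S2)"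
   using `continuous_on S2 (%y. tangential y (gr e y))` by (intro compact_continuous_image) auto
  then obtain D where D: "\<forall>y\<in>S2. norm (tangential y (gr e y)) <= D" using compact_imp_bounded[of "(%y. tangential y (gr e y)) ` S2"] by (auto simp: bounded_iff)
  show "integrable surf (%y. u y *R tangential y (gr e y))"
  proof (rule LI_bound[of surf "%y. D * u y"])
   show "AE y in surf. norm (u y *R tangential y (gr e y)) <= norm (D * u y)"
   proof (rule AE_I2)
    fix y assume "y \<in> space surf"
    hence "y \<in> S2" by simp
    hence "norm (tangential y (gr e y)) <= D" using D by blast
    hence "norm (tangential y (gr e y)) <= |D|" by linarith
     hence "|u y| * norm (tangential y (gr e y)) <= |u y| * |D|" by (intro mult_left_mono) auto
     thus "norm (u y *R tangential y (gr e y)) <= norm (D * u y)" by (simp add: abs_mult mult.commute)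
   qed
  qed (use iu tm in "auto intro!: borel_measurable_scaleR")
 qed
 have "(SI y. g y $ m * ev e y) = (SI y. (ev e y *R g y) $ m)" by (simp add: mult.commute)
 also have "... = (SI y. ev e y *R g y) $ m" by (rule integral_bounded_linear[OF bl i1])
 also have "... = (SI y. ((2 * u y * ev e y) *R y - u y *R tangential y (gr e y)) $ m)"
  unfolding eq by (rule integral_bounded_linear[OF bl i2, symmetric])
 also have "... = (SI y. u y * (2 * ev e y * y $ m - ev (tang m e) y))"
  by (simp add: ev_tang algebra_simps)
 finally show "(SI y. g y $ m * ev e y) = (SI y. u y * (2 * ev e y * y $ m - ev (tang m e) y))" .
qed

lemma weak_gradient_poly:
 assumes "has_weak_gradient u g"
 shows "(SI y. g y $ m * ev e y) = (SI y. u y * ev (PMul (PC 2) (PMul e (PV m))) y) - (SI y. u y * ev (tang m e) y)"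
proof -
 have iu: "integrable surf u" using assms by (auto simp: has_weak_gradient_def)
 show ?thesis unfolding weak_gradient_component[OF assms]
  by (subst LI_diff[symmetric, OF integrable_mult_ev[OF iu] integrable_mult_ev[OF iu]])
   (rule LI_cong, simp_all add: algebra_simps)
qed

lemma weak_gradient_sum:
 assumes w: "has_weak_gradient u g"
 shows "(SUM m:UNIV. \<integral>y. g y $ m * ev (E m) y \<partial>surf)
  = (SI y. u y * (SUM m:UNIV. 2 * ev (E m) y * y $ m - ev (tang m (E m)) y))"
proof -
 have "integrable surf u" using w by (auto simp: has_weak_gradient_def)
 from integrable_mult_ev[OF this] have "integrable surf (%y. u y * ev (PAdd (PMul (PC 2) (PMul (E m) (PV m))) (PMul (PC (-1)) (tang m (E m)))) y)" for m .
 thus ?thesis unfolding weak_gradient_component[OF w] sum_distrib_left by (intro LI_sum[symmetric]) (simp add: mult.assoc)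
qed

text \<open>Two weak gradients have the same pairings with all polynomials, and polynomials separate
  integrable functions.\<close>

lemma weak_gradient_unique:
 assumes "has_weak_gradient u g" "has_weak_gradient u g'"
 shows "AE y in surf. g y $ m = g' y $ m"
proof -
 have i: "integrable surf (%y. g y $ m)" "integrable surf (%y. g' y $ m)"
  using weak_gradient_component(2) assms by blast+
 have "AE y in surf. g y $ m - g' y $ m = 0"
 proof (rule integrable_orthogonal_poly_zero)
  fix e
  have "(SI y. ev e y * (g y $ m - g' y $ m)) = (SI y. g y $ m * ev e y - g' y $ m * ev e y)"
   by (simp add: algebra_simps)
  also have "... = 0"
   using integrable_mult_ev[OF i(1), of e] integrable_mult_ev[OF i(2), of e] weak_gradient_component(1)[OF assms(1), of m e] weak_gradient_component(1)[OF assms(2), of m e]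
   by simp
  finally show "(SI y. ev e y * (g y $ m - g' y $ m)) = 0" .
 qed (use i in auto)
 thus ?thesis by (rule AE_mp) (auto intro!: AE_I2)
qed

text \<open>\<open>grad_s\<close> is an arbitrary choice, so its components agree with those of a
  given weak gradient only almost everywhere. Second derivatives are carried across this
  difference.\<close>

lemma has_weak_gradient_AE_cong:
 assumes w: "has_weak_gradient u g" and ae: "AE y in surf. u y = v y" and iv: "integrable surf v"
 shows "has_weak_gradient v g"
 unfolding has_weak_gradient_def
proof (intro conjI allI impI)
 have iu: "integrable surf u" using w by (auto simp: has_weak_gradient_def)
 fix ph :: "real^3 => real" and G assume t: "(\<forall>y. GDERIV ph y :> G y) & continuous_on UNIV G"
 have "continuous_on UNIV ph"
  using t unfolding gderiv_def by (meson continuous_at_imp_continuous_on has_derivative_continuous)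
 hence pm: "ph \<in> borel_measurable surf" by (intro measurable_surfI borel_measurable_continuous_onI)
 have "continuous_on S2 (%y. tangential y (G y))"
  unfolding tangential_def using t by (intro continuous_intros) (auto intro: continuous_on_subset)
 hence tm: "(%y. tangential y (G y)) \<in> borel_measurable surf"
  by (rule borel_measurable_surf_continuous)
 have idm: "(%y::real^3. y) \<in> borel_measurable surf" by (rule measurable_surfI) simp
 have "(SI y. ph y *R g y) = (SI y. (2 * u y * ph y) *R y - u y *R tangential y (G y))"
  using w t unfolding has_weak_gradient_def by blast
 also have "... = (SI y. (2 * v y * ph y) *R y - v y *R tangential y (G y))"
 proof (rule integral_cong_AE)
  show "AE y in surf. (2 * u y * ph y) *R y - u y *R tangential y (G y) = (2 * v y * ph y) *R y - v y *R tangential y (G y)"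
   using ae by (rule AE_mp) (auto intro!: AE_I2)
 qed (use iu iv pm tm idm in "auto intro!: borel_measurable_diff borel_measurable_scaleR borel_measurable_times")
 finally show "(SI y. ph y *R g y) = (SI y. (2 * v y * ph y) *R y - v y *R tangential y (G y))" .
qed (use w iv in "auto simp: has_weak_gradient_def")

lemma grad_s_weak: "has_weak_gradient u g ==> has_weak_gradient u (grad_s u)"
 unfolding grad_s_def using someI[of "has_weak_gradient u" g] by simp

text \<open>Tested with the normal field e y, the curvature term and the divergence of the field are
  both 2 e and cancel.\<close>

lemma weak_gradient_tangential:
 assumes w: "has_weak_gradient u g"
 shows "(SUM m:UNIV. \<integral>y. g y $ m * ev (PMul e (PV m)) y \<partial>surf) = 0"
proof -
 have "(SUM m:UNIV. 2 * ev (PMul e (PV m)) y * y $ m - ev (tang m (PMul e (PV m))) y) = 0" if y: "y \<in> space surf" for y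
 proof -
  have n: "norm y = 1" using y by simp
  have "(SUM m:UNIV. 2 * ev (PMul e (PV m)) y * y $ m) = 2 * ev e y * (y .* y)" by (simp add: inner_vec_def sum_distrib_left mult_ac)
  thus ?thesis unfolding sum_subtractf sum_tang_mult[OF n] using n by (simp add: norm_eq_1)
 qed
 thus ?thesis unfolding weak_gradient_sum[OF w] by (subst LI_cong[OF refl, where g = "%_. 0"]) (simp_all del: ev.simps space_surf)
qed

text \<open>The test field is the tangential gradient of e. It is orthogonal to y, so the curvature
  term drops out, and its divergence is \<open>LB e\<close>.\<close>

lemma weak_gradient_LB:
 assumes w: "has_weak_gradient u g"
 shows "(SI y. u y * ev (LB e) y) = - (SUM m:UNIV. \<integral>y. g y $ m * ev (tang m e) y \<partial>surf)"
proof -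
 have "(SUM m:UNIV. 2 * ev (tang m e) y * y $ m - ev (tang m (tang m e)) y) = - ev (LB e) y" if y: "y \<in> space surf" for y
  using y sum_tang_coord[of y e] sum_tang_tang[of y e] by (simp add: sum_subtractf sum_distrib_left[symmetric] mult.assoc)
 thus ?thesis unfolding weak_gradient_sum[OF w] by (subst (2) LI_cong[OF refl, where g = "%y. - (u y * ev (LB e) y)"]) (simp_all del: ev.simps space_surf)
qed

text \<open>The bound on the pairing with \<open>LB e\<close> is the form in which the derivative of
  f enters the error estimate; its factor 3 comes from bounding the three components one by
  one.\<close>

lemma H1_0_facts:
 assumes "f \<in> H1_0"
 shows "sqi surf f" "(SI y. f y) = 0" "nrm surf f <= sobolev_norm 1 f"
  and "|\<integral>y. f y * ev (LB e) y \<partial>surf| <= 3 * sobolev_norm 1 f * H1s e"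
proof -
 have s: "in_sobolev 1 f" and z: "zero_mean f" using assms by (auto simp: H1_0_def sobolev_def)
 thus "sqi surf f" "(SI y. f y) = 0" by (auto simp: L2_sphere_sqi zero_mean_def)
 obtain g where w: "has_weak_gradient f g" and gm: "!!m. sqi surf (%y. g y $ m)"
  using s by (auto simp: L2_sphere_sqi)
 have wG: "has_weak_gradient f (grad_s f)" by (rule grad_s_weak[OF w])
 have Gm: "sqi surf (%y. grad_s f y $ m)" for m
 proof -
  have i: "integrable surf (%y. grad_s f y $ m)" using weak_gradient_component(2)[OF wG] .
  hence mG: "(%y. grad_s f y $ m) \<in> borel_measurable surf" by simp
  have "AE y in surf. (g y $ m)^2 = (grad_s f y $ m)^2"
   using weak_gradient_unique[OF w wG, of m] by (rule AE_mp) (auto intro!: AE_I2)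
  hence "integrable surf (%y. (grad_s f y $ m)^2)"
   using gm[of m] mG by (subst integrable_cong_AE[of _ _ "%y. (g y $ m)^2"]) (auto simp: sqi_def intro!: borel_measurable_power)
  thus ?thesis using mG by (simp add: sqi_def)
 qed
 have S: "(sobolev_norm 1 f)^2 = (nrm surf f)^2 + (SUM m:UNIV. (nrm surf (%y. grad_s f y $ m))^2)"
  by (simp add: L2_norm_nrm sum_nonneg)
 have S0: "0 <= sobolev_norm 1 f" by (simp add: sum_nonneg)
 have "(nrm surf f)^2 <= (sobolev_norm 1 f)^2" unfolding S by (simp add: sum_nonneg)
 thus "nrm surf f <= sobolev_norm 1 f" using S0 by (rule power2_le_imp_le)
 have c: "nrm surf (%y. grad_s f y $ m) <= sobolev_norm 1 f" for m
 proof (rule power2_le_imp_le[OF _ S0])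
  have "(nrm surf (%y. grad_s f y $ m))^2 <= (SUM m:UNIV. (nrm surf (%y. grad_s f y $ m))^2)"
   by (rule member_le_sum) auto
  thus "(nrm surf (%y. grad_s f y $ m))^2 <= (sobolev_norm 1 f)^2" unfolding S by (simp add: add_increasing)
 qed
 have "|\<integral>y. f y * ev (LB e) y \<partial>surf| <= (SUM m:UNIV. |\<integral>y. grad_s f y $ m * ev (tang m e) y \<partial>surf| )"
  unfolding weak_gradient_LB[OF wG] by (simp only: abs_minus_cancel) (rule sum_abs)
 also have "... <= (SUM m:(UNIV::3 set). sobolev_norm 1 f * H1s e)"
 proof (rule sum_mono)
  fix m
  have "|\<integral>y. grad_s f y $ m * ev (tang m e) y \<partial>surf| <= nrm surf (%y. grad_s f y $ m) * nrm surf (ev (tang m e))"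
   by (rule ip_le[OF Gm surf.sqi_ev])
  also have "... <= sobolev_norm 1 f * H1s e" using c nrm_tang_le S0 by (intro mult_mono) auto
  finally show "|\<integral>y. grad_s f y $ m * ev (tang m e) y \<partial>surf| <= sobolev_norm 1 f * H1s e" .
 qed
 finally show "|\<integral>y. f y * ev (LB e) y \<partial>surf| <= 3 * sobolev_norm 1 f * H1s e" by simp
qed

text \<open>Integration by parts is applied twice, to the components of \<open>grad_s u\<close> and
  then to u. The curvature term of the first step pairs \<open>grad_s u\<close> with a normal field
  and vanishes.\<close>

lemma weak_poisson:
 assumes u: "u \<in> sobolev 2 Int H1_0" and lap: "AE y in surf. - laplace_s u y = f y" and f: "integrable surf f"
 shows "(SI y. u y * ev (LB e) y) = - (SI y. f y * ev e y)"
proof -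
 have "in_sobolev (Suc 1) u" using u by (simp add: sobolev_def numeral_2_eq_2)
 then obtain g where w: "has_weak_gradient u g" and gm: "!!m. in_sobolev 1 (%y. g y $ m)"
  unfolding in_sobolev.simps(2)[of 1] by blast
 let ?G = "grad_s u"
 have wG: "has_weak_gradient u ?G" by (rule grad_s_weak[OF w])
 let ?H = "%m. grad_s (%z. ?G z $ m)"
 have wH: "has_weak_gradient (%z. ?G z $ m) (?H m)" for m
 proof -
  obtain g' where "has_weak_gradient (%y. g y $ m) g'" using gm[of m] by auto
  from has_weak_gradient_AE_cong[OF this weak_gradient_unique[OF w wG] weak_gradient_component(2)[OF wG]]
  show ?thesis by (rule grad_s_weak)
 qed
 have iH: "integrable surf (%y. ?H m y $ m * ev e y)" for m
  by (rule integrable_mult_ev[OF weak_gradient_component(2)[OF wH]])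
 have em: "ev e \<in> borel_measurable surf" by (rule measurable_surfI) simp
 have lm: "laplace_s u \<in> borel_measurable surf"
  unfolding laplace_s_def[abs_def]
  by (intro borel_measurable_sum borel_measurable_integrable weak_gradient_component(2)[OF wH])
 have fl: "(SI y. f y * ev e y) = (SI y. - laplace_s u y * ev e y)"
 proof (rule integral_cong_AE)
  show "AE y in surf. f y * ev e y = - laplace_s u y * ev e y"
   using lap by (rule AE_mp) (auto intro!: AE_I2)
 qed (use f em lm in "auto intro!: borel_measurable_times borel_measurable_uminus")
 have "(SI y. - laplace_s u y * ev e y) = - (SI y. laplace_s u y * ev e y)" by simp
 also have "(SI y. laplace_s u y * ev e y) = (SI y. (SUM m:UNIV. ?H m y $ m * ev e y))"
  by (simp add: laplace_s_def sum_distrib_right)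
 also have "... = (SUM m:UNIV. \<integral>y. ?H m y $ m * ev e y \<partial>surf)"
  by (intro LI_sum iH)
 also have "... = (SUM m:UNIV. (SI y. ?G y $ m * ev (PMul (PC 2) (PMul e (PV m))) y) - (SI y. ?G y $ m * ev (tang m e) y))"
  by (rule sum.cong[OF refl]) (rule weak_gradient_poly[OF wH])
 also have "... = 2 * (SUM m:UNIV. (SI y. ?G y $ m * ev (PMul e (PV m)) y)) - (SUM m:UNIV. \<integral>y. ?G y $ m * ev (tang m e) y \<partial>surf)"
  by (simp add: sum_subtractf sum_distrib_left mult.left_commute)
 also have "... = (SI y. u y * ev (LB e) y)"
  unfolding weak_gradient_tangential[OF wG] weak_gradient_LB[OF wG] by simp
 finally show ?thesis using fl by simp
qed

section \<open>Taylor and Poincare estimates on spherical cones\<close>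

lemma inner_cross_swap: "cross3 p v .* cross3 g w = (p .* g) * (v .* w) - (p .* w) * (v .* g)" for p v g w :: "real^3"
 by (simp add: cross3_def inner_vec_def sum_3 algebra_simps)

lemma unit_dist_sq: "norm a = 1 ==> norm b = 1 ==> (norm (a - b))^2 = 2 - 2 * (a .* b)" for a b :: "'a::real_inner"
 by (simp add: power2_norm_eq_inner inner_diff_left inner_diff_right inner_commute norm_eq_1)

text \<open>The function is constant on rays, so only the angular motion counts: it is p x v at
  every point of the line, divided by the squared distance from the origin.\<close>

lemma ev_sgn_line_deriv:
 fixes p v :: "real^3"
 defines "ga t == p + t *R v"
 assumes nz: "ga t ~= 0"
 shows "((%t. ev e (sgn (ga t))) has_real_derivative (cross3 p v .* Lv e (sgn (ga t))) / (norm (ga t))^2) (at t)"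
proof -
 let ?y = "ga t" and ?r = "norm (ga t)"
 have r: "?r > 0" using nz by simp
 have gd: "(ga has_derivative (%s. s *R v)) (at t)"
  unfolding ga_def by (auto intro!: derivative_eq_intros)
 have nd: "((%t. norm (ga t)) has_derivative (%s. (s *R v) .* sgn ?y)) (at t)"
  using has_derivative_compose[OF gd has_derivative_norm[OF nz]] by (simp add: inner_commute)
 have sd: "((%t. sgn (ga t)) has_derivative (%s. s *R ((1/?r) *R (v - (v .* sgn ?y) *R sgn ?y)))) (at t)"
 proof -
  have "((%t. inverse (norm (ga t)) *R ga t) has_derivative
   (%s. inverse ?r *R (s *R v) + (- (inverse ?r * ((s *R v) .* sgn ?y) * inverse ?r)) *R ?y)) (at t)"
   by (rule has_derivative_scaleR[OF Deriv.has_derivative_inverse[OF _ nd] gd]) (use r in simp)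
  moreover have "(%s. inverse ?r *R (s *R v) + (- (inverse ?r * ((s *R v) .* sgn ?y) * inverse ?r)) *R ?y)
   = (%s. s *R ((1/?r) *R (v - (v .* sgn ?y) *R sgn ?y)))"
   using r by (simp add: fun_eq_iff sgn_div_norm algebra_simps divide_inverse)
  ultimately show ?thesis by (simp add: sgn_div_norm)
 qed
 have "((%t. ev e (sgn (ga t))) has_derivative (%s. gr e (sgn ?y) .* (s *R ((1/?r) *R (v - (v .* sgn ?y) *R sgn ?y))))) (at t)"
  by (rule has_derivative_compose[OF sd has_derivative_ev])
 moreover have "(%s. gr e (sgn ?y) .* (s *R ((1/?r) *R (v - (v .* sgn ?y) *R sgn ?y)))) =
  (*) ((cross3 p v .* Lv e (sgn ?y)) / ?r^2)"
 proof
  fix s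
  let ?u = "sgn ?y" and ?g = "gr e (sgn ?y)"
  have yu: "?y = ?r *R ?u" using r by (simp add: sgn_div_norm)
  have pv: "cross3 p v = cross3 ?y v"
   by (simp add: ga_def cross_add_left cross_mult_left)
  have uu: "?u .* ?u = 1" using nz by (simp add: norm_sgn flip: norm_eq_1)
  have "cross3 p v .* Lv e ?u = ?r * (cross3 ?u v .* cross3 ?u ?g)"
   unfolding pv Lv_cross by (subst yu) (simp only: cross_mult_left inner_scaleR_left)
  also have "... = ?r * (v .* ?g - (?u .* ?g) * (v .* ?u))"
   unfolding inner_cross_swap uu by simp
  finally have main: "(cross3 p v .* Lv e ?u) / ?r^2 = (1/?r) * (v .* ?g - (?u .* ?g) * (v .* ?u))"
   using r by (simp add: power2_eq_square)
  show "?g .* (s *R ((1/?r) *R (v - (v .* ?u) *R ?u))) = ((cross3 p v .* Lv e ?u) / ?r^2) * s"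
   unfolding main by (simp add: inner_diff_right inner_commute[of ?g] right_diff_distrib algebra_simps)
 qed
 ultimately show ?thesis by (simp add: has_field_derivative_def)
qed

text \<open>The fundamental theorem of calculus and Cauchy-Schwarz on [0, 1]; the right side is an
  \<open>ennreal\<close> integral, ready for Fubini.\<close>

lemma square_increment_le:
 fixes F g :: "real => real"
 assumes d: "!!t. 0 <= t ==> t <= 1 ==> (F has_real_derivative g t) (at t)"
  and c: "continuous_on {0..1} g"
 shows "ennreal ((F 1 - F 0)^2) <= (NI t. ennreal ((g t)^2) * ind {0..1} t)"
proof -
 let ?i = "ind {0..1::real} :: real => real"
 have FTC: "(\<integral>t. ?i t *R g t \<partial>lborel) = F 1 - F 0"
  by (rule integral_FTC_Icc) (use d c in "auto simp: has_real_derivative_iff_has_vector_derivative[symmetric] intro: has_field_derivative_at_within")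
 have m1: "(%t. ?i t * g t) \<in> borel_measurable lborel"
  using borel_measurable_continuous_on_indicator[OF _ c] by simp
 have i2: "integrable lborel (%t. ?i t *R (g t)^2)"
  by (rule borel_integrable_compact) (use c in "auto intro: continuous_intros")
 have sq: "(?i t * g t)^2 = ?i t *R (g t)^2" for t by (simp add: indicator_def)
 have s1: "sqi lborel (%t. ?i t * g t)" unfolding sqi_def sq using m1 i2 by simp
 have ii: "(?i t)^2 = ?i t" for t by (simp add: indicator_def)
 have s2: "sqi lborel ?i" unfolding sqi_def ii by simp
 have n2: "nrm lborel ?i = 1"
  unfolding nrm_def ii by simp
 have "(\<integral>t. ?i t * (?i t * g t) \<partial>lborel) = F 1 - F 0"
 proof -
  have eq: "?i t * (?i t * g t) = ?i t *R g t" for t by (simp add: indicator_def)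
  show ?thesis unfolding eq by (rule FTC)
 qed
 with ip_le[OF s2 s1] n2 have "|F 1 - F 0| <= nrm lborel (%t. ?i t * g t)" by simp
 hence "(F 1 - F 0)^2 <= (nrm lborel (%t. ?i t * g t))^2" by (metis abs_ge_zero power2_abs power_mono)
 also have "... = (\<integral>t. ?i t *R (g t)^2 \<partial>lborel)" unfolding nrm_power2 sq ..
 finally have "ennreal ((F 1 - F 0)^2) <= ennreal (\<integral>t. ?i t *R (g t)^2 \<partial>lborel)" by (rule ennreal_leI)
 also have "... = (NI t. ennreal (?i t *R (g t)^2))"
  by (rule nn_integral_eq_integral[symmetric, OF i2]) auto
 also have "... = (NI t. ennreal ((g t)^2) * ind {0..1} t)"
  by (intro nn_integral_cong) (auto simp: indicator_def)
 finally show ?thesis .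
qed

lemma norm_cross_le: "norm (cross3 p v) <= norm p * norm v" for p v :: "real^3"
proof -
 have "(norm (cross3 p v))^2 <= (norm p * norm v)^2" using norm_cross_dot[of p v] zero_le_power2[of "p .* v"] by linarith
 thus ?thesis by (rule power2_le_imp_le) simp
qed

definition D2 :: "pexp => real^3 => real" where
 "D2 e y = (norm (Lv e y))^2 + (SUM m:UNIV. (norm (Lv (L m e) y))^2)"

lemma D2_nonneg: "0 <= D2 e y" by (simp add: D2_def sum_nonneg)

lemma borel_measurable_D2 [measurable]: "D2 e \<in> borel_measurable borel"
 unfolding D2_def[abs_def] by measurable

text \<open>First order Taylor formula with integral remainder along the segment from y to s a, for
  the extension of e that is constant on rays. The weight (1 - t)^2 stays under the integral because
  it will pay for a Jacobian.\<close>

lemma taylor_pointwise: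
 fixes y a :: "real^3"
 assumes na: "norm a = 1" and s: "s > 0" and y: "y ~= 0" and d: "norm (s *R a - y) <= de * norm y" and dl: "0 <= de" "de <= 1/10"
 shows "ennreal ((ev e a - ev e (sgn y) - (cross3 y (s *R a) .* Lv e (sgn y)) / (norm y)^2)^2)
  <= (NI t. ennreal (16 * de^4 * ((1 - t)^2 * D2 e (sgn ((1-t) *R y + (t * s) *R a)))) * ind {0..1} t)"
proof -
 define v where "v = s *R a - y"
 define ga where "ga t = y + t *R v" for t
 define k where "k = cross3 y v"
 let ?r = "%t. norm (ga t)" and ?k = "%e t. k .* Lv e (sgn (ga t))"
 have keq: "k = cross3 y (s *R a)" by (simp add: k_def v_def Cross3.right_diff_distrib)
 have g: "ga t = (1-t) *R y + (t * s) *R a" for t by (simp add: ga_def v_def algebra_simps)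
 \<comment> \<open>The segment has length at most |y| / 10 and therefore stays away from the
   origin.\<close>
 have gn: "?r t >= 9/10 * norm y" "?r t > 0" if "0 <= t" "t <= 1" for t
 proof -
  have "norm y - norm (t *R v) <= ?r t" unfolding ga_def by (metis add.commute norm_diff_ineq)
  moreover have "norm (t *R v) <= norm v" using that by (simp add: mult_left_le_one_le)
  moreover have "norm v <= 1/10 * norm y" using d mult_right_mono[OF dl(2), of "norm y"] by (simp add: v_def)
  ultimately show "?r t >= 9/10 * norm y" by simp
  hence "9/10 * norm y <= ?r t" .
  moreover have "norm y > 0" using y by simp
  ultimately show "?r t > 0" by linarith
 qed
 define P where "P t = ?k e t / (?r t)^2" for t
 define Q where "Q t = ((SUM m:UNIV. k $ m * ?k (L m e) t) - 2 * ?k e t * (ga t .* v)) / (?r t)^4" for t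
 \<comment> \<open>P is the derivative of the last summand, so F leads from the first order Taylor
   polynomial at y to the value at a, with F' = (1 - t) P'.\<close>
 define F where "F t = (1 - t) * P t + ev e (sgn (ga t))" for t
 have ke: "?k e t = (SUM m:UNIV. k $ m * ev (L m e) (sgn (ga t)))" for t by (simp add: inner_vec_def)
 have d1: "((%t. ev e (sgn (ga t))) has_real_derivative ?k e t / (?r t)^2) (at t)" if "0 <= t" "t <= 1" for t e
  using ev_sgn_line_deriv[of y t v e] gn(2)[OF that] unfolding ga_def k_def by simp
 have dF: "(F has_real_derivative (1 - t) * Q t) (at t)" if t: "0 <= t" "t <= 1" for t
 proof -
  have n1: "(?k e has_real_derivative (SUM m:UNIV. k $ m * ?k (L m e) t) / (?r t)^2) (at t)"
   unfolding ke by (rule DERIV_cong[OF DERIV_sum[OF DERIV_cmult[OF d1[OF t]]]]) (simp add: sum_divide_distrib)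
  have n2: "((%t. (?r t)^2) has_real_derivative 2 * (ga t .* v)) (at t)"
   unfolding power2_norm_eq_inner ga_def has_field_derivative_def
   by (auto intro!: derivative_eq_intros simp: fun_eq_iff inner_commute algebra_simps)
  have m: "(P has_real_derivative Q t) (at t)" unfolding P_def[abs_def]
   by (rule DERIV_cong[OF DERIV_divide[OF n1 n2]]) (use gn(2)[OF t] in "simp_all add: Q_def field_simps power4_eq_xxxx power2_eq_square")
  have "((%t. 1 - t) has_real_derivative (-1)) (at t)" by (auto intro!: derivative_eq_intros)
  from DERIV_add[OF DERIV_mult[OF this m] d1[OF t, of e]] show ?thesis
   unfolding F_def[abs_def] by (rule DERIV_cong) (simp add: P_def algebra_simps)
 qed
 have cg: "continuous_on {0..1} ga" unfolding ga_def by (intro continuous_intros)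
 have gz: "!!t. t \<in> {0..1} ==> ga t ~= 0" using gn(2) by fastforce
 have cs: "continuous_on {0..1} (%t. sgn (ga t))" using cg gz by (intro continuous_on_sgn) auto
 have cQ: "continuous_on {0..1} (%t. (1 - t) * Q t)" unfolding Q_def by (intro continuous_intros cg cs) (use gz in auto)
 have "sgn (s *R a) = a" using s na by (simp add: sgn_div_norm)
 hence "ev e a - ev e (sgn y) - (cross3 y (s *R a) .* Lv e (sgn y)) / (norm y)^2 = F 1 - F 0" by (simp add: F_def P_def g keq)
 hence "ennreal ((ev e a - ev e (sgn y) - (cross3 y (s *R a) .* Lv e (sgn y)) / (norm y)^2)^2)
   <= (NI t. ennreal (((1 - t) * Q t)^2) * ind {0..1} t)" using square_increment_le[OF dF cQ] by simp
 also have "... <= (NI t. ennreal (16 * de^4 * ((1 - t)^2 * D2 e (sgn (ga t)))) * ind {0..1} t)"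
 proof (rule nn_integral_mono, goal_cases)
  case (1 t)
  show ?case
  proof (cases "t \<in> {0..1}")
   case True
   hence t: "0 <= t" "t <= 1" by auto
   let ?q = "%e. norm (Lv e (sgn (ga t)))" and ?r = "?r t"
   define q2 where "q2 = sqrt (SUM m:UNIV. (?q (L m e))^2)"
   define c :: "real^3" where "c = (\<chi> m. ?k (L m e) t)"
   have q: "q2 >= 0" by (auto simp: q2_def sum_nonneg)
   have n: "norm y <= 10/9 * ?r" and rp: "?r > 0" using gn[OF t] by simp_all
   have "norm v <= de * norm y" using d by (simp add: v_def)
   also have "... <= de * (10/9 * ?r)" using n dl by (intro mult_left_mono) auto
   finally have nv: "norm v <= de * (10/9 * ?r)" .
   have "norm k <= norm y * norm v" unfolding k_def by (rule norm_cross_le)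
   also have "... <= (10/9 * ?r) * (de * (10/9 * ?r))" using n nv by (intro mult_mono) auto
   also have "... <= 5/4 * de * ?r^2" using dl by (simp add: power2_eq_square)
   finally have nk: "norm k <= 5/4 * de * ?r^2" .
   have "(norm c)^2 = (SUM m:UNIV. (?k (L m e) t)^2)" by (simp add: norm_vec_def L2_set_def c_def sum_nonneg)
   also have "... <= (SUM m:UNIV. (norm k * ?q (L m e))^2)" by (simp add: sum_mono power_mult_distrib power2_norm_eq_inner Cauchy_Schwarz_ineq)
   also have "... = (norm k * q2)^2" by (simp add: power_mult_distrib q2_def sum_nonneg sum_distrib_left)
   finally have "norm c <= norm k * q2" by (rule power2_le_imp_le) (use q in simp)
   hence "|k .* c| <= norm k * (norm k * q2)" using Cauchy_Schwarz_ineq2[of k c] mult_left_mono[of "norm c" "norm k * q2" "norm k"] by simp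
   also have "... <= (5/4 * de * ?r^2) * ((5/4 * de * ?r^2) * q2)" using nk q dl by (intro mult_mono) auto
   finally have A: "|k .* c| <= 25/16 * de^2 * q2 * ?r^4" by (simp add: power2_eq_square power4_eq_xxxx mult_ac)
   have "|?k e t| * |ga t .* v| <= (norm k * ?q e) * (?r * norm v)" by (intro mult_mono Cauchy_Schwarz_ineq2) auto
   also have "... <= ((5/4 * de * ?r^2) * ?q e) * (?r * (de * (10/9 * ?r)))" using nk nv dl by (intro mult_mono) auto
   also have "... <= 25/16 * de^2 * ?q e * ?r^4" using dl by (simp add: power2_eq_square power4_eq_xxxx mult_ac)
   finally have B: "|2 * ?k e t * (ga t .* v)| <= 25/8 * de^2 * ?q e * ?r^4" by (simp add: abs_mult)
   have "|Q t| * ?r^4 = |k .* c - 2 * ?k e t * (ga t .* v)|" using rp by (simp add: Q_def c_def inner_vec_def[of k])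
   also have "... <= 25/16 * de^2 * q2 * ?r^4 + 25/8 * de^2 * ?q e * ?r^4" using A B by linarith
   also have "... = (25/16 * de^2 * (q2 + 2 * ?q e)) * ?r^4" by (simp add: algebra_simps)
   finally have "|Q t| <= 25/16 * de^2 * (q2 + 2 * ?q e)" using rp by (simp add: mult_le_cancel_right)
   hence "(Q t)^2 <= (25/16 * de^2 * (q2 + 2 * ?q e))^2" by (metis abs_ge_zero power2_abs power_mono)
   also have "... = 625/256 * de^4 * (q2 + 2 * ?q e)^2" by (simp add: power_mult_distrib power_divide flip: power_mult)
   \<comment> \<open>Cauchy-Schwarz with the weights 1 and 2 gives the factor 1 + 4 = 5; afterwards
     3125 / 256 is rounded up to 16.\<close>
   also have "... <= 625/256 * de^4 * (5 * ((?q e)^2 + q2^2))"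
    using zero_le_power2[of "?q e - 2 * q2"] by (intro mult_left_mono) (simp_all add: power2_eq_square algebra_simps)
   also have "... = 3125/256 * (de^4 * ((?q e)^2 + q2^2))" by simp
   also have "... <= 16 * (de^4 * ((?q e)^2 + q2^2))" by (intro mult_right_mono) auto
   also have "(?q e)^2 + q2^2 = D2 e (sgn (ga t))" by (simp add: D2_def q2_def sum_nonneg)
   finally have "(1 - t)^2 * (Q t)^2 <= (1 - t)^2 * (16 * (de^4 * D2 e (sgn (ga t))))" by (rule mult_left_mono) simp
   thus ?thesis using True by (simp add: ennreal_leI power_mult_distrib mult_ac)
  qed simp
 qed
 finally show ?thesis unfolding g .
qed

text \<open>By \<open>nn_integral_shell\<close>, a shell with b^3 - a^3 >= 3 weighs at least as much
  as the surface; boundedness on the sphere provides the finiteness required there.\<close>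

lemma nn_integral_shell_ge:
 assumes F[measurable]: "F \<in> borel_measurable borel" and B: "!!y. y \<in> S2 ==> F y <= ennreal B" and ab: "0 < a" "a <= b" "b^3 - a^3 >= 3"
 shows "(\<integral>\<^sup>+y. F y \<partial>surf) <= (NI y. F (sgn y) * ind {y. a < norm y & norm y <= b} y)"
proof -
 let ?X = "\<integral>\<^sup>+y. F (sgn y) * ind {y. a < norm y & norm y <= b} y \<partial>lborel"
 have "(\<integral>\<^sup>+y. F y \<partial>surf) <= (\<integral>\<^sup>+y. ennreal B \<partial>surf)" using B by (intro nn_integral_mono) auto
 also have "... < \<infinity>" by (simp add: ennreal_mult_less_top surf.emeasure_eq_measure)
 finally have fin: "(\<integral>\<^sup>+y. F y \<partial>surf) < \<infinity>" .
 have "3 * (\<integral>\<^sup>+y. F y \<partial>surf) = ennreal 3 * (\<integral>\<^sup>+y. F y \<partial>surf)" by simp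
 also have "... <= ennreal (b^3 - a^3) * (\<integral>\<^sup>+y. F y \<partial>surf)" using ab by (intro mult_right_mono ennreal_leI) auto
 also have "... = 3 * ?X" by (rule nn_integral_shell[OF F ab(1,2) fin, symmetric])
 finally show ?thesis by (rule ennreal_mult_le_mult_iff[THEN iffD1, rotated 2]) simp_all
qed

lemma integrable_surf_indicator:
 fixes F :: "real^3 => real"
 assumes F: "integrable surf F" and K: "K \<in> sets borel" shows "integrable surf (%y. F y * ind K y)"
proof (rule LI_bound[OF F])
 show "(%y. F y * ind K y) \<in> borel_measurable surf"
  by (intro borel_measurable_times borel_measurable_integrable[OF F] measurable_surfI borel_measurable_indicator K)
qed (auto simp: indicator_def)

lemma integrable_surf_bounded:
 fixes f :: "real^3 => real"
 assumes "f \<in> borel_measurable surf" "!!y. y \<in> S2 ==> |f y| <= B"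
 shows "integrable surf f"
 by (rule surf.integrable_const_bound[of _ B]) (use assms in auto)

lemma continuous_bounded_S2:
 fixes f :: "real^3 => real" assumes "continuous_on S2 f" shows "\<exists>B. \<forall>y\<in>S2. |f y| <= B"
proof -
 have "bounded (f ` S2)" using assms by (intro compact_imp_bounded compact_continuous_image) auto
 thus ?thesis by (auto simp: bounded_iff)
qed

lemma integrable_continuous_S2:
 fixes f :: "real^3 => real" assumes f: "continuous_on S2 f" shows "integrable surf f"
proof -
 obtain B where "!!y. y \<in> S2 ==> |f y| <= B" using continuous_bounded_S2[OF f] by blast
 thus ?thesis by (intro integrable_surf_bounded borel_measurable_surf_continuous f)
qed

lemma sqi_continuous: "continuous_on S2 f ==> sqi surf f" for f :: "real^3 => real"
 unfolding sqi_def by (intro conjI borel_measurable_surf_continuous integrable_continuous_S2 continuous_on_power)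

lemma continuous_on_D2 [continuous_intros]: "continuous_on A f ==> continuous_on A (%x. D2 e (f x))"
 unfolding D2_def by (intro continuous_intros)

text \<open>The segment from y ends at (\<nu> . y) a, the point on the ray of a that a linear form
  \<nu> with \<nu> . a = 1 selects. For a triangle \<nu> is the form that equals 1 on its plane; for
  a cell it is the generator itself.\<close>

definition taylor_rem :: "real^3 => real^3 => pexp => real^3 => real" where
 "taylor_rem a \<nu> e y = ev e a - ev e y - cross3 y ((\<nu> .* y) *R a) .* Lv e y"

lemma continuous_on_taylor_rem [continuous_intros]:
 fixes f :: "'a::t2_space => real^3"
 shows "continuous_on A f ==> continuous_on A (%x. taylor_rem a \<nu> e (f x))"
 unfolding taylor_rem_def by (intro continuous_on_cross continuous_intros)

lemma borel_measurable_taylor_rem [measurable]: "taylor_rem a \<nu> e \<in> borel_measurable borel"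
 by (rule borel_measurable_continuous_onI) (intro continuous_intros)

lemma cone_sgn_iff:
 fixes K :: "(real^3) set"
 assumes "!!y r. y \<in> K ==> r > 0 ==> r *R y \<in> K"
 shows "sgn y \<in> K \<longleftrightarrow> y \<in> K"
proof (cases "y = 0")
 case False
 hence n: "norm y > 0" by simp
 show ?thesis
 proof
  assume "sgn y \<in> K"
  from assms[OF this n] show "y \<in> K" using False by (simp add: sgn_div_norm)
 next
  assume "y \<in> K"
  from assms[OF this, of "inverse (norm y)"] show "sgn y \<in> K" using n by (simp add: sgn_div_norm)
 qed
qed (simp add: sgn_div_norm)

(* Integrating the remainder along the segments from y to the apex: the linear map M_t has
 determinant (1 - t)^2, which is compensated by the weight (1 - t)^2 of the remainder. *)
lemma taylor_cone:
 fixes a \<nu> :: "real^3"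
 assumes K[measurable]: "K \<in> sets borel"
  and cone: "!!y r. y \<in> K ==> r > 0 ==> r *R y \<in> K"
  and na: "norm a = 1" and nua: "\<nu> .* a = 1"
  and pos: "!!y. y \<in> K ==> \<nu> .* y > 0"
  and conv: "!!y t. y \<in> K ==> 0 <= t ==> t < 1 ==> (1 - t) *R y + (t * (\<nu> .* y)) *R a \<in> K"
  and d: "!!y. y \<in> K ==> norm ((\<nu> .* y) *R a - y) <= de * norm y" and dl: "0 <= de" "de <= 1/10"
 shows "(SI y. (taylor_rem a \<nu> e y)^2 * ind K y) <= 144 * de^4 * (SI y. D2 e y * ind K y)"
proof -
 let ?c = "ennreal (16 * de^4)" and ?B = "%c. {y::real^3. 0 < norm y & norm y <= c}"
 define R where "R y = ev e a - ev e (sgn y) - (cross3 y ((\<nu> .* y) *R a) .* Lv e (sgn y)) / (norm y)^2" for y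
 define M where "M t y = (1 - t) *R y + (t * (\<nu> .* y)) *R a" for t y
 define G where "G y = ennreal (D2 e (sgn y)) * ind (K Int ?B 2) y" for y
 let ?f = "%t y. ?c * (ennreal ((1 - t)^2) * G (M t y)) * ind {0..<1} t" and ?X = "NI y. G y" and ?R = "%y. ennreal ((R y)^2) * ind (K Int ?B 1) y"
 have shm[measurable]: "?B c \<in> sets borel" for c by measurable
 have Gm[measurable]: "G \<in> borel_measurable borel" unfolding G_def by measurable
 have K0: "y ~= 0" if "y \<in> K" for y using pos[OF that] by auto
 note Ksgn = cone_sgn_iff[OF cone]
 have Rt: "R y = taylor_rem a \<nu> e (sgn y)" if "y ~= 0" for y
 proof -
  have yu: "y = norm y *R sgn y" using that by (simp add: sgn_div_norm)
  have "cross3 y ((\<nu> .* y) *R a) = (norm y)^2 *R cross3 (sgn y) ((\<nu> .* sgn y) *R a)"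
   by (subst (1 2) yu) (simp add: cross_mult_left cross_mult_right power2_eq_square)
  thus ?thesis using that by (simp add: R_def taylor_rem_def)
 qed
 have lin: "linear (M t)" for t
  by (rule linearI) (simp_all add: M_def inner_add_right algebra_simps)
 \<comment> \<open>\<open>M t\<close> is (1 - t) times the identity plus the rank one map t a
   \<nu>^T, so its determinant is (1 - t)^2 ((1 - t) + t (\<nu> . a)).\<close>
 have det: "det (matrix (M t)) = (1 - t)^2" for t
 proof -
  have nua': "\<nu>$1 * a$1 + \<nu>$2 * a$2 + \<nu>$3 * a$3 = 1" using nua by (simp add: inner_vec_def sum_3)
  have mm: "matrix (M t) = (\<chi> i j. (1 - t) * (if i = j then 1 else 0) + t * \<nu>$j * a$i)"
  proof -
   have "\<nu> .* axis j 1 = \<nu> $ j" for j by (simp add: inner_axis)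
   thus ?thesis unfolding matrix_def M_def vec_eq_iff by (simp only:) (simp add: axis_def)
  qed
  have "det (matrix (M t)) = (1 - t)^2 * ((1 - t) + t * (\<nu>$1 * a$1 + \<nu>$2 * a$2 + \<nu>$3 * a$3))"
   unfolding mm det_3 by (simp add: three_neq power2_eq_square algebra_simps)
  thus ?thesis unfolding nua' by simp
 qed
 have step: "?R y <= (NI t. ?f t y)" for y
 proof (cases "y \<in> K Int ?B 1")
  case True
  hence yK: "y \<in> K" and yn: "norm y <= 1" by auto
  have "ennreal ((R y)^2) <= (NI t. ennreal (16 * de^4 * ((1 - t)^2 * D2 e (sgn (M t y)))) * ind {0..1} t)"
   unfolding R_def M_def by (rule taylor_pointwise[OF na pos[OF yK] K0[OF yK] d[OF yK] dl])
  also have "... <= (NI t. ?f t y)"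
  proof (rule nn_integral_mono_AE)
   \<comment> \<open>\<open>M t\<close> is singular at t = 1; this single parameter is
     dropped.\<close>
   have "AE t in lborel. t ~= (1::real)" by (rule AE_lborel_singleton)
   thus "AE t in lborel. ennreal (16 * de^4 * ((1 - t)^2 * D2 e (sgn (M t y)))) * ind {0..1} t <= ?f t y"
   proof eventually_elim
    case (elim t)
    show ?case
    proof (cases "t \<in> {0..<1}")
     case t: True
     have MK: "M t y \<in> K" unfolding M_def using conv[OF yK] t by auto
     have "M t y = y + t *R ((\<nu> .* y) *R a - y)" by (simp add: M_def algebra_simps)
     hence "norm (M t y - y) = |t| * norm ((\<nu> .* y) *R a - y)" by simp
     also have "... <= 1 * (de * norm y)" using d[OF yK] t by (intro mult_mono) auto
     also have "... <= 1 * ((1/10) * 1)" using dl yn by (intro mult_left_mono mult_mono) auto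
     finally have "norm (M t y - y) <= 1/10" by simp
     moreover have "norm (M t y) <= norm y + norm (M t y - y)" by norm
     ultimately have "norm (M t y) <= 2" using yn by linarith
     moreover have "0 < norm (M t y)" using K0[OF MK] by simp
     ultimately have "G (M t y) = ennreal (D2 e (sgn (M t y)))" using MK by (simp add: G_def)
     thus ?thesis using t D2_nonneg by (simp add: ennreal_mult)
    next
     case False
     hence "t ~: {0..1}" using elim by auto
     thus ?thesis by simp
    qed
   qed
  qed
  finally show ?thesis using True by simp
 qed simp
 have Mm: "(%(y, t). M t y) \<in> borel_measurable (borel \<Otimes>\<^sub>M borel)"
  unfolding borel_prod M_def split_beta' by (intro borel_measurable_continuous_onI continuous_intros)
 have GMm[measurable]: "(%(y, t). G (M t y)) \<in> borel_measurable (lborel \<Otimes>\<^sub>M lborel)"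
  using measurable_compose[OF Mm Gm] by (simp add: split_beta')
 have GMt[measurable]: "(%y. G (M t y)) \<in> borel_measurable borel" for t
 proof -
  have "continuous_on UNIV (M t)" unfolding M_def by (intro continuous_intros)
  from measurable_compose[OF borel_measurable_continuous_onI[OF this] Gm] show ?thesis .
 qed
 have "(NI y. ?R y) <= (NI y. NI t. ?f t y)" by (rule nn_integral_mono) (rule step)
 also have "... = (NI t. NI y. ?f t y)"
  by (rule lborel_pair.Fubini'[symmetric]) (use GMm in "simp add: split_beta'")
 also have "... = (NI t. ?c * ?X * ind {0..<1::real} t)"
 proof (rule nn_integral_cong, goal_cases)
  case (1 t)
  show ?case
  proof (cases "t \<in> {0..<1}")
   case True
   hence "det (matrix (M t)) ~= 0" unfolding det by simp
   from nn_integral_linear_change[OF lin this Gm]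
   have "?X = ennreal ((1 - t)^2) * (NI y. G (M t y))" unfolding det by simp
   thus ?thesis using True by (simp add: nn_integral_cmult)
  qed simp
 qed
 also have "... = ?c * ?X" by (simp add: nn_integral_cmult)
 finally have main: "(NI y. ?R y) <= ?c * ?X" .
 define F1 where "F1 y = (taylor_rem a \<nu> e y)^2 * ind K y" for y
 define F2 where "F2 y = D2 e y * ind K y" for y
 have [measurable]: "F1 \<in> borel_measurable borel" "F2 \<in> borel_measurable borel" unfolding F1_def F2_def by measurable
 have F0: "0 <= F1 y" "0 <= F2 y" for y using D2_nonneg by (auto simp: F1_def F2_def)
 have i1: "integrable surf F1" and i2: "integrable surf F2"
  unfolding F1_def[abs_def] F2_def[abs_def] by (intro integrable_surf_indicator K integrable_continuous_S2 continuous_intros)+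
 have "(\<integral>\<^sup>+y. ennreal (F1 y) \<partial>surf) = 3 * (NI y. ennreal (F1 (sgn y)) * ind (?B 1) y)"
  using nn_integral_ball_sgn[of "%y. ennreal (F1 y)" 1] by simp
 also have "(NI y. ennreal (F1 (sgn y)) * ind (?B 1) y) = (NI y. ?R y)"
  by (rule nn_integral_cong) (use Rt Ksgn K0 in "auto simp: F1_def indicator_def")
 also have "3 * ... <= 3 * (?c * ?X)" by (rule mult_left_mono[OF main]) simp
 also have "... = ?c * (3 * ?X)" by (simp only: mult.left_commute)
 also have "?X = (NI y. ennreal (F2 (sgn y)) * ind (?B 2) y)"
  by (rule nn_integral_cong) (use Ksgn in "auto simp: F2_def G_def indicator_def")
 also have "3 * ... = ennreal (2^3) * (\<integral>\<^sup>+y. ennreal (F2 y) \<partial>surf)" by (rule nn_integral_ball_sgn) auto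
 also have "?c * ... = ennreal (128 * de^4 * (SI y. F2 y))"
  using F0 i2 by (subst nn_integral_eq_integral) (auto simp: ennreal_mult[symmetric] simp flip: ennreal_numeral)
 finally have "ennreal (SI y. F1 y) <= ennreal (128 * de^4 * (SI y. F2 y))"
  using F0 i1 by (subst (asm) nn_integral_eq_integral) auto
 hence "(SI y. F1 y) <= 128 * de^4 * (SI y. F2 y)" using F0 by (simp add: ennreal_le_iff LI_nonneg)
 \<comment> \<open>128 = 16 * 2^3, where 2 bounds |M t y| for |y| <= 1. It is rounded up to the
   square 144 = 12^2.\<close>
 also have "... <= 144 * de^4 * (SI y. F2 y)" using F0 by (intro mult_right_mono) (auto intro: LI_nonneg)
 finally show ?thesis by (simp add: F1_def[abs_def] F2_def[abs_def])
qed

section \<open>Poincare inequality on convex cones\<close>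

lemma segment_integral_le:
 fixes A :: "(real^3) set"
 assumes [measurable]: "A \<in> sets borel" and [measurable]: "F \<in> borel_measurable borel" and c: "c >= 1/2"
 shows "(NI z. F (b + c *R z)) <= 8 * (\<integral>\<^sup>+z. F z \<partial>(lborel :: (real^3) measure))"
proof -
 have c0: "c ~= 0" "c > 0" using c by auto
 have "(NI z. F z) = (\<integral>\<^sup>+z. F z \<partial>density (distr lborel borel (%x. b + c *R x)) (%_. |c|^DIM(real^3)))"
  by (subst lborel_affine[OF c0(1), of b]) simp
 also have "... = ennreal (c^3) * (NI z. F (b + c *R z))"
  using c0 by (simp add: nn_integral_density nn_integral_distr nn_integral_cmult)
 finally have eq: "(NI z. F z) = ennreal (c^3) * (NI z. F (b + c *R z))" .
 have "1 <= 8 * c^3" using power_mono[of "1/2" c 3] c by (simp add: power_divide)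
 hence "1 <= ennreal (8 * c^3)" by (metis ennreal_1 ennreal_leI)
 hence "1 * (NI z. F (b + c *R z)) <= ennreal (8 * c^3) * (NI z. F (b + c *R z))"
  by (rule mult_right_mono) simp
 also have "... = 8 * (NI z. F z)" unfolding eq using c0 by (simp add: ennreal_mult mult.assoc)
 finally show ?thesis by simp
qed

text \<open>The point (1 - t) p + t z moves with factor t in z and with factor 1 - t in p. One of
  the two is at least 1/2, and integrating first in that variable costs a Jacobian of at most
  8.\<close>

lemma poincare_convex:
 fixes A :: "(real^3) set" and F W :: "real^3 => ennreal" and D :: "real^3 => real^3 => ennreal"
 assumes A[measurable]: "A \<in> sets borel" and cA: "convex A" and F[measurable]: "F \<in> borel_measurable borel"
  and D: "!!p z. p \<in> A ==> z \<in> A ==> D p z <= (NI t. F ((1 - t) *R p + t *R z) * ind {0..1} t)"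
 shows "(NI p. (NI z. D p z * ind A z) * ind A p)
  <= 8 * emeasure lborel A * (NI z. F z * ind A z)"
proof -
 define G where "G y = F y * ind A y" for y
 have Gm[measurable]: "G \<in> borel_measurable borel" unfolding G_def by measurable
 let ?I = "%t p z. G ((1 - t) *R p + t *R z) * ind {0..1::real} t * ind A z * ind A p"
 let ?X = "\<integral>\<^sup>+z. G z \<partial>lborel"
 have cont: "continuous_on UNIV (%(p::real^3, z::real^3, t::real). (1 - t) *R p + t *R z)"
  unfolding split_beta' by (intro continuous_intros)
 have M3: "(%q. (1 - snd (snd q)) *R fst q + snd (snd q) *R fst (snd q)) \<in> borel_measurable (borel \<Otimes>\<^sub>M (borel \<Otimes>\<^sub>M borel) :: ((real^3) \<times> ((real^3) \<times> real)) measure)"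
  using borel_measurable_continuous_onI[OF cont] unfolding borel_prod split_beta' .
 have G3[measurable]: "(%q. G ((1 - snd (snd q)) *R fst q + snd (snd q) *R fst (snd q))) \<in> borel_measurable (borel \<Otimes>\<^sub>M (borel \<Otimes>\<^sub>M borel))"
  using measurable_compose[OF M3 Gm] .
 have g1[measurable]: "(%x. G ((1 - h x) *R f x + h x *R g x)) \<in> borel_measurable N"
  if [measurable]: "f \<in> borel_measurable N" "g \<in> borel_measurable N" "h \<in> borel_measurable N"
  for f g :: "'z => real^3" and h :: "'z => real" and N
  by measurable
 have st: "(NI z. D p z * ind A z) * ind A p <= (NI z. (NI t. ?I t p z))" for p
 proof (cases "p \<in> A")
  case True
  have "D p z * ind A z <= (NI t. ?I t p z)" for z
  proof (cases "z \<in> A")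
   case z: True
   have "D p z <= (NI t. F ((1 - t) *R p + t *R z) * ind {0..1} t)" by (rule D[OF True z])
   also have "... = (NI t. ?I t p z)"
   proof (rule nn_integral_cong)
    fix t :: real
    show "F ((1 - t) *R p + t *R z) * ind {0..1} t = ?I t p z"
    proof (cases "t \<in> {0..1}")
     case t: True
     hence "(1 - t) *R p + t *R z \<in> A" using cA True z by (intro convexD_alt) auto
     thus ?thesis using t True z by (simp add: G_def)
    qed simp
   qed
   finally show ?thesis using z by simp
  qed simp
  thus ?thesis using True by (simp add: nn_integral_mono)
 qed simp
 have half: "(NI p. (NI z. ?I t p z)) <= 8 * emeasure lborel A * ?X * ind {0..1} t" for t :: real
 proof (cases "t \<in> {0..1}")
  case t: True
  show ?thesis
  proof (cases "t >= 1/2")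
   case True
   have "(NI p. (NI z. ?I t p z)) <= (NI p. 8 * ?X * ind A p)"
   proof (rule nn_integral_mono)
    fix p
    have "(NI z. ?I t p z) <= (NI z. G ((1 - t) *R p + t *R z)) * ind A p"
     by (auto simp: indicator_def intro!: nn_integral_mono)
    also have "... <= 8 * ?X * ind A p" by (intro mult_right_mono segment_integral_le A Gm True) auto
    finally show "(NI z. ?I t p z) <= 8 * ?X * ind A p" .
   qed
   also have "... = 8 * ?X * emeasure lborel A" by (rule nn_integral_cmult_indicator) simp
   also have "... = 8 * emeasure lborel A * ?X * ind {0..1} t" using t by (simp add: mult_ac)
   finally show ?thesis .
  next
   case False
   have "(NI p. (NI z. ?I t p z)) = (NI z. (NI p. ?I t p z))"
    by (rule lborel_pair.Fubini'[symmetric]) (simp add: split_beta', measurable)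
   also have "... <= (NI z. 8 * ?X * ind A z)"
   proof (rule nn_integral_mono)
    fix z
    have "(NI p. ?I t p z) <= (NI p. G (t *R z + (1 - t) *R p)) * ind A z"
     by (auto simp: indicator_def add.commute intro!: nn_integral_mono)
    also have "... <= 8 * ?X * ind A z" using False by (intro mult_right_mono segment_integral_le A Gm) auto
    finally show "(NI p. ?I t p z) <= 8 * ?X * ind A z" .
   qed
   also have "... = 8 * ?X * emeasure lborel A" by (rule nn_integral_cmult_indicator) simp
   also have "... = 8 * emeasure lborel A * ?X * ind {0..1} t" using t by (simp add: mult_ac)
   finally show ?thesis .
  qed
 qed simp
 have "(NI p. (NI z. D p z * ind A z) * ind A p) <= (NI p. (NI z. (NI t. ?I t p z)))"
  by (rule nn_integral_mono) (rule st)
 also have "... = (NI p. (NI t. (NI z. ?I t p z)))"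
  by (intro nn_integral_cong lborel_pair.Fubini'[symmetric]) (simp add: split_beta', measurable)
 also have "... = (NI t. (NI p. (NI z. ?I t p z)))"
  by (rule lborel_pair.Fubini'[symmetric]) (simp add: split_beta', measurable)
 also have "... <= (NI t. 8 * emeasure lborel A * ?X * ind {0..1::real} t)"
  by (rule nn_integral_mono) (rule half)
 also have "... = 8 * emeasure lborel A * ?X * emeasure lborel {0..1::real}" by (rule nn_integral_cmult_indicator) simp
 finally show ?thesis by (simp add: G_def)
qed

lemma abs_increment_le:
 fixes F g :: "real => real"
 assumes d: "!!t. 0 <= t ==> t <= 1 ==> (F has_real_derivative g t) (at t)" and c: "continuous_on {0..1} g"
 shows "ennreal |F 1 - F 0| <= (NI t. ennreal |g t| * ind {0..1} t)"
proof -
 let ?f = "%t. ind {0..1::real} t *R g t"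
 have "(\<integral>t. ?f t \<partial>lborel) = F 1 - F 0"
  by (rule integral_FTC_Icc) (use d c in "auto simp: has_real_derivative_iff_has_vector_derivative[symmetric] intro: has_field_derivative_at_within")
 moreover have "integrable lborel ?f" by (rule borel_integrable_compact) (use c in auto)
 ultimately have "ennreal |F 1 - F 0| <= (NI t. ennreal (norm (?f t)))"
  using integral_norm_bound_ennreal[of lborel ?f] by simp
 also have "... = (NI t. ennreal |g t| * ind {0..1} t)"
  by (intro nn_integral_cong) (auto simp: indicator_def)
 finally show ?thesis .
qed

text \<open>Spherical integrals are compared with Lebesgue integrals over the convex slab 1 <= a . y
  <= 2 of the cone. An L^1 inequality is wanted because it will be applied to products of two square
  integrable functions.\<close>

lemma poincare_cone:
 fixes a :: "real^3"
 assumes K[measurable]: "K \<in> sets borel" and cK: "convex K"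
  and cone: "!!y r. y \<in> K ==> r > 0 ==> r *R y \<in> K"
  and na: "norm a = 1"
  and d: "!!y. y \<in> K ==> y ~= 0 & norm (sgn y - a) <= de" and dl: "0 <= de" "de <= 1/10"
 shows "(\<integral>\<^sup>+p. (\<integral>\<^sup>+z. ennreal |ev g p - ev g z| * ind K z \<partial>surf) * ind K p \<partial>surf)
  <= ennreal (6000 * de) * emeasure surf (K Int S2) * (\<integral>\<^sup>+y. ennreal (norm (Lv g y)) * ind K y \<partial>surf)"
proof -
 note Ksgn = cone_sgn_iff[OF cone]
 define A where "A = K Int {y. 1 <= a .* y & a .* y <= 2}"
 have aa: "{y. 1 <= a .* y & a .* y <= 2} = {y. a .* y >= 1} Int {y. a .* y <= 2}" by auto
 have Am[measurable]: "A \<in> sets borel" unfolding A_def by measurable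
 have cA: "convex A" unfolding A_def aa by (intro convex_Int cK convex_halfspace_le convex_halfspace_ge)
 have K1: "norm (sgn y) = 1" "norm y > 0" if "y \<in> K" for y using d[OF that] by (auto simp: norm_sgn)
 have as: "199/200 * norm y <= a .* y & a .* y <= norm y" if "y \<in> K" for y
 proof -
  have "2 - 2 * (sgn y .* a) <= (1/10)^2"
   unfolding unit_dist_sq[OF K1(1)[OF that] na, symmetric] using d[OF that] dl by (intro power_mono) auto
  hence "199/200 <= a .* sgn y" by (simp add: power2_eq_square inner_commute)
  hence "199/200 * norm y <= (a .* sgn y) * norm y" by (intro mult_right_mono) auto
  also have "(a .* sgn y) * norm y = a .* y" using K1(2)[OF that] by (simp add: sgn_div_norm)
  finally show ?thesis using Cauchy_Schwarz_ineq2[of a y] na by simp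
 qed
 have An: "1 <= norm y & norm y <= 202/100" "y \<in> K" if "y \<in> A" for y
  using as[of y] that by (auto simp: A_def)
 have kb: "norm (cross3 p z) <= 41/5 * de" if "p \<in> A" "z \<in> A" for p z
 proof -
  have pK: "p \<in> K" "z \<in> K" using that by (auto simp: A_def)
  have "cross3 p z = (norm p * norm z) *R cross3 (sgn p) (sgn z)"
   using K1(2)[OF pK(1)] K1(2)[OF pK(2)] by (simp add: sgn_div_norm cross_mult_left cross_mult_right field_simps)
  also have "cross3 (sgn p) (sgn z) = cross3 (sgn p) (sgn z - sgn p)" by (simp add: Cross3.right_diff_distrib)
  finally have "norm (cross3 p z) = (norm p * norm z) * norm (cross3 (sgn p) (sgn z - sgn p))" by simp
  \<comment> \<open>2.02 bounds |y| on the slab, and 2 \<open>de\<close> the distance of two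
    directions in the cone; the product is below 41/5 times \<open>de\<close>.\<close>
  also have "... <= (202/100 * (202/100)) * (2 * de)"
  proof (intro mult_mono)
   have "norm (cross3 (sgn p) (sgn z - sgn p)) <= 1 * norm (sgn z - sgn p)" using norm_cross_le[of "sgn p"] K1[OF pK(1)] by simp
   moreover have "norm (sgn z - sgn p) <= norm (sgn z - a) + norm (sgn p - a)" by norm
   ultimately show "norm (cross3 (sgn p) (sgn z - sgn p)) <= 2 * de" using d[OF pK(1)] d[OF pK(2)] by linarith
  qed (use An that in auto)
  finally show ?thesis using dl by simp
 qed
 define F where "F y = ennreal (41/5 * de) * ennreal (norm (Lv g (sgn y)))" for y
 define D where "D p z = ennreal |ev g (sgn z) - ev g (sgn p)|" for p z
 have Fm[measurable]: "F \<in> borel_measurable borel" unfolding F_def by measurable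
 have DF: "D p z <= (NI t. F ((1 - t) *R p + t *R z) * ind {0..1} t)" if pz: "p \<in> A" "z \<in> A" for p z
 proof -
  define v where "v = z - p"
  define ga where "ga t = p + t *R v" for t
  have g: "ga t = (1 - t) *R p + t *R z" for t by (simp add: ga_def v_def algebra_simps)
  have gA: "ga t \<in> A" if "0 <= t" "t <= 1" for t unfolding g using cA pz that by (intro convexD_alt) auto
  have gz: "ga t ~= 0" if "0 <= t" "t <= 1" for t using An(1)[OF gA[OF that]] by auto
  have kz: "cross3 p v = cross3 p z" by (simp add: v_def Cross3.right_diff_distrib)
  let ?P = "%t. (cross3 p v .* Lv g (sgn (ga t))) / (norm (ga t))^2"
  have d1: "((%t. ev g (sgn (ga t))) has_real_derivative ?P t) (at t)" if "0 <= t" "t <= 1" for t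
   using ev_sgn_line_deriv[of p t v g] gz[OF that] unfolding ga_def by simp
  have cg: "continuous_on {0..1} ga" unfolding ga_def by (intro continuous_intros)
  have cs: "continuous_on {0..1} (%t. sgn (ga t))" using cg gz by (intro continuous_on_sgn) auto
  have c1: "continuous_on {0..1} ?P" by (intro continuous_intros cg cs) (use gz in auto)
  have "ennreal |ev g (sgn (ga 1)) - ev g (sgn (ga 0))| <= (NI t. ennreal |?P t| * ind {0..1} t)"
   by (rule abs_increment_le[OF d1 c1])
  also have "... <= (NI t. F ((1 - t) *R p + t *R z) * ind {0..1} t)"
  proof (intro nn_integral_mono)
   fix t :: real
   show "ennreal |?P t| * ind {0..1} t <= F ((1 - t) *R p + t *R z) * ind {0..1} t"
   proof (cases "t \<in> {0..1}")
    case True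
    have r: "1 <= (norm (ga t))^2" using An(1)[OF gA[of t]] True by simp
    have "|?P t| = |cross3 p v .* Lv g (sgn (ga t))| / (norm (ga t))^2" by (simp add: abs_divide)
    also have "... <= |cross3 p v .* Lv g (sgn (ga t))| / 1" by (rule divide_left_mono[OF r]) (use r in auto)
    also have "... <= norm (cross3 p z) * norm (Lv g (sgn (ga t)))" using Cauchy_Schwarz_ineq2 by (simp add: kz)
    also have "... <= 41/5 * de * norm (Lv g (sgn (ga t)))" using kb[OF pz] by (intro mult_right_mono) auto
    finally show ?thesis using True dl unfolding F_def g[symmetric] by (simp add: ennreal_leI flip: ennreal_mult)
   qed simp
  qed
  finally show ?thesis by (simp add: D_def g)
 qed
 \<comment> \<open>The slab contains the part of the cone with 3/2 < |y| <= 2 and lies in the ball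
   of radius 3. The shell satisfies 2^3 - (3/2)^3 >= 3, and the ball gives the factor 3^3 / 3 =
   9.\<close>
 let ?s2 = "{y::real^3. 3/2 < norm y & norm y <= 2}" and ?b = "{y::real^3. 0 < norm y & norm y <= 3}"
 have shm[measurable]: "?s2 \<in> sets borel" "?b \<in> sets borel" by measurable
 have Ab: "ind A y <= (ind K (sgn y) * ind ?b y :: ennreal)" for y
  using An[of y] Ksgn[of y] by (auto simp: indicator_def)
 have s2A: "(ind K (sgn y) * ind ?s2 y :: ennreal) <= ind A y" for y
  using as[of y] Ksgn[of y] by (auto simp: indicator_def A_def)
 have ball: "(NI y. G (sgn y) * ind A y) <= 9 * (\<integral>\<^sup>+y. G y * ind K y \<partial>surf)" if [measurable]: "G \<in> borel_measurable borel" for G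
 proof -
  have "3 * (NI y. G (sgn y) * ind A y) <= 3 * (NI y. (G (sgn y) * ind K (sgn y)) * ind ?b y)"
   using Ab by (intro mult_left_mono nn_integral_mono) (auto simp: mult.assoc intro: mult_left_mono)
  also have "... = ennreal (3^3) * (\<integral>\<^sup>+y. G y * ind K y \<partial>surf)"
   by (rule nn_integral_ball_sgn[of "%y. G y * ind K y"]) auto
  also have "... = 3 * (9 * (\<integral>\<^sup>+y. G y * ind K y \<partial>surf))" by (simp add: mult.assoc[symmetric])
  finally show ?thesis by (rule ennreal_mult_le_mult_iff[THEN iffD1, rotated 2]) simp_all
 qed
 have KS: "K Int S2 \<in> sets surf" by (rule sets_surfI) auto
 have "(\<integral>\<^sup>+y. ind K y \<partial>surf) = (\<integral>\<^sup>+y. ind (K Int S2) y \<partial>surf)"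
  by (rule nn_integral_cong) (auto simp: indicator_def)
 hence eA: "emeasure lborel A <= 9 * emeasure surf (K Int S2)" using ball[of "%_. 1"] nn_integral_indicator[OF KS] by simp
 let ?Y = "\<integral>\<^sup>+y. ennreal (norm (Lv g y)) * ind K y \<partial>surf"
 have "(NI z. F z * ind A z) = ennreal (41/5 * de) * (NI z. ennreal (norm (Lv g (sgn z))) * ind A z)"
  unfolding F_def mult.assoc by (rule nn_integral_cmult) measurable
 also have "... <= ennreal (41/5 * de) * (9 * ?Y)" by (intro mult_left_mono ball[of "%z. ennreal (norm (Lv g z))"]) measurable
 finally have eF: "(NI z. F z * ind A z) <= ennreal (41/5 * de) * (9 * ?Y)" .
 obtain C where C: "\<forall>y\<in>S2. |ev g y| <= C" using ev_bounded by blast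
 have dC: "|ev g p - ev g z| <= 2 * C" if "z \<in> S2" "p \<in> S2" for z p
  using bspec[OF C that(1)] bspec[OF C that(2)] by linarith
 define H where "H p = (\<integral>\<^sup>+z. ennreal |ev g p - ev g z| * ind K z \<partial>surf)" for p
 have H1: "H (sgn p) <= (NI z. D p z * ind A z)" if "p ~= 0" for p
 proof -
  have "H (sgn p) <= (NI z. (ennreal |ev g (sgn p) - ev g (sgn z)| * ind K (sgn z)) * ind ?s2 z)"
   unfolding H_def
   by (rule nn_integral_shell_ge[of _ "2 * C"]) (use dC that in "auto simp: indicator_def norm_sgn power3_eq_cube intro!: ennreal_leI")
  also have "... <= (NI z. D p z * ind A z)"
   unfolding D_def using s2A by (intro nn_integral_mono) (simp add: abs_minus_commute mult.assoc mult_left_mono)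
  finally show ?thesis .
 qed
 have [measurable]: "(%z. ev g z) \<in> borel_measurable surf" "ind K \<in> borel_measurable surf" by (auto intro!: measurable_surfI)
 have Hm[measurable]: "H \<in> borel_measurable borel" unfolding H_def by measurable
 have Hb: "H p <= ennreal (2 * C * area S2)" if "p \<in> S2" for p
 proof -
  have "H p <= (\<integral>\<^sup>+z. ennreal (2 * C) \<partial>surf)"
   unfolding H_def using dC that by (intro nn_integral_mono) (auto simp: indicator_def intro!: ennreal_leI)
  moreover have "0 <= 2 * C" using dC[OF that that] by simp
  ultimately show ?thesis by (simp add: surf.emeasure_eq_measure ennreal_mult)
 qed
 have "(\<integral>\<^sup>+p. H p * ind K p \<partial>surf) <= (NI p. (H (sgn p) * ind K (sgn p)) * ind ?s2 p)"
  by (rule nn_integral_shell_ge[of _ "2 * C * area S2"]) (use Hb in "auto simp: indicator_def power3_eq_cube")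
 also have "... <= (NI p. (NI z. D p z * ind A z) * ind A p)"
 proof (rule nn_integral_mono)
  fix p
  have "(H (sgn p) * ind K (sgn p)) * ind ?s2 p <= H (sgn p) * ind A p"
   using s2A by (simp add: mult.assoc mult_left_mono)
  also have "... <= (NI z. D p z * ind A z) * ind A p"
   using H1[of p] An(1)[of p] by (cases "p \<in> A"; cases "p = 0") auto
  finally show "(H (sgn p) * ind K (sgn p)) * ind ?s2 p <= (NI z. D p z * ind A z) * ind A p" .
 qed
 also have "... <= 8 * emeasure lborel A * (NI z. F z * ind A z)"
  by (rule poincare_convex[OF Am cA Fm DF])
 also have "... <= 8 * (9 * emeasure surf (K Int S2)) * (ennreal (41/5 * de) * (9 * ?Y))"
  using eA eF by (intro mult_mono) auto
 also have "... = ((8 * 9 * 9) * ennreal (41/5 * de)) * emeasure surf (K Int S2) * ?Y" by (simp only: mult_ac)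
 also have "(8 * 9 * 9) * ennreal (41/5 * de) = ennreal 648 * ennreal (41/5 * de)" by simp
 also have "... = ennreal (648 * (41/5 * de))" using dl by (intro ennreal_mult[symmetric]) auto
 also have "... * emeasure surf (K Int S2) * ?Y <= ennreal (6000 * de) * emeasure surf (K Int S2) * ?Y"
  using dl by (intro mult_right_mono ennreal_leI) auto
 finally show ?thesis unfolding H_def .
qed

(* Since q has mean zero, g may be replaced by its deviation from its mean over the cone. *)
lemma cone_mean:
 fixes a :: "real^3"
 assumes K[measurable]: "K \<in> sets borel" and cK: "convex K"
  and cone: "!!y r. y \<in> K ==> r > 0 ==> r *R y \<in> K"
  and na: "norm a = 1"
  and d: "!!y. y \<in> K ==> y ~= 0 & norm (sgn y - a) <= de" and dl: "0 <= de" "de <= 1/10"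
  and area: "area (K Int S2) > 0"
  and q: "continuous_on S2 q" "!!y. y \<in> K ==> y \<in> S2 ==> |q y| <= c" "c >= 0" "(SI y. q y * ind K y) = 0"
 shows "|\<integral>y. q y * ev g y * ind K y \<partial>surf| <= 6000 * de * c * (SI y. norm (Lv g y) * ind K y)"
proof -
 let ?i = "ind K :: _ => real" and ?m = "area (K Int S2)"
 define G where "G = (SI p. ev g p * ?i p)"
 define k where "k y = |?m * ev g y - G|" for y
 have ci: "integrable surf (%y. F y * ?i y)" if "continuous_on S2 F" for F :: "real^3 => real"
  by (intro integrable_surf_indicator integrable_continuous_S2 that K)
 have KS: "K Int S2 \<in> sets surf" by (rule sets_surfI) auto
 have mi: "(SI p. c * ?i p) = c * ?m" for c
 proof -
  have "(SI p. c * ?i p) = (SI p. c * ind (K Int S2) p)"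
   by (intro LI_cong) (auto simp: indicator_def)
  thus ?thesis using KS by (simp add: Int_absorb2)
 qed
 have ckn: "continuous_on S2 k" unfolding k_def[abs_def] by (intro continuous_intros)
 have kle: "k y <= (SI p. |ev g y - ev g p| * ?i p)" for y
 proof -
  have "?m * ev g y - G = (SI p. ev g y * ?i p - ev g p * ?i p)"
   using ci[of "%_. ev g y"] ci[of "ev g"] by (simp add: G_def mi continuous_intros mult.commute)
  hence "k y <= (SI p. |ev g y * ?i p - ev g p * ?i p| )" unfolding k_def by (simp add: integral_abs_bound)
  also have "... = (SI p. |ev g y - ev g p| * ?i p)"
   by (intro LI_cong) (auto simp: indicator_def)
  finally show ?thesis .
 qed
 have en: "ennreal (SI p. F p * ?i p) = (\<integral>\<^sup>+p. ennreal (F p) * ind K p \<partial>surf)"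
  if "continuous_on S2 F" "!!p. 0 <= F p" for F :: "real^3 => real"
 proof -
  have "(\<integral>\<^sup>+p. ennreal (F p) * ind K p \<partial>surf) = (\<integral>\<^sup>+p. ennreal (F p * ?i p) \<partial>surf)"
   by (intro nn_integral_cong) (auto simp: indicator_def)
  thus ?thesis using nn_integral_eq_integral[OF ci[OF that(1)]] that(2) by simp
 qed
 have "ennreal (SI y. k y * ?i y) = (\<integral>\<^sup>+y. ennreal (k y) * ind K y \<partial>surf)" by (rule en[OF ckn]) (simp add: k_def)
 also have "... <= (\<integral>\<^sup>+y. (\<integral>\<^sup>+p. ennreal |ev g y - ev g p| * ind K p \<partial>surf) * ind K y \<partial>surf)"
  using kle by (intro nn_integral_mono mult_right_mono) (auto simp: en[symmetric] continuous_intros intro!: ennreal_leI)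
 also have "... <= ennreal (6000 * de) * emeasure surf (K Int S2) * (\<integral>\<^sup>+y. ennreal (norm (Lv g y)) * ind K y \<partial>surf)"
  by (rule poincare_cone[OF K cK cone na d dl])
 also have "(\<integral>\<^sup>+y. ennreal (norm (Lv g y)) * ind K y \<partial>surf) = ennreal (SI y. norm (Lv g y) * ?i y)"
  by (rule en[symmetric]) (intro continuous_intros, simp)
 also have "ennreal (6000 * de) * emeasure surf (K Int S2) * ... = ennreal (6000 * de * ?m * (SI y. norm (Lv g y) * ?i y))"
  using dl by (simp add: surf.emeasure_eq_measure ennreal_mult LI_nonneg)
 finally have kk: "(SI y. k y * ?i y) <= 6000 * de * ?m * (SI y. norm (Lv g y) * ?i y)"
  using dl by (subst (asm) ennreal_le_iff) (auto intro!: mult_nonneg_nonneg LI_nonneg)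
 \<comment> \<open>The mean of g over the cone is G divided by the area; multiplying through by the
   area avoids the quotient.\<close>
 have "?m * (SI y. q y * ev g y * ?i y) = (SI y. ?m * (q y * ev g y * ?i y) - G * (q y * ?i y))"
  using ci[of "%y. q y * ev g y"] ci[OF q(1)] q(1,4) by (simp add: continuous_intros)
 also have "... = (SI y. (q y * (?m * ev g y - G)) * ?i y)" by (simp add: algebra_simps)
 also have "|...| <= (SI y. c * (k y * ?i y))"
 proof (rule order_trans[OF integral_abs_bound integral_mono])
  show "integrable surf (%y. |q y * (?m * ev g y - G) * ?i y| )" by (intro integrable_abs ci continuous_intros q)
  show "integrable surf (%y. c * (k y * ?i y))" using ci[OF ckn] by simp
  fix y assume "y \<in> space surf"
  thus "|q y * (?m * ev g y - G) * ?i y| <= c * (k y * ?i y)"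
   using q(2)[of y] by (auto simp: indicator_def k_def abs_mult intro: mult_right_mono)
 qed
 also have "... <= c * (6000 * de * ?m * (SI y. norm (Lv g y) * ?i y))" using kk q(3) by (simp add: mult_left_mono)
 finally have "?m * |\<integral>y. q y * ev g y * ?i y \<partial>surf| <= ?m * (6000 * de * c * (SI y. norm (Lv g y) * ?i y))"
  using area by (simp add: abs_mult mult_ac)
 thus ?thesis using area by simp
qed

section \<open>Length of circular arcs\<close>

lemma hausdorff1_pre_le:
 assumes "A <= (\<Union>n. U n)" "!!n. bounded (U n) & diameter (U n) <= de"
 shows "hausdorff1_pre de A <= (\<Sum>n. ennreal (diameter (U n)))"
 unfolding hausdorff1_pre_def using assms by (intro INF_lower) auto

text \<open>Used in contraposition: an edge of positive length contains two distinct points.\<close>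

lemma curve_length_subsingleton:
 fixes A :: "'a::metric_space set"
 assumes "!!y z. y \<in> A ==> z \<in> A ==> y = z" shows "curve_length A = 0"
proof -
 have "A = {} \<or> (\<exists>y. A = {y})" using assms by blast
 hence b: "bounded A" "diameter A = 0" by auto
 have "hausdorff1_pre de A <= 0" if "de > 0" for de
  using hausdorff1_pre_le[of A "%_. A" de] b that by simp
 hence "hausdorff1 A = 0" unfolding hausdorff1_def by (auto simp: SUP_eq_iff intro!: antisym SUP_least)
 thus ?thesis by (simp add: curve_length_def)
qed

definition circ :: "real^3 => real^3 => real => real^3" where
 "circ m t te = cos te *R m + sin te *R t"

lemma circ_dist:
 assumes "norm m = 1" "norm t = 1" "m .* t = 0"
 shows "dist (circ m t te) (circ m t ph) = 2 * |sin ((te - ph) / 2)|"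
proof -
 have mm: "m .* m = 1" "t .* t = 1" using assms by (simp_all add: norm_eq_1)
 have "(dist (circ m t te) (circ m t ph))^2 = (cos te - cos ph)^2 + (sin te - sin ph)^2"
  unfolding dist_norm power2_norm_eq_inner circ_def using mm assms(3)
  by (simp add: inner_diff_left inner_diff_right inner_add_left inner_add_right inner_commute[of t m] power2_eq_square algebra_simps)
 also have "... = (sin te)^2 + (cos te)^2 + ((sin ph)^2 + (cos ph)^2) - 2 * cos (te - ph)"
  by (simp add: cos_diff power2_eq_square algebra_simps)
 also have "... = (2 * |sin ((te - ph) / 2)| )^2"
 proof -
  have h: "2 * ((te - ph) / 2) = te - ph" by (simp add: field_simps)
  have "cos (te - ph) = 1 - 2 * (sin ((te - ph) / 2))^2"
   using cos_double_sin[of "(te - ph) / 2"] unfolding h .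
  thus ?thesis by (simp add: power_mult_distrib)
 qed
 finally show ?thesis by (rule power2_eq_imp_eq) auto
qed

lemma circ_dist_le:
 assumes "norm m = 1" "norm t = 1" "m .* t = 0"
 shows "dist (circ m t te) (circ m t ph) <= |te - ph|"
 unfolding circ_dist[OF assms] using abs_sin_x_le_abs_x[of "(te - ph) / 2"] by simp

lemma arcsin_le:
 assumes "0 <= y" "y <= d" "d < 1" shows "arcsin y <= y / sqrt (1 - d^2)"
proof (cases "y = 0")
 case False
 hence y: "0 < y" using assms by simp
 have der: "(arcsin has_real_derivative inverse (sqrt (1 - x^2))) (at x)" if "0 <= x" "x <= y" for x
  using that assms by (intro DERIV_arcsin) auto
 obtain z where z: "0 < z" "z < y" "arcsin y - arcsin 0 = (y - 0) * inverse (sqrt (1 - z^2))"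
  using MVT2[OF y, of arcsin "%x. inverse (sqrt (1 - x^2))"] der by blast
 have d1: "d^2 < 1" using assms power_strict_mono[of d 1 2] by simp
 have "z^2 <= d^2" using z assms by (intro power_mono) auto
 hence s: "sqrt (1 - d^2) <= sqrt (1 - z^2)" "0 < sqrt (1 - d^2)" using d1 by auto
 have "arcsin y = y * inverse (sqrt (1 - z^2))" using z(3) by simp
 also have "... <= y * inverse (sqrt (1 - d^2))" using s y by (intro mult_left_mono le_imp_inverse_le) auto
 finally show ?thesis by (simp add: divide_inverse)
qed simp

text \<open>The chord is 2 sin of half the angle, which arcsin inverts for angles up to pi. The
  quotient of angle and chord tends to 1 with \<open>de\<close>.\<close>

lemma circ_dist_ge:
 assumes o: "norm m = 1" "norm t = 1" "m .* t = 0" and r: "|te - ph| <= pi" and d: "dist (circ m t te) (circ m t ph) <= de" "de < 2"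
 shows "|te - ph| <= dist (circ m t te) (circ m t ph) / sqrt (1 - (de/2)^2)"
proof -
 define x where "x = |te - ph| / 2"
 have x: "0 <= x" "x <= pi / 2" using r by (auto simp: x_def)
 have sx: "0 <= sin x" using x pi_ge_zero by (intro sin_ge_zero) linarith+
 have "|sin ((te - ph) / 2)| = sin x"
 proof (cases "te >= ph")
  case True thus ?thesis using sx by (simp add: x_def)
 next
  case False
  hence "x = (ph - te) / 2" by (simp add: x_def)
  hence "(te - ph) / 2 = - x" by (simp add: field_simps)
  thus ?thesis using sx by simp
 qed
 hence D: "dist (circ m t te) (circ m t ph) = 2 * sin x" using circ_dist[OF o] by simp
 have "x = arcsin (sin x)" using x by (intro arcsin_sin[symmetric]) auto
 also have "... <= sin x / sqrt (1 - (de/2)^2)" using d sx unfolding D by (intro arcsin_le) auto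
 finally show ?thesis unfolding D by (simp add: x_def mult.commute)
qed

lemma hausdorff1_circ_le:
 assumes o: "norm m = 1" "norm t = 1" "m .* t = 0" and ab: "a <= b"
 shows "hausdorff1 (circ m t ` {a..b}) <= ennreal (b - a)"
 unfolding hausdorff1_def
proof (rule SUP_least)
 fix de :: real assume "de \<in> {0<..}"
 hence d: "de > 0" by simp
 obtain n :: nat where n: "(b - a) / de < real n" using reals_Archimedean2 by blast
 have n0: "real n > 0" using n ab d by (smt (verit) divide_nonneg_pos)
 define s where "s = (b - a) / n"
 have s: "0 <= s" "s <= de" "real n * s = b - a" using n n0 d ab by (auto simp: s_def field_simps)
 define U where "U k = (if k < n then circ m t ` {a + real k * s .. a + real (Suc k) * s} else {})" for k
 have Ud: "bounded (U k) & diameter (U k) <= (if k < n then s else 0)" for k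
 proof (cases "k < n")
  case True
  have dd: "dist y z <= s" if "y \<in> U k" "z \<in> U k" for y z
  proof -
   obtain te ph where "y = circ m t te" "z = circ m t ph" "te \<in> {a + real k * s .. a + real (Suc k) * s}" "ph \<in> {a + real k * s .. a + real (Suc k) * s}"
    using `y \<in> U k` `z \<in> U k` True by (auto simp: U_def)
   moreover from this have "|te - ph| <= s" by (auto simp: algebra_simps abs_le_iff)
   ultimately show ?thesis using circ_dist_le[OF o, of te ph] by simp
  qed
  hence "bounded (U k)" by (auto simp: bounded_two_points)
  moreover have "diameter (U k) <= s" using dd s(1) by (intro diameter_le) (auto simp: dist_norm)
  ultimately show ?thesis using True by simp
 qed (simp add: U_def)
 have Ud2: "bounded (U k) & diameter (U k) <= de" for k using Ud[of k] s(2) d by (auto split: if_splits)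
 have cover: "circ m t ` {a..b} <= (\<Union>k. U k)"
 proof
  fix y assume "y \<in> circ m t ` {a..b}"
  then obtain te where th: "y = circ m t te" "a <= te" "te <= b" by auto
  \<comment> \<open>The end point b belongs to the last arc, of index n - 1, whereas the floor below
    would return n.\<close>
  show "y \<in> (\<Union>k. U k)"
  proof (cases "s = 0 \<or> te = b")
   case True
   have "a + real (n - 1) * s <= b & b <= a + real (Suc (n - 1)) * s"
   proof -
    have "real (Suc (n - 1)) = real n" "real (n - 1) = real n - 1" using n0 by (auto simp: of_nat_diff)
    thus ?thesis using s by (simp add: algebra_simps)
   qed
   moreover have "te = b" using True s(3) th by auto
   ultimately have "y \<in> U (n - 1)" using th n0 by (auto simp: U_def)
   thus ?thesis by blast
  next
   case False
   hence sp: "s > 0" "te < b" using s th by auto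
   define k where "k = nat \<lfloor>(te - a) / s\<rfloor>"
   have q: "0 <= (te - a) / s" using th sp by simp
   hence kf: "real k = of_int \<lfloor>(te - a) / s\<rfloor>" by (simp add: k_def)
   have k1: "real k <= (te - a) / s" "(te - a) / s < real k + 1" unfolding kf by linarith+
   hence k2: "a + real k * s <= te" "te <= a + real (Suc k) * s" using sp by (auto simp: field_simps)
   have "real k * s < real n * s" using k2 sp s(3) by linarith
   hence "k < n" using sp by simp
   hence "y \<in> U k" using k2 th by (auto simp: U_def)
   thus ?thesis by blast
  qed
 qed
 have "hausdorff1_pre de (circ m t ` {a..b}) <= (\<Sum>k. ennreal (diameter (U k)))"
  by (rule hausdorff1_pre_le[OF cover Ud2])
 also have "... = (\<Sum>k<n. ennreal (diameter (U k)))"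
  by (rule suminf_finite) (auto simp: U_def)
 also have "... <= (\<Sum>k<n. ennreal s)"
 proof (intro sum_mono ennreal_leI)
  fix k assume "k \<in> {..<n}"
  thus "diameter (U k) <= s" using Ud[of k] by simp
 qed
 also have "... = ennreal (real n * s)"
  using s(1) by (simp add: ennreal_of_nat_eq_real_of_nat ennreal_mult)
 finally show "hausdorff1_pre de (circ m t ` {a..b}) <= ennreal (b - a)" unfolding s(3) .
qed

text \<open>A cover of the arc is pulled back to the parameter interval. Each piece is replaced by
  the interval from its infimum to its supremum, which is measurable and no longer than a constant
  times the diameter; subadditivity of Lebesgue measure gives the rest.\<close>

lemma hausdorff1_circ_ge:
 assumes o: "norm m = 1" "norm t = 1" "m .* t = 0" and ab: "a <= b" "b - a <= pi" and d: "0 < de" "de < 2"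
 shows "ennreal ((b - a) * sqrt (1 - (de/2)^2)) <= hausdorff1 (circ m t ` {a..b})"
proof -
 let ?s = "sqrt (1 - (de/2)^2)"
 define K where "K = 1 / ?s"
 have "(de/2)^2 < 1" using d power_strict_mono[of "de/2" 1 2] by simp
 hence sq: "?s > 0" by simp
 have K: "K > 0" unfolding K_def using sq by simp
 have "ennreal ((b - a) * ?s) <= hausdorff1_pre de (circ m t ` {a..b})"
  unfolding hausdorff1_pre_def
 proof (rule INF_greatest)
  fix U :: "nat => (real^3) set"
  assume "U \<in> {U. circ m t ` {a..b} <= (\<Union>n. U n) & (\<forall>n. bounded (U n) & diameter (U n) <= de)}"
  hence cov: "circ m t ` {a..b} <= (\<Union>n. U n)" and bU: "!!n. bounded (U n)" and dU: "!!n. diameter (U n) <= de" by auto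
  let ?D = "\<Sum>n. ennreal (diameter (U n))"
  define T where "T n = {te\<in>{a..b}. circ m t te \<in> U n}" for n
  define I where "I n = (if T n = {} then {} else {Inf (T n)..Sup (T n)})" for n
  have bT: "bdd_above (T n)" "bdd_below (T n)" for n by (auto simp: T_def intro!: bdd_aboveI[of _ b] bdd_belowI[of _ a])
  have TI: "T n <= I n" for n using cInf_lower[OF _ bT(2)] cSup_upper[OF _ bT(1)] by (auto simp: I_def)
  have dd: "|te - ph| <= K * diameter (U n)" if "te \<in> T n" "ph \<in> T n" for te ph n
  proof -
   have "dist (circ m t te) (circ m t ph) <= diameter (U n)"
    using that bU by (intro diameter_bounded_bound) (auto simp: T_def)
   moreover have "|te - ph| <= dist (circ m t te) (circ m t ph) / ?s"
    using that ab dU[of n] calculation by (intro circ_dist_ge[OF o _ _ d(2)]) (auto simp: T_def)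
   ultimately show ?thesis using sq by (simp add: K_def field_simps)
  qed
  have eI: "emeasure lborel (I n) <= ennreal (K * diameter (U n))" for n
  proof (cases "T n = {}")
   case False
   then obtain te0 where t0: "te0 \<in> T n" by blast
   have "Sup (T n) - K * diameter (U n) <= ph" if p: "ph \<in> T n" for ph
   proof -
    have "Sup (T n) <= ph + K * diameter (U n)"
     using False dd[OF _ p] by (intro cSup_least) (auto simp: abs_le_iff algebra_simps)
    thus ?thesis by simp
   qed
   hence "Sup (T n) - K * diameter (U n) <= Inf (T n)" using False by (intro cInf_greatest) auto
   moreover have "Inf (T n) <= Sup (T n)" using cInf_lower[OF t0 bT(2)] cSup_upper[OF t0 bT(1)] by linarith
   ultimately show ?thesis using False by (simp add: I_def ennreal_leI)
  qed (simp add: I_def)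
  have "{a..b} <= (\<Union>n. I n)"
  proof
   fix te assume "te \<in> {a..b}"
   then obtain n where "circ m t te \<in> U n" using cov by blast
   hence "te \<in> T n" using `te \<in> {a..b}` by (simp add: T_def)
   thus "te \<in> (\<Union>n. I n)" using TI by blast
  qed
  hence "ennreal (b - a) <= emeasure lborel (\<Union>n. I n)"
   using emeasure_mono[of "{a..b}" "\<Union>n. I n" lborel] ab by (auto simp: I_def)
  also have "... <= (\<Sum>n. emeasure lborel (I n))" by (rule emeasure_subadditive_countably) (auto simp: I_def)
  also have "... <= (\<Sum>n. ennreal K * ennreal (diameter (U n)))"
   using eI K by (intro suminf_le) (auto simp: ennreal_mult diameter_ge_0 bU)
  also have "... = ennreal K * ?D" by simp
  finally have m: "ennreal (b - a) <= ennreal K * ?D" .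
  have "ennreal ((b - a) * ?s) = ennreal (?s) * ennreal (b - a)"
   using sq ab by (simp add: ennreal_mult[symmetric] mult.commute)
  also have "... <= ennreal (?s) * (ennreal K * ?D)"
   using m by (rule mult_left_mono) simp
  also have "... = ?D"
   using sq K by (simp add: mult.assoc[symmetric] ennreal_mult[symmetric] K_def)
  finally show "ennreal ((b - a) * ?s) <= ?D" .
 qed
 also have "... <= hausdorff1 (circ m t ` {a..b})"
  unfolding hausdorff1_def using d by (intro SUP_upper) auto
 finally show ?thesis .
qed

theorem curve_length_circ:
 assumes o: "norm m = 1" "norm t = 1" "m .* t = 0" and ab: "a <= b" "b - a <= pi"
 shows "curve_length (circ m t ` {a..b}) = b - a"
proof -
 let ?H = "hausdorff1 (circ m t ` {a..b})"
 have up: "?H <= ennreal (b - a)" by (rule hausdorff1_circ_le[OF o ab(1)])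
 hence fin: "?H = ennreal (enn2real ?H)" by (metis ennreal_enn2real ennreal_less_top order_le_less_trans)
 have u: "enn2real ?H <= b - a" using up ab by (simp add: enn2real_leI)
 have lo: "(b - a) * sqrt (1 - (de/2)^2) <= enn2real ?H" if "0 < de" "de < 2" for de
 proof -
  have "ennreal ((b - a) * sqrt (1 - (de/2)^2)) <= ennreal (enn2real ?H)"
   using hausdorff1_circ_ge[OF o ab that] fin by simp
  thus ?thesis by (simp add: ennreal_le_iff)
 qed
 have lim: "((%de. (b - a) * sqrt (1 - (de/2)^2)) \<longlongrightarrow> (b - a) * sqrt (1 - (0/2)^2)) (at_right 0)"
  by (intro tendsto_intros) auto
 have "\<forall>\<^sub>F de in at_right (0::real). 0 < de & de < 2"
  using eventually_at_right_less[of "0::real"] eventually_at_right[of 0 "1::real" "%x. x < 2"] by (intro eventually_conj) (auto intro: exI[of _ 1])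
 hence "\<forall>\<^sub>F de in at_right 0. (b - a) * sqrt (1 - (de/2)^2) <= enn2real ?H"
  by (rule eventually_mono) (use lo in auto)
 from tendsto_upperbound[OF lim this] have "b - a <= enn2real ?H" by simp
 with u show ?thesis by (simp add: curve_length_def)
qed

section \<open>Voronoi cells and Delaunay triangles\<close>

lemma unit_dot_less_1: "norm a = 1 ==> norm b = 1 ==> a ~= b ==> a .* b < 1" for a b :: "'a::real_inner"
proof -
 assume a: "norm a = 1" "norm b = 1" "a ~= b"
 have "(norm (a - b))^2 = 2 - 2 * (a .* b)"
  using a(1,2) by (simp add: power2_norm_eq_inner inner_diff_left inner_diff_right inner_commute norm_eq_1)
 moreover have "(norm (a - b))^2 > 0" using a by simp
 ultimately show ?thesis by simp
qed

definition crossN :: "real^3 => real^3 => real^3 => real^3" where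
 "crossN a b c = cross3 (a - c) (b - c)"

text \<open>M is normal to the plane of the three points, hence a multiple of n. In the identity for
  M . M - \<Delta>^2 the right side is positive for distinct unit vectors, which rules out
  degenerate triangles.\<close>

lemma crossN_facts:
 fixes a b c n :: "real^3"
 assumes u: "norm a = 1" "norm b = 1" "norm c = 1" "norm n = 1"
  and d: "a ~= b" "b ~= c" "a ~= c" and h: "n .* a = s" "n .* b = s" "n .* c = s"
 defines "M == crossN a b c" and "\<Delta> == a .* cross3 b c"
 shows "M = (M .* n) *R n" "\<Delta> = (M .* n) * s" "M .* M = (M .* n)^2" "M .* M > 0"
  "M .* M - \<Delta>^2 = 2 * (1 - a .* b) * (1 - b .* c) * (1 - a .* c)"
  "M .* cross3 a b = (1 - a .* b) * ((a - c) .* (b - c))" "\<Delta> = M .* a"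
proof -
 have nn: "n .* n = 1" "a .* a = 1" "b .* b = 1" "c .* c = 1" using u by (simp_all add: norm_eq_1)
 have "cross3 n (cross3 M n) = (n .* n) *R M - (n .* M) *R n" by (rule Lagrange)
 moreover have "cross3 M n = 0"
 proof -
  have "cross3 n M = (n .* (b - c)) *R (a - c) - (n .* (a - c)) *R (b - c)"
   unfolding M_def crossN_def by (rule Lagrange)
  also have "... = 0" using h by (simp add: inner_diff_right)
  finally show ?thesis by (metis cross_skew minus_zero)
 qed
 ultimately show M: "M = (M .* n) *R n" using nn by (simp add: inner_commute)
 have Ma: "\<Delta> = M .* a"
  unfolding \<Delta>_def M_def crossN_def by (simp add: cross3_def inner_vec_def sum_3 algebra_simps)
 thus "\<Delta> = M .* a" .
 have "M .* a = ((M .* n) *R n) .* a" by (rule arg_cong[OF M])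
 thus "\<Delta> = (M .* n) * s" unfolding Ma by (simp add: h)
 show MM: "M .* M = (M .* n)^2" by (subst (1 2) M) (simp add: nn power2_eq_square)
 have M2: "M .* M = ((a - c) .* (a - c)) * ((b - c) .* (b - c)) - ((a - c) .* (b - c))^2"
  unfolding M_def crossN_def dot_cross by (simp add: inner_commute power2_eq_square)
 have D2: "\<Delta>^2 = 1 + 2 * (a .* b) * (b .* c) * (a .* c) - (a .* b)^2 - (b .* c)^2 - (a .* c)^2"
 proof -
  have "\<Delta>^2 = (a.*a) * (b.*b) * (c.*c) + 2 * (a .* b) * (b .* c) * (a .* c) - (a .* b)^2 * (c.*c) - (b .* c)^2 * (a.*a) - (a .* c)^2 * (b.*b)"
   unfolding \<Delta>_def by (simp add: cross3_def inner_vec_def sum_3 power2_eq_square algebra_simps)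
  thus ?thesis unfolding nn by simp
 qed
 show id: "M .* M - \<Delta>^2 = 2 * (1 - a .* b) * (1 - b .* c) * (1 - a .* c)"
  unfolding M2 D2 by (simp add: inner_diff_left inner_diff_right nn inner_commute power2_eq_square algebra_simps)
 have "2 * (1 - a .* b) * (1 - b .* c) * (1 - a .* c) > 0"
  using unit_dot_less_1[OF u(1,2) d(1)] unit_dot_less_1[OF u(2,3) d(2)] unit_dot_less_1[OF u(1,3) d(3)] by simp
 thus "M .* M > 0" using id zero_le_power2[of \<Delta>] by linarith
 have "M .* cross3 a b = (a .* a) * (b .* b) - (a .* b)^2 + (a .* b) * (b .* c) - (a .* c) * (b .* b) + (a .* c) * (a .* b) - (b .* c) * (a .* a)"
  unfolding M_def crossN_def by (simp add: cross3_def inner_vec_def sum_3 power2_eq_square algebra_simps)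
 thus "M .* cross3 a b = (1 - a .* b) * ((a - c) .* (b - c))"
  by (simp add: inner_diff_left inner_diff_right nn inner_commute power2_eq_square algebra_simps)
qed

lemma cramer_cross: "(a .* cross3 b c) *R y = (y .* cross3 b c) *R a + (y .* cross3 c a) *R b + (y .* cross3 a b) *R c"
 by (simp add: vec_eq_iff forall_3 cross3_def inner_vec_def sum_3 algebra_simps)

section \<open>Closed cells, Voronoi vertices and dual coordinates of a triangle\<close>

locale vd =
 fixes N :: nat and x :: "nat => real^3"
 assumes vd: "voronoi_delaunay N x"
begin

definition I :: "nat set" where "I = {1..N}"
abbreviation "\<T> == delaunay N x"

lemma finite_I [simp]: "finite I" by (simp add: I_def)

lemmas vd_I = vd[unfolded voronoi_delaunay_def, folded I_def]
lemmas cell_I = voronoi_cell_def[of N x, folded I_def]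
lemmas neighbors_def_I = neighbors_def[of N x, folded I_def]
lemmas delaunay_def_I = delaunay_def[of N x, folded I_def]

text \<open>arccos is decreasing, so nearness on the sphere means a large scalar product, and the
  closed cells are given by linear inequalities.\<close>

definition W :: "nat => (real^3) set" where
 "W i = {y \<in> S2. \<forall>j\<in>I. x j .* y <= x i .* y}"

lemma nx: assumes "i \<in> I" shows "norm (x i) = 1"
proof -
 have "x i \<in> S2" using vd_I assms by blast
 thus ?thesis by simp
qed

lemma xx: "i \<in> I ==> x i .* x i = 1"
 using nx by (simp add: norm_eq_1)

lemma inj_x: "i \<in> I ==> j \<in> I ==> x i = x j \<longleftrightarrow> i = j"
proof -
 assume "i \<in> I" "j \<in> I"
 moreover have "inj_on x I" using vd_I by blast
 ultimately show "x i = x j \<longleftrightarrow> i = j" by (intro inj_on_eq_iff)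
qed

lemma dot_less_1: "i \<in> I ==> j \<in> I ==> i ~= j ==> x i .* x j < 1"
 using unit_dot_less_1 nx inj_x by blast

lemma tiles: "(\<Union>t\<in>\<T>. geodesic_triangle x t) = S2"
 using vd_I unfolding tiles_sphere_def by blast

lemma cell_eq:
 assumes "i \<in> I"
 shows "voronoi_cell N x i = {y\<in>S2. \<forall>j\<in>I - {i}. x j .* y < x i .* y}"
proof -
 have "geodist y (x i) < geodist y (x j) \<longleftrightarrow> x j .* y < x i .* y" if "y \<in> S2" "j \<in> I" for y j
 proof -
  have "|y .* x i| <= 1" "|y .* x j| <= 1"
   using Cauchy_Schwarz_ineq2[of y "x i"] Cauchy_Schwarz_ineq2[of y "x j"] nx assms that by auto
  thus ?thesis unfolding geodist_def by (simp add: arccos_less_mono inner_commute)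
 qed
 hence "y \<in> voronoi_cell N x i \<longleftrightarrow> y \<in> {y\<in>S2. \<forall>j\<in>I - {i}. x j .* y < x i .* y}" for y
  unfolding cell_I mem_Collect_eq by blast
 thus ?thesis by blast
qed

lemma closed_W: "closed (W i)"
proof -
 have "W i = S2 Int (\<Inter>j\<in>I. {y. x j .* y <= x i .* y})" by (auto simp: W_def)
 moreover have "closed {y. x j .* y <= x i .* y}" for j by (intro closed_Collect_le continuous_intros)
 ultimately show ?thesis by (auto intro!: closed_Int closed_INT)
qed

text \<open>Moving a point towards the generator makes all the weak inequalities strict.\<close>

lemma closure_cell:
 assumes i: "i \<in> I" shows "closure (voronoi_cell N x i) = W i"
proof
 have "voronoi_cell N x i <= W i" unfolding cell_eq[OF i] W_def by (auto intro: less_imp_le)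
 thus "closure (voronoi_cell N x i) <= W i" using closed_W by (rule closure_minimal)
 show "W i <= closure (voronoi_cell N x i)"
 proof
  fix y assume y: "y \<in> W i"
  hence ny: "norm y = 1" by (simp add: W_def)
  \<comment> \<open>The weight is at most 1/2, so \<open>v n\<close> cannot vanish, not even if y is
    opposite to the generator.\<close>
  define v where "v n = y + (1 / real (Suc (Suc n))) *R x i" for n
  have v0: "v n ~= 0" for n
  proof
   assume "v n = 0"
   hence "y = - ((1 / real (Suc (Suc n))) *R x i)" by (simp add: v_def eq_neg_iff_add_eq_0)
   hence "norm y = 1 / real (Suc (Suc n))" using nx[OF i] by simp
   thus False using ny by simp
  qed
  have "sgn (v n) \<in> voronoi_cell N x i" for n
   unfolding cell_eq[OF i] mem_Collect_eq
  proof (intro conjI ballI)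
   show "sgn (v n) \<in> S2" using v0 by (simp add: norm_sgn)
   fix j assume "j \<in> I - {i}"
   hence j: "j \<in> I" "j ~= i" by auto
   have "x j .* v n < x i .* v n"
   proof -
    have "x j .* y <= x i .* y" using y j by (simp add: W_def)
    moreover have "(1 / real (Suc (Suc n))) * (x j .* x i) < (1 / real (Suc (Suc n))) * (x i .* x i)"
     using dot_less_1[OF j(1) i j(2)] xx[OF i] by (intro mult_strict_left_mono) auto
    ultimately show ?thesis by (simp add: v_def inner_add_right)
   qed
   thus "x j .* sgn (v n) < x i .* sgn (v n)"
    using v0[of n] by (simp add: sgn_div_norm mult_strict_left_mono)
  qed
  moreover have "(%n. sgn (v n)) \<longlonglongrightarrow> y"
  proof -
   have "(%n. 1 / real (Suc (Suc n))) \<longlonglongrightarrow> 0"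
    using LIMSEQ_Suc[OF LIMSEQ_inverse_real_of_nat] by (simp add: inverse_eq_divide)
   hence "v \<longlonglongrightarrow> y + 0 *R x i" unfolding v_def by (intro tendsto_intros)
   hence "(%n. sgn (v n)) \<longlonglongrightarrow> sgn y" using ny by (intro tendsto_sgn) auto
   thus ?thesis using ny by (simp add: sgn_div_norm)
  qed
  ultimately show "y \<in> closure (voronoi_cell N x i)"
   unfolding closure_sequential by (intro exI[of _ "%n. sgn (v n)"]) auto
 qed
qed

lemma edge_eq: "i \<in> I ==> j \<in> I ==> voronoi_edge N x i j = W i Int W j"
 by (simp add: voronoi_edge_def closure_cell)

lemma neighbors_sym: "j \<in> neighbors N x i ==> i \<in> I ==> i \<in> neighbors N x j"
 by (auto simp: neighbors_def_I voronoi_edge_def Int_commute)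

lemma neighbors_I: "j \<in> neighbors N x i ==> j \<in> I & j ~= i" by (auto simp: neighbors_def_I)

lemma finite_T: "finite \<T>"
 by (rule finite_subset[of _ "Pow I"]) (auto simp: delaunay_def_I)

lemma T_sub: "t \<in> \<T> ==> i \<in> t ==> i \<in> I" by (auto simp: delaunay_def_I)
lemma T_finite: "t \<in> \<T> ==> finite t" using finite_subset[of t I] by (auto simp: delaunay_def_I)
lemma T_card: "t \<in> \<T> ==> card t = 3" by (auto simp: delaunay_def_I)
lemma T_nbr: "t \<in> \<T> ==> i \<in> t ==> j \<in> t ==> i ~= j ==> j \<in> neighbors N x i" by (auto simp: delaunay_def_I)

lemma T_nonempty: "t \<in> \<T> ==> t ~= {}" using T_card by fastforce

lemma T_triple:
 assumes "t \<in> \<T>" "k \<in> t"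
 obtains i j where "t = {i, j, k}" "i ~= j" "i ~= k" "j ~= k"
proof -
 obtain a b c where abc: "t = {a, b, c}" "a ~= b" "b ~= c" "a ~= c"
  using T_card[OF assms(1)] unfolding card_3_iff by auto
 consider "k = a" | "k = b" | "k = c" using assms(2) abc(1) by auto
 thus thesis
 proof cases
  case 1 thus thesis using that[of b c] abc by auto
 next
  case 2 thus thesis using that[of a c] abc by auto
 next
  case 3 thus thesis using that[of a b] abc by auto
 qed
qed

lemma hull_rep:
 assumes "finite t" "t <= I" "z \<in> convex hull (x ` t)"
 obtains u where "!!i. i \<in> t ==> 0 <= u i" "(SUM i:t. u i) = 1" "z = (SUM i:t. u i *R x i)"
proof -
 have inj: "inj_on x t" using assms(2) inj_x by (auto simp: inj_on_def subset_iff)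
 obtain u where u: "\<forall>y\<in>x ` t. 0 <= u y" "sum u (x ` t) = 1" "(SUM y:x ` t. u y *R y) = z"
  using assms(1,3) unfolding convex_hull_finite[OF finite_imageI[OF assms(1)]] by auto
 show thesis
 proof (rule that[of "%i. u (x i)"])
  show "(SUM i:t. u (x i)) = 1" using u(2) inj by (simp add: sum.reindex)
  show "z = (SUM i:t. u (x i) *R x i)" using u(3) inj by (simp add: sum.reindex)
 qed (use u(1) in auto)
qed

lemma cover:
 assumes "y \<in> S2"
 obtains t z where "t \<in> \<T>" "z \<in> convex hull (x ` t)" "y = sgn z" "z ~= 0" "z = norm z *R y"
proof -
 obtain t where t: "t \<in> \<T>" "y \<in> geodesic_triangle x t" using assms tiles by blast
 then obtain z where z: "z \<in> convex hull (x ` t)" "y = sgn z"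
  by (auto simp: geodesic_triangle_def planar_triangle_def)
 have "z ~= 0" using assms z(2) by auto
 thus thesis using that[OF t(1) z] by (simp add: z(2) sgn_div_norm)
qed

text \<open>Otherwise every convex combination of generators would have a nonpositive product with
  y, and no triangle could cover y.\<close>

lemma max_pos: assumes "y \<in> S2" shows "\<exists>i\<in>I. x i .* y > 0"
proof (rule ccontr)
 assume "~ ?thesis"
 hence neg: "!!i. i \<in> I ==> x i .* y <= 0" by (auto simp: not_less)
 obtain t z where t: "t \<in> \<T>" "z \<in> convex hull (x ` t)" "y = sgn z" "z ~= 0" "z = norm z *R y" by (rule cover[OF assms])
 have ts: "t <= I" using T_sub[OF t(1)] by auto
 obtain u where u: "!!i. i \<in> t ==> 0 <= u i" "(SUM i:t. u i) = 1" "z = (SUM i:t. u i *R x i)"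
  using hull_rep[OF T_finite[OF t(1)] ts t(2)] by blast
 have "z .* y = (SUM i:t. u i * (x i .* y))" unfolding u(3) by (simp add: inner_sum_left)
 also have "... <= 0" using u(1) neg T_sub[OF t(1)] by (intro sum_nonpos) (simp add: mult_nonneg_nonpos)
 finally have "z .* y <= 0" .
 moreover have "z .* y = norm z" using assms by (subst t(5)) (simp add: norm_eq_1)
 ultimately show False using t(4) by simp
qed

lemma W_pos: assumes "y \<in> W i" shows "x i .* y > 0"
proof -
 have "y \<in> S2" using assms by (simp add: W_def)
 then obtain j where j: "j \<in> I" "x j .* y > 0" using max_pos by blast
 hence "x j .* y <= x i .* y" using assms unfolding W_def by blast
 thus ?thesis using j by linarith
qed

text \<open>A common point of the three closed cells, that is, the Voronoi vertex of the triangle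
  and the unit normal of its plane; \<open>tc\<close> is then the distance of this plane from the
  origin.\<close>

definition tn :: "nat set => real^3" where
 "tn t = (SOME n. \<forall>i\<in>t. n \<in> W i)"

definition tc :: "nat set => real" where
 "tc t = x (SOME i. i \<in> t) .* tn t"

lemma tn_W: assumes "t \<in> \<T>" "i \<in> t" shows "tn t \<in> W i"
proof -
 have "(\<Inter>i\<in>t. closure (voronoi_cell N x i)) ~= {}" using assms by (auto simp: delaunay_def_I)
 then obtain n where "\<forall>i\<in>t. n \<in> W i" using closure_cell T_sub[OF assms(1)] by auto
 hence "\<forall>i\<in>t. tn t \<in> W i" unfolding tn_def by (rule someI)
 thus ?thesis using assms(2) by blast
qed

lemma norm_tn: "t \<in> \<T> ==> norm (tn t) = 1"
 using tn_W T_nonempty by (fastforce simp: W_def)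

lemma tn_dot: assumes "t \<in> \<T>" "i \<in> t" shows "x i .* tn t = tc t"
proof -
 have s: "(SOME i. i \<in> t) \<in> t" using assms(2) by (rule someI)
 show ?thesis unfolding tc_def
  using tn_W[OF assms] tn_W[OF assms(1) s] T_sub[OF assms] T_sub[OF assms(1) s]
  by (intro antisym) (auto simp: W_def)
qed

lemma tn_dot_le: assumes "t \<in> \<T>" "l \<in> I" shows "x l .* tn t <= tc t"
proof -
 obtain i where "i \<in> t" using T_nonempty[OF assms(1)] by blast
 thus ?thesis using tn_W[OF assms(1), of i] tn_dot[OF assms(1), of i] assms(2) by (auto simp: W_def)
qed

lemma tc_pos: assumes "t \<in> \<T>" shows "tc t > 0"
proof -
 obtain i where "i \<in> t" using T_nonempty[OF assms(1)] by blast
 thus ?thesis using W_pos[OF tn_W[OF assms]] tn_dot[OF assms] by simp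
qed

text \<open>The dual basis by Cramer's rule. Its determinant is the product of M . n, nonzero since
  the triangle is not degenerate, and \<open>tc t\<close>, which is positive.\<close>

lemma alpha_ex:
 assumes t: "t \<in> \<T>"
 shows "\<exists>\<alpha>. (\<forall>i\<in>t. \<forall>j\<in>t. \<alpha> i .* x j = (if i = j then 1 else 0)) & (\<forall>y. y = (SUM i:t. (\<alpha> i .* y) *R x i))"
proof -
 obtain c where c: "c \<in> t" using T_nonempty[OF t] by blast
 obtain a b where abc: "t = {a, b, c}" "a ~= b" "a ~= c" "b ~= c" by (rule T_triple[OF t c])
 have m: "a \<in> t" "b \<in> t" using abc by auto
 have mI: "a \<in> I" "b \<in> I" "c \<in> I" using T_sub[OF t] m c by auto
 let ?D = "x a .* cross3 (x b) (x c)"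
 let ?M = "crossN (x a) (x b) (x c)"
 have h: "tn t .* x a = tc t" "tn t .* x b = tc t" "tn t .* x c = tc t"
  using tn_dot[OF t] m c by (auto simp: inner_commute)
 have ne: "x a ~= x b" "x b ~= x c" "x a ~= x c" using inj_x mI abc by auto
 note F = crossN_facts[OF nx[OF mI(1)] nx[OF mI(2)] nx[OF mI(3)] norm_tn[OF t] ne h]
 have "?M .* tn t ~= 0" using F(3,4) by auto
 hence D: "?D ~= 0" using F(2) tc_pos[OF t] by simp
 define \<alpha> where "\<alpha> i = (1 / ?D) *R (if i = a then cross3 (x b) (x c) else if i = b then cross3 (x c) (x a) else cross3 (x a) (x b))" for i
 have y: "y = (SUM i:t. (\<alpha> i .* y) *R x i)" for y
 proof -
  have "(SUM i:t. (\<alpha> i .* y) *R x i) = (\<alpha> a .* y) *R x a + (\<alpha> b .* y) *R x b + (\<alpha> c .* y) *R x c"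
   unfolding abc(1) using abc by (simp add: add.assoc)
  also have "... = (1 / ?D) *R ((y .* cross3 (x b) (x c)) *R x a + (y .* cross3 (x c) (x a)) *R x b + (y .* cross3 (x a) (x b)) *R x c)"
   using abc by (simp add: \<alpha>_def inner_commute scaleR_add_right)
  also have "... = y" unfolding cramer_cross[symmetric] using D by simp
  finally show ?thesis by simp
 qed
 have tr: "u .* cross3 v w = v .* cross3 w u" "u .* cross3 v w = w .* cross3 u v" for u v w :: "real^3"
  by (simp_all add: cross3_def inner_vec_def sum_3 algebra_simps)
 have d0: "x a .* cross3 (x b) (x a) = 0" "x a .* cross3 (x a) (x b) = 0" "x b .* cross3 (x b) (x c) = 0" "x c .* cross3 (x b) (x c) = 0"
  "x a .* cross3 (x c) (x a) = 0" "x c .* cross3 (x c) (x a) = 0" "x b .* cross3 (x a) (x b) = 0"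
  by (simp_all add: dot_cross_self)
 have "\<alpha> i .* x j = (if i = j then 1 else 0)" if "i \<in> t" "j \<in> t" for i j
  using that abc D tr(1)[of "x a" "x b" "x c"] tr(2)[of "x a" "x b" "x c"] d0
  unfolding abc(1) \<alpha>_def by (auto simp: inner_commute[of "cross3 _ _"])
 thus ?thesis using y by blast
qed

definition alpha :: "nat set => nat => real^3" where
 "alpha t = (SOME \<alpha>. (\<forall>i\<in>t. \<forall>j\<in>t. \<alpha> i .* x j = (if i = j then 1 else 0)) & (\<forall>y. y = (SUM i:t. (\<alpha> i .* y) *R x i)))"

lemma alpha_dual: "t \<in> \<T> ==> i \<in> t ==> j \<in> t ==> alpha t i .* x j = (if i = j then 1 else 0)"
 using someI_ex[OF alpha_ex] unfolding alpha_def by blast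

lemma alpha_rep: assumes "t \<in> \<T>" shows "(SUM i:t. (alpha t i .* y) *R x i) = y"
proof -
 have "\<forall>y. y = (SUM i:t. (alpha t i .* y) *R x i)"
  using someI_ex[OF alpha_ex[OF assms]] unfolding alpha_def by blast
 thus ?thesis by metis
qed

lemma alpha_unique: assumes t: "t \<in> \<T>" and i: "i \<in> t" and y: "y = (SUM j:t. b j *R x j)" shows "alpha t i .* y = b i"
proof -
 have "alpha t i .* y = (SUM j:t. b j * (if i = j then 1 else 0))"
  unfolding y inner_sum_right by (intro sum.cong) (auto simp: alpha_dual[OF t i])
 also have "... = b i" using i T_finite[OF t] by (simp add: if_distrib cong: if_cong)
 finally show ?thesis .
qed

lemma eq_by_dots:
 assumes t: "t \<in> \<T>" and e: "!!i. i \<in> t ==> u .* x i = v .* x i" shows "u = v"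
proof -
 have "u .* y = v .* y" for y
  using e by (subst (1 2) alpha_rep[OF t, of y, symmetric]) (simp add: inner_sum_right)
 thus ?thesis by (metis vector_eq_rdot inner_commute)
qed

text \<open>The linear form with value 1 on the plane of the triangle.\<close>

definition nu :: "nat set => real^3" where "nu t = (1 / tc t) *R tn t"

lemma nu_dot: "t \<in> \<T> ==> i \<in> t ==> nu t .* x i = 1"
 using tn_dot[of t i] tc_pos[of t] by (simp add: nu_def inner_commute)

lemma nu_sum: assumes t: "t \<in> \<T>" shows "nu t = (SUM i:t. alpha t i)"
proof (rule eq_by_dots[OF t])
 fix j assume j: "j \<in> t"
 have "(SUM i:t. alpha t i) .* x j = (SUM i:t. if i = j then 1 else 0)"
  unfolding inner_sum_left by (intro sum.cong) (auto simp: alpha_dual[OF t _ j])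
 thus "nu t .* x j = (SUM i:t. alpha t i) .* x j" using j T_finite[OF t] nu_dot[OF t j] by simp
qed

lemma nu_dot_sum: "t \<in> \<T> ==> nu t .* y = (SUM i:t. alpha t i .* y)"
 by (simp add: nu_sum inner_sum_left)

lemma tn_unique:
 assumes t: "t \<in> \<T>" and y: "norm y = 1" and q: "!!i. i \<in> t ==> x i .* y = q" "q > 0" shows "y = tn t"
proof -
 have "y = (q / tc t) *R tn t"
  by (rule eq_by_dots[OF t]) (use q tn_dot[OF t] tc_pos[OF t] in "simp add: inner_commute")
 moreover from this have "1 = q / tc t" using y norm_tn[OF t] q tc_pos[OF t] by (metis abs_of_pos divide_pos_pos mult.right_neutral norm_scaleR)
 ultimately show ?thesis by simp
qed

text \<open>The positive length of the three edges excludes a fourth generator on the plane. A point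
  of the edge opposite to k, distinct from the Voronoi vertex, forces the k-th affine coordinate of
  such a generator to be nonnegative; the generator would then be a convex combination of unit
  vectors different from it, against strict convexity of the ball.\<close>

lemma T_plane:
 assumes t: "t \<in> \<T>" and l: "l \<in> I" and e: "x l .* tn t = tc t" shows "l \<in> t"
proof (rule ccontr)
 assume nl: "l ~: t"
 define b where "b i = alpha t i .* x l" for i
 have xl: "x l = (SUM i:t. b i *R x i)" unfolding b_def using alpha_rep[OF t] by metis
 have "tc t = (SUM i:t. b i * tc t)"
  using e tn_dot[OF t] unfolding xl inner_sum_left by simp
 hence sb: "(SUM i:t. b i) = 1" using tc_pos[OF t] by (simp flip: sum_distrib_right)
 have bn: "b k >= 0" if k: "k \<in> t" for k
 proof -
  obtain i j where ijk: "t = {i, j, k}" "i ~= j" "i ~= k" "j ~= k" by (rule T_triple[OF t k])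
  have m: "i \<in> t" "j \<in> t" "i \<in> I" "j \<in> I" using ijk T_sub[OF t] by auto
  have "curve_length (voronoi_edge N x i j) > 0"
   using T_nbr[OF t m(1,2) ijk(2)] by (simp add: neighbors_def_I)
  then obtain y1 y2 where "y1 \<in> W i Int W j" "y2 \<in> W i Int W j" "y1 ~= y2"
   using curve_length_subsingleton[of "voronoi_edge N x i j"] edge_eq[OF m(3,4)] by force
  then obtain y where y: "y \<in> W i" "y \<in> W j" "y ~= tn t" by (metis IntE)
  define q where "q = x i .* y"
  have q: "x i .* y = q" "x j .* y = q" "q > 0"
   using y m W_pos[OF y(1)] by (auto simp: W_def q_def intro: antisym)
  have kq: "x k .* y < q"
  proof -
   have "x k .* y <= q" using y T_sub[OF t k] by (auto simp: W_def q_def)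
   moreover have "x k .* y ~= q"
   proof
    assume "x k .* y = q"
    hence "y = tn t" using tn_unique[OF t, of y q] q y ijk by (auto simp: W_def)
    thus False using y by simp
   qed
   ultimately show ?thesis by simp
  qed
  have s3: "b i + b j + b k = 1" using sb ijk by (simp add: add.assoc)
  have "x l .* y = b i * q + b j * q + b k * (x k .* y)"
   unfolding xl inner_sum_left using ijk q by (simp add: add.assoc)
  also have "... = (b i + b j + b k) * q - b k * (q - x k .* y)" by (simp add: algebra_simps)
  also have "... = q - b k * (q - x k .* y)" by (simp add: s3)
  finally have "x l .* y = q - b k * (q - x k .* y)" .
  moreover have "x l .* y <= q" using y l by (auto simp: W_def q_def)
  ultimately have "0 <= b k * (q - x k .* y)" by simp
  thus ?thesis using kq by (simp add: zero_le_mult_iff)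
 qed
 have "\<exists>k\<in>t. b k > 0"
 proof (rule ccontr)
  assume "~ (\<exists>k\<in>t. b k > 0)"
  hence "(SUM i:t. b i) <= 0" by (intro sum_nonpos) (auto simp: not_less)
  thus False using sb by simp
 qed
 then obtain k where k: "k \<in> t" "b k > 0" by blast
 have lt: "x i .* x l < 1" if "i \<in> t" for i using dot_less_1[OF T_sub[OF t that] l] that nl by auto
 have "1 = x l .* x l" using xx[OF l] by simp
 also have "... = (SUM i:t. b i *R x i) .* x l" using xl by simp
 also have "... = (SUM i:t. b i * (x i .* x l))" by (simp add: inner_sum_left)
 also have "... < (SUM i:t. b i * 1)"
 proof (rule sum_strict_mono_ex1[OF T_finite[OF t]])
  show "\<forall>i\<in>t. b i * (x i .* x l) <= b i * 1"
   using bn lt by (intro ballI mult_left_mono) (auto intro: less_imp_le)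
  show "\<exists>i\<in>t. b i * (x i .* x l) < b i * 1" using k lt by (intro bexI[of _ k]) auto
 qed
 also have "... = 1" using sb by simp
 finally show False by simp
qed

text \<open>Some triangle of the tiling covers the direction of the centroid of the three
  generators. Comparing the supporting planes with normals y and \<open>tn t\<close> shows that all
  three lie on the plane of that triangle, so \<open>T_plane\<close> makes them its
  vertices.\<close>

lemma triple_point:
 assumes y: "y \<in> W i" "y \<in> W j" "y \<in> W l" and d: "i ~= j" "i ~= l" "j ~= l" and m: "i \<in> I" "j \<in> I" "l \<in> I"
 shows "{i, j, l} \<in> \<T>" "tn {i, j, l} = y"
proof -
 have ny: "norm y = 1" using y by (simp add: W_def)
 define c where "c = x i .* y"
 have c: "x i .* y = c" "x j .* y = c" "x l .* y = c" "c > 0"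
  using y m W_pos[OF y(1)] by (auto simp: W_def c_def intro: antisym)
 define z where "z = (1/3::real) *R (x i + x j + x l)"
 have yz: "z .* y = c" using c by (simp add: z_def inner_add_left)
 have z0: "z ~= 0" using yz c by auto
 have sS: "sgn z \<in> S2" using z0 by (simp add: norm_sgn)
 obtain t z' where t: "t \<in> \<T>" "z' \<in> convex hull (x ` t)" "sgn z = sgn z'" "z' ~= 0" "z' = norm z' *R sgn z" by (rule cover[OF sS])
 have ts: "t <= I" using T_sub[OF t(1)] by auto
 obtain u where u: "!!i. i \<in> t ==> 0 <= u i" "(SUM i:t. u i) = 1" "z' = (SUM i:t. u i *R x i)"
  using hull_rep[OF T_finite[OF t(1)] ts t(2)] by blast
 define \<mu> where "\<mu> = norm z / norm z'"
 have mu: "\<mu> > 0" using z0 t(4) by (simp add: \<mu>_def)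
 have zz: "z = \<mu> *R z'"
  using z0 t(4) by (subst t(5)) (simp add: \<mu>_def sgn_div_norm)
 have "z' .* tn t = (SUM i:t. u i * tc t)" unfolding u(3) by (simp add: inner_sum_left tn_dot[OF t(1)])
 hence z't: "z' .* tn t = tc t" using u(2) by (simp flip: sum_distrib_right)
 have "z' .* y = (SUM i:t. u i * (x i .* y))" unfolding u(3) by (simp add: inner_sum_left)
 also have "... <= (SUM i:t. u i * c)"
  using u(1) y(1) ts by (intro sum_mono mult_left_mono) (auto simp: W_def c_def)
 finally have "z' .* y <= c" using u(2) by (simp flip: sum_distrib_right)
 hence "c <= \<mu> * c" using yz mu unfolding zz by (metis inner_scaleR_left mult_left_mono less_imp_le)
 hence m1: "\<mu> >= 1" using c(4) by simp
 have le3: "x i .* tn t <= tc t" "x j .* tn t <= tc t" "x l .* tn t <= tc t" using tn_dot_le[OF t(1)] m by auto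
 have ez: "3 * (z .* tn t) = x i .* tn t + x j .* tn t + x l .* tn t" by (simp add: z_def inner_add_left)
 have "z .* tn t = \<mu> * tc t" unfolding zz using z't by simp
 moreover have "\<mu> * tc t >= tc t" using m1 tc_pos[OF t(1)] by simp
 ultimately have "x i .* tn t = tc t" "x j .* tn t = tc t" "x l .* tn t = tc t" using le3 ez by linarith+
 hence "{i, j, l} <= t" using T_plane[OF t(1)] m by auto
 hence teq: "{i, j, l} = t" using T_card[OF t(1)] T_finite[OF t(1)] d by (intro card_subset_eq) auto
 thus "{i, j, l} \<in> \<T>" using t(1) by simp
 show "tn {i, j, l} = y" using tn_unique[OF t(1), of y c] c ny teq by auto
qed

section \<open>Cones over the triangles, conformity, and connectivity of the neighbour graph\<close>

definition tcone :: "nat set => (real^3) set" where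
 "tcone t = {y. \<forall>i\<in>t. 0 <= alpha t i .* y}"

lemma nu_pos: assumes t: "t \<in> \<T>" and y: "y \<in> tcone t" "y ~= 0" shows "nu t .* y > 0"
proof -
 have "nu t .* y >= 0" unfolding nu_dot_sum[OF t] using y by (intro sum_nonneg) (auto simp: tcone_def)
 moreover have "nu t .* y ~= 0"
 proof
  assume "nu t .* y = 0"
  hence "\<forall>i\<in>t. alpha t i .* y = 0"
   unfolding nu_dot_sum[OF t] using y T_finite[OF t] by (subst (asm) sum_nonneg_eq_0_iff) (auto simp: tcone_def)
  hence "y = 0" using alpha_rep[OF t, of y] by simp
  thus False using y by simp
 qed
 ultimately show ?thesis by simp
qed

lemma cone_scale: "y \<in> tcone t ==> r >= 0 ==> r *R y \<in> tcone t" by (simp add: tcone_def)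

lemma closed_cone: "closed (tcone t)"
proof -
 have "tcone t = (\<Inter>i\<in>t. {y. 0 <= alpha t i .* y})" by (auto simp: tcone_def)
 moreover have "closed {y. 0 <= alpha t i .* y}" for i by (intro closed_Collect_le continuous_intros)
 ultimately show ?thesis by auto
qed

lemma hull_cone: assumes t: "t \<in> \<T>" shows "planar_triangle x t = {z \<in> tcone t. nu t .* z = 1}"
proof
 have ts: "t <= I" using T_sub[OF t(1)] by auto
 show "planar_triangle x t <= {z \<in> tcone t. nu t .* z = 1}"
 proof
  fix z assume "z \<in> planar_triangle x t"
  then obtain u where u: "!!i. i \<in> t ==> 0 <= u i" "(SUM i:t. u i) = 1" "z = (SUM i:t. u i *R x i)"
   using hull_rep[OF T_finite[OF t(1)] ts] unfolding planar_triangle_def by blast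
  have "alpha t i .* z = u i" if "i \<in> t" for i by (rule alpha_unique[OF t that u(3)])
  thus "z \<in> {z \<in> tcone t. nu t .* z = 1}" using u by (simp add: tcone_def nu_dot_sum[OF t])
 qed
 show "{z \<in> tcone t. nu t .* z = 1} <= planar_triangle x t"
 proof
  fix z assume z: "z \<in> {z \<in> tcone t. nu t .* z = 1}"
  have "(SUM i:t. (alpha t i .* z) *R x i) \<in> convex hull (x ` t)"
   using z by (intro convex_sum T_finite[OF t]) (auto simp: tcone_def nu_dot_sum[OF t] hull_inc)
  thus "z \<in> planar_triangle x t" unfolding planar_triangle_def alpha_rep[OF t] .
 qed
qed

lemma geodesic_cone: assumes t: "t \<in> \<T>" shows "geodesic_triangle x t = tcone t Int S2"
proof
 have n0: "z ~= 0" if "nu t .* z = 1" for z using that by auto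
 show "geodesic_triangle x t <= tcone t Int S2"
  unfolding geodesic_triangle_def hull_cone[OF t] using n0 by (auto simp: norm_sgn sgn_div_norm tcone_def)
 show "tcone t Int S2 <= geodesic_triangle x t"
 proof
  fix y assume y: "y \<in> tcone t Int S2"
  hence "y ~= 0" by auto
  hence p: "nu t .* y > 0" using nu_pos[OF t] y by blast
  let ?z = "(1 / (nu t .* y)) *R y"
  have "?z \<in> planar_triangle x t" unfolding hull_cone[OF t] using y p by (auto intro: cone_scale)
  moreover have "sgn ?z = y" using p y by (simp add: sgn_div_norm)
  ultimately show "y \<in> geodesic_triangle x t" unfolding geodesic_triangle_def by (metis imageI)
 qed
qed

lemma cone_cover: assumes "y ~= 0" obtains t where "t \<in> \<T>" "y \<in> tcone t"
proof -
 have "sgn y \<in> S2" using assms by (simp add: norm_sgn)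
 then obtain t where t: "t \<in> \<T>" "sgn y \<in> tcone t" using tiles geodesic_cone by blast
 have "y = norm y *R sgn y" using assms by (simp add: sgn_div_norm)
 hence "y \<in> tcone t" using cone_scale[OF t(2), of "norm y"] by simp
 thus thesis using that t by blast
qed

text \<open>No generator lies beyond the plane of a triangle, by the empty circumscribed cap. The
  polyhedral surface is therefore convex, and on each cone the form of its own triangle is the
  largest.\<close>

lemma nu_le:
 assumes t: "t \<in> \<T>" "t' \<in> \<T>" and y: "y \<in> tcone t'" shows "nu t .* y <= nu t' .* y"
proof -
 have "nu t .* y = (SUM i:t'. (alpha t' i .* y) * (nu t .* x i))"
  by (subst alpha_rep[OF t(2), of y, symmetric]) (simp add: inner_sum_right)
 also have "... <= (SUM i:t'. (alpha t' i .* y) * 1)"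
 proof (intro sum_mono mult_left_mono)
  fix i assume "i \<in> t'"
  thus "nu t .* x i <= 1" using tn_dot_le[OF t(1) T_sub[OF t(2)]] tc_pos[OF t(1)] by (simp add: nu_def inner_commute)
  show "0 <= alpha t' i .* y" using y `i \<in> t'` by (simp add: tcone_def)
 qed
 finally show ?thesis by (simp add: nu_dot_sum[OF t(2)])
qed

lemma nu_eq:
 assumes "t \<in> \<T>" "t' \<in> \<T>" "y \<in> tcone t" "y \<in> tcone t'" shows "nu t .* y = nu t' .* y"
 using nu_le[of t t' y] nu_le[of t' t y] assms by simp

text \<open>At a common point the two linear forms agree; hence every generator with positive weight
  lies on both planes, and \<open>T_plane\<close> identifies it as a vertex of the other
  triangle.\<close>

lemma support:
 assumes t: "t \<in> \<T>" "t' \<in> \<T>" and y: "y \<in> tcone t" "y \<in> tcone t'" and i: "i \<in> t" "alpha t i .* y > 0"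
 shows "i \<in> t'"
proof (rule T_plane[OF t(2) T_sub[OF t(1) i(1)]])
 have le: "nu t' .* x j <= 1" if "j \<in> t" for j
  using tn_dot_le[OF t(2) T_sub[OF t(1) that]] tc_pos[OF t(2)] by (simp add: nu_def inner_commute)
 have "(SUM j:t. (alpha t j .* y) * (1 - nu t' .* x j)) = nu t .* y - (SUM j:t. (alpha t j .* y) * (nu t' .* x j))"
  by (simp add: nu_dot_sum[OF t(1)] sum_subtractf algebra_simps)
 also have "(SUM j:t. (alpha t j .* y) * (nu t' .* x j)) = nu t' .* y"
  by (subst (2) alpha_rep[OF t(1), of y, symmetric]) (simp add: inner_sum_right)
 finally have "(SUM j:t. (alpha t j .* y) * (1 - nu t' .* x j)) = 0" using nu_eq[OF t y] by simp
 hence "(alpha t i .* y) * (1 - nu t' .* x i) = 0"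
  using le y(1) i(1) T_finite[OF t(1)] by (subst (asm) sum_nonneg_eq_0_iff) (auto simp: tcone_def)
 hence "nu t' .* x i = 1" using i(2) by simp
 thus "x i .* tn t' = tc t'" using tc_pos[OF t(2)] by (simp add: nu_def inner_commute)
qed

text \<open>Vertices that are not shared have weight 0 at a common point, so the two expansions
  coincide. This conformity makes piecewise linear functions well defined.\<close>

lemma coords_eq:
 assumes t: "t \<in> \<T>" "t' \<in> \<T>" and y: "y \<in> tcone t" "y \<in> tcone t'" and i: "i \<in> t'"
 shows "alpha t' i .* y = (if i \<in> t then alpha t i .* y else 0)"
proof (rule alpha_unique[OF t(2) i])
 have z: "alpha t j .* y = 0" if "j \<in> t - t'" for j
  using support[OF t y, of j] y(1) that by (force simp: tcone_def)
 have "y = (SUM j:t. (alpha t j .* y) *R x j)" by (simp add: alpha_rep[OF t(1)])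
 also have "... = (SUM j:t Int t'. (alpha t j .* y) *R x j)"
  using z by (intro sum.mono_neutral_right T_finite[OF t(1)]) auto
 also have "... = (SUM j:t'. (if j \<in> t then alpha t j .* y else 0) *R x j)"
  by (intro sum.mono_neutral_cong_left T_finite[OF t(2)]) auto
 finally show "y = (SUM j:t'. (if j \<in> t then alpha t j .* y else 0) *R x j)" .
qed

text \<open>The ray of the generator hits a planar triangle, whose points have norm at most 1; hence
  \<open>nu t\<close> is at least 1 at the generator. The empty cap gives the converse, and
  \<open>T_plane\<close> applies.\<close>

lemma vertex_in_T: assumes i: "i \<in> I" obtains t where "t \<in> \<T>" "i \<in> t"
proof -
 have x0: "x i ~= 0" using nx[OF i] by auto
 obtain t where t: "t \<in> \<T>" "x i \<in> tcone t" by (rule cone_cover[OF x0])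
 have le1: "nu t .* x i <= 1"
  using tn_dot_le[OF t(1) i] tc_pos[OF t(1)] by (simp add: nu_def inner_commute)
 define z where "z = (1 / (nu t .* x i)) *R x i"
 have p: "nu t .* x i > 0" by (rule nu_pos[OF t x0])
 have "z \<in> planar_triangle x t" unfolding hull_cone[OF t(1)] z_def using t p by (auto intro: cone_scale)
 hence "z \<in> convex hull (cball 0 1)"
  unfolding planar_triangle_def using nx T_sub[OF t(1)] by (elim rev_subsetD) (intro hull_mono, auto)
 hence "norm z <= 1" by (simp add: convex_hull_eq[THEN iffD2])
 hence "nu t .* x i >= 1" using p nx[OF i] by (simp add: z_def)
 hence "x i .* tn t = tc t" using le1 tc_pos[OF t(1)] by (simp add: nu_def inner_commute)
 thus thesis using that[OF t(1)] T_plane[OF t(1) i] by blast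
qed

text \<open>If no neighbours joined A to its complement, each triangle would have all vertices on
  one side, and the sphere would be the union of two closed sets. They meet by connectedness, and a
  meeting point gives positive weight to a vertex of both sides.\<close>

lemma neighbor_graph_connected:
 assumes A: "A <= I" "A ~= {}" "A ~= I"
 shows "\<exists>i\<in>A. \<exists>j\<in>I - A. j \<in> neighbors N x i"
proof (rule ccontr)
 assume no: "~ ?thesis"
 have split: "t <= A \<or> t Int A = {}" if t: "t \<in> \<T>" for t
 proof (rule ccontr)
  assume "~ ?thesis"
  then obtain i j where "i \<in> t" "i \<in> A" "j \<in> t" "j ~: A" by blast
  thus False using no T_nbr[OF t, of i j] T_sub[OF t] by blast
 qed
 define U1 where "U1 = (\<Union>t\<in>{t\<in>\<T>. t <= A}. tcone t Int S2)"
 define U2 where "U2 = (\<Union>t\<in>{t\<in>\<T>. t Int A = {}}. tcone t Int S2)"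
 have cl: "closed U1" "closed U2"
  unfolding U1_def U2_def using finite_T by (auto intro!: closed_UN closed_Int closed_cone)
 have un: "U1 \<union> U2 = S2"
 proof
  show "S2 <= U1 \<union> U2"
  proof
   fix y assume y: "y \<in> S2"
   hence "y ~= 0" by auto
   then obtain t where "t \<in> \<T>" "y \<in> tcone t" by (rule cone_cover)
   thus "y \<in> U1 \<union> U2" using split[of t] y unfolding U1_def U2_def by blast
  qed
 qed (auto simp: U1_def U2_def)
 have vc: "x i \<in> tcone t Int S2" if "t \<in> \<T>" "i \<in> t" for t i
  using that nx T_sub alpha_dual by (auto simp: tcone_def)
 obtain i where i: "i \<in> A" using A by blast
 then obtain t where t: "t \<in> \<T>" "i \<in> t" using vertex_in_T A by blast
 hence "x i \<in> U1" using vc split[OF t(1)] i unfolding U1_def by blast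
 hence ne1: "U1 ~= {}" by blast
 obtain j where j: "j \<in> I" "j ~: A" using A by blast
 then obtain t' where t': "t' \<in> \<T>" "j \<in> t'" using vertex_in_T by blast
 hence "x j \<in> U2" using vc split[OF t'(1)] j unfolding U2_def by blast
 hence ne2: "U2 ~= {}" by blast
 have "connected S2" by (rule connected_sphere) simp
 hence "U1 Int U2 ~= {}"
  using connected_closedD[of S2 U1 U2] cl un ne1 ne2 by blast
 then obtain y s s' where s: "s \<in> \<T>" "s <= A" "y \<in> tcone s" and s': "s' \<in> \<T>" "s' Int A = {}" "y \<in> tcone s'" and y: "y \<in> S2"
  unfolding U1_def U2_def by blast
 have "y ~= 0" using y by auto
 hence "nu s .* y > 0" by (rule nu_pos[OF s(1,3)])
 hence "\<exists>k\<in>s. alpha s k .* y > 0"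
  unfolding nu_dot_sum[OF s(1)] by (metis not_less sum_nonpos)
 then obtain k where "k \<in> s" "alpha s k .* y > 0" by blast
 hence "k \<in> s'" using support[OF s(1) s'(1) s(3) s'(3)] by blast
 thus False using `k \<in> s` s(2) s'(2) by blast
qed

end

section \<open>Voronoi edges\<close>

lemma orthonormal_expand:
 fixes m w t :: "real^3"
 assumes m: "norm m = 1" "norm w = 1" "m .* w = 0" and t: "t = cross3 m w"
 shows "norm t = 1" "m .* t = 0" "w .* t = 0" "y = (y .* m) *R m + (y .* w) *R w + (y .* t) *R t"
proof -
 have n: "m .* m = 1" "w .* w = 1" "w .* m = 0" using m by (simp_all add: norm_eq_1 inner_commute)
 have "(norm t)^2 = 1" unfolding t using norm_cross[of m w] m by simp
 thus "norm t = 1" using norm_ge_zero[of t] by (auto simp: power2_eq_1_iff)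
 show "m .* t = 0" "w .* t = 0" unfolding t by (simp_all add: dot_cross_self)
 have c1: "cross3 w t = m" unfolding t Lagrange using n by simp
 have "cross3 m t = (m .* w) *R m - (m .* m) *R w" unfolding t by (rule Lagrange)
 hence "cross3 m t = - w" using n m by simp
 hence c2: "cross3 t m = w" by (metis cross_skew minus_minus)
 have "(m .* cross3 w t) *R y = (y .* cross3 w t) *R m + (y .* cross3 t m) *R w + (y .* cross3 m w) *R t"
  by (rule cramer_cross)
 thus "y = (y .* m) *R m + (y .* w) *R w + (y .* t) *R t"
  unfolding c1 c2 t[symmetric] n by simp
qed

text \<open>Half the cotangent of the angle at c.\<close>

definition om :: "real^3 => real^3 => real^3 => real" where
 "om a b c = ((a - c) .* (b - c)) / (2 * norm (crossN a b c))"

lemma om_sym: "om a b c = om b a c"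
proof -
 have "crossN a b c = - crossN b a c" unfolding crossN_def by (rule cross_skew)
 thus ?thesis by (simp add: om_def inner_commute)
qed

text \<open>A linear program in one variable: the end of the feasible half line is attained at an
  active constraint of positive slope.\<close>

lemma halfline_end:
 fixes \<alpha> \<beta> :: "'i => real"
 assumes I: "finite I" and \<sigma>: "\<forall>l\<in>I. \<alpha> l + \<sigma> * \<beta> l <= ka" and l0: "l0 \<in> I" "\<beta> l0 > 0"
 obtains tu l where "\<forall>l\<in>I. \<alpha> l + tu * \<beta> l <= ka" "l \<in> I" "\<beta> l > 0" "\<alpha> l + tu * \<beta> l = ka"
proof -
 let ?S = "{l\<in>I. \<beta> l > 0}" and ?r = "%l. (ka - \<alpha> l) / \<beta> l"
 have S: "finite ?S" "?S ~= {}" using I l0 by auto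
 obtain l where l: "l \<in> ?S" "!!k. k \<in> ?S ==> ?r l <= ?r k"
  using arg_min_if_finite(1)[OF S, of ?r] arg_min_least[OF S, of _ ?r] by blast
 have sl: "\<sigma> <= ?r l" using \<sigma> l(1) by (simp add: pos_le_divide_eq algebra_simps)
 have "\<alpha> k + ?r l * \<beta> k <= ka" if k: "k \<in> I" for k
 proof (cases "\<beta> k > 0")
  case True
  thus ?thesis using l(2)[of k] k mult_right_mono[of "?r l" "?r k" "\<beta> k"] by simp
 next
  case False
  hence "?r l * \<beta> k <= \<sigma> * \<beta> k" using sl by (intro mult_right_mono_neg) auto
  thus ?thesis using \<sigma> k by fastforce
 qed
 thus thesis using l(1) by (intro that[of "?r l" l]) auto
qed

context vd begin

lemma tn_inj: assumes t: "t \<in> \<T>" "t' \<in> \<T>" "tn t = tn t'" shows "t = t'"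
proof -
 have c: "tc s <= tc s'" if s: "s \<in> \<T>" "s' \<in> \<T>" "tn s = tn s'" for s s'
 proof -
  obtain k where k: "k \<in> s" using T_nonempty[OF s(1)] by blast
  show ?thesis using tn_dot_le[OF s(2) T_sub[OF s(1) k]] tn_dot[OF s(1) k] s(3) by simp
 qed
 have "s <= s'" if s: "s \<in> \<T>" "s' \<in> \<T>" "tn s = tn s'" for s s'
  using T_plane[OF s(2) T_sub[OF s(1)]] tn_dot[OF s(1)] c[OF s] c[OF s(2,1) s(3)[symmetric]] s(3) by fastforce
 thus ?thesis using t by (metis subset_antisym)
qed

definition third :: "nat set => nat => nat => nat" where
 "third t i j = (SOME k. k \<in> t & k ~= i & k ~= j)"

lemma third_eq: assumes "i ~= k" "j ~= k" shows "third {i, j, k} i j = k"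
 unfolding third_def by (rule some_equality) (use assms in auto)

definition omega :: "nat set => nat => nat => real" where
 "omega t i j = om (x i) (x j) (x (third t i j))"

definition dd :: "nat => nat => real" where "dd i j = norm (x j - x i)"

text \<open>The signed angle from the midpoint direction of the two generators to the Voronoi vertex
  of t, negative if the angle of t at the third vertex is obtuse.\<close>

definition sarc :: "nat set => nat => nat => real" where
 "sarc t i j = arctan (dd i j * omega t i j / tc t)"

lemma dd_sym: "dd i j = dd j i" by (simp add: dd_def norm_minus_commute)

lemma third_sym: "third t i j = third t j i"
 unfolding third_def by (rule arg_cong[where f=Eps]) auto

lemma omega_sym: "omega t i j = omega t j i"
 unfolding omega_def third_sym[of t i j] by (rule om_sym)

lemma dd_pos: "i \<in> I ==> j \<in> I ==> i ~= j ==> dd i j > 0"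
 using inj_x by (simp add: dd_def)

text \<open>The edge lies on the half circle of points equidistant from both generators, with the
  gnomonic coordinate tu. The other generators cut this to an interval [tm, tp]. At each end a third
  generator becomes active, so the ends are the Voronoi vertices of the two triangles at the edge,
  and the signed arcs from the midpoint add up to the edge.\<close>

lemma edge_length:
 assumes i: "i \<in> I" and j: "j \<in> neighbors N x i"
 shows "curve_length (voronoi_edge N x i j) = (\<Sum>T\<in>{T\<in>\<T>. i \<in> T & j \<in> T}. sarc T i j)"
proof -
 have jI: "j \<in> I" "j ~= i" and cl: "curve_length (voronoi_edge N x i j) > 0"
  using j by (auto simp: neighbors_def_I)
 let ?a = "x i" and ?b = "x j"
 have aa: "?a .* ?a = 1" "?b .* ?b = 1" using xx i jI by auto
 obtain y0 where y0: "y0 \<in> W i Int W j"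
 proof -
  have "W i Int W j ~= {}"
  proof
   assume "W i Int W j = {}"
   hence "curve_length (voronoi_edge N x i j) = 0"
    using curve_length_subsingleton[of "voronoi_edge N x i j"] edge_eq[OF i jI(1)] by auto
   thus False using cl by simp
  qed
  thus thesis using that by blast
 qed
 have y0d: "?a .* y0 = ?b .* y0" "?a .* y0 > 0"
  using y0 i jI W_pos[of y0 i] by (auto simp: W_def intro: antisym)
 define q where "q = norm (?a + ?b)"
 have ab0: "?a + ?b ~= 0"
 proof
  assume "?a + ?b = 0"
  hence "?a .* y0 + ?b .* y0 = 0" by (metis inner_add_left inner_zero_left)
  thus False using y0d by simp
 qed
 hence q: "q > 0" by (simp add: q_def)
 define d where "d = norm (?b - ?a)"
 have d: "d > 0" using inj_x[OF i jI(1)] jI(2) by (auto simp: d_def)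
 define m where "m = (1/q) *R (?a + ?b)"
 define w where "w = (1/d) *R (?b - ?a)"
 define t where "t = cross3 m w"
 have nm: "norm m = 1" using q by (simp add: m_def q_def)
 have nw: "norm w = 1" using d by (simp add: w_def d_def)
 have mw: "m .* w = 0"
 proof -
  have "(?a + ?b) .* (?b - ?a) = 0"
   by (simp add: inner_add_left inner_diff_right aa inner_commute[of "x j" "x i"])
  thus ?thesis unfolding m_def w_def by simp
 qed
 note on = orthonormal_expand[OF nm nw mw t_def]
 have a_eq: "?a = (q/2) *R m - (d/2) *R w" and b_eq: "?b = (q/2) *R m + (d/2) *R w"
  using q d by (simp_all add: m_def w_def vec_eq_iff field_simps)
 have mm: "m .* m = 1" "w .* w = 1" "t .* t = 1" "t .* m = 0" "w .* m = 0" "t .* w = 0"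
  using nm nw on mw by (simp_all add: norm_eq_1 inner_commute)
 have ta: "t .* ?a = 0" "t .* ?b = 0"
  by (simp_all add: a_eq b_eq inner_diff_right inner_add_right mm)
 define ka where "ka = q / 2"
 have k0: "ka > 0" using q by (simp add: ka_def)
 have ma: "m .* ?a = ka" "m .* ?b = ka"
  by (simp_all add: a_eq b_eq inner_diff_right inner_add_right mm mw ka_def)
 have cab: "cross3 ?a ?b = (ka * d) *R t"
 proof -
  have wm: "cross3 w m = - t" unfolding t_def by (rule cross_skew)
  have "cross3 ?a ?b = (q/2 * (d/2)) *R cross3 m w - (q/2 * (d/2)) *R cross3 w m"
   unfolding a_eq b_eq
   by (simp add: cross_add_right Cross3.left_diff_distrib cross_mult_left cross_mult_right algebra_simps)
  also have "... = (q/2 * (d/2) + q/2 * (d/2)) *R t"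
   unfolding wm t_def[symmetric] scaleR_left.add by simp
  also have "q/2 * (d/2) + q/2 * (d/2) = ka * d" by (simp add: ka_def field_simps)
  finally show ?thesis .
 qed
 define P where "P tu = m + tu *R t" for tu
 have Pa: "?a .* P tu = ka" "?b .* P tu = ka" for tu
  using ta ma by (simp_all add: P_def inner_add_right inner_commute)
 have P0: "P tu ~= 0" for tu using Pa(1)[of tu] k0 by auto
 have nP: "norm (P tu) = sqrt (1 + tu^2)" for tu
  by (simp add: P_def norm_eq_sqrt_inner inner_add_left inner_add_right mm on(2) power2_eq_square)
 have sP: "sgn (P tu) = circ m t (arctan tu)" for tu
 proof -
  have "sgn (P tu) = (1 / sqrt (1 + tu^2)) *R P tu" by (simp add: sgn_div_norm nP inverse_eq_divide)
  thus ?thesis by (simp add: circ_def cos_arctan sin_arctan P_def scaleR_add_right)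
 qed
 define J where "J = {tu. \<forall>l\<in>I. x l .* m + tu * (x l .* t) <= ka}"
 have Px: "x l .* P tu = x l .* m + tu * (x l .* t)" for l tu by (simp add: P_def inner_add_right)
 have JW: "sgn (P tu) \<in> W i Int W j" if "tu \<in> J" for tu
 proof -
  have r: "1 / norm (P tu) > 0" using P0 by simp
  have "x l .* sgn (P tu) <= ka * (1 / norm (P tu))" if "l \<in> I" for l
   using `tu \<in> J` that mult_right_mono[of "x l .* P tu" ka "1 / norm (P tu)"] r unfolding J_def Px[symmetric]
   by (simp add: sgn_div_norm divide_inverse mult.commute)
  moreover have "?a .* sgn (P tu) = ka * (1 / norm (P tu))" "?b .* sgn (P tu) = ka * (1 / norm (P tu))"
   using Pa by (simp_all add: sgn_div_norm divide_inverse mult.commute)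
  ultimately show ?thesis using P0 unfolding W_def by (auto simp: norm_sgn)
 qed
 have WJ: "\<exists>tu\<in>J. y = sgn (P tu) & (\<forall>l\<in>I. x l .* y = ?a .* y --> x l .* P tu = ka)" if y: "y \<in> W i Int W j" for y
 proof -
  have yd: "?a .* y = ?b .* y" "?a .* y > 0"
   using y i jI W_pos[of y i] by (auto simp: W_def intro: antisym)
  have ny: "norm y = 1" using y by (simp add: W_def)
  have "y .* w = 0" using yd by (simp add: w_def inner_diff_right inner_commute)
  hence ye: "y = (y .* m) *R m + (y .* t) *R t" using on(4)[of y] by simp
  have "?a .* y = (y .* m) * ka" by (subst ye) (use ta ma in "simp add: inner_add_right inner_commute")
  hence ym: "y .* m > 0" using yd k0 by (simp add: zero_less_mult_iff)
  define tu where "tu = (y .* t) / (y .* m)"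
  have yP: "y = (y .* m) *R P tu" by (subst ye) (use ym in "simp add: P_def tu_def scaleR_add_right")
  have sy: "sgn (P tu) = y"
  proof -
   have "sgn y = sgn (P tu)" by (subst yP) (use ym in "simp add: sgn_scaleR")
   thus ?thesis using ny by (simp add: sgn_div_norm)
  qed
  have sc: "x l .* y = (y .* m) * (x l .* P tu)" for l by (subst yP) simp
  have ay: "?a .* y = (y .* m) * ka" using sc[of i] Pa by simp
  have "x l .* P tu <= ka" if "l \<in> I" for l
  proof -
   have "x l .* y <= ?a .* y" using y that by (auto simp: W_def)
   hence "(y .* m) * (x l .* P tu) <= (y .* m) * ka" using sc[of l] ay by simp
   thus ?thesis using ym by simp
  qed
  hence "tu \<in> J" by (simp add: J_def Px)
  moreover have "x l .* P tu = ka" if "x l .* y = ?a .* y" for l using that ym unfolding sc[of l] ay by simp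
  ultimately show ?thesis using sy by blast
 qed
 obtain tu0 where t0: "\<forall>l\<in>I. x l .* m + tu0 * (x l .* t) <= ka" using WJ[OF y0] by (auto simp: J_def)
 \<comment> \<open>There are generators on both sides of the plane spanned by the pair, so the
   interval is bounded at both ends.\<close>
 have tS: "t \<in> S2" "- t \<in> S2" using on(1) by auto
 obtain l1 where l1: "l1 \<in> I" "x l1 .* t > 0" using max_pos[OF tS(1)] by blast
 obtain l2 where l2: "l2 \<in> I" "- (x l2 .* t) > 0" using max_pos[OF tS(2)] by auto
 obtain tp lp where lp: "\<forall>l\<in>I. x l .* m + tp * (x l .* t) <= ka" "lp \<in> I" "x lp .* t > 0" "x lp .* m + tp * (x lp .* t) = ka"
  by (rule halfline_end[OF finite_I t0 l1])
 have t0': "\<forall>l\<in>I. x l .* m + - tu0 * - (x l .* t) <= ka" using t0 by simp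
 obtain tm' lm where lm': "\<forall>l\<in>I. x l .* m + tm' * - (x l .* t) <= ka" "lm \<in> I" "- (x lm .* t) > 0" "x lm .* m + tm' * - (x lm .* t) = ka"
  by (rule halfline_end[OF finite_I t0' l2])
 define tm where "tm = - tm'"
 have lm: "lm \<in> I" "x lm .* t < 0" "x lm .* m + tm * (x lm .* t) = ka" using lm' by (auto simp: tm_def)
 have tpJ: "tp \<in> J" and tmJ: "tm \<in> J" using lp lm' by (auto simp: J_def tm_def)
 have hi: "tu <= tu'" if "tu \<in> J" "l \<in> I" "x l .* t > 0" "x l .* P tu' = ka" for l tu tu'
  using that by (auto simp: J_def Px)
 have lo: "tu' <= tu" if "tu \<in> J" "l \<in> I" "x l .* t < 0" "x l .* P tu' = ka" for l tu tu'
  using that by (fastforce simp: J_def Px)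
 have up: "tu <= tp" "tm <= tu" if "tu \<in> J" for tu
  using hi[OF that lp(2,3)] lo[OF that lm(1,2)] lp(4) lm(3) by (auto simp: Px)
 have Jint: "tu \<in> J" if tu: "tm <= tu" "tu <= tp" for tu
  unfolding J_def
 proof (rule CollectI, rule ballI)
  fix l assume l: "l \<in> I"
  have "tu * (x l .* t) <= tp * (x l .* t) \<or> tu * (x l .* t) <= tm * (x l .* t)"
   using tu by (cases "x l .* t >= 0") (auto intro: mult_right_mono mult_right_mono_neg)
  thus "x l .* m + tu * (x l .* t) <= ka" using tpJ tmJ l by (fastforce simp: J_def)
 qed
 have G: "W i Int W j = circ m t ` {arctan tm..arctan tp}"
 proof
  show "W i Int W j <= circ m t ` {arctan tm..arctan tp}"
  proof
   fix y assume "y \<in> W i Int W j"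
   then obtain tu where "tu \<in> J" "y = sgn (P tu)" using WJ by blast
   thus "y \<in> circ m t ` {arctan tm..arctan tp}" using up[of tu] unfolding sP by (auto simp: arctan_le_iff)
  qed
  show "circ m t ` {arctan tm..arctan tp} <= W i Int W j"
  proof
   fix y assume "y \<in> circ m t ` {arctan tm..arctan tp}"
   then obtain te where th: "y = circ m t te" "arctan tm <= te" "te <= arctan tp" by auto
   hence "- (pi/2) < te" "te < pi/2" using arctan_lbound[of tm] arctan_ubound[of tp] by linarith+
   hence at: "arctan (tan te) = te" by (intro arctan_tan)
   hence "arctan tm <= arctan (tan te)" "arctan (tan te) <= arctan tp" using th by auto
   hence "tan te \<in> J" by (intro Jint) (simp_all add: arctan_le_iff)
   thus "y \<in> W i Int W j" using JW[of "tan te"] unfolding sP at th(1) by simp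
  qed
 qed
 have le: "tm <= tp" using up[OF tmJ] by simp
 have "curve_length (voronoi_edge N x i j) = arctan tp - arctan tm"
  unfolding edge_eq[OF i jI(1)] G
  by (rule curve_length_circ[OF nm on(1,2)])
   (use le arctan_lbound[of tm] arctan_ubound[of tp] in "simp_all add: arctan_le_iff")
 note len = this
 have lt: "tm < tp" using len cl le by (cases "tm = tp") auto
 \<comment> \<open>At the Voronoi vertex P tu the cotangent weight returns tu up to the sign that
   tells on which side the third generator lies. The sign turns the lower end tm into the summand -
   arctan tm.\<close>
 have val: "dd i j * omega {i, j, l} i j / tc {i, j, l} = sgn (x l .* t) * tu & x l .* t ~= 0"
  if T: "{i, j, l} \<in> \<T>" "i ~= l" "j ~= l" and n: "tn {i, j, l} = sgn (P tu)" for l tu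
 proof -
  let ?T = "{i, j, l}" and ?c = "x l"
  let ?n = "tn ?T" and ?s = "tc ?T"
  have lI: "l \<in> I" using T_sub[OF T(1)] by simp
  have h: "?n .* ?a = ?s" "?n .* ?b = ?s" "?n .* ?c = ?s" using tn_dot[OF T(1)] by (auto simp: inner_commute)
  have ne: "?a ~= ?b" "?b ~= ?c" "?a ~= ?c" using inj_x i jI lI T by auto
  let ?M = "crossN ?a ?b ?c"
  note F = crossN_facts[OF nx[OF i] nx[OF jI(1)] nx[OF lI] norm_tn[OF T(1)] ne h]
  define \<mu> where "\<mu> = ?M .* ?n"
  define D where "D = norm ?M"
  define Q where "Q = (?a - ?c) .* (?b - ?c)"
  have D: "D > 0" "D = |\<mu>|" using F(3,4) by (auto simp: D_def \<mu>_def norm_eq_sqrt_inner)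
  have s: "?s > 0" by (rule tc_pos[OF T(1)])
  define \<rho> where "\<rho> = 1 / norm (P tu)"
  have rho: "\<rho> > 0" using P0 by (simp add: \<rho>_def)
  have nP': "?n = \<rho> *R P tu" unfolding n by (simp add: sgn_div_norm \<rho>_def inverse_eq_divide)
  have sk: "?s = \<rho> * ka" using h(1) Pa(1)[of tu] unfolding nP' by (simp add: inner_commute)
  have tP: "P tu .* t = tu" by (simp add: P_def inner_add_left mm on(2))
  have "?M .* cross3 ?a ?b = \<mu> * (?n .* cross3 ?a ?b)" unfolding \<mu>_def by (subst F(1)) simp
  also have "?n .* cross3 ?a ?b = \<rho> * ka * d * tu" unfolding cab nP' by (simp add: tP)
  finally have e1: "(1 - ?a .* ?b) * Q = \<mu> * (\<rho> * ka * d * tu)" using F(6) by (simp add: Q_def)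
  have d2: "d^2 = 2 * (1 - ?a .* ?b)"
   unfolding d_def using unit_dist_sq[OF nx[OF jI(1)] nx[OF i]] by (simp add: inner_commute)
  have "?a .* cross3 ?b ?c = ?c .* cross3 ?a ?b" by (simp add: cross3_def inner_vec_def sum_3 algebra_simps)
  hence e2: "ka * d * (?c .* t) = \<mu> * ?s" using F(2) unfolding cab \<mu>_def by simp
  have mu0: "\<mu> ~= 0" using D by auto
  hence ct: "?c .* t ~= 0" using e2 s by auto
  have sg: "sgn (?c .* t) = sgn \<mu>"
  proof -
   have "sgn (ka * d * (?c .* t)) = sgn (\<mu> * ?s)" using e2 by simp
   thus ?thesis using k0 d s by (simp add: sgn_mult)
  qed
  have "dd i j * omega ?T i j / ?s = d * (Q / (2 * D)) / (\<rho> * ka)"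
   using T by (simp add: dd_def omega_def third_eq om_def d_def Q_def D_def sk)
  also have "... = (d^2 * Q) / (2 * D * d * (\<rho> * ka))" using d by (simp add: power2_eq_square)
  also have "d^2 * Q = 2 * (\<mu> * (\<rho> * ka * d * tu))" unfolding d2 e1[symmetric] by (simp only: mult.assoc)
  also have "2 * (\<mu> * (\<rho> * ka * d * tu)) / (2 * D * d * (\<rho> * ka)) = (\<mu> / D) * tu"
   using rho k0 d D(1) by (simp add: field_simps)
  also have "\<mu> / D = sgn \<mu>" unfolding D(2) using mu0 by (simp add: sgn_real_def)
  finally show ?thesis using sg ct by simp
 qed
 note Pl = lp(4)[folded Px] lm(3)[folded Px]
 have dl: "i ~= lp" "j ~= lp" "i ~= lm" "j ~= lm" "lp ~= lm"
  using lp(3) lm(2) ta by (auto simp: inner_commute)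
 have WW: "sgn (P tu) \<in> W l" if "tu \<in> J" "l \<in> I" "x l .* P tu = ka" for tu l
 proof -
  have "x l .* sgn (P tu) = ?a .* sgn (P tu)" using that(3) Pa(1) by (simp add: sgn_div_norm)
  thus ?thesis using JW[OF that(1)] unfolding W_def by auto
 qed
 have Tp: "{i, j, lp} \<in> \<T>" "tn {i, j, lp} = sgn (P tp)"
  using triple_point[of "sgn (P tp)" i j lp] JW[OF tpJ] WW[OF tpJ lp(2) Pl(1)] dl jI i lp(2) by auto
 have Tm: "{i, j, lm} \<in> \<T>" "tn {i, j, lm} = sgn (P tm)"
  using triple_point[of "sgn (P tm)" i j lm] JW[OF tmJ] WW[OF tmJ lm(1) Pl(2)] dl jI i lm(1) by auto
 have only: "T = {i, j, lp} \<or> T = {i, j, lm}" if T: "T \<in> \<T>" "i \<in> T" "j \<in> T" for T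
 proof -
  obtain k where k: "T = {i, j, k}" "i ~= k" "j ~= k"
  proof -
   obtain u v where "T = {u, v, i}" "u ~= v" "u ~= i" "v ~= i" by (rule T_triple[OF T(1,2)])
   note uv = this
   have "j = u \<or> j = v" using uv T(3) jI by auto
   thus thesis
   proof
    assume "j = u"
    thus thesis using that[of v] uv by (simp add: insert_commute)
   next
    assume "j = v"
    thus thesis using that[of u] uv by (simp add: insert_commute)
   qed
  qed
  have kI: "k \<in> I" using T_sub[OF T(1)] k by simp
  have "tn T \<in> W i Int W j" using tn_W[OF T(1)] T by blast
  then obtain tu where tu: "tu \<in> J" "tn T = sgn (P tu)" "\<forall>l\<in>I. x l .* tn T = ?a .* tn T --> x l .* P tu = ka"
   using WJ by blast
  have kP: "x k .* P tu = ka" using tu(3) kI tn_dot[OF T(1), of k] tn_dot[OF T(1), of i] k by auto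
  have k0': "x k .* t ~= 0" using val[of k tu] T(1) tu(2) k by simp
  consider "x k .* t > 0" | "x k .* t < 0" using k0' by linarith
  thus ?thesis
  proof cases
   case 1
   hence "tu = tp" using hi[OF tpJ kI _ kP] up(1)[OF tu(1)] by simp
   thus ?thesis using tn_inj[OF T(1) Tp(1)] tu(2) Tp(2) by simp
  next
   case 2
   hence "tu = tm" using lo[OF tmJ kI _ kP] up(2)[OF tu(1)] by simp
   thus ?thesis using tn_inj[OF T(1) Tm(1)] tu(2) Tm(2) by simp
  qed
 qed
 have set: "{T\<in>\<T>. i \<in> T & j \<in> T} = {{i, j, lp}, {i, j, lm}}" using only Tp(1) Tm(1) by blast
 have ne: "{i, j, lp} ~= {i, j, lm}" using dl by (auto simp: doubleton_eq_iff)
 have "sarc {i, j, lp} i j = arctan tp"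
  using val[OF Tp(1) dl(1,2) Tp(2)] lp(3) by (simp add: sarc_def)
 moreover have "sarc {i, j, lm} i j = - arctan tm"
  using val[OF Tm(1) dl(3,4) Tm(2)] lm(2) by (simp add: sarc_def arctan_minus)
 ultimately show ?thesis unfolding len set using ne by simp
qed

section \<open>The finite volume form as a symmetric sum over triangles\<close>

definition Bh :: "(nat => real) => (nat => real) => real" where
 "Bh v w = (1/2) * (SUM t:\<T>. SUM i:t. SUM j:t - {i}. sarc t i j / dd i j * ((v i - v j) * (w i - w j)))"

definition coef :: "nat => nat => real" where
 "coef i j = (if j \<in> neighbors N x i then curve_length (voronoi_edge N x i j) / dd i j else 0)"

lemma coef_sym: "i \<in> I ==> j \<in> I ==> coef i j = coef j i"
 using neighbors_sym[of j i] neighbors_sym[of i j] by (auto simp: coef_def dd_sym[of i j] voronoi_edge_def Int_commute)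

lemma neighbors_sub: "neighbors N x i <= I" by (auto simp: neighbors_def_I)

text \<open>Summation by parts: the coefficients are symmetric and the differences antisymmetric, so
  exchanging i and j and averaging gives the symmetric form.\<close>

lemma fv_form_coef:
 "fv_form N x u w = (1/2) * (SUM i:I. SUM j:I. coef i j * ((u (x i) - u (x j)) * (w (x i) - w (x j))))"
proof -
 let ?u = "%i. u (x i)" and ?w = "%i. w (x i)"
 have inner: "(SUM j:neighbors N x i. flux N x u i j) = (SUM j:I. coef i j * (?u i - ?u j))" for i
 proof -
  have "(SUM j:neighbors N x i. flux N x u i j) = (SUM j:neighbors N x i. coef i j * (?u i - ?u j))"
   by (rule sum.cong) (auto simp: flux_def coef_def dd_def field_simps)
  also have "... = (SUM j:I. coef i j * (?u i - ?u j))"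
   by (rule sum.mono_neutral_left) (use neighbors_sub in "auto simp: coef_def")
  finally show ?thesis .
 qed
 let ?S = "SUM i:I. SUM j:I. coef i j * ((?u i - ?u j) * ?w i)"
 have f: "fv_form N x u w = ?S"
  unfolding fv_form_def inner I_def[symmetric] by (simp add: sum_distrib_left mult_ac)
 have "?S = (SUM j:I. SUM i:I. coef i j * ((?u i - ?u j) * ?w i))" by (rule sum.swap)
 also have "... = (SUM i:I. SUM j:I. coef i j * ((?u i - ?u j) * (- ?w j)))"
  by (intro sum.cong refl) (use coef_sym in "simp add: algebra_simps")
 finally have "?S + ?S = (SUM i:I. SUM j:I. coef i j * ((?u i - ?u j) * ?w i)) + (SUM i:I. SUM j:I. coef i j * ((?u i - ?u j) * (- ?w j)))"
  by simp
 also have "... = (SUM i:I. SUM j:I. coef i j * ((?u i - ?u j) * (?w i - ?w j)))"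
  by (simp add: sum.distrib[symmetric] algebra_simps)
 finally show ?thesis unfolding f by simp
qed

text \<open>Each edge coefficient is the sum of the arcs of the triangles at this edge; exchanging
  the sums localises the form.\<close>

lemma fv_form_Bh: "fv_form N x u w = Bh (%i. u (x i)) (%i. w (x i))"
proof -
 let ?f = "%i j. (u (x i) - u (x j)) * (w (x i) - w (x j))"
 let ?g = "%t i j. if i \<in> t & j \<in> t & i ~= j then sarc t i j / dd i j * ?f i j else 0"
 have c: "coef i j * ?f i j = (SUM t:\<T>. ?g t i j)" if "i \<in> I" "j \<in> I" for i j
 proof (cases "j \<in> neighbors N x i")
  case True
  have ij: "i ~= j" using neighbors_I[OF True] by simp
  have "coef i j * ?f i j = (\<Sum>T\<in>{T\<in>\<T>. i \<in> T & j \<in> T}. sarc T i j / dd i j * ?f i j)"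
   using True edge_length[OF that(1) True] by (simp add: coef_def sum_divide_distrib sum_distrib_right)
  also have "... = (SUM t:\<T>. ?g t i j)"
   using ij by (intro sum.mono_neutral_cong_left finite_T) auto
  finally show ?thesis .
 next
  case False
  have "?g t i j = 0" if "t \<in> \<T>" for t using T_nbr[OF that, of i j] False by auto
  thus ?thesis using False by (simp add: coef_def)
 qed
 have "(SUM i:I. SUM j:I. coef i j * ?f i j) = (SUM i:I. SUM j:I. SUM t:\<T>. ?g t i j)"
  by (intro sum.cong refl c)
 also have "... = (SUM i:I. SUM t:\<T>. SUM j:I. ?g t i j)" by (intro sum.cong refl sum.swap)
 also have "... = (SUM t:\<T>. SUM i:I. SUM j:I. ?g t i j)" by (rule sum.swap)
 also have "... = (SUM t:\<T>. SUM i:t. SUM j:t - {i}. sarc t i j / dd i j * ?f i j)"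
 proof (rule sum.cong[OF refl])
  fix t assume t: "t \<in> \<T>"
  have ts: "t <= I" using T_sub[OF t] by blast
  have "(SUM i:I. SUM j:I. ?g t i j) = (SUM i:t. SUM j:I. ?g t i j)"
   using ts by (intro sum.mono_neutral_right) auto
  also have "... = (SUM i:t. SUM j:t - {i}. sarc t i j / dd i j * ?f i j)"
   using ts by (intro sum.cong refl sum.mono_neutral_cong_right) auto
  finally show "(SUM i:I. SUM j:I. ?g t i j) = (SUM i:t. SUM j:t - {i}. sarc t i j / dd i j * ?f i j)" .
 qed
 finally show ?thesis unfolding fv_form_coef Bh_def by simp
qed

end

section \<open>Piecewise linear functions on the Delaunay triangulation\<close>

lemma norm_crossN_perm: "norm (crossN a b c) = norm (crossN b c a)" "norm (crossN a b c) = norm (crossN b a c)"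
proof -
 have "crossN a b c = crossN b c a" by (simp add: crossN_def vec_eq_iff forall_3 cross3_def algebra_simps)
 thus "norm (crossN a b c) = norm (crossN b c a)" by simp
 have "crossN a b c = - crossN b a c" unfolding crossN_def by (rule cross_skew)
 thus "norm (crossN a b c) = norm (crossN b a c)" by simp
qed

(* The cotangent formula for the stiffness matrix of a planar triangle, with the cotangents
 written as dot products divided by twice the area. *)
lemma cotangent_identity:
 fixes a b c n \<beta> \<beta>' :: "real^3"
 assumes M: "crossN a b c = (crossN a b c .* n) *R n" and D: "norm (crossN a b c) > 0"
  and b: "\<beta> .* n = 0" "\<beta>' .* n = 0"
 shows "om a b c * ((\<beta> .* (a - b)) * (\<beta>' .* (a - b))) + om b c a * ((\<beta> .* (b - c)) * (\<beta>' .* (b - c))) + om c a b * ((\<beta> .* (c - a)) * (\<beta>' .* (c - a)))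
  = norm (crossN a b c) / 2 * (\<beta> .* \<beta>')"
proof -
 define u v where "u = a - c" and "v = b - c"
 define D where "D = norm (crossN a b c)"
 have D0: "D > 0" using D by (simp add: D_def)
 have M': "crossN a b c = cross3 u v" by (simp add: crossN_def u_def v_def)
 define p q p' q' where "p = \<beta> .* u" and "q = \<beta> .* v" and "p' = \<beta>' .* u" and "q' = \<beta>' .* v"
 have bM: "\<beta> .* cross3 u v = 0" "\<beta>' .* cross3 u v = 0"
  using b M unfolding M' by (metis inner_scaleR_right mult_zero_right)+
 have "cross3 \<beta> (cross3 v u) .* cross3 \<beta>' (cross3 v u) = (\<beta> .* \<beta>') * (cross3 v u .* cross3 v u) - (\<beta> .* cross3 v u) * (cross3 v u .* \<beta>')"
  by (rule inner_cross_swap)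
 moreover have sk: "cross3 v u = - cross3 u v" by (rule cross_skew)
 ultimately have e1: "cross3 \<beta> (cross3 v u) .* cross3 \<beta>' (cross3 v u) = (\<beta> .* \<beta>') * D^2"
  unfolding sk using bM by (simp add: D_def M' power2_norm_eq_inner)
 have l: "cross3 \<beta> (cross3 v u) = p *R v - q *R u" "cross3 \<beta>' (cross3 v u) = p' *R v - q' *R u"
  unfolding Lagrange by (simp_all add: p_def q_def p'_def q'_def)
 have e2: "p * p' * (v .* v) - (u .* v) * (p * q' + q * p') + q * q' * (u .* u) = (\<beta> .* \<beta>') * D^2"
  using e1 unfolding l by (simp add: inner_diff_left inner_diff_right inner_commute[of v u] algebra_simps)
 have n: "norm (crossN b c a) = D" "norm (crossN c a b) = D"
  using norm_crossN_perm(1)[of a b c] norm_crossN_perm(1)[of b c a] by (simp_all add: D_def)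
 have o: "om a b c = (u .* v) / (2 * D)" "om b c a = (u .* u - u .* v) / (2 * D)" "om c a b = (v .* v - u .* v) / (2 * D)"
  unfolding om_def n D_def[symmetric] u_def v_def
  by (simp_all add: inner_diff_left inner_diff_right inner_commute algebra_simps)
 have d: "\<beta> .* (a - b) = p - q" "\<beta>' .* (a - b) = p' - q'" "\<beta> .* (b - c) = q" "\<beta>' .* (b - c) = q'" "\<beta> .* (c - a) = - p" "\<beta>' .* (c - a) = - p'"
  unfolding p_def q_def p'_def q'_def u_def v_def by (simp_all add: inner_diff_right)
 have "om a b c * ((\<beta> .* (a - b)) * (\<beta>' .* (a - b))) + om b c a * ((\<beta> .* (b - c)) * (\<beta>' .* (b - c))) + om c a b * ((\<beta> .* (c - a)) * (\<beta>' .* (c - a)))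
  = ((u .* v) * ((p - q) * (p' - q')) + (u .* u - u .* v) * (q * q') + (v .* v - u .* v) * (p * p')) / (2 * D)"
  unfolding o d by (simp add: add_divide_distrib)
 also have "(u .* v) * ((p - q) * (p' - q')) + (u .* u - u .* v) * (q * q') + (v .* v - u .* v) * (p * p')
  = p * p' * (v .* v) - (u .* v) * (p * q' + q * p') + q * q' * (u .* u)" by (simp add: algebra_simps)
 also have "... / (2 * D) = D / 2 * (\<beta> .* \<beta>')" unfolding e2 using D0 by (simp add: power2_eq_square)
 finally show ?thesis by (simp add: D_def)
qed

context vd begin

text \<open>Any triangle whose cone contains y gives the same value, by \<open>coords_eq\<close>.
  The quotient is constant on rays: these are the barycentric coordinates of the point where the ray
  meets the polyhedral surface.\<close>

definition bary :: "real^3 => nat => real" where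
 "bary y i = (let t = (SOME t. t \<in> \<T> & y \<in> tcone t) in if i \<in> t then (alpha t i .* y) / (nu t .* y) else 0)"

lemma bary_eq:
 assumes t: "t \<in> \<T>" "y \<in> tcone t"
 shows "bary y i = (if i \<in> t then (alpha t i .* y) / (nu t .* y) else 0)"
proof -
 define s where "s = (SOME t. t \<in> \<T> & y \<in> tcone t)"
 have s: "s \<in> \<T> & y \<in> tcone s" unfolding s_def by (rule someI[of _ t]) (use t in simp)
 have b: "bary y i = (if i \<in> s then (alpha s i .* y) / (nu s .* y) else 0)"
  by (simp add: bary_def s_def[symmetric])
 have n: "nu s .* y = nu t .* y" using nu_eq s t by blast
 show ?thesis
 proof (cases "i \<in> t")
  case True
  thus ?thesis using b n coords_eq[of s t y i] s t by simp
 next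
  case False
  show ?thesis
  proof (cases "i \<in> s")
   case True
   hence "alpha s i .* y = 0" using coords_eq[of t s y i] s t False by simp
   thus ?thesis using b False by simp
  next
   case f: False
   thus ?thesis using b False by simp
  qed
 qed
qed

definition Jf :: "(nat => real) => real^3 => real" where
 "Jf v y = (SUM i:I. v i * bary y i)"

text \<open>The linear form with the nodal values at the vertices; on the cone, the discrete
  function is its quotient by \<open>nu t\<close>.\<close>

definition Av :: "nat set => (nat => real) => real^3" where
 "Av t v = (SUM i:t. v i *R alpha t i)"

lemma Av_dot: assumes "t \<in> \<T>" "i \<in> t" shows "Av t v .* x i = v i"
proof -
 have "Av t v .* x i = (SUM j:t. v j * (if j = i then 1 else 0))"
  unfolding Av_def inner_sum_left by (intro sum.cong) (auto simp: alpha_dual[OF assms(1) _ assms(2)])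
 thus ?thesis using assms T_finite by (simp add: if_distrib cong: if_cong)
qed

lemma Jf_sum: assumes t: "t \<in> \<T>" "y \<in> tcone t" shows "Jf v y = (SUM i:t. v i * ((alpha t i .* y) / (nu t .* y)))"
proof -
 have "t <= I" using T_sub t(1) by blast
 thus ?thesis unfolding Jf_def bary_eq[OF t]
  by (intro sum.mono_neutral_cong_right) auto
qed

lemma Jf_eq: assumes t: "t \<in> \<T>" "y \<in> tcone t" shows "Jf v y = (Av t v .* y) / (nu t .* y)"
 unfolding Jf_sum[OF t] Av_def inner_sum_left by (simp add: sum_divide_distrib)

lemma bary_nonneg: assumes "y ~= 0" shows "0 <= bary y i"
proof -
 obtain t where t: "t \<in> \<T>" "y \<in> tcone t" by (rule cone_cover[OF assms])
 show ?thesis unfolding bary_eq[OF t] using nu_pos[OF t assms] t(2) by (simp add: tcone_def)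
qed

lemma bary_sum: assumes "y ~= 0" shows "(SUM i:I. bary y i) = 1"
proof -
 obtain t where t: "t \<in> \<T>" "y \<in> tcone t" by (rule cone_cover[OF assms])
 have "(SUM i:I. bary y i) = Jf (%_. 1) y" by (simp add: Jf_def)
 also have "... = (SUM i:t. alpha t i .* y) / (nu t .* y)" unfolding Jf_sum[OF t] by (simp add: sum_divide_distrib)
 also have "... = 1" using nu_pos[OF t assms] by (simp add: nu_dot_sum[OF t(1)])
 finally show ?thesis .
qed

lemma Jf_bounds:
 assumes "y ~= 0" "!!i. i \<in> I ==> a <= v i" "!!i. i \<in> I ==> v i <= b"
 shows "a <= Jf v y" "Jf v y <= b"
proof -
 have "a = (SUM i:I. a * bary y i)" using bary_sum[OF assms(1)] by (simp flip: sum_distrib_left)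
 also have "... <= Jf v y" unfolding Jf_def using assms bary_nonneg[OF assms(1)] by (intro sum_mono mult_right_mono) auto
 finally show "a <= Jf v y" .
 have "Jf v y <= (SUM i:I. b * bary y i)" unfolding Jf_def using assms bary_nonneg[OF assms(1)] by (intro sum_mono mult_right_mono) auto
 also have "... = b" using bary_sum[OF assms(1)] by (simp flip: sum_distrib_left)
 finally show "Jf v y <= b" .
qed

lemma vertex_cone: "t \<in> \<T> ==> i \<in> t ==> x i \<in> tcone t"
 using alpha_dual by (simp add: tcone_def)

lemma Jf_vertex: assumes i: "i \<in> I" shows "Jf v (x i) = v i"
proof -
 obtain t where t: "t \<in> \<T>" "i \<in> t" by (rule vertex_in_T[OF i])
 show ?thesis unfolding Jf_eq[OF t(1) vertex_cone[OF t]] by (simp add: Av_dot[OF t] nu_dot[OF t])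
qed

lemma Jf_add_const: "y ~= 0 ==> Jf (%i. v i - c) y = Jf v y - c"
 using bary_sum[of y] by (simp add: Jf_def sum_subtractf algebra_simps flip: sum_distrib_left)

lemma nu_ge: assumes t: "t \<in> \<T>" and y: "y \<in> tcone t" shows "nu t .* y >= norm y"
proof -
 have "norm y = norm (SUM i:t. (alpha t i .* y) *R x i)" by (simp add: alpha_rep[OF t])
 also have "... <= (SUM i:t. norm ((alpha t i .* y) *R x i))" by (rule norm_sum)
 also have "... = (SUM i:t. alpha t i .* y)"
  using y nx T_sub[OF t] by (intro sum.cong) (auto simp: tcone_def)
 finally show ?thesis by (simp add: nu_dot_sum[OF t])
qed

lemma Jf_continuous_Union:
 assumes U: "!!t. t \<in> \<T> ==> closed (U t)" "!!t. t \<in> \<T> ==> U t <= tcone t - {0}"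
 shows "continuous_on (\<Union>t\<in>\<T>. U t) (Jf v)"
proof (rule continuous_on_closed_Union[OF finite_T U(1)])
 fix t assume t: "t \<in> \<T>"
 have "continuous_on (U t) (%y. (Av t v .* y) / (nu t .* y))"
  using nu_pos[OF t] U(2)[OF t] by (intro continuous_intros) force
 thus "continuous_on (U t) (Jf v)"
  by (rule continuous_on_cong[THEN iffD1, rotated 2, OF _ refl]) (use Jf_eq[OF t] U(2)[OF t] in auto)
qed

lemma Jf_measurable: "Jf v \<in> borel_measurable surf"
proof (rule borel_measurable_surf_continuous)
 have "S2 = (\<Union>t\<in>\<T>. tcone t Int S2)" using tiles geodesic_cone by auto
 moreover have "continuous_on (\<Union>t\<in>\<T>. tcone t Int S2) (Jf v)"
  by (rule Jf_continuous_Union) (auto intro: closed_Int closed_cone)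
 ultimately show "continuous_on S2 (Jf v)" by simp
qed

text \<open>The gradient of the discrete function on the planar triangle, turned by a right angle
  within the plane.\<close>

definition mt :: "nat set => (nat => real) => real^3" where
 "mt t v = cross3 (Av t v) (tn t)"

definition ticone :: "nat set => (real^3) set" where
 "ticone t = {y. \<forall>i\<in>t. 0 < alpha t i .* y}"

text \<open>The cross product of y with the gradient of the quotient of \<open>Av t v\<close> and
  \<open>nu t\<close>, the quotient rule being rewritten as a double cross product.\<close>

definition Lt :: "nat set => (nat => real) => real^3 => real^3" where
 "Lt t v y = (tc t / (tn t .* y)^2) *R cross3 y (cross3 y (mt t v))"

definition LJ :: "(nat => real) => real^3 => real^3" where
 "LJ v y = (SUM t:\<T>. ind (ticone t) y *R Lt t v y)"

lemma tn_nu: "t \<in> \<T> ==> tn t .* y = tc t * (nu t .* y)"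
 using tc_pos[of t] by (simp add: nu_def)

lemma tn_ge: "t \<in> \<T> ==> y \<in> tcone t ==> norm y = 1 ==> tn t .* y >= tc t"
 unfolding tn_nu using nu_ge[of t y] tc_pos[of t] by simp

lemma ticone_tcone: "ticone t <= tcone t" by (auto simp: ticone_def tcone_def less_imp_le)

lemma open_ticone: "t \<in> \<T> ==> open (ticone t)"
proof -
 assume "t \<in> \<T>"
 have "ticone t = (\<Inter>i\<in>t. {y. 0 < alpha t i .* y})" by (auto simp: ticone_def)
 thus ?thesis using T_finite[OF `t \<in> \<T>`] by (auto intro!: open_INT open_halfspace_gt)
qed

lemma ticone_disjoint:
 assumes "t \<in> \<T>" "t' \<in> \<T>" "y \<in> ticone t" "y \<in> tcone t'" shows "t = t'"
proof -
 have "t <= t'" using support[OF assms(1,2) _ assms(4)] assms(3) ticone_tcone by (auto simp: ticone_def)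
 thus ?thesis using T_card assms(1,2) T_finite card_subset_eq by metis
qed

lemma AE_ticone: "AE y in surf. \<exists>t\<in>\<T>. y \<in> ticone t"
proof -
 have "AE y in surf. \<forall>t\<in>\<T>. \<forall>i\<in>t. alpha t i .* y ~= 0"
 proof (intro AE_finite_allI finite_T T_finite surf_hyperplane_null)
  fix t i assume "t \<in> \<T>" "i \<in> t"
  thus "alpha t i ~= 0" using alpha_dual[of t i i] by auto
 qed
 thus ?thesis
 proof (rule AE_mp[OF _ AE_I2], intro impI)
  fix y assume "y \<in> space surf" and a: "\<forall>t\<in>\<T>. \<forall>i\<in>t. alpha t i .* y ~= 0"
  hence "y ~= 0" by auto
  then obtain t where t: "t \<in> \<T>" "y \<in> tcone t" by (rule cone_cover)
  thus "\<exists>t\<in>\<T>. y \<in> ticone t" using a by (force simp: tcone_def ticone_def)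
 qed
qed

lemma LJ_eq: assumes "t \<in> \<T>" "y \<in> ticone t" shows "LJ v y = Lt t v y"
proof -
 have "y ~: ticone s" if "s \<in> \<T>" "s ~= t" for s
  using ticone_disjoint[OF that(1) assms(1)] that(2) assms(2) ticone_tcone by blast
 hence "LJ v y = (SUM s:\<T>. if s = t then Lt t v y else 0)"
  unfolding LJ_def by (intro sum.cong refl) (simp add: assms(2))
 thus ?thesis using assms(1) finite_T by simp
qed

lemma cross_Av: assumes t: "t \<in> \<T>"
 shows "cross3 y (mt t v) = (tn t .* y) *R Av t v - (Av t v .* y) *R tn t"
 unfolding mt_def Lagrange by (simp add: inner_commute)

lemma Lt_bound: assumes t: "t \<in> \<T>" and y: "y \<in> tcone t" "norm y = 1" shows "norm (Lt t v y) <= norm (mt t v) / tc t"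
proof -
 have c: "tc t > 0" and n: "tn t .* y >= tc t" using tc_pos[OF t] tn_ge[OF t y] by auto
 have "norm (cross3 y (cross3 y (mt t v))) <= norm (mt t v)"
  using norm_cross_le[of y "cross3 y (mt t v)"] norm_cross_le[of y "mt t v"] y(2) by simp
 moreover have "tc t / (tn t .* y)^2 <= tc t / (tc t)^2" using c n by (intro divide_left_mono power_mono) auto
 moreover have "tc t / (tc t)^2 = 1 / tc t" using c by (simp add: power2_eq_square)
 moreover have "norm (Lt t v y) = (tc t / (tn t .* y)^2) * norm (cross3 y (cross3 y (mt t v)))"
  unfolding Lt_def using c by simp
 ultimately have "norm (Lt t v y) <= (1 / tc t) * norm (mt t v)" using c by (metis mult_mono norm_ge_zero zero_le_divide_1_iff less_imp_le)
 thus ?thesis by simp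
qed

text \<open>Over a common denominator the numerator is (y x z) . (\<open>Av t v\<close> x
  \<open>nu t\<close>), and y x z = (y - z) x z; the denominators are at least the norms of y and
  z.\<close>

lemma Jf_cone_lipschitz:
 assumes t: "t \<in> \<T>" and y: "y \<in> tcone t" "y ~= 0" and z: "z \<in> tcone t" "z ~= 0"
 shows "|Jf v y - Jf v z| <= norm (mt t v) / tc t * (norm (y - z) / norm y)"
proof -
 have p: "nu t .* y > 0" "nu t .* z > 0" "tc t > 0" using nu_pos[OF t] y z tc_pos[OF t] by auto
 have "cross3 y z .* cross3 (Av t v) (nu t) = (y .* Av t v) * (z .* nu t) - (y .* nu t) * (z .* Av t v)"
  using inner_cross_swap[of z "Av t v" y "nu t"] by (simp add: dot_cross inner_commute)
 moreover have "cross3 (Av t v) (nu t) = (1 / tc t) *R mt t v" by (simp add: nu_def mt_def cross_mult_right)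
 ultimately have "Jf v y - Jf v z = (cross3 y z .* mt t v) / tc t / ((nu t .* y) * (nu t .* z))"
  unfolding Jf_eq[OF t y(1)] Jf_eq[OF t z(1)] using p by (simp add: diff_frac_eq inner_commute mult.commute)
 hence "|Jf v y - Jf v z| = |cross3 y z .* mt t v| / tc t / ((nu t .* y) * (nu t .* z))" using p by (simp add: abs_mult)
 also have "... <= (norm (y - z) * norm z * norm (mt t v)) / tc t / (norm y * norm z)"
 proof (intro frac_le divide_right_mono mult_mono)
  have "cross3 y z = cross3 (y - z) z" by (simp add: Cross3.left_diff_distrib)
  hence "norm (cross3 y z) <= norm (y - z) * norm z" using norm_cross_le by simp
  thus "|cross3 y z .* mt t v| <= norm (y - z) * norm z * norm (mt t v)"
   using Cauchy_Schwarz_ineq2[of "cross3 y z" "mt t v"] mult_right_mono[of _ _ "norm (mt t v)"] by (meson norm_ge_zero order_trans)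
 qed (use p y z nu_ge[OF t] in auto)
 also have "... = norm (mt t v) / tc t * (norm (y - z) / norm y)" using z by simp
 finally show ?thesis .
qed

text \<open>The parameter interval is covered by finitely many closed sets, one for each cone, on
  which the function is Lipschitz. M bounds the gradients just on the triangles that the path meets,
  which the comparison on cells exploits.\<close>

lemma Jf_path_lipschitz:
 fixes ga :: "real => real^3"
 assumes ab: "a <= b" and r: "r > 0" and g: "!!s. s \<in> {a..b} ==> norm (ga s) >= r" "l-lipschitz_on {a..b} ga"
  and M: "M >= 0" "!!t s. t \<in> \<T> ==> s \<in> {a..b} ==> ga s \<in> tcone t ==> norm (mt t v) / tc t <= M"
 shows "|Jf v (ga b) - Jf v (ga a)| <= M * (l / r) * (b - a)"
proof -
 have l0: "l >= 0" using g(2) by (rule lipschitz_on_nonneg)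
 have n0: "ga s ~= 0" if "s \<in> {a..b}" for s using g(1)[OF that] r by auto
 define U where "U t = {s\<in>{a..b}. ga s \<in> tcone t}" for t
 have lip: "(M * (l / r))-lipschitz_on (U t) (%s. Jf v (ga s))" if t: "t \<in> \<T>" for t
 proof (rule lipschitz_onI)
  show "0 <= M * (l / r)" using M(1) l0 r by simp
  fix s s' assume s: "s \<in> U t" "s' \<in> U t"
  have "|Jf v (ga s) - Jf v (ga s')| <= norm (mt t v) / tc t * (norm (ga s - ga s') / norm (ga s))"
   using s n0 by (intro Jf_cone_lipschitz[OF t]) (auto simp: U_def)
  also have "... <= M * ((l * dist s s') / r)"
   using M t s g r l0 lipschitz_onD[OF g(2), of s s'] by (intro mult_mono frac_le) (auto simp: U_def dist_norm)
  finally show "dist (Jf v (ga s)) (Jf v (ga s')) <= M * (l / r) * dist s s'" by (simp add: dist_real_def)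
 qed
 have "(M * (l / r))-lipschitz_on {a..b} (%s. Jf v (ga s))"
 proof (rule lipschitz_on_closed_Union[OF lip _ finite_T])
  show "closed (U t)" for t
   using continuous_closed_preimage[OF lipschitz_on_continuous_on[OF g(2)] closed_atLeastAtMost closed_cone, of t]
   by (simp add: U_def Int_def vimage_def)
  show "{a..b} <= \<Union> (U ` \<T>)"
  proof
   fix s assume s: "s \<in> {a..b}"
   obtain t where "t \<in> \<T>" "ga s \<in> tcone t" by (rule cone_cover[OF n0[OF s]])
   thus "s \<in> \<Union> (U ` \<T>)" using s by (auto simp: U_def)
  qed
 qed (use M l0 r in auto)
 from lipschitz_onD[OF this, of b a] show ?thesis using ab by (simp add: dist_real_def)
qed

lemma Jf_rot_lipschitz:
 assumes a: "norm a = 1" and y: "y \<in> S2" and t: "0 <= t"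
 shows "|Jf v (rot a t y) - Jf v y| <= (SUM t:\<T>. norm (mt t v) / tc t) * t"
proof -
 have "|Jf v (rot a t y) - Jf v (rot a 0 y)| <= (SUM t:\<T>. norm (mt t v) / tc t) * (1 / 1) * (t - 0)"
 proof (rule Jf_path_lipschitz[OF t])
  show "1-lipschitz_on {0..t} (%s. rot a s y)"
  proof (rule lipschitz_onI)
   fix s s' assume "s \<in> {0..t}" "s' \<in> {0..t}"
   have "norm (rot a s y - rot a s' y) <= 1 * norm (s - s')"
   proof (rule differentiable_bound[of UNIV "%s. rot a s y" "%s h. h *R cross3 a (rot a s y)"])
    fix s :: real
    show "((%s. rot a s y) has_derivative (%h. h *R cross3 a (rot a s y))) (at s within UNIV)"
     using rot_has_derivative[OF a, of y s] by (simp add: has_vector_derivative_def)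
    have "norm (cross3 a (rot a s y)) <= 1" using norm_cross_le[of a "rot a s y"] norm_rot[OF a] a y by simp
    thus "onorm (%h. h *R cross3 a (rot a s y)) <= 1"
     by (intro onorm_le) (auto simp: mult.commute intro: mult_left_le)
   qed auto
   thus "dist (rot a s y) (rot a s' y) <= 1 * dist s s'" by (simp add: dist_norm)
  qed simp
  fix t assume "t \<in> \<T>"
  thus "norm (mt t v) / tc t <= (SUM t:\<T>. norm (mt t v) / tc t)"
   using tc_pos by (intro member_le_sum[where f = "%t. norm (mt t v) / tc t"] finite_T) (simp_all add: less_imp_le)
 qed (use y tc_pos norm_rot[OF a] in "auto intro!: sum_nonneg simp: less_imp_le")
 thus ?thesis by simp
qed

lemma Jf_rot_derivative:
 assumes a: "norm a = 1" and t: "t \<in> \<T>" and y: "y \<in> ticone t" "y ~= 0"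
 shows "((%s. Jf v (rot a s y)) has_real_derivative (a .* Lt t v y)) (at 0)"
proof -
 let ?n = "(Av t v .* cross3 a y) * (nu t .* y) - (Av t v .* y) * (nu t .* cross3 a y)"
 have yt: "y \<in> tcone t" using y ticone_tcone by blast
 have p: "nu t .* y > 0" "tc t > 0" using nu_pos[OF t yt y(2)] tc_pos[OF t] by auto
 have dr: "((%s. u .* rot a s y) has_real_derivative (u .* cross3 a y)) (at 0)" for u
 proof -
  have "((%s. u .* rot a s y) has_derivative (%h. u .* (h *R cross3 a y))) (at 0)"
   using rot_has_derivative[OF a, of y 0] unfolding has_vector_derivative_def by (intro has_derivative_inner_right) simp
  thus ?thesis unfolding has_field_derivative_def by (simp add: mult.commute[of _ "u .* cross3 a y"])
 qed
 have d: "((%s. (Av t v .* rot a s y) / (nu t .* rot a s y)) has_real_derivative ?n / (nu t .* y)^2) (at 0)"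
  using DERIV_divide[OF dr dr, of "nu t"] p by (simp add: power2_eq_square)
 have e: "?n / (nu t .* y)^2 = a .* Lt t v y"
 proof -
  have "a .* cross3 y (cross3 y (mt t v)) = (tn t .* y) * (Av t v .* cross3 a y) - (Av t v .* y) * (tn t .* cross3 a y)"
   unfolding cross_Av[OF t] by (simp add: Cross3.right_diff_distrib cross_mult_right inner_diff_right cross_triple inner_commute)
    (metis cross_triple inner_commute)
  also have "... = tc t * ?n"
   by (simp add: tn_nu[OF t] algebra_simps)
  finally show ?thesis unfolding Lt_def using p by (simp add: tn_nu[OF t] power_mult_distrib) (simp add: power2_eq_square)
 qed
 have ev: "\<forall>\<^sub>F s in nhds 0. (Av t v .* rot a s y) / (nu t .* rot a s y) = Jf v (rot a s y)"
 proof -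
  have "isCont (%s. rot a s y) 0" using has_vector_derivative_continuous[OF rot_has_derivative[OF a]] .
  hence "\<forall>\<^sub>F s in at 0. rot a s y \<in> ticone t"
   unfolding isCont_def using topological_tendstoD[OF _ open_ticone[OF t]] y by simp
  hence "\<forall>\<^sub>F s in nhds 0. rot a s y \<in> ticone t" using y by (simp add: eventually_nhds_conv_at)
  thus ?thesis
  proof eventually_elim
   case (elim s)
   hence "rot a s y \<in> tcone t" using ticone_tcone by blast
   thus ?case using Jf_eq[OF t] by simp
  qed
 qed
 show ?thesis using d[unfolded e] DERIV_cong_ev[OF refl ev refl] by simp
qed

lemma Lt_measurable [measurable]: "Lt t v \<in> borel_measurable surf"
proof -
 have "continuous_on UNIV (%y. cross3 (y::real^3) (cross3 y (mt t v)))" by (intro continuous_on_cross continuous_intros)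
 hence "(%y. cross3 y (cross3 y (mt t v))) \<in> borel_measurable borel" by (rule borel_measurable_continuous_onI)
 thus ?thesis unfolding Lt_def[abs_def] by (intro measurable_surfI) simp
qed

lemma ticone_sets [measurable]: "t \<in> \<T> ==> ticone t \<in> sets borel" by (simp add: open_ticone)

lemma indicator_ticone_measurable: "t \<in> \<T> ==> (ind (ticone t) :: _ => real) \<in> borel_measurable surf"
 by (intro measurable_surfI borel_measurable_indicator) (rule ticone_sets)

lemma LJ_measurable: "LJ v \<in> borel_measurable surf"
 unfolding LJ_def[abs_def] by (intro borel_measurable_sum borel_measurable_scaleR indicator_ticone_measurable Lt_measurable)

lemma LJ_bounded: assumes y: "norm y = 1" shows "norm (LJ v y) <= (SUM t:\<T>. norm (mt t v) / tc t)"
 unfolding LJ_def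
proof (rule sum_norm_le)
 fix t assume t: "t \<in> \<T>"
 show "norm (ind (ticone t) y *R Lt t v y) <= norm (mt t v) / tc t"
  using Lt_bound[OF t _ y] ticone_tcone tc_pos[OF t] by (auto simp: indicator_def intro: less_imp_le)
qed

text \<open>The function is Lipschitz along rotations and differentiable off the sides of the
  triangles, which form a null set; so the sides contribute nothing.\<close>

lemma Jf_parts: "(SI y. Jf v y * ev (LB w) y) = - (SI y. LJ v y .* Lv w y)"
proof (rule parts_LB[OF Jf_measurable _ _ LJ_measurable LJ_bounded])
 define C where "C = (SUM i:I. |v i| )"
 have C: "|v i| <= C" if "i \<in> I" for i unfolding C_def using that by (intro member_le_sum) auto
 show "|Jf v y| <= C" if "y \<in> S2" for y using Jf_bounds[of y "-C" v C] C that by (fastforce simp: abs_le_iff)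
 show "AE y in surf. \<forall>a. norm a = 1 --> ((%t. Jf v (rot a t y)) has_real_derivative a .* LJ v y) (at 0)"
  using AE_ticone
 proof (rule AE_mp[OF _ AE_I2], intro impI allI)
  fix y a assume y: "y \<in> space surf" and e: "\<exists>t\<in>\<T>. y \<in> ticone t" and a: "norm (a :: real^3) = 1"
  then obtain t where t: "t \<in> \<T>" "y \<in> ticone t" by blast
  have "y ~= 0" using y by auto
  thus "((%t. Jf v (rot a t y)) has_real_derivative a .* LJ v y) (at 0)"
   unfolding LJ_eq[OF t] by (rule Jf_rot_derivative[OF a t])
 qed
 show "|Jf v (rot a t y) - Jf v y| <= (SUM t:\<T>. norm (mt t v) / tc t) * t"
  if "norm a = 1" "y \<in> S2" "0 < t" "t <= 1" for a y t using Jf_rot_lipschitz that by simp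
qed simp

end

section \<open>The finite volume system and local quantities\<close>

context vd begin

lemma Jf_scale: assumes "y ~= 0" "r > 0" shows "Jf v (r *R y) = Jf v y"
proof -
 obtain t where t: "t \<in> \<T>" "y \<in> tcone t" by (rule cone_cover[OF assms(1)])
 show ?thesis using Jf_eq[OF t] Jf_eq[OF t(1) cone_scale[OF t(2), of r]] assms(2) by simp
qed

lemma inv_sgn_surface:
 assumes t: "t \<in> \<T>" and y: "y \<in> tcone t" "norm y = 1"
 shows "inv_into (polyhedral_surface N x) sgn y = (1 / (nu t .* y)) *R y" "(1 / (nu t .* y)) *R y \<in> planar_triangle x t"
proof -
 have y0: "y ~= 0" using y by auto
 have p: "nu t .* y > 0" by (rule nu_pos[OF t y(1) y0])
 define q where "q = (1 / (nu t .* y)) *R y"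
 have qt: "q \<in> tcone t" "nu t .* q = 1" "q ~= 0" using cone_scale[OF y(1)] p y0 by (auto simp: q_def)
 show qP: "(1 / (nu t .* y)) *R y \<in> planar_triangle x t" unfolding hull_cone[OF t] q_def[symmetric] using qt by simp
 have qS: "q \<in> polyhedral_surface N x" using qP t by (auto simp: polyhedral_surface_def q_def)
 have sq: "sgn q = y" using p y by (simp add: q_def sgn_div_norm)
 define z where "z = inv_into (polyhedral_surface N x) sgn y"
 have z: "z \<in> polyhedral_surface N x" "sgn z = y"
  unfolding z_def using qS sq by (metis image_eqI inv_into_into, metis image_eqI f_inv_into_f)
 then obtain s where s: "s \<in> \<T>" "z \<in> tcone s" "nu s .* z = 1" using hull_cone by (auto simp: polyhedral_surface_def)
 have zy: "z = norm z *R y" unfolding z(2)[symmetric] by (cases "z = 0") (auto simp: sgn_div_norm)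
 have "z \<in> tcone t" using cone_scale[OF y(1), of "norm z"] zy by simp
 hence "nu t .* z = 1" using nu_eq[OF t s(1)] s by simp
 hence "norm z * (nu t .* y) = 1" by (subst (asm) zy) simp
 hence "norm z = 1 / (nu t .* y)" using p by (simp add: field_simps)
 thus "inv_into (polyhedral_surface N x) sgn y = (1 / (nu t .* y)) *R y" using zy by (simp add: z_def)
qed

lemma inv_sgn_vertex: assumes "i \<in> I" shows "inv_into (polyhedral_surface N x) sgn (x i) = x i"
proof -
 obtain t where t: "t \<in> \<T>" "i \<in> t" by (rule vertex_in_T[OF assms])
 show ?thesis using inv_sgn_surface(1)[OF t(1) vertex_cone[OF t] nx[OF assms]] nu_dot[OF t] by simp
qed

lemma fe_space_Jf:
 assumes u: "u \<in> fe_space N x" and y: "norm y = 1"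
 shows "u y = Jf (%i. u (x i)) y"
proof -
 let ?g = "inv_into (polyhedral_surface N x) sgn"
 obtain w where w: "!!t. t \<in> \<T> ==> affine_on (planar_triangle x t) w" "!!y. y \<in> S2 ==> u y = w (?g y)"
  using u unfolding fe_space_def by blast
 have "y ~= 0" using y by auto
 then obtain t where t: "t \<in> \<T>" "y \<in> tcone t" by (rule cone_cover)
 obtain a b where ab: "!!z. z \<in> planar_triangle x t ==> w z = a .* z + b" using w(1)[OF t(1)] by (auto simp: affine_on_def)
 have ux: "u (x i) = a .* x i + b" if i: "i \<in> t" for i
 proof -
  have "x i \<in> planar_triangle x t" unfolding planar_triangle_def using i by (intro hull_inc) simp
  thus ?thesis using ab w(2)[of "x i"] inv_sgn_vertex nx T_sub[OF t(1) i] by simp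
 qed
 have p: "nu t .* y > 0" using nu_pos[OF t `y ~= 0`] .
 have "u y = a .* ((1 / (nu t .* y)) *R y) + b" using w(2)[of y] inv_sgn_surface[OF t y] ab y by simp
 also have "... = (a .* y + b * (nu t .* y)) / (nu t .* y)" using p by (simp add: field_simps)
 also have "a .* y + b * (nu t .* y) = (SUM i:t. (alpha t i .* y) * (a .* x i)) + b * (SUM i:t. alpha t i .* y)"
  by (subst alpha_rep[OF t(1), of y, symmetric]) (simp add: inner_sum_right nu_dot_sum[OF t(1)])
 also have "... = Av t (%i. u (x i)) .* y"
  unfolding Av_def inner_sum_left sum_distrib_left sum.distrib[symmetric] by (intro sum.cong) (simp_all add: ux algebra_simps)
 finally show ?thesis by (simp add: Jf_eq[OF t])
qed

lemma integrable_Jf: "integrable surf (Jf v)"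
proof (rule integrable_surf_bounded[OF Jf_measurable])
 fix y :: "real^3" assume "y \<in> S2"
 define C where "C = (SUM i:I. |v i| )"
 have "|v i| <= C" if "i \<in> I" for i unfolding C_def using that by (intro member_le_sum) auto
 thus "|Jf v y| <= (SUM i:I. |v i| )" using Jf_bounds[of y "-C" v C] `y \<in> S2` unfolding C_def[symmetric] by (fastforce simp: abs_le_iff)
qed

lemma Jf_fe_space:
 assumes "(SI y. Jf v y) = 0"
 shows "Jf v \<in> fe_space N x"
proof -
 have "continuous_on (polyhedral_surface N x) (Jf v)"
  unfolding polyhedral_surface_def
 proof (rule Jf_continuous_Union)
  fix t assume t: "t \<in> \<T>"
  show "closed (planar_triangle x t)" unfolding planar_triangle_def using T_finite[OF t]
   by (intro compact_imp_closed compact_convex_hull finite_imp_compact) auto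
  show "planar_triangle x t <= tcone t - {0}" unfolding hull_cone[OF t] by auto
 qed
 moreover have "affine_on (planar_triangle x t) (Jf v)" if t: "t \<in> \<T>" for t
  unfolding affine_on_def hull_cone[OF t] by (rule exI[of _ "Av t v"], rule exI[of _ 0]) (simp add: Jf_eq[OF t])
 moreover have "Jf v y = Jf v (inv_into (polyhedral_surface N x) sgn y)" if y: "y \<in> S2" for y
 proof -
  have y0: "y ~= 0" using y by auto
  obtain t where t: "t \<in> \<T>" "y \<in> tcone t" by (rule cone_cover[OF y0])
  show ?thesis using inv_sgn_surface(1)[OF t] y Jf_scale[OF y0, of "1 / (nu t .* y)" v] nu_pos[OF t y0] by simp
 qed
 ultimately show ?thesis using assms integrable_Jf unfolding fe_space_def zero_mean_def by blast
qed

section \<open>The discrete system tested with piecewise constant functions\<close>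

definition vh :: "(nat => real) => real^3 => real" where
 "vh v y = (SUM i:I. v i * ind (voronoi_cell N x i) y)"

lemma cell_sets: assumes "i \<in> I" shows "voronoi_cell N x i \<in> sets surf" "voronoi_cell N x i \<in> sets borel"
proof -
 have "voronoi_cell N x i = S2 Int (\<Inter>j\<in>I - {i}. {y. (x j - x i) .* y < 0})"
  using cell_eq[OF assms] by (auto simp: inner_diff_left)
 moreover have "open (\<Inter>j\<in>I - {i}. {y. (x j - x i) .* y < 0})" by (intro open_INT) (auto intro: open_halfspace_lt)
 ultimately show b: "voronoi_cell N x i \<in> sets borel" by (metis sets.Int borel_open borel_closed closed_sphere)
 show "voronoi_cell N x i \<in> sets surf" using b cell_eq[OF assms] by (intro sets_surfI) auto
qed

lemma vh_measurable: "vh v \<in> borel_measurable surf"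
 unfolding vh_def[abs_def] using cell_sets by (intro borel_measurable_sum borel_measurable_times borel_measurable_indicator) auto

lemma cell_disjoint: assumes "i \<in> I" "j \<in> I" "y \<in> voronoi_cell N x i" "y \<in> voronoi_cell N x j" shows "i = j"
proof (rule ccontr)
 assume "i ~= j"
 hence "x j .* y < x i .* y" "x i .* y < x j .* y" using assms by (auto simp: cell_eq)
 thus False by linarith
qed

lemma vh_eq: assumes "i \<in> I" "y \<in> voronoi_cell N x i" shows "vh v y = v i"
proof -
 have "y ~: voronoi_cell N x j" if "j \<in> I" "j ~= i" for j using cell_disjoint[OF that(1) assms(1) _ assms(2)] that(2) by blast
 hence "vh v y = (SUM j:I. if j = i then v i else 0)" unfolding vh_def by (intro sum.cong refl) (simp add: assms(2))
 thus ?thesis using assms by simp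
qed

lemma AE_cell: "AE y in surf. \<exists>i\<in>I. y \<in> voronoi_cell N x i"
proof -
 have "AE y in surf. \<forall>i\<in>I. \<forall>j\<in>I - {i}. (x i - x j) .* y ~= 0"
  using inj_x by (intro AE_finite_allI surf_hyperplane_null) auto
 thus ?thesis
 proof (rule AE_mp[OF _ AE_I2], intro impI)
  fix y assume y: "y \<in> space surf" and a: "\<forall>i\<in>I. \<forall>j\<in>I - {i}. (x i - x j) .* y ~= 0"
  have ne: "I ~= {}" using max_pos[of y] y by auto
  define m where "m = Max ((%i. x i .* y) ` I)"
  have "m \<in> (%i. x i .* y) ` I" unfolding m_def using ne by (intro Max_in) auto
  then obtain i where i: "i \<in> I" "x i .* y = m" by auto
  have "x j .* y < x i .* y" if j: "j \<in> I - {i}" for j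
  proof -
   have "x j .* y <= m" unfolding m_def using j by (intro Max_ge) auto
   moreover have "x i .* y ~= x j .* y" using a i(1) j by (auto simp: inner_diff_left)
   ultimately show ?thesis using i by simp
  qed
  hence "y \<in> voronoi_cell N x i" unfolding cell_eq[OF i(1)] using y by simp
  thus "\<exists>i\<in>I. y \<in> voronoi_cell N x i" using i(1) by blast
 qed
qed

lemma vh_bounded: "|vh v y| <= (SUM i:I. |v i| )"
 unfolding vh_def by (rule order_trans[OF sum_abs sum_mono]) (auto simp: indicator_def)

text \<open>Test functions in \<open>fe_space\<close> have mean zero. An arbitrary v is shifted by
  the mean of its interpolant: the form sees only differences and f has mean zero, so neither side
  changes.\<close>

lemma fv_system:
 assumes s: "fv_solution N x f u" and f: "sqi surf f" "(SI y. f y) = 0"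
 shows "Bh (%i. u (x i)) v = (SI y. f y * vh v y)"
proof -
 define c where "c = (SI y. Jf v y) / area S2"
 define w where "w = Jf (%i. v i - c)"
 have wx: "w (x i) = v i - c" if "i \<in> I" for i using Jf_vertex[OF that] by (simp add: w_def)
 have "(SI y. w y) = (SI y. Jf v y - c)"
  unfolding w_def by (intro LI_cong refl Jf_add_const) auto
 also have "... = 0" using integrable_Jf area_S2_pos by (simp add: c_def)
 finally have "w \<in> fe_space N x" unfolding w_def by (rule Jf_fe_space)
 hence "Bh (%i. u (x i)) (%i. pw_const N x w (x i)) = (SI y. f y * pw_const N x w y)"
  using s unfolding fv_solution_def fv_form_Bh by blast
 moreover have pw: "pw_const N x w y = vh (%i. w (x i)) y" for y by (simp add: pw_const_def vh_def I_def)
 have xc: "x i \<in> voronoi_cell N x i" if "i \<in> I" for i using dot_less_1[of _ i] that nx by (simp add: cell_eq xx)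
 have "vh (%i. w (x i)) (x i) = v i - c" if "i \<in> I" for i using vh_eq[OF that xc[OF that]] wx[OF that] by simp
 hence "Bh (%i. u (x i)) (%i. pw_const N x w (x i)) = Bh (%i. u (x i)) v"
  unfolding Bh_def pw using T_sub by (intro arg_cong[of _ _ "(*) (1/2)"] sum.cong refl) auto
 moreover have "(SI y. f y * pw_const N x w y) = (SI y. f y * vh v y - c * f y)"
 proof (rule integral_cong_AE)
  show "AE y in surf. f y * pw_const N x w y = f y * vh v y - c * f y" using AE_cell
  proof (rule AE_mp[OF _ AE_I2], intro impI)
   fix y assume "\<exists>i\<in>I. y \<in> voronoi_cell N x i"
   then obtain i where i: "i \<in> I" "y \<in> voronoi_cell N x i" by blast
   show "f y * pw_const N x w y = f y * vh v y - c * f y" unfolding pw vh_eq[OF i] wx[OF i(1)] by (simp add: algebra_simps)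
  qed
  show "(%y. f y * pw_const N x w y) \<in> borel_measurable surf" "(%y. f y * vh v y - c * f y) \<in> borel_measurable surf"
   using f(1) vh_measurable unfolding pw sqi_def by (auto intro!: borel_measurable_times borel_measurable_diff)
 qed
 moreover have "... = (SI y. f y * vh v y) - c * (SI y. f y)"
 proof -
  have "sqi surf (vh v)" using vh_bounded by (intro surf.sqi_bounded[OF vh_measurable]) auto
  hence "integrable surf (%y. f y * vh v y)" using f(1) by (intro sqi_mult)
  moreover have "integrable surf f" using f(1) by (rule surf.sqi_integrable)
  ultimately show ?thesis by simp
 qed
 ultimately show ?thesis using f(2) by simp
qed

text \<open>Twice the area of the planar triangle. A triangle is a set, so an ordering of its
  vertices is chosen; all orderings give the same value.\<close>

definition Dt :: "nat set => real" where
 "Dt t = (SOME D. \<exists>i j k. t = {i, j, k} & i ~= j & i ~= k & j ~= k & D = norm (crossN (x i) (x j) (x k)))"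

lemma Dt_eq: assumes "t = {i, j, k}" "i ~= j" "i ~= k" "j ~= k" shows "Dt t = norm (crossN (x i) (x j) (x k))"
proof -
 let ?n = "%i j k. norm (crossN (x i) (x j) (x k))"
 have p: "?n b c a = ?n a b c" "?n b a c = ?n a b c" "?n c a b = ?n a b c" "?n a c b = ?n a b c" "?n c b a = ?n a b c" for a b c
  using norm_crossN_perm by metis+
 have "\<exists>i j k. t = {i, j, k} & i ~= j & i ~= k & j ~= k & Dt t = ?n i j k"
  unfolding Dt_def by (rule someI_ex) (use assms in blast)
 then obtain a b c where abc: "t = {a, b, c}" "a ~= b" "a ~= c" "b ~= c" "Dt t = ?n a b c" by blast
 hence "i \<in> {a, b, c}" "j \<in> {a, b, c}" "k \<in> {a, b, c}" using assms(1) by auto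
 thus ?thesis unfolding abc(5) using p[of a b c] assms(2-4) by (elim insertE emptyE) simp_all
qed

lemma T_crossN:
 assumes t: "t \<in> \<T>" and e: "t = {i, j, k}" "i ~= j" "i ~= k" "j ~= k"
 defines "M == crossN (x i) (x j) (x k)"
 shows "M = (M .* tn t) *R tn t" "norm M = Dt t" "Dt t > 0" "|x i .* cross3 (x j) (x k)| = Dt t * tc t"
proof -
 have m: "i \<in> t" "j \<in> t" "k \<in> t" using e by auto
 have mI: "i \<in> I" "j \<in> I" "k \<in> I" using T_sub[OF t] m by auto
 have ne: "x i ~= x j" "x j ~= x k" "x i ~= x k" using inj_x mI e by auto
 have d: "tn t .* x i = tc t" "tn t .* x j = tc t" "tn t .* x k = tc t" using tn_dot[OF t] m by (simp_all add: inner_commute)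
 note c = crossN_facts[OF nx[OF mI(1)] nx[OF mI(2)] nx[OF mI(3)] norm_tn[OF t] ne d]
 show "M = (M .* tn t) *R tn t" unfolding M_def by (rule c(1))
 show nM: "norm M = Dt t" unfolding M_def using Dt_eq[OF e] by simp
 show "Dt t > 0" unfolding nM[symmetric] M_def using c(4) by simp
 have "|M .* tn t| = Dt t" unfolding nM[symmetric] using c(3) unfolding M_def norm_eq_sqrt_inner by simp
 thus "|x i .* cross3 (x j) (x k)| = Dt t * tc t" using c(2) tc_pos[OF t] unfolding M_def by (simp add: abs_mult)
qed

lemma Dt_pos: assumes t: "t \<in> \<T>" shows "Dt t > 0"
proof -
 obtain k where k: "k \<in> t" using T_nonempty[OF t] by blast
 obtain i j where "t = {i, j, k}" "i ~= j" "i ~= k" "j ~= k" by (rule T_triple[OF t k])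
 thus ?thesis by (rule T_crossN(3)[OF t])
qed

definition bt :: "nat set => (nat => real) => real^3" where
 "bt t v = Av t v - (Av t v .* tn t) *R tn t"

lemma bt_facts:
 assumes t: "t \<in> \<T>"
 shows "bt t v .* tn t = 0" "mt t v .* mt t w = bt t v .* bt t w" "norm (mt t v) = norm (bt t v)"
  "mt t v .* tn t = 0" "i \<in> t ==> j \<in> t ==> bt t v .* (x i - x j) = v i - v j"
proof -
 have n: "tn t .* tn t = 1" using norm_tn[OF t] by (simp add: norm_eq_1)
 show "bt t v .* tn t = 0" by (simp add: bt_def inner_diff_left n)
 show m: "mt t v .* mt t w = bt t v .* bt t w" for w
  unfolding mt_def bt_def dot_cross by (simp add: inner_diff_left inner_diff_right n inner_commute)
 show "norm (mt t v) = norm (bt t v)" unfolding norm_eq_sqrt_inner m ..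
 show "mt t v .* tn t = 0" unfolding mt_def by (simp add: dot_cross_self inner_commute)
 assume ij: "i \<in> t" "j \<in> t"
 have "tn t .* (x i - x j) = 0" using tn_dot[OF t] ij by (simp add: inner_diff_right inner_commute)
 thus "bt t v .* (x i - x j) = v i - v j" unfolding bt_def inner_diff_left
  by (simp add: inner_diff_right Av_dot[OF t] ij)
qed

lemma diff_le_mt: "t \<in> \<T> ==> i \<in> t ==> j \<in> t ==> |v i - v j| <= norm (mt t v) * dd i j"
 using Cauchy_Schwarz_ineq2[of "bt t v" "x i - x j"] bt_facts(3,5)[of t] by (simp add: dd_def norm_minus_commute)

section \<open>Stiffness, shape and area of a single triangle\<close>

lemma sum_pairs:
 fixes F :: "nat => nat => real"
 assumes "t = {i, j, k}" "i ~= j" "i ~= k" "j ~= k" and s: "!!i j. F i j = F j i"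
 shows "(SUM a:t. SUM b:t - {a}. F a b) = 2 * (F i j + F j k + F k i)"
proof -
 have "t - {i} = {j, k}" "t - {j} = {i, k}" "t - {k} = {i, j}" using assms by auto
 thus ?thesis using assms(1-4) s[of j i] s[of k j] s[of i k] by (simp add: assms(1))
qed

text \<open>The cotangent formula, with each unordered pair occurring twice in the double
  sum.\<close>

lemma local_form:
 assumes t: "t \<in> \<T>"
 shows "(SUM i:t. SUM j:t - {i}. omega t i j * ((v i - v j) * (w i - w j))) = Dt t * (mt t v .* mt t w)"
proof -
 obtain k where k: "k \<in> t" using T_nonempty[OF t] by blast
 obtain i j where e: "t = {i, j, k}" "i ~= j" "i ~= k" "j ~= k" by (rule T_triple[OF t k])
 note c = T_crossN[OF t e]
 have m: "i \<in> t" "j \<in> t" using e by auto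
 have o: "omega t i j = om (x i) (x j) (x k)" "omega t j k = om (x j) (x k) (x i)" "omega t k i = om (x k) (x i) (x j)"
  using third_eq[of i k j] third_eq[of j i k] third_eq[of k j i] e by (simp_all add: omega_def insert_commute)
 have "(SUM i:t. SUM j:t - {i}. omega t i j * ((v i - v j) * (w i - w j)))
  = 2 * (omega t i j * ((v i - v j) * (w i - w j)) + omega t j k * ((v j - v k) * (w j - w k)) + omega t k i * ((v k - v i) * (w k - w i)))"
  by (rule sum_pairs[OF e]) (simp add: omega_sym[of t] algebra_simps)
 also have "... = 2 * (norm (crossN (x i) (x j) (x k)) / 2 * (bt t v .* bt t w))"
  using cotangent_identity[OF c(1) _ bt_facts(1)[OF t] bt_facts(1)[OF t], of v w] c(2,3) m k
  by (simp add: bt_facts(5)[OF t] o)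
 finally show ?thesis using c(2) by (simp add: bt_facts(2)[OF t])
qed

text \<open>The gradient is recovered from two sides: by Lagrange's identity its cross product with
  the normal combines these sides, with increments of v as coefficients.\<close>

lemma mt_le:
 assumes t: "t \<in> \<T>" and d: "!!i j. i \<in> t ==> j \<in> t ==> |v i - v j| <= de" and l: "!!i j. i \<in> t ==> j \<in> t ==> dd i j <= l"
 shows "Dt t * norm (mt t v) <= 2 * de * l"
proof -
 obtain k where k: "k \<in> t" using T_nonempty[OF t] by blast
 obtain i j where e: "t = {i, j, k}" "i ~= j" "i ~= k" "j ~= k" by (rule T_triple[OF t k])
 have m: "i \<in> t" "j \<in> t" using e by auto
 note c = T_crossN[OF t e]
 let ?M = "crossN (x i) (x j) (x k)"
 have "bt t v .* ?M = 0" by (subst c(1)) (simp add: bt_facts(1)[OF t])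
 hence "(norm (cross3 (bt t v) ?M))^2 = (norm (bt t v) * norm ?M)^2" using norm_cross_dot[of "bt t v" ?M] by simp
 hence "norm (cross3 (bt t v) ?M) = norm (bt t v) * norm ?M" by (rule power2_eq_imp_eq) auto
 moreover have "cross3 (bt t v) ?M = (bt t v .* (x j - x k)) *R (x i - x k) - (bt t v .* (x i - x k)) *R (x j - x k)"
  unfolding crossN_def Lagrange ..
 moreover have "norm ((v j - v k) *R (x i - x k) - (v i - v k) *R (x j - x k)) <= de * l + de * l"
 proof (rule order_trans[OF norm_triangle_ineq4])
  have "norm (x i - x k) <= l" "norm (x j - x k) <= l" using l[of k i] l[of k j] m k by (auto simp: dd_def)
  moreover have "de >= 0" using d[OF k k] by simp
  ultimately have "|v j - v k| * norm (x i - x k) <= de * l" "|v i - v k| * norm (x j - x k) <= de * l"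
   using d[OF m(2) k] d[OF m(1) k] by (auto intro!: mult_mono)
  thus "norm ((v j - v k) *R (x i - x k)) + norm ((v i - v k) *R (x j - x k)) <= de * l + de * l" by simp
 qed
 ultimately show ?thesis using c(2) bt_facts(3)[OF t] bt_facts(5)[OF t] m k by (simp add: mult_ac)
qed

lemma omega_le:
 assumes t: "t \<in> \<T>" and l: "!!i j. i \<in> t ==> j \<in> t ==> dd i j <= l" and i: "i \<in> t" "j \<in> t" "i ~= j"
 shows "|omega t i j| <= l^2 / (2 * Dt t)"
proof -
 obtain a b where e: "t = {a, b, j}" "a ~= b" "a ~= j" "b ~= j" by (rule T_triple[OF t i(2)])
 then obtain k where k: "t = {i, j, k}" "i ~= k" "j ~= k" using i by blast
 have D: "Dt t > 0" by (rule Dt_pos[OF t])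
 have o: "omega t i j = ((x i - x k) .* (x j - x k)) / (2 * Dt t)"
  using third_eq[OF k(2,3)] Dt_eq[OF k(1) i(3) k(2,3)] k(1) by (simp add: omega_def om_def)
 have "|(x i - x k) .* (x j - x k)| <= norm (x i - x k) * norm (x j - x k)" by (rule Cauchy_Schwarz_ineq2)
 also have "... <= l * l" using l[of k i] l[of k j] i k by (intro mult_mono) (auto simp: dd_def intro: order_trans[OF norm_ge_zero])
 finally show ?thesis unfolding o using D by (simp add: power2_eq_square divide_right_mono)
qed

text \<open>The product of the sides is twice the circumradius times \<open>Dt\<close>. The planar
  circumcentre is q as seen from a vertex, and |q| is at most the distance r of the vertices from
  the Voronoi vertex.\<close>

lemma Dt_ge:
 assumes t: "t \<in> \<T>" and d: "!!i j. i \<in> t ==> j \<in> t ==> i ~= j ==> de <= dd i j" "de >= 0"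
  and r: "!!i. i \<in> t ==> norm (tn t - x i) <= r"
 shows "de ^ 3 <= 2 * r * Dt t"
proof -
 obtain k where k: "k \<in> t" using T_nonempty[OF t] by blast
 obtain i j where e: "t = {i, j, k}" "i ~= j" "i ~= k" "j ~= k" by (rule T_triple[OF t k])
 have m: "i \<in> t" "j \<in> t" using e by auto
 have mI: "i \<in> I" "j \<in> I" "k \<in> I" using T_sub[OF t] m k by auto
 define u v q where "u = x i - x k" and "v = x j - x k" and "q = tc t *R tn t - x k"
 have n1: "tn t .* tn t = 1" using norm_tn[OF t] by (simp add: norm_eq_1)
 have nd: "tn t .* x l = tc t" if "l \<in> t" for l using tn_dot[OF t that] by (simp add: inner_commute)
 have q: "2 * (q .* u) = u .* u" "2 * (q .* v) = v .* v"
  unfolding u_def v_def q_def using xx mI nd m k by (simp_all add: inner_diff_left inner_diff_right inner_commute)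
 have "norm q <= norm (tn t - x k)"
 proof (rule power2_le_imp_le)
  have "(norm (tn t - x k))^2 - (norm q)^2 = (1 - tc t)^2"
   unfolding q_def power2_norm_eq_inner by (simp add: inner_diff_left inner_diff_right n1 nd[OF k] tn_dot[OF t k] power2_eq_square algebra_simps)
  thus "(norm q)^2 <= (norm (tn t - x k))^2" by (smt (verit) zero_le_power2)
 qed simp
 hence qr: "norm q <= r" using r[OF k] by simp
 have "cross3 q (cross3 u v) = (q .* v) *R u - (q .* u) *R v" by (rule Lagrange)
 hence "2 *R cross3 q (cross3 u v) = (v .* v) *R u - (u .* u) *R v" using q by (simp add: scaleR_diff_right)
 moreover have "norm ((v .* v) *R u - (u .* u) *R v) = norm u * norm v * norm (u - v)"
 proof (rule power2_eq_imp_eq)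
  show "(norm ((v .* v) *R u - (u .* u) *R v))^2 = (norm u * norm v * norm (u - v))^2"
   unfolding power_mult_distrib power2_norm_eq_inner
   by (simp add: inner_diff_left inner_diff_right inner_commute algebra_simps)
 qed auto
 ultimately have "norm u * norm v * norm (u - v) = 2 * norm (cross3 q (cross3 u v))" by (metis norm_scaleR abs_numeral)
 also have "... <= 2 * (norm q * norm (cross3 u v))" using norm_cross_le by simp
 also have "... <= 2 * (r * Dt t)" using T_crossN(2)[OF t e] qr unfolding crossN_def u_def[symmetric] v_def[symmetric] using Dt_pos[OF t] by (simp add: mult_right_mono)
 finally have "norm u * norm v * norm (u - v) <= 2 * (r * Dt t)" .
 moreover have "de <= norm u" "de <= norm v" "de <= norm (u - v)"
  using d(1)[of k i] d(1)[of k j] d(1)[of j i] m k e by (auto simp: dd_def u_def v_def)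
 hence "de * de * de <= norm u * norm v * norm (u - v)" using d(2) by (intro mult_mono) auto
 ultimately show ?thesis by (simp add: power3_eq_cube)
qed

text \<open>The solid is the simplex spanned by 0 and r times the generators; six times its content
  is a determinant.\<close>

lemma simplex_content:
 assumes t: "t \<in> \<T>" and r: "r > 0"
 shows "emeasure lborel {y \<in> tcone t. nu t .* y <= r} = ennreal (r ^ 3 * (Dt t * tc t) / 6)"
proof -
 obtain k where k: "k \<in> t" using T_nonempty[OF t] by blast
 obtain i j where e: "t = {i, j, k}" "i ~= j" "i ~= k" "j ~= k" by (rule T_triple[OF t k])
 have mI: "i \<in> I" "j \<in> I" "k \<in> I" using T_sub[OF t] e by auto
 have ne: "x i ~= x j" "x j ~= x k" "x i ~= x k" using inj_x mI e by auto
 have n0: "x i ~= 0" "x j ~= 0" "x k ~= 0" using nx mI by force+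
 define f :: "3 => real^3" where "f m = r *R (if m = 1 then x i else if m = 2 then x j else x k)" for m
 define X where "X = insert 0 ((*R) r ` (x ` t))"
 have "bij_betw f UNIV (X - {0})"
 proof (rule bij_betw_imageI)
  show "inj f" unfolding inj_on_def f_def using three_neq ne r exhaust_3 by (auto split: if_splits)
  have X0: "X - {0} = {r *R x i, r *R x j, r *R x k}" using r n0 by (auto simp: X_def e(1))
  show "f ` UNIV = X - {0}" unfolding X0 UNIV_3 by (auto simp: f_def three_neq)
 qed
 moreover have "card X = Suc CARD(3)"
 proof -
  have "card X = Suc (card ((*R) r ` (x ` t)))" unfolding X_def using r n0 by (intro card_insert_disjoint) (auto simp: e(1))
  also have "card ((*R) r ` (x ` t)) = card t"
   using r ne e(2-4) by (simp add: card_image inj_on_def e(1))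
  finally show ?thesis using T_card[OF t] by simp
 qed
 ultimately have "measure lborel (convex hull X) = |det (\<chi> a b. f b $ a - (0::real^3) $ a)| / fact CARD(3)"
  using T_finite[OF t] by (intro content_simplex) (auto simp: X_def)
 also have "det (\<chi> a b. f b $ a - (0::real^3) $ a) = r ^ 3 * (x i .* cross3 (x j) (x k))"
  by (simp add: det_3 f_def three_neq cross3_def inner_vec_def sum_3 power3_eq_cube algebra_simps)
 also have "|r ^ 3 * (x i .* cross3 (x j) (x k))| = r ^ 3 * (Dt t * tc t)" using T_crossN(4)[OF t e] r by (simp add: abs_mult)
 finally have c: "measure lborel (convex hull X) = r ^ 3 * (Dt t * tc t) / 6" by (simp add: fact_numeral)
 have h: "convex hull ((*R) r ` (x ` t)) = (*R) r ` planar_triangle x t" unfolding planar_triangle_def by (rule convex_hull_scaling)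
 have S: "convex hull X = {y \<in> tcone t. nu t .* y <= r}"
 proof
  show "convex hull X <= {y \<in> tcone t. nu t .* y <= r}"
  proof (rule hull_minimal)
   show "X <= {y \<in> tcone t. nu t .* y <= r}"
    unfolding X_def using r cone_scale[OF vertex_cone[OF t]] nu_dot[OF t] by (auto simp: tcone_def)
   have "{y \<in> tcone t. nu t .* y <= r} = {y. nu t .* y <= r} Int (\<Inter>i\<in>t. {y. alpha t i .* y >= 0})" by (auto simp: tcone_def)
   thus "convex {y \<in> tcone t. nu t .* y <= r}"
    by (auto intro!: convex_Int convex_INT convex_halfspace_le convex_halfspace_ge)
  qed
  show "{y \<in> tcone t. nu t .* y <= r} <= convex hull X"
  proof
   fix y assume y: "y \<in> {y \<in> tcone t. nu t .* y <= r}"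
   show "y \<in> convex hull X"
   proof (cases "y = 0")
    case True thus ?thesis by (intro hull_inc) (simp add: X_def)
   next
    case False
    define s where "s = nu t .* y"
    have s: "s > 0" "s <= r" using nu_pos[OF t _ False] y by (auto simp: s_def)
    have "(1 / s) *R y \<in> planar_triangle x t" unfolding hull_cone[OF t] using y s cone_scale[of y t "1 / s"] by (simp add: s_def)
    hence "r *R ((1 / s) *R y) \<in> convex hull ((*R) r ` (x ` t))" unfolding h by (rule imageI)
    moreover have "convex hull ((*R) r ` (x ` t)) <= convex hull X" by (rule hull_mono) (auto simp: X_def)
    ultimately have "r *R ((1 / s) *R y) \<in> convex hull X" by blast
    moreover have "0 \<in> convex hull X" by (intro hull_inc) (simp add: X_def)
    ultimately have "(1 - s / r) *R 0 + (s / r) *R (r *R ((1 / s) *R y)) \<in> convex hull X"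
     using s r by (intro convexD[OF convex_convex_hull]) auto
    thus ?thesis using s r by simp
   qed
  qed
 qed
 have "compact (convex hull X)" using T_finite[OF t] by (intro compact_convex_hull finite_imp_compact) (auto simp: X_def)
 hence "emeasure lborel (convex hull X) = ennreal (measure lborel (convex hull X))"
  by (intro emeasure_eq_ennreal_measure) (use emeasure_compact_finite in "auto simp: less_top")
 thus ?thesis unfolding S[symmetric] c by simp
qed

text \<open>The solid cone over the spherical triangle contains the simplex cut off where
  \<open>nu t\<close> is 1 and lies in the one cut off where it is 1 / \<open>tc t\<close>.\<close>

lemma area_bounds:
 assumes t: "t \<in> \<T>"
 shows "tc t * Dt t / 2 <= area (ticone t Int S2)" "area (ticone t Int S2) <= Dt t / (2 * (tc t)^2)"
proof -
 let ?A = "tcone t Int S2" and ?B = "{y. sgn y \<in> tcone t Int S2 & norm y <= 1}"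
 have c: "tc t > 0" and D: "Dt t > 0" using tc_pos[OF t] Dt_pos[OF t] by auto
 have sg: "sgn y \<in> tcone t Int S2 \<longleftrightarrow> y \<in> tcone t & y ~= 0" for y
 proof
  assume a: "sgn y \<in> tcone t Int S2"
  have "y = norm y *R sgn y" by (cases "y = 0") (auto simp: sgn_div_norm)
  thus "y \<in> tcone t & y ~= 0" using a cone_scale[of "sgn y" t "norm y"] by auto
 qed (simp add: sgn_div_norm cone_scale norm_sgn)
 have Ab: "?A \<in> sets borel" using closed_cone[of t] by auto
 have e: "emeasure surf ?A = 3 * emeasure lborel ?B" by (rule emeasure_surf[OF Ab]) auto
 have eA: "emeasure surf ?A = ennreal (area ?A)" by (rule surf.emeasure_eq_measure)
 have Bb: "?B \<in> sets borel"
 proof -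
  have "?B = (tcone t Int cball 0 1) - {0}" unfolding sg by auto
  thus ?thesis using closed_cone[of t] by auto
 qed
 have sb: "{y \<in> tcone t. nu t .* y <= r} \<in> sets borel" for r
 proof -
  have "{y \<in> tcone t. nu t .* y <= r} = tcone t Int {y. nu t .* y <= r}" by auto
  thus ?thesis using closed_cone[of t] closed_halfspace_le by (metis closed_Int borel_closed)
 qed
 have ae: "area (ticone t Int S2) = area ?A"
 proof (rule measure_eq_AE)
  show "AE y in surf. y \<in> ticone t Int S2 \<longleftrightarrow> y \<in> tcone t Int S2" using AE_ticone
  proof (rule AE_mp[OF _ AE_I2], intro impI)
   fix y assume "\<exists>s\<in>\<T>. y \<in> ticone s"
   thus "y \<in> ticone t Int S2 \<longleftrightarrow> y \<in> tcone t Int S2" using ticone_disjoint[OF _ t] ticone_tcone by blast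
  qed
  show "ticone t Int S2 \<in> sets surf" using ticone_sets[OF t] by (intro sets_surfI) auto
  show "?A \<in> sets surf" using Ab by (intro sets_surfI) auto
 qed
 have "emeasure lborel {y \<in> tcone t. nu t .* y <= 1} = emeasure lborel ({y \<in> tcone t. nu t .* y <= 1} - {0})"
  using sb by (intro emeasure_Diff_null_set[symmetric]) auto
 also have "... <= emeasure lborel ?B"
  using Bb nu_ge[OF t] unfolding sg by (intro emeasure_mono) (auto intro: order_trans)
 finally have "3 * ennreal (1 ^ 3 * (Dt t * tc t) / 6) <= ennreal (area ?A)"
  unfolding eA[symmetric] e simplex_content[OF t zero_less_one] by (rule mult_left_mono) simp
 hence "ennreal (3 * ((Dt t * tc t) / 6)) <= ennreal (area ?A)" using c D by (subst ennreal_mult) auto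
 thus "tc t * Dt t / 2 <= area (ticone t Int S2)" unfolding ae using measure_nonneg[of surf ?A] by (simp add: ennreal_le_iff mult.commute)
 have "emeasure lborel ?B <= emeasure lborel {y \<in> tcone t. nu t .* y <= 1 / tc t}"
 proof (rule emeasure_mono)
  show "?B <= {y \<in> tcone t. nu t .* y <= 1 / tc t}"
  proof
   fix y assume y: "y \<in> ?B"
   have "tn t .* y <= norm (tn t) * norm y" by (rule norm_cauchy_schwarz)
   hence "tn t .* y <= 1" using y norm_tn[OF t] by simp
   thus "y \<in> {y \<in> tcone t. nu t .* y <= 1 / tc t}" using y c unfolding sg by (simp add: nu_def divide_right_mono)
  qed
 qed (use sb in simp)
 hence "ennreal (area ?A) <= 3 * ennreal ((1 / tc t) ^ 3 * (Dt t * tc t) / 6)"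
  using c unfolding eA[symmetric] e by (subst simplex_content[OF t, symmetric]) (auto intro: mult_left_mono)
 also have "... = ennreal (3 * ((1 / tc t) ^ 3 * (Dt t * tc t) / 6))" using c D by (subst ennreal_mult) auto
 also have "3 * ((1 / tc t) ^ 3 * (Dt t * tc t) / 6) = Dt t / (2 * (tc t)^2)" using c by (simp add: field_simps power3_eq_cube power2_eq_square)
 finally show "area (ticone t Int S2) <= Dt t / (2 * (tc t)^2)" unfolding ae using D by (subst (asm) ennreal_le_iff) auto
qed

end

section \<open>Consistency of the discrete form on fine meshes\<close>

lemma arctan_cubic: "|arctan z - z| <= |z| ^ 3"
proof -
 have "norm ((arctan z - z) - (arctan 0 - 0)) <= z^2 * norm (z - 0)"
 proof (rule field_differentiable_bound[where S = "{- |z|..|z|}" and f' = "%s. inverse (1 + s^2) - 1"])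
  fix s assume s: "s \<in> {- |z|..|z|}"
  show "((%s. arctan s - s) has_field_derivative inverse (1 + s^2) - 1) (at s within {- |z|..|z|})"
   by (auto intro!: derivative_eq_intros)
  have p: "1 + s^2 > 0" by (smt (verit) zero_le_power2)
  have "|s| <= |z|" using s by auto
  hence "s^2 <= z^2" using abs_le_square_iff by blast
  moreover have "inverse (1 + s^2) - 1 = - (s^2 / (1 + s^2))" using p by (simp add: field_simps)
  moreover have "s^2 / (1 + s^2) <= s^2 / 1" by (intro divide_left_mono) (use p in auto)
  ultimately show "norm (inverse (1 + s^2) - 1) <= z^2" by simp
 qed auto
 thus ?thesis by (simp add: power2_eq_square power3_eq_cube abs_mult)
qed

lemma integral_partition:
 fixes F :: "'a => real"
 assumes F: "integrable M F" and S: "finite S" and m: "!!s. s \<in> S ==> (ind (A s) :: 'a => real) \<in> borel_measurable M"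
  and c: "AE y in M. \<exists>s\<in>S. y \<in> A s" and d: "!!s s' y. s \<in> S ==> s' \<in> S ==> y \<in> A s ==> y \<in> A s' ==> s = s'"
 shows "(\<integral>y. F y \<partial>M) = (SUM s:S. \<integral>y. ind (A s) y * F y \<partial>M)"
  and "s \<in> S ==> integrable M (%y. ind (A s) y * F y)"
proof -
 show i: "integrable M (%y. ind (A s) y * F y)" if "s \<in> S" for s
 proof (rule LI_bound[OF F])
  show "(%y. ind (A s) y * F y) \<in> borel_measurable M"
   by (intro borel_measurable_times m that borel_measurable_integrable F)
 qed (auto simp: indicator_def)
 have "(\<integral>y. F y \<partial>M) = (\<integral>y. (SUM s:S. ind (A s) y * F y) \<partial>M)"
 proof (rule integral_cong_AE)
  show "AE y in M. F y = (SUM s:S. ind (A s) y * F y)" using c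
  proof (rule AE_mp[OF _ AE_I2], intro impI)
   fix y assume "\<exists>s\<in>S. y \<in> A s"
   then obtain s where s: "s \<in> S" "y \<in> A s" by blast
   have "y ~: A s'" if "s' \<in> S" "s' ~= s" for s' using d[OF that(1) s(1) _ s(2)] that(2) by blast
   hence "(SUM s:S. ind (A s) y * F y) = (\<Sum>s'\<in>S. if s' = s then F y else 0)"
    by (intro sum.cong refl) (simp add: s(2))
   thus "F y = (SUM s:S. ind (A s) y * F y)" using s(1) S by simp
  qed
 qed (use F i in "auto intro!: borel_measurable_sum dest!: borel_measurable_integrable")
 also have "... = (SUM s:S. \<integral>y. ind (A s) y * F y \<partial>M)" by (rule LI_sum[OF i])
 finally show "(\<integral>y. F y \<partial>M) = (SUM s:S. \<integral>y. ind (A s) y * F y \<partial>M)" .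
qed

context vd begin

lemma split_ticone:
 fixes F :: "real^3 => real"
 assumes F: "integrable surf F"
 shows "(SI y. F y) = (SUM t:\<T>. \<integral>y. ind (ticone t) y * F y \<partial>surf)"
  and "t \<in> \<T> ==> integrable surf (%y. ind (ticone t) y * F y)"
 using integral_partition[OF F finite_T, of ticone] AE_ticone indicator_ticone_measurable ticone_disjoint subsetD[OF ticone_tcone]
 by blast+

lemma split_cell:
 fixes F :: "real^3 => real"
 assumes F: "integrable surf F"
 shows "(SI y. F y) = (SUM i:I. \<integral>y. ind (voronoi_cell N x i) y * F y \<partial>surf)"
  and "i \<in> I ==> integrable surf (%y. ind (voronoi_cell N x i) y * F y)"
 using integral_partition[OF F finite_I, of "voronoi_cell N x"] AE_cell cell_disjoint borel_measurable_indicator[OF cell_sets(1)]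
 by blast+

end

text \<open>\<open>h_Dt\<close> bounds the shape of the triangles: their sides are at most 2 h,
  their areas at least a multiple of h^2. \<open>W_h\<close> concerns chords, which the geodesic
  mesh size bounds as well. \<open>Q\<close> and \<open>a0\<close> will depend on the uniformity
  constants alone.\<close>

locale fine = vd +
 fixes h Q a0 :: real
 assumes h0: "0 < h" and h1: "h <= 1 / 100" and Q1: "Q >= 1" and a0: "a0 > 0"
  and W_h: "!!i y. i \<in> I ==> y \<in> W i ==> norm (y - x i) <= h"
  and h_Dt: "!!t. t \<in> \<T> ==> 2 * h^2 <= Q * Dt t"
  and area_ge: "!!i. i \<in> I ==> a0 * h^2 <= area (voronoi_cell N x i)"
  and centroid: "!!i e. i \<in> I ==> e .* x i = 0 ==> (SI y. ind (voronoi_cell N x i) y * (e .* y)) = 0"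
begin

lemma hh: "h^2 <= 1 / 10000" "0 < h^2" "h * h = h^2"
 using power_mono[OF h1, of 2] h0 by (simp_all add: power2_eq_square)

lemma tn_near: "t \<in> \<T> ==> i \<in> t ==> norm (tn t - x i) <= h"
 using W_h[OF T_sub tn_W] .

lemma tc_ge: assumes t: "t \<in> \<T>" shows "1 - h^2 / 2 <= tc t" "tc t <= 1"
proof -
 obtain i where i: "i \<in> t" using T_nonempty[OF t] by blast
 have e: "(norm (tn t - x i))^2 = 2 - 2 * tc t"
  using unit_dist_sq[OF norm_tn[OF t] nx[OF T_sub[OF t i]]] tn_dot[OF t i] by (simp add: inner_commute)
 moreover have "(norm (tn t - x i))^2 <= h^2" using tn_near[OF t i] by (rule power_mono) simp
 ultimately show "1 - h^2 / 2 <= tc t" by (simp add: field_simps)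
 show "tc t <= 1" using e zero_le_power2[of "norm (tn t - x i)"] by linarith
qed

lemma tc_inv: assumes t: "t \<in> \<T>"
 shows "tc t >= 99 / 100" "1 / tc t <= 1 + h^2" "1 / (tc t)^2 <= 1 + 2 * h^2" "1 - h^2 <= (tc t)^2" "(tc t)^2 <= 1"
proof -
 note c = tc_ge[OF t]
 show c9: "tc t >= 99 / 100" using c hh by linarith
 have gen: "1 <= (1 + q) * (1 - q / 2) & 1 <= (1 + 2 * q) * (1 - q)" if q: "0 < q" "q <= 1 / 10000" for q :: real
 proof -
  define s where "s = q * q"
  have "q * q <= (1/10000) * q" using q by (intro mult_right_mono) auto
  hence s: "s <= q / 10000" by (simp add: s_def)
  have e: "(1 + q) * (1 - q / 2) = 1 + q / 2 - s / 2" "(1 + 2 * q) * (1 - q) = 1 + q - 2 * s"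
   by (simp_all add: s_def field_simps)
  show ?thesis unfolding e using q s by auto
 qed
 have p: "1 <= (1 + h^2) * (1 - h^2 / 2)" "1 <= (1 + 2 * h^2) * (1 - h^2)" using gen[OF hh(2,1)] by auto
 have "(1 + h^2) * (1 - h^2 / 2) <= (1 + h^2) * tc t" using c hh by (intro mult_left_mono) auto
 thus "1 / tc t <= 1 + h^2" using p c9 by (simp add: divide_le_eq)
 have "(1 - h^2 / 2)^2 <= (tc t)^2" using c hh by (intro power_mono) auto
 moreover have "(1 - h^2 / 2)^2 = 1 - h^2 + (h^2 / 2)^2" by (simp add: power2_eq_square algebra_simps)
 ultimately show c2: "1 - h^2 <= (tc t)^2" using zero_le_power2[of "h^2 / 2"] by linarith
 hence "(1 + 2 * h^2) * (1 - h^2) <= (1 + 2 * h^2) * (tc t)^2" using hh by (intro mult_left_mono) auto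
 thus "1 / (tc t)^2 <= 1 + 2 * h^2" using p c9 by (simp add: divide_le_eq)
 show "(tc t)^2 <= 1" using c c9 by (simp add: power_le_one)
qed

lemma dd_le: "t \<in> \<T> ==> i \<in> t ==> j \<in> t ==> dd i j <= 2 * h"
 using norm_triangle_ineq4[of "tn t - x i" "tn t - x j"] tn_near[of t i] tn_near[of t j] by (simp add: dd_def)

lemma omega_Q: assumes "t \<in> \<T>" "i \<in> t" "j \<in> t" "i ~= j" shows "|omega t i j| <= Q"
proof -
 have "|omega t i j| <= (2 * h)^2 / (2 * Dt t)" using assms by (intro omega_le dd_le) auto
 also have "... <= Q" using h_Dt[OF assms(1)] Dt_pos[OF assms(1)] by (simp add: divide_le_eq power_mult_distrib)
 finally show ?thesis .
qed

text \<open>Two errors of order h^2: arctan against its argument, which is of size \<open>Q\<close>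
  h, and \<open>tc t\<close> against 1.\<close>

lemma sarc_near:
 assumes t: "t \<in> \<T>" "i \<in> t" "j \<in> t" "i ~= j"
 shows "|sarc t i j / dd i j - omega t i j| <= 9 * Q ^ 3 * h^2"
proof -
 define d o' z where "d = dd i j" and "o' = omega t i j" and "z = d * o' / tc t"
 have d: "0 < d" "d <= 2 * h" using dd_pos dd_le T_sub t by (auto simp: d_def)
 have o': "|o'| <= Q" using omega_Q[OF t] by (simp add: o'_def)
 note c = tc_inv[OF t(1)] tc_pos[OF t(1)] tc_ge(2)[OF t(1)]
 have c2: "1 / tc t <= 101/100" using c(2) hh by linarith
 have "|arctan z / d - o'| <= |arctan z - z| / d + |z / d - o'|"
  using d by (simp add: abs_le_iff field_simps abs_if)
 also have "|z / d - o'| = |o'| * (1 / tc t - 1)"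
 proof -
  have "z / d - o' = o' * (1 / tc t - 1)" using d by (simp add: z_def algebra_simps)
  thus ?thesis using c by (simp add: abs_mult)
 qed
 also have "... <= Q * h^2" using o' c by (intro mult_mono) auto
 also have "|arctan z - z| / d <= |z| ^ 3 / d" using arctan_cubic d by (intro divide_right_mono) auto
 also have "|z| = d * ( |o'| * (1 / tc t))" using d c(6) by (simp add: z_def abs_mult)
 also have "(d * ( |o'| * (1 / tc t))) ^ 3 / d = d^2 * ( |o'| * (1 / tc t)) ^ 3"
  unfolding power_mult_distrib[of d] using d by (simp add: power2_eq_square power3_eq_cube)
 also have "... <= (2 * h)^2 * (Q * (101/100)) ^ 3" using d o' c c2 Q1 by (intro mult_mono power_mono) auto
 also have "... <= 8 * Q ^ 3 * h^2" using Q1 by (simp add: power_mult_distrib power3_eq_cube)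
 also have "Q * h^2 <= Q ^ 3 * h^2" using Q1 by (intro mult_right_mono) (auto intro: self_le_power)
 finally show ?thesis unfolding sarc_def d_def[symmetric] o'_def[symmetric] z_def[symmetric] by simp
qed

section \<open>Comparison of the finite volume form, the planar stiffness form and the Dirichlet
  form on the sphere\<close>

definition SN :: "(nat => real) => real" where
 "SN v = L2_set (%t. sqrt (Dt t) * norm (mt t v)) \<T>"

text \<open>The stiffness form of the planar triangles: \<open>Dt t\<close> / 2 is the area, and
  \<open>mt t v\<close> has the length of the gradient. Hence the diagonal value is half the square
  of \<open>SN v\<close>.\<close>

definition B0 :: "(nat => real) => (nat => real) => real" where
 "B0 v w = (1/2) * (SUM t:\<T>. Dt t * (mt t v .* mt t w))"

lemma SN_nonneg [simp]: "0 <= SN v" by (simp add: SN_def L2_set_nonneg)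

lemma sqrt_Dt: "t \<in> \<T> ==> sqrt (Dt t) * sqrt (Dt t) = Dt t" using Dt_pos[of t] by simp

lemma SN_power2: "(SN v)^2 = (SUM t:\<T>. Dt t * (norm (mt t v))^2)"
 unfolding SN_def L2_set_def using Dt_pos
 by (subst real_sqrt_pow2) (auto intro!: sum_nonneg sum.cong simp: power_mult_distrib less_imp_le)

lemma B0_diag: "B0 v v = (SN v)^2 / 2"
 by (simp add: B0_def SN_power2 power2_norm_eq_inner)

lemma SN_CS: "(SUM t:\<T>. Dt t * (norm (mt t v) * norm (mt t w))) <= SN v * SN w"
proof -
 have "(SUM t:\<T>. |sqrt (Dt t) * norm (mt t v)| * |sqrt (Dt t) * norm (mt t w)| ) <= SN v * SN w"
  unfolding SN_def by (rule L2_set_mult_ineq)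
 moreover have "|sqrt (Dt t) * norm (mt t v)| * |sqrt (Dt t) * norm (mt t w)| = Dt t * (norm (mt t v) * norm (mt t w))"
  if t: "t \<in> \<T>" for t using sqrt_Dt[OF t] Dt_pos[OF t] by (simp add: abs_mult mult.assoc mult.left_commute)
 ultimately show ?thesis by simp
qed

lemma local_bound_sum:
 assumes "!!t. t \<in> \<T> ==> |F t| <= K * (Dt t * (norm (mt t v) * norm (mt t w)))" "K >= 0"
 shows "|SUM t:\<T>. F t| <= K * (SN v * SN w)"
proof -
 have "|SUM t:\<T>. F t| <= (SUM t:\<T>. K * (Dt t * (norm (mt t v) * norm (mt t w))))"
  by (rule order_trans[OF sum_abs sum_mono]) (rule assms)
 also have "... <= K * (SN v * SN w)" unfolding sum_distrib_left[symmetric] using SN_CS assms(2) by (rule mult_left_mono)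
 finally show ?thesis .
qed

text \<open>With the weights \<open>omega\<close> the form would be exactly \<open>B0\<close>; their
  deviation costs 18 for each of the six ordered pairs of a triangle, and the form takes half of the
  sum.\<close>

lemma Bh_near: "|Bh v w - B0 v w| <= 54 * Q ^ 4 * h^2 * (SN v * SN w)"
proof -
 let ?d = "%t. SUM i:t. SUM j:t - {i}. (sarc t i j / dd i j - omega t i j) * ((v i - v j) * (w i - w j))"
 have "|SUM t:\<T>. ?d t| <= 108 * Q ^ 4 * h^2 * (SN v * SN w)"
 proof (rule local_bound_sum)
  fix t assume t: "t \<in> \<T>"
  let ?m = "norm (mt t v) * norm (mt t w)"
  have D: "Dt t > 0" by (rule Dt_pos[OF t])
  have one: "|(sarc t i j / dd i j - omega t i j) * ((v i - v j) * (w i - w j))| <= 18 * Q ^ 4 * h^2 * (Dt t * ?m)"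
   if ij: "i \<in> t" "j \<in> t - {i}" for i j
  proof -
   have d: "0 <= dd i j" "dd i j <= 2 * h" using dd_le[OF t] ij by (auto simp: dd_def)
   have v: "|u i - u j| <= norm (mt t u) * (2 * h)" for u
    using diff_le_mt[OF t, of i j u] ij mult_left_mono[OF d(2), of "norm (mt t u)"] by auto
   have "|v i - v j| * |w i - w j| <= (norm (mt t v) * (2 * h)) * (norm (mt t w) * (2 * h))"
    by (intro mult_mono v) (use h0 in auto)
   also have "... = 2 * (2 * h^2) * ?m" by (simp add: power2_eq_square)
   also have "... <= 2 * (Q * Dt t) * ?m" using h_Dt[OF t] by (intro mult_right_mono) auto
   finally have vw: "|v i - v j| * |w i - w j| <= 2 * (Q * Dt t) * ?m" .
   have "|sarc t i j / dd i j - omega t i j| * ( |v i - v j| * |w i - w j| ) <= (9 * Q ^ 3 * h^2) * (2 * (Q * Dt t) * ?m)"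
    using Q1 ij by (intro mult_mono vw sarc_near[OF t]) auto
   also have "... = 18 * Q ^ 4 * h^2 * (Dt t * ?m)" by (simp add: power_numeral_reduce)
   finally show ?thesis by (simp add: abs_mult)
  qed
  have "|?d t| <= (SUM i:t. SUM j:t - {i}. 18 * Q ^ 4 * h^2 * (Dt t * ?m))"
   by (intro order_trans[OF sum_abs sum_mono]) (rule one)
  also have "... = real (SUM i:t. card (t - {i})) * (18 * Q ^ 4 * h^2 * (Dt t * ?m))"
   by (simp add: sum_distrib_right[symmetric])
  also have "(SUM i:t. card (t - {i})) = 6" using T_card[OF t] T_finite[OF t] by simp
  finally show "|?d t| <= 108 * Q ^ 4 * h^2 * (Dt t * ?m)" by simp
 qed (use Q1 in auto)
 moreover have "Bh v w - B0 v w = (1/2) * (SUM t:\<T>. ?d t)"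
  unfolding Bh_def B0_def local_form[symmetric] by (simp add: local_form[symmetric] left_diff_distrib sum_subtractf right_diff_distrib)
 ultimately show ?thesis by (simp add: abs_mult)
qed

text \<open>\<open>mt t v\<close> is orthogonal to \<open>tn t\<close>, from which y deviates by at
  most h; so the double cross product with y preserves scalar products up to order h^2. The scalar
  factor of \<open>Lt\<close> is equally close to 1.\<close>

lemma Lt_inner_near:
 assumes t: "t \<in> \<T>" and y: "y \<in> ticone t" "norm y = 1"
 shows "|Lt t v y .* Lt t w y - mt t v .* mt t w| <= 4 * h^2 * (norm (mt t v) * norm (mt t w))"
proof -
 define c s m m' where "c = tc t" and "s = tn t .* y" and "m = mt t v" and "m' = mt t w"
 have yt: "y \<in> tcone t" using y ticone_tcone by blast
 note cc = tc_inv[OF t, folded c_def] tc_ge[OF t, folded c_def]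
 have s: "c <= s" "s <= 1" using tn_ge[OF t yt y(2)] norm_cauchy_schwarz[of "tn t" y] norm_tn[OF t] y by (auto simp: c_def s_def)
 have yy: "y .* y = 1" using y(2) by (simp add: norm_eq_1)
 have "(norm (y - tn t))^2 = 2 - 2 * s" using unit_dist_sq[OF y(2) norm_tn[OF t]] by (simp add: s_def inner_commute)
 also have "... <= h^2" using s cc(6) by linarith
 finally have yn: "norm (y - tn t) <= h" using h0 by (simp add: power2_le_iff_abs_le)
 have ym: "|y .* mt t u| <= h * norm (mt t u)" for u
 proof -
  have "y .* mt t u = (y - tn t) .* mt t u" using bt_facts(4)[OF t] by (simp add: inner_diff_left inner_commute[of "tn t"])
  thus ?thesis using Cauchy_Schwarz_ineq2[of "y - tn t" "mt t u"] mult_right_mono[OF yn, of "norm (mt t u)"] by simp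
 qed
 have "|y .* m| * |y .* m'| <= (h * norm m) * (h * norm m')" unfolding m_def m'_def by (intro mult_mono ym) (use h0 in auto)
 hence q: "|(y .* m) * (y .* m')| <= h^2 * (norm m * norm m')" by (simp add: abs_mult power2_eq_square mult_ac)
 have i: "|m .* m'| <= norm m * norm m'" by (rule Cauchy_Schwarz_ineq2)
 have cr: "cross3 y (cross3 y m) .* cross3 y (cross3 y m') = m .* m' - (y .* m) * (y .* m')" for m m'
  by (simp add: Lagrange inner_diff_left inner_diff_right yy inner_commute algebra_simps)
 define k where "k = (c / s^2)^2"
 have sp: "s > 0" using s cc by linarith
 have ck: "c^2 <= k"
 proof -
  have "s^2 <= 1" using s sp by (simp add: power_le_one)
  hence "c <= c / s^2" using sp cc(1) by (simp add: le_divide_eq mult_left_le)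
  thus ?thesis unfolding k_def using cc(1) by (intro power_mono) auto
 qed
 have kc: "k <= 1 / c^2"
 proof -
  have "c^2 <= s^2" using s cc(1) by (intro power_mono) auto
  hence "c / s^2 <= c / c^2" using cc(1) sp by (intro divide_left_mono) auto
  also have "... = 1 / c" by (simp add: power2_eq_square)
  finally have "k <= (1 / c)^2" unfolding k_def using cc(1) sp by (intro power_mono) auto
  thus ?thesis by (simp add: power_divide)
 qed
 have k: "|k - 1| <= 2 * h^2" "k <= 2" using ck kc cc hh unfolding abs_le_iff by linarith+
 have k0: "0 <= k" by (simp add: k_def)
 have "Lt t v y .* Lt t w y - m .* m' = (k - 1) * (m .* m') - k * ((y .* m) * (y .* m'))"
  unfolding Lt_def c_def[symmetric] s_def[symmetric] m_def[symmetric] m'_def[symmetric] inner_scaleR_left inner_scaleR_right cr k_def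
  by (simp add: power2_eq_square algebra_simps)
 also have "|...| <= |k - 1| * |m .* m'| + k * |(y .* m) * (y .* m')|"
  using k0 by (metis abs_mult abs_of_nonneg abs_triangle_ineq4)
 also have "... <= (2 * h^2) * (norm m * norm m') + 2 * (h^2 * (norm m * norm m'))"
  using k k0 q i by (intro add_mono mult_mono) auto
 finally show ?thesis unfolding m_def m'_def by simp
qed

lemma LJ_inner_integrable: "integrable surf (%y. LJ v y .* LJ w y)"
proof (rule integrable_surf_bounded)
 show "(%y. LJ v y .* LJ w y) \<in> borel_measurable surf" by (intro borel_measurable_inner LJ_measurable)
 show "|LJ v y .* LJ w y| <= (SUM t:\<T>. norm (mt t v) / tc t) * (SUM t:\<T>. norm (mt t w) / tc t)" if "y \<in> S2" for y
 proof (rule order_trans[OF Cauchy_Schwarz_ineq2 mult_mono[OF LJ_bounded LJ_bounded]])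
  show "0 <= (SUM t:\<T>. norm (mt t v) / tc t)" using tc_pos by (intro sum_nonneg) (simp add: less_imp_le)
 qed (use that in auto)
qed

text \<open>On each triangle the integrand is nearly constant and the spherical area is nearly
  \<open>Dt t\<close> / 2.\<close>

lemma LJ_near: "|(SI y. LJ v y .* LJ w y) - B0 v w| <= 5 * h^2 * (SN v * SN w)"
proof -
 let ?L = "%y. LJ v y .* LJ w y"
 let ?S = "%t. SI y. ind (ticone t) y * ?L y"
 let ?F = "%t. ?S t - Dt t / 2 * (mt t v .* mt t w)"
 have "|SUM t:\<T>. ?F t| <= 5 * h^2 * (SN v * SN w)"
 proof (rule local_bound_sum)
  fix t assume t: "t \<in> \<T>"
  let ?m = "norm (mt t v) * norm (mt t w)" and ?i = "mt t v .* mt t w" and ?A = "ticone t Int S2"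
  have D: "Dt t > 0" by (rule Dt_pos[OF t])
  have As: "?A \<in> sets surf" using ticone_sets[OF t] by (intro sets_surfI) auto
  have "area ?A <= Dt t / 2 * (1 / (tc t)^2)" using area_bounds(2)[OF t] by simp
  also have "... <= Dt t / 2 * (1 + 2 * h^2)" using D tc_inv[OF t] by (intro mult_left_mono) auto
  finally have u: "area ?A <= Dt t / 2 * (1 + 2 * h^2)" .
  have int: "integrable surf (%y. ind ?A y * ?L y)"
   using integrable_real_mult_indicator[OF As LJ_inner_integrable] by (simp add: mult.commute)
  have iA: "integrable surf (%y. ind ?A y * c)" for c :: real
   using integrable_real_mult_indicator[OF As, of "%_. c"] by (simp add: mult.commute)
  have "?S t = (SI y. ind ?A y * ?L y)"
   by (intro LI_cong) (auto simp: indicator_def)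
  hence "|?S t - area ?A * ?i| = |\<integral>y. ind ?A y * ?L y - ind ?A y * ?i \<partial>surf|"
   using int iA As by (simp add: mult.commute)
  also have "... <= (SI y. ind ?A y * (4 * h^2 * ?m))"
  proof (rule order_trans[OF integral_abs_bound], rule integral_mono)
   fix y
   show "|ind ?A y * ?L y - ind ?A y * ?i| <= ind ?A y * (4 * h^2 * ?m)"
    using Lt_inner_near[OF t, of y v w] LJ_eq[OF t] by (auto simp: indicator_def)
  qed (use int iA in auto)
  also have "... = area ?A * (4 * h^2 * ?m)" using As by simp
  also have "... <= (Dt t / 2 * (1 + 2 * h^2)) * (4 * h^2 * ?m)" using u by (intro mult_right_mono) auto
  also have "... <= (Dt t / 2 * 2) * (4 * h^2 * ?m)"
   using D hh by (intro mult_right_mono mult_left_mono) auto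
  finally have 1: "|?S t - area ?A * ?i| <= Dt t * (4 * h^2 * ?m)" by simp
  have "|area ?A - Dt t / 2| <= Dt t * h^2"
  proof -
   have "Dt t / 2 * (1 - h^2 / 2) <= Dt t / 2 * tc t" using D tc_ge[OF t] by (intro mult_left_mono) auto
   also have "... <= area ?A" using area_bounds(1)[OF t] by (simp add: mult.commute)
   finally have "Dt t / 2 - Dt t * h^2 / 4 <= area ?A" by (simp add: algebra_simps)
   moreover have "0 <= Dt t * h^2" using D by simp
   ultimately show ?thesis using u by (simp add: algebra_simps)
  qed
  hence "|area ?A - Dt t / 2| * |?i| <= (Dt t * h^2) * ?m"
   using D by (intro mult_mono Cauchy_Schwarz_ineq2) auto
  hence 2: "|area ?A * ?i - Dt t / 2 * ?i| <= (Dt t * h^2) * ?m" unfolding abs_mult[symmetric] by (simp add: algebra_simps)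
  have "|?F t| <= Dt t * (4 * h^2 * ?m) + (Dt t * h^2) * ?m" using 1 2 by linarith
  thus "|?F t| <= 5 * h^2 * (Dt t * ?m)" by (simp add: algebra_simps)
 qed simp
 moreover have "(SI y. LJ v y .* LJ w y) - B0 v w = (SUM t:\<T>. ?F t)"
  unfolding split_ticone(1)[OF LJ_inner_integrable] B0_def by (simp add: sum_subtractf sum_distrib_left)
 ultimately show ?thesis by simp
qed

lemma Bh_LJ: "|Bh v w - (SI y. LJ v y .* LJ w y)| <= 59 * Q ^ 4 * h^2 * (SN v * SN w)"
proof -
 have "5 * h^2 * (SN v * SN w) <= 5 * Q ^ 4 * h^2 * (SN v * SN w)" using Q1 by (intro mult_right_mono) auto
 thus ?thesis using Bh_near[of v w] LJ_near[of v w] by simp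
qed

lemma SN_LJ: "(SN v)^2 <= 4 * (SI y. LJ v y .* LJ v y)" "(SI y. LJ v y .* LJ v y) <= (SN v)^2"
proof -
 have "5 * h^2 * (SN v)^2 <= (1/4) * (SN v)^2" using hh by (intro mult_right_mono) auto
 thus "(SN v)^2 <= 4 * (SI y. LJ v y .* LJ v y)" "(SI y. LJ v y .* LJ v y) <= (SN v)^2"
  using LJ_near[of v v] unfolding B0_diag power2_eq_square[symmetric, of "SN v"] by linarith+
qed

text \<open>Coercivity: \<open>B0\<close> contributes 1/2, and 216 = 4 * 54 keeps the deviation of
  \<open>Bh\<close> below 1/4.\<close>

lemma SN_Bh: assumes "216 * Q ^ 4 * h^2 <= 1" shows "(SN v)^2 <= 4 * Bh v v"
proof -
 have "54 * Q ^ 4 * h^2 * (SN v)^2 <= (1/4) * (SN v)^2" using assms by (intro mult_right_mono) auto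
 thus ?thesis using Bh_near[of v v] unfolding B0_diag power2_eq_square[symmetric, of "SN v"] by linarith
qed

end

section \<open>Areas, packing, and piecewise constant against piecewise linear functions\<close>

lemma cap_area:
 assumes p: "norm p = 1" and A: "A \<in> sets borel" "A <= S2" "!!y. y \<in> A ==> norm (y - p) <= r" and r: "r >= 0"
 shows "area A <= 24 * r^2"
proof -
 obtain z :: "real^3" where z: "z ~= 0" "orthogonal p z" using orthogonal_to_vector_exists[of p] by auto
 define e g where "e = sgn z" and "g = cross3 p e"
 have e: "norm e = 1" "p .* e = 0" using z by (auto simp: e_def norm_sgn sgn_div_norm orthogonal_def)
 note o = orthonormal_expand[OF p e g_def]
 have b: "|u .* y| <= r" if "y \<in> A" "norm u = 1" "p .* u = 0" for u y
 proof -
  have "u .* y = u .* (y - p)" using that(3) by (simp add: inner_diff_right inner_commute)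
  thus ?thesis using Cauchy_Schwarz_ineq2[of u "y - p"] that(2) A(3)[OF that(1)] by simp
 qed
 have "emeasure surf A <= ennreal (6 * (r - - r) * (r - - r))"
 proof (rule emeasure_surf_box[OF e(1) o(1,3) _ r _ r A(1,2)])
  show "- r <= e .* y & e .* y <= r & - r <= g .* y & g .* y <= r" if "y \<in> A" for y
   using b[OF that e] b[OF that o(1,2)] by (simp add: abs_le_iff)
 qed (use r in auto)
 thus ?thesis unfolding surf.emeasure_eq_measure using r by (subst (asm) ennreal_le_iff) (auto simp: power2_eq_square)
qed

context fine begin

lemma cell_W: "i \<in> I ==> voronoi_cell N x i <= W i" using closure_subset[of "voronoi_cell N x i"] by (simp add: closure_cell)

lemma cell_sub: "i \<in> I ==> voronoi_cell N x i <= S2" by (auto simp: cell_eq)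

text \<open>The cells of the counted generators are disjoint, have area at least \<open>a0\<close>
  h^2 each, and lie in a cap of radius (r + 1) h.\<close>

lemma packing:
 assumes A: "A <= I" and p: "norm p = 1" and r: "!!k. k \<in> A ==> norm (x k - p) <= r * h" "r >= 0"
 shows "real (card A) <= 24 * (r + 1)^2 / a0"
proof -
 have fA: "finite A" using A by (rule finite_subset) simp
 let ?U = "\<Union>k\<in>A. voronoi_cell N x k"
 have "real (card A) * (a0 * h^2) <= (SUM k:A. area (voronoi_cell N x k))"
  using sum_mono[of A "%_. a0 * h^2" "%k. area (voronoi_cell N x k)"] area_ge A by auto
 also have "... = area ?U"
  using fA A cell_sets cell_disjoint by (intro surf.finite_measure_finite_Union[symmetric]) (fastforce simp: disjoint_family_on_def)+
 also have "... <= 24 * ((r + 1) * h)^2"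
 proof (rule cap_area[OF p])
  show "?U \<in> sets borel" using fA A cell_sets by (intro sets.finite_UN) auto
  show "?U <= S2" using A cell_sub by blast
  fix y assume "y \<in> ?U"
  then obtain k where k: "k \<in> A" "y \<in> voronoi_cell N x k" by blast
  hence "norm (y - x k) <= h" using W_h cell_W A by blast
  hence "norm (y - p) <= h + r * h" using norm_triangle_ineq[of "y - x k" "x k - p"] r(1)[OF k(1)] by simp
  thus "norm (y - p) <= (r + 1) * h" by (simp add: algebra_simps)
 qed (use h0 r in simp)
 also have "... = 24 * (r + 1)^2 * h^2" by (simp add: power_mult_distrib)
 finally have "real (card A) * a0 <= 24 * (r + 1)^2" using hh(2) by (simp add: mult.assoc[symmetric])
 thus ?thesis using a0 by (simp add: le_divide_eq)
qed

lemma tcone_near: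
 assumes t: "t \<in> \<T>" and y: "y \<in> tcone t" and i: "i \<in> t"
 shows "norm ((nu t .* y) *R x i - y) <= 3 * h * norm y"
proof -
 have "(nu t .* y) *R x i - y = (SUM j:t. (alpha t j .* y) *R (x i - x j))"
  using alpha_rep[OF t, of y] by (simp add: scaleR_diff_right sum_subtractf nu_dot_sum[OF t] flip: scaleR_sum_left)
 also have "norm ... <= (SUM j:t. (alpha t j .* y) * (2 * h))"
 proof (rule sum_norm_le)
  fix j assume j: "j \<in> t"
  thus "norm ((alpha t j .* y) *R (x i - x j)) <= (alpha t j .* y) * (2 * h)"
   using y dd_le[OF t j i] by (simp add: tcone_def dd_def mult_left_mono)
 qed
 also have "... = (nu t .* y) * (2 * h)" by (simp add: nu_dot_sum[OF t] sum_distrib_right)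
 also have "... <= (101 / 100 * norm y) * (2 * h)"
 proof (rule mult_right_mono)
  have "tn t .* y <= norm y" using norm_cauchy_schwarz[of "tn t" y] norm_tn[OF t] by simp
  hence "nu t .* y <= 1 / tc t * norm y" using tc_pos[OF t] by (simp add: nu_def divide_right_mono)
  also have "... <= 101 / 100 * norm y" using tc_inv(2)[OF t] hh by (intro mult_right_mono) auto
  finally show "nu t .* y <= 101 / 100 * norm y" .
 qed (use h0 in simp)
 also have "... <= 3 * h * norm y" using h0 by (simp add: mult_right_mono)
 finally show ?thesis .
qed

lemma tcone_near_unit:
 assumes t: "t \<in> \<T>" and y: "y \<in> tcone t" "norm y = 1" and i: "i \<in> t"
 shows "norm (y - x i) <= 6 * h"
proof -
 have n: "norm ((nu t .* y) *R x i - y) <= 3 * h" using tcone_near[OF t y(1) i] y by simp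
 have "|norm ((nu t .* y) *R x i) - norm y| <= norm ((nu t .* y) *R x i - y)" by (rule norm_triangle_ineq3)
 hence "norm ((1 - nu t .* y) *R x i) <= 3 * h" using n y nx[OF T_sub[OF t i]] nu_ge[OF t y(1)] by simp
 moreover have "norm (x i - y) <= norm ((nu t .* y) *R x i - y) + norm ((1 - nu t .* y) *R x i)"
  using norm_triangle_ineq[of "(nu t .* y) *R x i - y" "(1 - nu t .* y) *R x i"] by (simp add: algebra_simps)
 ultimately show ?thesis using n by (simp add: norm_minus_commute)
qed

text \<open>Collects the factors of \<open>cell_near\<close>: 16 h^2 from the pointwise bound, 24
  h^2 for the area of a cell, one half from \<open>h_Dt\<close>, so 16 * 24 / 2 = 192, and 24 * 64 /
  \<open>a0\<close> for the number of cells near a triangle.\<close>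

definition KC :: real where "KC = sqrt (192 * Q * (24 * 64 / a0))"

(* The segment from a point of a cell to its generator stays in the cell, and meets only triangles
 that are close to the generator; a packing argument bounds how often each triangle is met. *)
lemma cell_near: "nrm surf (%y. vh v y - Jf v y) <= KC * h * SN v"
proof -
 define T where "T k = {t\<in>\<T>. \<exists>z\<in>tcone t. z \<in> W k}" for k
 let ?m = "%t. (norm (mt t v))^2"
 let ?G = "%t. 192 * Q * h^2 * (Dt t * (norm (mt t v))^2)"
 have fT: "finite (T k)" for k using finite_T by (simp add: T_def)
 have pt: "(v k - Jf v y)^2 <= 16 * h^2 * (SUM t:T k. ?m t)" if k: "k \<in> I" and y: "y \<in> voronoi_cell N x k" for k y
 proof -
  have yW: "y \<in> W k" "norm y = 1" using cell_W[OF k] y by (auto simp: W_def)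
  have yx: "norm (y - x k) <= h" by (rule W_h[OF k yW(1)])
  define ga where "ga s = (1 - s) *R y + s *R x k" for s
  define M where "M = sqrt (SUM t:T k. ?m t)"
  have gx: "ga s - x k = (1 - s) *R (y - x k)" for s by (simp add: ga_def algebra_simps)
  have gn: "norm (ga s) >= 1/2" if s: "s \<in> {0..1}" for s
  proof -
   have "norm (ga s - x k) <= 1 * norm (y - x k)" unfolding gx using s by (simp add: mult_left_le_one_le)
   thus ?thesis using yx h1 norm_triangle_ineq2[of "x k" "x k - ga s"] nx[OF k] by (simp add: norm_minus_commute)
  qed
  have "|Jf v (ga 1) - Jf v (ga 0)| <= (2 * M) * (h / (1/2)) * (1 - 0)"
  proof (rule Jf_path_lipschitz[OF _ _ gn])
   show "h-lipschitz_on {0..1} ga"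
   proof (rule lipschitz_onI)
    fix s s' :: real
    have "ga s - ga s' = (s' - s) *R (y - x k)" by (simp add: ga_def algebra_simps)
    thus "dist (ga s) (ga s') <= h * dist s s'"
     using mult_right_mono[OF yx, of "|s' - s|"] by (simp add: dist_norm mult.commute abs_minus_commute)
   qed (use h0 in simp)
   show "2 * M >= 0" by (simp add: M_def sum_nonneg)
   fix t s assume t: "t \<in> \<T>" and s: "s \<in> {0..1}" and g: "ga s \<in> tcone t"
   have g0: "ga s ~= 0" using gn[OF s] by auto
   have "x j .* ga s <= x k .* ga s" if j: "j \<in> I" for j
   proof -
    have "x j .* y <= x k .* y" "x j .* x k <= x k .* x k" using yW(1) j dot_less_1[OF j k] xx[OF k] by (auto simp: W_def) (cases "j = k"; simp)
    thus ?thesis using s unfolding ga_def inner_add_right inner_scaleR_right by (intro add_mono mult_left_mono) auto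
   qed
   hence "sgn (ga s) \<in> W k" using g0 by (simp add: W_def norm_sgn sgn_div_norm divide_right_mono)
   moreover have "sgn (ga s) \<in> tcone t" using g by (simp add: sgn_div_norm cone_scale)
   ultimately have "t \<in> T k" using t by (auto simp: T_def)
   hence "?m t <= (SUM t:T k. ?m t)" by (intro member_le_sum fT) auto
   hence m: "norm (mt t v) <= M" unfolding M_def by (rule real_le_rsqrt)
   have "norm (mt t v) / tc t <= norm (mt t v) / (1/2)" using tc_inv(1)[OF t] by (intro divide_left_mono) auto
   thus "norm (mt t v) / tc t <= 2 * M" using m by simp
  qed auto
  moreover have "Jf v (ga 1) = v k" "ga 0 = y" using Jf_vertex[OF k] by (simp_all add: ga_def)
  ultimately have "|v k - Jf v y| <= 4 * h * M" by (simp add: algebra_simps)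
  hence "(v k - Jf v y)^2 <= (4 * h * M)^2" using abs_le_square_iff[of "v k - Jf v y" "4 * h * M"] by linarith
  also have "... = 16 * h^2 * (SUM t:T k. ?m t)" by (simp add: M_def power_mult_distrib sum_nonneg)
  finally show ?thesis .
 qed
 define C where "C = (SUM i:I. |v i| )"
 have "|v i| <= C" if "i \<in> I" for i unfolding C_def using that by (intro member_le_sum) auto
 hence Jb: "|Jf v y| <= C" if "y \<in> S2" for y using Jf_bounds[of y "- C" v C] that by (fastforce simp: abs_le_iff)
 have "sqi surf (%y. vh v y - Jf v y)"
  using vh_bounded[of v] Jb by (intro sqi_diff surf.sqi_bounded[where B = C] vh_measurable Jf_measurable) (auto simp: C_def)
 hence int: "integrable surf (%y. (vh v y - Jf v y)^2)" by (rule sqi_power2)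
 have "(nrm surf (%y. vh v y - Jf v y))^2 = (SUM k:I. \<integral>y. ind (voronoi_cell N x k) y * (vh v y - Jf v y)^2 \<partial>surf)"
  unfolding nrm_power2 by (rule split_cell(1)[OF int])
 also have "... <= (SUM k:I. SUM t:T k. ?G t)"
 proof (rule sum_mono)
  fix k assume k: "k \<in> I"
  let ?V = "voronoi_cell N x k" and ?S = "SUM t:T k. ?m t"
  have "(SI y. ind ?V y * (vh v y - Jf v y)^2) <= (SI y. ind ?V y * (16 * h^2 * ?S))"
  proof (rule integral_mono[OF split_cell(2)[OF int k]])
   show "integrable surf (%y. ind ?V y * (16 * h^2 * ?S))"
    using integrable_real_mult_indicator[OF cell_sets(1)[OF k], of "%_. 16 * h^2 * ?S"] by (simp add: mult.commute)
   show "ind ?V y * (vh v y - Jf v y)^2 <= ind ?V y * (16 * h^2 * ?S)" for y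
    using pt[OF k] vh_eq[OF k] by (cases "y \<in> ?V") auto
  qed
  also have "... = area ?V * (16 * h^2 * ?S)" using cell_sets(1)[OF k] Int_absorb2[OF cell_sub[OF k]] by simp
  also have "... <= (24 * h^2) * (16 * h^2 * ?S)"
   using cap_area[OF nx[OF k] cell_sets(2)[OF k] cell_sub[OF k], of h] W_h[OF k] cell_W[OF k] h0 by (intro mult_right_mono) (auto intro!: sum_nonneg mult_nonneg_nonneg)
  also have "... = (SUM t:T k. 192 * h^2 * (2 * h^2 * ?m t))" by (simp add: sum_distrib_left algebra_simps)
  also have "... <= (SUM t:T k. 192 * h^2 * (Q * Dt t * ?m t))"
   using h_Dt by (intro sum_mono mult_left_mono mult_right_mono) (auto simp: T_def)
  finally show "(SI y. ind ?V y * (vh v y - Jf v y)^2) <= (SUM t:T k. ?G t)"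
   by (simp add: mult_ac)
 qed
 also have "... = (SUM k:I. SUM t:\<T>. if t \<in> T k then ?G t else 0)"
  using finite_T by (intro sum.cong refl sum.mono_neutral_cong_left) (auto simp: T_def)
 also have "... = (SUM t:\<T>. SUM k:I. if t \<in> T k then ?G t else 0)" by (rule sum.swap)
 also have "... = (SUM t:\<T>. real (card {k\<in>I. t \<in> T k}) * ?G t)"
  by (simp add: sum.inter_filter[symmetric])
 also have "... <= (SUM t:\<T>. (24 * 64 / a0) * ?G t)"
 proof (intro sum_mono mult_right_mono)
  fix t assume t: "t \<in> \<T>"
  obtain i where i: "i \<in> t" using T_nonempty[OF t] by blast
  \<comment> \<open>A counted generator and a vertex of t share a nearby point z, at distances h and
    6 h, which gives the packing radius 7 h.\<close>
  have "real (card {k\<in>I. t \<in> T k}) <= 24 * (7 + 1)^2 / a0"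
  proof (rule packing[OF _ nx[OF T_sub[OF t i]]])
   fix k assume "k \<in> {k\<in>I. t \<in> T k}"
   then obtain z where z: "k \<in> I" "z \<in> tcone t" "z \<in> W k" by (auto simp: T_def)
   hence "norm (z - x k) <= h" "norm (z - x i) <= 6 * h" using W_h tcone_near_unit[OF t _ _ i] by (auto simp: W_def)
   thus "norm (x k - x i) <= 7 * h" using norm_triangle_ineq4[of "z - x i" "z - x k"] by simp
  qed auto
  thus "real (card {k\<in>I. t \<in> T k}) <= 24 * 64 / a0" by simp
  show "0 <= ?G t" using Q1 Dt_pos[OF t] by simp
 qed
 also have "... = (KC * h * SN v)^2"
  unfolding power_mult_distrib SN_power2 KC_def using Q1 a0 by (simp add: sum_distrib_left sum_distrib_right sum_divide_distrib mult_ac)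
 finally show ?thesis by (rule power2_le_imp_le) (use Q1 a0 h0 in "auto simp: KC_def")
qed

section \<open>Interpolation of polynomials at the generators\<close>

lemma Lt_linear: "linear (%A. (tc t / (tn t .* y)^2) *R cross3 y (cross3 y (cross3 A (tn t))))"
 by (rule linearI) (simp_all add: cross_add_left cross_add_right cross_mult_left cross_mult_right scaleR_add_right)

definition hat :: "nat => nat => real" where "hat i j = (if j = i then 1 else 0)"

lemma Av_hat: assumes "t \<in> \<T>" "i \<in> t" shows "Av t (hat i) = alpha t i"
proof -
 have "Av t (hat i) = (SUM j:t. if j = i then alpha t i else 0)" unfolding Av_def hat_def by (intro sum.cong) auto
 thus ?thesis using assms T_finite by simp
qed

lemma Lt_sum:
 assumes t: "t \<in> \<T>"
 shows "(SUM i:t. s i *R Lt t (hat i) y) = (tc t / (tn t .* y)^2) *R cross3 y (cross3 y (cross3 (SUM i:t. s i *R alpha t i) (tn t)))"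
proof -
 define G where "G = (%A. (tc t / (tn t .* y)^2) *R cross3 y (cross3 y (cross3 A (tn t))))"
 have l: "linear G" unfolding G_def by (rule Lt_linear)
 have "G (SUM i:t. s i *R alpha t i) = (SUM i:t. s i *R G (alpha t i))" by (simp add: linear_sum[OF l] linear_cmul[OF l])
 also have "... = (SUM i:t. s i *R Lt t (hat i) y)"
  by (intro sum.cong refl) (simp add: Lt_def mt_def Av_hat[OF t] G_def)
 finally show ?thesis by (simp add: G_def)
qed

abbreviation "smp w == (%i. ev w (x i))"

text \<open>The weights sum to 1 and reproduce y, so constants and the linear Taylor term at y are
  interpolated exactly, in value and in derivative. What is left are the remainders at the
  vertices.\<close>

lemma interp_pointwise:
 fixes w :: pexp
 assumes t: "t \<in> \<T>" and y: "y \<in> tcone t" "norm y = 1"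
 defines "R == %i. taylor_rem (x i) (nu t) w y"
 shows "Jf (smp w) y - ev w y = (SUM i:t. R i * ((alpha t i .* y) / (nu t .* y)))"
  and "Lt t (smp w) y - Lv w y = (SUM i:t. R i *R Lt t (hat i) y)"
proof -
 define s where "s = nu t .* y"
 let ?z = "%i. cross3 y (s *R x i) .* Lv w y" and ?a = "%i. (alpha t i .* y) / s"
 define g where "g = cross3 (Lv w y) y"
 have s0: "s > 0" unfolding s_def using y by (intro nu_pos[OF t]) auto
 have yL: "y .* Lv w y = 0" by (simp add: Lv_cross dot_cross_self)
 have yy: "y .* y = 1" using y by (simp add: norm_eq_1)
 have R: "ev w (x i) = R i + ev w y + ?z i" for i
  by (simp add: R_def taylor_rem_def s_def)
 have sa: "(SUM i:t. ?a i) = 1" using s0 by (simp add: sum_divide_distrib[symmetric] s_def nu_dot_sum[OF t])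
 have "(SUM i:t. ?z i * ?a i) = cross3 y (SUM i:t. (alpha t i .* y) *R x i) .* Lv w y"
 proof -
  have "linear (cross3 y)" by (rule linearI) (simp_all add: cross_add_right cross_mult_right)
  from linear_sum[OF this, of "%i. (alpha t i .* y) *R x i" t] show ?thesis using s0
   by (simp add: inner_sum_left cross_mult_right algebra_simps)
 qed
 also have "... = 0" by (simp add: alpha_rep[OF t])
 finally have z: "(SUM i:t. ?z i * ?a i) = 0" .
 have "Jf (smp w) y = (SUM i:t. R i * ?a i) + ev w y * (SUM i:t. ?a i)
   + (SUM i:t. ?z i * ?a i)"
  unfolding Jf_sum[OF t y(1)] s_def[symmetric] by (subst R) (simp add: distrib_right add_divide_distrib sum.distrib sum_distrib_left)
 thus "Jf (smp w) y - ev w y = (SUM i:t. R i * ((alpha t i .* y) / (nu t .* y)))" unfolding z sa by (simp add: s_def)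
 have yg: "y .* g = 0" by (simp add: g_def dot_cross_self)
 have cg: "cross3 y g = Lv w y" unfolding g_def Lagrange using yL yy by simp
 have xg: "?z i = (s *R g) .* x i" for i
  unfolding g_def by (simp add: cross_mult_right) (metis cross_triple inner_commute)
 let ?A = "SUM i:t. ((s *R g) .* x i) *R alpha t i"
 have "?A = s *R g"
 proof (rule eq_by_dots[OF t])
  fix j assume j: "j \<in> t"
  have "?A .* x j = (SUM i:t. ((s *R g) .* x i) * (if i = j then 1 else 0))"
   unfolding inner_sum_left by (intro sum.cong) (auto simp: alpha_dual[OF t _ j])
  thus "?A .* x j = (s *R g) .* x j"
   using j T_finite[OF t] by (simp add: if_distrib cong: if_cong)
 qed
 hence "(SUM i:t. ?z i *R Lt t (hat i) y)
   = (tc t / (tn t .* y)^2) *R cross3 y (cross3 y (cross3 (s *R g) (tn t)))"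
  unfolding xg Lt_sum[OF t] by simp
 also have "cross3 y (cross3 (s *R g) (tn t)) = (tn t .* y) *R (s *R g)"
  unfolding Lagrange using yg by (simp add: inner_commute)
 also have "(tc t / (tn t .* y)^2) *R cross3 y ((tn t .* y) *R (s *R g)) = Lv w y"
  using s0 tc_pos[OF t] by (simp add: cross_mult_right cg tn_nu[OF t] s_def[symmetric] power2_eq_square)
 finally have z: "(SUM i:t. ?z i *R Lt t (hat i) y) = Lv w y" .
 have c: "(SUM i:t. Lt t (hat i) y) = 0"
  using Lt_sum[OF t, of "%_. 1" y] nu_sum[OF t, symmetric] by (simp add: nu_def cross_mult_left)
 have "Lt t (smp w) y = (SUM i:t. ev w (x i) *R Lt t (hat i) y)"
  unfolding Lt_sum[OF t] by (simp add: Lt_def mt_def Av_def)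
 also have "... = (SUM i:t. R i *R Lt t (hat i) y) + ev w y *R (SUM i:t. Lt t (hat i) y) + (SUM i:t. ?z i *R Lt t (hat i) y)"
  by (subst R) (simp add: scaleR_add_left sum.distrib scaleR_sum_right)
 finally show "Lt t (smp w) y - Lv w y = (SUM i:t. R i *R Lt t (hat i) y)" unfolding z c by simp
qed

text \<open>An inverse estimate: a hat function changes by 1 on a triangle with sides at most 2 h
  and \<open>Dt t\<close> at least a multiple of h^2.\<close>

lemma Lt_hat: assumes t: "t \<in> \<T>" "i \<in> t" and y: "y \<in> tcone t" "norm y = 1" shows "norm (Lt t (hat i) y) <= 3 * Q / h"
proof -
 have "Dt t * norm (mt t (hat i)) <= 2 * 1 * (2 * h)"
  by (rule mt_le[OF t(1)]) (auto simp: hat_def intro: dd_le[OF t(1)])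
 hence "(2 * h^2) * norm (mt t (hat i)) <= Q * (4 * h)"
  by (intro order_trans[OF mult_right_mono[OF h_Dt[OF t(1)]]]) (use Q1 in "simp_all add: mult.assoc")
 hence "norm (mt t (hat i)) <= 2 * Q / h" using h0 by (simp add: power2_eq_square field_simps)
 moreover have "norm (mt t (hat i)) / tc t <= norm (mt t (hat i)) / (2/3)"
  using tc_inv(1)[OF t(1)] by (intro divide_left_mono) auto
 moreover have "norm (mt t (hat i)) / (2/3) <= (2 * Q / h) / (2/3)" using `norm (mt t (hat i)) <= 2 * Q / h` by (rule divide_right_mono) simp
 moreover have "(2 * Q / h) / (2/3) = 3 * Q / h" by simp
 ultimately show ?thesis using Lt_bound[OF t(1) y, of "hat i"] by (metis order_trans)
qed

text \<open>Inside a triangle, the sum of the squared remainders at its three vertices; on the sides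
  of triangles it is 0.\<close>

definition TR :: "pexp => real^3 => real" where
 "TR w y = (SUM t:\<T>. ind (ticone t) y * (SUM i:t. (taylor_rem (x i) (nu t) w y)^2))"

lemma integrable_D2: "integrable surf (D2 w)" "(SI y. D2 w y) <= (3 * H2s w)^2"
proof -
 have i: "integrable surf (%y. (norm (Lv e y))^2)" for e using sqi_power2[OF sqi_norm_Lv] .
 show "integrable surf (D2 w)" unfolding D2_def[abs_def] using i by simp
 have "(SI y. D2 w y) = (H1s w)^2 + (H2s w)^2"
  unfolding D2_def using i by (simp add: H2s_power2 H1s_def nrm_power2)
 also have "(H1s w)^2 <= (2 * H2s w)^2" using H1s_le_H2s by (rule power_mono) simp
 also have "(2 * H2s w)^2 + (H2s w)^2 <= (3 * H2s w)^2" by (simp add: power_mult_distrib)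
 finally show "(SI y. D2 w y) <= (3 * H2s w)^2" by simp
qed

lemma taylor_rem_sqi: "sqi surf (taylor_rem a b w)" by (intro sqi_continuous continuous_on_taylor_rem continuous_on_id)

lemma TR_facts:
 shows "integrable surf (TR w)" "(SI y. TR w y) <= 35000 * h ^ 4 * (3 * H2s w)^2"
  and "t \<in> \<T> ==> y \<in> ticone t ==> TR w y = (SUM i:t. (taylor_rem (x i) (nu t) w y)^2)"
proof -
 have r: "integrable surf (%y. ind (ticone t) y * (taylor_rem (x i) (nu t) w y)^2)" if "t \<in> \<T>" for t i
  using split_ticone(2)[OF sqi_power2[OF taylor_rem_sqi] that] .
 show "integrable surf (TR w)" unfolding TR_def sum_distrib_left by (intro Bochner_Integration.integrable_sum r)
 have one: "(SI y. ind (ticone t) y * (taylor_rem (x i) (nu t) w y)^2) <= 144 * (3 * h) ^ 4 * (SI y. ind (ticone t) y * D2 w y)"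
  if t: "t \<in> \<T>" and i: "i \<in> t" for t i
 proof -
  have tt: "y \<in> tcone t" "y ~= 0" if "y \<in> ticone t" for y
   using that ticone_tcone i by (auto simp: ticone_def)
  have "(SI y. (taylor_rem (x i) (nu t) w y)^2 * ind (ticone t) y) <= 144 * (3 * h) ^ 4 * (SI y. D2 w y * ind (ticone t) y)"
  proof (rule taylor_cone[OF ticone_sets[OF t] _ nx[OF T_sub[OF t i]] nu_dot[OF t i]])
   show "r *R y \<in> ticone t" if "y \<in> ticone t" "r > 0" for y r using that by (simp add: ticone_def)
   show "nu t .* y > 0" if "y \<in> ticone t" for y using nu_pos[OF t tt[OF that]] .
   show "norm ((nu t .* y) *R x i - y) <= 3 * h * norm y" if "y \<in> ticone t" for y using tcone_near[OF t tt(1)[OF that] i] .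
   fix y s assume y: "y \<in> ticone t" and s: "0 <= s" "s < (1::real)"
   have "0 < (1 - s) * (alpha t j .* y) + (s * (nu t .* y)) * (alpha t j .* x i)" if j: "j \<in> t" for j
    using y s nu_pos[OF t tt[OF y]] alpha_dual[OF t j i] j by (intro add_pos_nonneg) (auto simp: ticone_def)
   thus "(1 - s) *R y + (s * (nu t .* y)) *R x i \<in> ticone t" by (simp add: ticone_def inner_add_right)
  qed (use h0 h1 in auto)
  thus ?thesis by (simp add: mult.commute)
 qed
 have "(SI y. TR w y) = (SUM t:\<T>. SUM i:t. \<integral>y. ind (ticone t) y * (taylor_rem (x i) (nu t) w y)^2 \<partial>surf)"
  unfolding TR_def sum_distrib_left using r by (simp add: LI_sum)
 also have "... <= (SUM t:\<T>. SUM i:t. 144 * (3 * h) ^ 4 * (SI y. ind (ticone t) y * D2 w y))"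
  by (intro sum_mono one)
 also have "... = 3 * (144 * (3 * h) ^ 4) * (SUM t:\<T>. \<integral>y. ind (ticone t) y * D2 w y \<partial>surf)"
  by (simp add: T_card sum_distrib_left mult.assoc)
 \<comment> \<open>Three vertices, 144 from \<open>taylor_cone\<close>, and 3^4 from the relative
   distance 3 h: 3 * 144 * 81.\<close>
 also have "... = 34992 * h ^ 4 * (SI y. D2 w y)" unfolding split_ticone(1)[OF integrable_D2(1)] by (simp add: power_mult_distrib mult.assoc)
 also have "... <= 35000 * h ^ 4 * (3 * H2s w)^2" by (intro mult_mono integrable_D2) (auto intro: integral_nonneg_AE D2_nonneg)
 finally show "(SI y. TR w y) <= 35000 * h ^ 4 * (3 * H2s w)^2" .
 assume t: "t \<in> \<T>" "y \<in> ticone t"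
 have "y ~: ticone s" if "s \<in> \<T>" "s ~= t" for s
  using ticone_disjoint[OF that(1) t(1)] that(2) t(2) ticone_tcone by blast
 hence "TR w y = (SUM s:\<T>. if s = t then (SUM i:t. (taylor_rem (x i) (nu t) w y)^2) else 0)"
  unfolding TR_def by (intro sum.cong refl) (simp add: t(2))
 thus "TR w y = (SUM i:t. (taylor_rem (x i) (nu t) w y)^2)" using t(1) finite_T by simp
qed

text \<open>Squaring a sum of three remainders costs a factor 3, and 3 * 35000 * 9 is below
  1000^2.\<close>

lemma interp_bound:
 assumes K: "K >= 0" and F: "F \<in> borel_measurable surf"
  and le: "!!t y. t \<in> \<T> ==> y \<in> ticone t ==> norm y = 1 ==> |F y| <= K * (SUM i:t. |taylor_rem (x i) (nu t) w y| )"
 shows "nrm surf F <= 1000 * K * h^2 * H2s w"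
proof (rule power2_le_imp_le)
 have "(nrm surf F)^2 <= (SI y. 3 * K^2 * TR w y)" unfolding nrm_power2
 proof (rule integral_mono_AE')
  show "AE y in surf. (F y)^2 <= 3 * K^2 * TR w y" using AE_ticone
  proof (rule AE_mp[OF _ AE_I2], intro impI)
   fix y assume y: "y \<in> space surf" and "\<exists>t\<in>\<T>. y \<in> ticone t"
   then obtain t where t: "t \<in> \<T>" "y \<in> ticone t" by blast
   let ?R = "%i. |taylor_rem (x i) (nu t) w y|"
   have "(F y)^2 <= (K * (SUM i:t. ?R i))^2" using power_mono[OF le[OF t], of 2] y by simp
   also have "... <= K^2 * ((SUM i:t. (?R i)^2) * 3)"
    unfolding power_mult_distrib using sum_squared_le_sum_of_squares[of ?R t] T_card[OF t(1)] by (intro mult_left_mono) auto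
   finally show "(F y)^2 <= 3 * K^2 * TR w y" using TR_facts(3)[OF t] by simp
  qed
  show "AE y in surf. 0 <= 3 * K^2 * TR w y" by (auto intro!: AE_I2 mult_nonneg_nonneg sum_nonneg simp: TR_def)
 qed (use TR_facts(1) in auto)
 also have "... <= 3 * K^2 * (35000 * h ^ 4 * (3 * H2s w)^2)"
  using mult_left_mono[OF TR_facts(2)[of w], of "3 * K^2"] by simp
 also have "... <= 1000000 * (K^2 * (h ^ 4 * (H2s w)^2))" by (simp add: power_mult_distrib)
 also have "... = (1000 * K * h^2 * H2s w)^2" by (simp add: power_mult_distrib)
 finally show "(nrm surf F)^2 <= (1000 * K * h^2 * H2s w)^2" .
qed (use K in simp)

lemma interp_L2: "nrm surf (%y. Jf (smp w) y - ev w y) <= 1000 * h^2 * H2s w"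
proof -
 have "nrm surf (%y. Jf (smp w) y - ev w y) <= 1000 * 1 * h^2 * H2s w"
 proof (rule interp_bound)
  show "(%y. Jf (smp w) y - ev w y) \<in> borel_measurable surf" by (intro borel_measurable_diff Jf_measurable measurable_surfI) simp
  fix t y assume t: "t \<in> \<T>" and y: "y \<in> ticone t" "norm y = 1"
  have yt: "y \<in> tcone t" using y ticone_tcone by blast
  have "y ~= 0" using y(2) by auto
  hence p: "nu t .* y > 0" by (rule nu_pos[OF t yt])
  have "|r * ((alpha t i .* y) / (nu t .* y))| <= |r|" if i: "i \<in> t" for i r
  proof -
   have "alpha t i .* y <= (SUM j:t. alpha t j .* y)" using yt T_finite[OF t] i by (intro member_le_sum) (auto simp: tcone_def)
   hence "|(alpha t i .* y) / (nu t .* y)| <= 1" using p yt i by (simp add: nu_dot_sum[OF t] tcone_def)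
   thus ?thesis unfolding abs_mult by (intro mult_left_le) auto
  qed
  thus "|Jf (smp w) y - ev w y| <= 1 * (SUM i:t. |taylor_rem (x i) (nu t) w y| )"
   unfolding interp_pointwise(1)[OF t yt y(2)] mult_1
   by (intro order_trans[OF sum_abs sum_mono])
 qed simp
 thus ?thesis by simp
qed

lemma interp_H1: "nrm surf (%y. norm (LJ (smp w) y - Lv w y)) <= 3000 * Q * h * H2s w"
proof -
 have "nrm surf (%y. norm (LJ (smp w) y - Lv w y)) <= 1000 * (3 * Q / h) * h^2 * H2s w"
 proof (rule interp_bound)
  show "(%y. norm (LJ (smp w) y - Lv w y)) \<in> borel_measurable surf"
   by (intro measurable_compose[OF _ borel_measurable_norm] borel_measurable_diff LJ_measurable measurable_surf_Lv)
  fix t y assume t: "t \<in> \<T>" and y: "y \<in> ticone t" "norm y = 1"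
  have yt: "y \<in> tcone t" using y ticone_tcone by blast
  have "norm (SUM i:t. taylor_rem (x i) (nu t) w y *R Lt t (hat i) y) <= (SUM i:t. |taylor_rem (x i) (nu t) w y| * (3 * Q / h))"
   using Lt_hat[OF t _ yt y(2)] by (intro sum_norm_le) (auto simp only: norm_scaleR intro!: mult_left_mono)
  thus "|norm (LJ (smp w) y - Lv w y)| <= (3 * Q / h) * (SUM i:t. |taylor_rem (x i) (nu t) w y| )"
   unfolding LJ_eq[OF t y(1)] interp_pointwise(2)[OF t yt y(2)] sum_distrib_right[symmetric] by (simp add: mult.commute)
 qed (use Q1 h0 in simp)
 thus ?thesis using h0 by (simp add: power2_eq_square)
qed

end

section \<open>Sampling error on the Voronoi cells\<close>

lemma CS_bound:
 assumes s: "sqi M f" "sqi M g" and c: "c >= 0" and b: "!!y. y \<in> space M ==> |F y| <= c * ( |f y| * |g y| )"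
 shows "|\<integral>y. F y \<partial>M| <= c * (nrm M f * nrm M g)"
proof (cases "integrable M F")
 case True
 have a: "sqi M (%y. |f y| )" if "sqi M f" for f :: "'a => real" using that by (auto simp: sqi_def)
 note fg = a[OF s(1)] a[OF s(2)]
 have "|\<integral>y. F y \<partial>M| <= (\<integral>y. |F y| \<partial>M)" by (rule integral_abs_bound)
 also have "... <= (\<integral>y. c * ( |f y| * |g y| ) \<partial>M)" using True sqi_mult[OF fg] b by (intro integral_mono) auto
 also have "... = c * (\<integral>y. |f y| * |g y| \<partial>M)" by simp
 also have "... <= c * (nrm M (%y. |f y| ) * nrm M (%y. |g y| ))" using ip_le[OF fg] c by (intro mult_left_mono) auto
 finally show ?thesis by (simp add: nrm_def)
\<comment> \<open>The integral of a function that is not integrable is 0 by convention.\<close>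
qed (use c in "simp add: not_integrable_integral_eq")

context fine begin

abbreviation "ci k y == (ind (voronoi_cell N x k) y :: real)"

definition nV :: "nat => (real^3 => real) => real" where "nV k F = nrm surf (%y. ci k y * F y)"

lemma nV_nonneg [simp]: "0 <= nV k F" by (simp add: nV_def)

lemma nV_power2: "(nV k F)^2 = (SI y. ci k y * (F y)^2)"
 unfolding nV_def nrm_power2 by (intro LI_cong) (auto simp: indicator_def)

lemma sqi_cell: assumes k: "k \<in> I" and F: "sqi surf F" shows "sqi surf (%y. ci k y * F y)"
proof -
 have "(%y. (ci k y * F y)^2) = (%y. ci k y * (F y)^2)" by (auto simp: indicator_def fun_eq_iff)
 moreover have "(%y. ci k y * F y) \<in> borel_measurable surf"
  using F cell_sets(1)[OF k] unfolding sqi_def by (intro borel_measurable_times borel_measurable_indicator) auto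
 ultimately show ?thesis using split_cell(2)[OF sqi_power2[OF F] k] by (simp add: sqi_def)
qed

lemma nV_L2_set: assumes "sqi surf F" shows "L2_set (%k. nV k F) I = nrm surf F"
 unfolding L2_set_def nV_power2 split_cell(1)[OF sqi_power2[OF assms], symmetric] nrm_def ..

lemma cell_ip:
 assumes k: "k \<in> I" and s: "sqi surf f" "sqi surf g" and c: "c >= 0"
  and b: "!!y. y \<in> voronoi_cell N x k ==> |F y| <= c * ( |f y| * |g y| )"
 shows "|\<integral>y. ci k y * F y \<partial>surf| <= c * (nV k f * nV k g)"
 unfolding nV_def using b by (intro CS_bound sqi_cell k s c) (auto simp: indicator_def)

text \<open>The Taylor and Poincare estimates are formulated for cones in R^3; this is the one over
  the open cell.\<close>

definition ccone :: "nat => (real^3) set" where "ccone k = {y. \<forall>j\<in>I - {k}. x j .* y < x k .* y}"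

lemma ccone_facts:
 assumes k: "k \<in> I"
 shows "ccone k \<in> sets borel" "convex (ccone k)" "y \<in> ccone k ==> r > 0 ==> r *R y \<in> ccone k"
  "ccone k Int S2 = voronoi_cell N x k" "y \<in> ccone k ==> y ~= 0" "y \<in> ccone k ==> sgn y \<in> voronoi_cell N x k"
proof -
 have e: "ccone k = (\<Inter>j\<in>I - {k}. {y. (x j - x k) .* y < 0})" by (auto simp: ccone_def inner_diff_left)
 have "open (ccone k)" unfolding e by (intro open_INT) (auto intro: open_halfspace_lt)
 thus "ccone k \<in> sets borel" by simp
 show "convex (ccone k)" unfolding e by (intro convex_INT convex_halfspace_lt)
 show sc: "r *R y \<in> ccone k" if "y \<in> ccone k" "r > 0" for y r using that by (simp add: ccone_def)
 show S: "ccone k Int S2 = voronoi_cell N x k" unfolding cell_eq[OF k] by (auto simp: ccone_def)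
 obtain t where t: "t \<in> \<T>" "k \<in> t" by (rule vertex_in_T[OF k])
 obtain i j where ij: "t = {i, j, k}" "i ~= j" "i ~= k" "j ~= k" by (rule T_triple[OF t])
 have "i \<in> I - {k}" using T_sub[OF t(1), of i] ij by auto
 thus n0: "y ~= 0" if "y \<in> ccone k" for y using that by (auto simp: ccone_def)
 show "sgn y \<in> voronoi_cell N x k" if y: "y \<in> ccone k"
  unfolding S[symmetric] using sc[OF y, of "inverse (norm y)"] n0[OF y] by (simp add: sgn_div_norm norm_sgn)
qed

lemma cell_near_unit: "k \<in> I ==> y \<in> voronoi_cell N x k ==> norm (y - x k) <= h"
 using W_h cell_W by blast

lemma ci_ccone: assumes k: "k \<in> I" shows "(SI y. F y * ind (ccone k) y) = (SI y. ci k y * F y)"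
proof (rule LI_cong[OF refl])
 fix y assume "y \<in> space surf"
 hence "y \<in> ccone k \<longleftrightarrow> y \<in> voronoi_cell N x k" unfolding ccone_facts(4)[OF k, symmetric] by simp
 thus "F y * ind (ccone k) y = ci k y * F y" by (simp add: indicator_def)
qed

text \<open>Apex and linear form are both the generator. Generators have unit length, so a segment
  towards the ray of the generator keeps the strict inequalities of the cone, as
  \<open>taylor_cone\<close> requires.\<close>

lemma cell_taylor:
 assumes k: "k \<in> I"
 shows "nV k (taylor_rem (x k) (x k) w) <= 12 * h^2 * nV k (%y. sqrt (D2 w y))"
proof (rule power2_le_imp_le)
 let ?a = "x k"
 have near: "norm ((?a .* y) *R ?a - y) <= h * norm y & ?a .* y > 0" if y: "y \<in> ccone k" for y
 proof -
  define s where "s = sgn y"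
  have s: "s \<in> voronoi_cell N x k" "norm s = 1" "y = norm y *R s"
   using ccone_facts(5,6)[OF k y] by (auto simp: s_def norm_sgn sgn_div_norm)
  have p: "?a .* s > 0" using W_pos[of s k] cell_W[OF k] s(1) by blast
  have ss: "s .* s = 1" using s(2) by (simp add: norm_eq_1)
  have "(norm (s - ?a))^2 - (norm ((?a .* s) *R ?a - s))^2 = (1 - ?a .* s)^2"
   unfolding power2_norm_eq_inner by (simp add: inner_diff_left inner_diff_right xx[OF k] ss inner_commute power2_eq_square algebra_simps)
  hence "(norm ((?a .* s) *R ?a - s))^2 <= (norm (s - ?a))^2"
   using zero_le_power2[of "1 - ?a .* s"] by linarith
  hence "norm ((?a .* s) *R ?a - s) <= norm (s - ?a)" by (rule power2_le_imp_le) simp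
  also have "... <= h" by (rule cell_near_unit[OF k s(1)])
  finally have n: "norm ((?a .* s) *R ?a - s) <= h" .
  have "(?a .* y) *R ?a - y = norm y *R ((?a .* s) *R ?a - s)"
   using ccone_facts(5)[OF k y] by (simp add: s_def sgn_div_norm scaleR_diff_right)
  hence "norm ((?a .* y) *R ?a - y) = norm y * norm ((?a .* s) *R ?a - s)" by simp
  moreover have "?a .* y > 0" using p ccone_facts(5)[OF k y] by (simp add: s_def sgn_div_norm zero_less_mult_iff)
  ultimately show ?thesis using mult_left_mono[OF n, of "norm y"] by (simp add: mult.commute)
 qed
 have "(SI y. (taylor_rem ?a ?a w y)^2 * ind (ccone k) y) <= 144 * h ^ 4 * (SI y. D2 w y * ind (ccone k) y)"
 proof (rule taylor_cone[OF ccone_facts(1,3)[OF k] nx[OF k] xx[OF k]])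
  fix y s assume y: "y \<in> ccone k" and s: "0 <= s" "s < (1::real)"
  have "x j .* ((1 - s) *R y + (s * (?a .* y)) *R ?a) < ?a .* ((1 - s) *R y + (s * (?a .* y)) *R ?a)" if j: "j \<in> I - {k}" for j
  proof -
   have "x j .* ?a <= 1" "x j .* y < ?a .* y" using dot_less_1[of j k] k j y by (auto simp: ccone_def)
   hence "(1 - s) * (x j .* y) + (s * (?a .* y)) * (x j .* ?a) < (1 - s) * (?a .* y) + (s * (?a .* y)) * 1"
    using s near[OF y] by (intro add_less_le_mono mult_strict_left_mono mult_left_mono) auto
   thus ?thesis by (simp add: inner_add_right xx[OF k])
  qed
  thus "(1 - s) *R y + (s * (?a .* y)) *R ?a \<in> ccone k" by (simp add: ccone_def)
 qed (use near h0 h1 in auto)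
 thus "(nV k (taylor_rem ?a ?a w))^2 <= (12 * h^2 * nV k (%y. sqrt (D2 w y)))^2"
  unfolding ci_ccone[OF k] power_mult_distrib nV_power2 by (simp add: D2_nonneg)
qed simp

lemma sqi_D2: "sqi surf (%y. sqrt (D2 w y))"
 by (intro sqi_continuous continuous_on_real_sqrt continuous_on_D2 continuous_on_id)

lemma D2_ge: "norm (Lv w y) <= sqrt (D2 w y)" "norm (Lv (L j w) y) <= sqrt (D2 w y)" "|ev (L j w) y| <= sqrt (D2 w y)"
proof -
 show n: "norm (Lv w y) <= sqrt (D2 w y)" by (rule real_le_rsqrt) (simp add: D2_def sum_nonneg)
 have "(norm (Lv (L j w) y))^2 <= (SUM m:UNIV. (norm (Lv (L m w) y))^2)" by (rule member_le_sum) auto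
 thus "norm (Lv (L j w) y) <= sqrt (D2 w y)" using zero_le_power2[of "norm (Lv w y)"] unfolding D2_def by (intro real_le_rsqrt) linarith
 show "|ev (L j w) y| <= sqrt (D2 w y)" using component_le_norm_cart[of "Lv w y" j] n by simp
qed

text \<open>The components of y x x_k are linear forms vanishing at x_k, so they have mean zero over
  the cell by the centroid property. They are bounded by h, and \<open>cone_mean\<close> supplies
  the second factor h.\<close>

lemma cell_moment:
 assumes k: "k \<in> I"
 shows "|\<integral>y. ci k y * (cross3 y (x k) $ j * ev g y) \<partial>surf| <= 6000 * h^2 * (SI y. ci k y * norm (Lv g y))"
proof -
 have "|\<integral>y. (cross3 y (x k) $ j) * ev g y * ind (ccone k) y \<partial>surf| <= 6000 * h * h * (SI y. norm (Lv g y) * ind (ccone k) y)"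
 proof (rule cone_mean[OF ccone_facts(1,2,3)[OF k] nx[OF k]])
  show "area (ccone k Int S2) > 0" unfolding ccone_facts(4)[OF k] using area_ge[OF k] a0 hh(2) by (smt (verit) mult_pos_pos)
  show "continuous_on S2 (%y. cross3 y (x k) $ j)" by (intro continuous_on_cross continuous_intros)
  have "cross3 y (x k) $ j = cross3 (x k) (axis j 1) .* y" for y
   using cross_triple[of y "x k" "axis j 1"] by (simp add: inner_axis)
  thus "(SI y. cross3 y (x k) $ j * ind (ccone k) y) = 0"
   unfolding ci_ccone[OF k] using centroid[OF k, of "cross3 (x k) (axis j 1)"] by (simp add: dot_cross_self inner_commute)
  show "|cross3 y (x k) $ j| <= h" if "y \<in> ccone k" "y \<in> S2" for y
  proof -
   have n: "norm (y - x k) <= h" using cell_near_unit[OF k] ccone_facts(4)[OF k] that by blast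
   have "cross3 y (x k) = cross3 (y - x k) (x k)" by (simp add: Cross3.left_diff_distrib)
   thus ?thesis using component_le_norm_cart[of "cross3 y (x k)" j] norm_cross_le[of "y - x k" "x k"] nx[OF k] n by simp
  qed
 qed (use ccone_facts(5,6)[OF k] cell_near_unit[OF k] h0 h1 in auto)
 thus ?thesis unfolding ci_ccone[OF k] by (simp add: power2_eq_square mult.assoc)
qed

(* By the centroid property, the first order term of the Taylor expansion at the generator only sees
 the oscillation of z times the gradient of w. *)
lemma cell_term:
 assumes k: "k \<in> I"
 shows "|\<integral>y. ci k y * (ev z y * (ev w y - ev w (x k))) \<partial>surf|
  <= 20000 * h^2 * ((nV k (ev z) + nV k (%y. norm (Lv z y))) * nV k (%y. sqrt (D2 w y)))"
proof -
 define a q where "a = x k" and "q = (%y. cross3 y a)"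
 define Z Z1 Wd where "Z = nV k (ev z)" and "Z1 = nV k (%y. norm (Lv z y))" and "Wd = nV k (%y. sqrt (D2 w y))"
 have sz: "sqi surf (ev z)" by (rule surf.sqi_ev)
 have pos: "0 <= Z" "0 <= Z1" "0 <= Wd" "0 <= h" using h0 by (auto simp: Z_def Z1_def Wd_def)
 \<comment> \<open>The linear Taylor term is (a . y) (q . Lv w). \<open>T2\<close> carries it with
   coefficient 1, where the centroid property applies; \<open>T5\<close> corrects this by the small
   number 1 - a . y; \<open>T1\<close> contains the remainder.\<close>
 define T1 T2 T5 where "T1 = (%y. ev z y * taylor_rem a a w y)" and "T2 = (%j y. q y $ j * ev (PMul z (L j w)) y)"
  and "T5 = (%y. ev z y * ((1 - a .* y) * (q y .* Lv w y)))"
 have "|\<integral>y. ci k y * T1 y \<partial>surf| <= 1 * (Z * nV k (taylor_rem a a w))"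
  unfolding Z_def by (rule cell_ip[OF k sz taylor_rem_sqi]) (auto simp: T1_def abs_mult)
 also have "... <= 1 * (Z * (12 * h^2 * Wd))"
  using cell_taylor[OF k] pos unfolding a_def Wd_def by (intro mult_left_mono) auto
 finally have b1: "|\<integral>y. ci k y * T1 y \<partial>surf| <= 12 * (h^2 * (Z * Wd))" by (simp add: mult_ac)
 have b2: "|\<integral>y. ci k y * T2 j y \<partial>surf| <= 6000 * (h^2 * ((Z + Z1) * Wd))" for j
 proof -
  define f where "f = (%y. |ev z y| + norm (Lv z y))"
  have sa: "sqi surf (%y. |ev z y| )" using sz by (auto simp: sqi_def)
  have "nV k f = nrm surf (%y. ci k y * |ev z y| + ci k y * norm (Lv z y))" by (simp add: nV_def f_def distrib_left)
  also have "... <= nV k (%y. |ev z y| ) + Z1" unfolding nV_def Z1_def by (intro nrm_triangle sqi_cell k sa sqi_norm_Lv)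
  also have "nV k (%y. |ev z y| ) = Z" by (simp add: nV_def Z_def nrm_def power_mult_distrib)
  finally have nf: "nV k f <= Z + Z1" .
  have "|\<integral>y. ci k y * norm (Lv (PMul z (L j w)) y) \<partial>surf| <= 1 * (nV k f * nV k (%y. sqrt (D2 w y)))"
  proof (rule cell_ip[OF k _ sqi_D2])
   show "sqi surf f" unfolding f_def by (intro sqi_add sa sqi_norm_Lv)
   fix y
   have "Lv (PMul z (L j w)) y = ev (L j w) y *R Lv z y + ev z y *R Lv (L j w) y" by (simp add: vec_eq_iff)
   hence "norm (Lv (PMul z (L j w)) y) <= |ev (L j w) y| * norm (Lv z y) + |ev z y| * norm (Lv (L j w) y)"
    using norm_triangle_ineq by (metis norm_scaleR)
   also have "... <= sqrt (D2 w y) * norm (Lv z y) + |ev z y| * sqrt (D2 w y)"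
    by (intro add_mono mult_mono D2_ge) (auto simp: D2_nonneg)
   finally show "|norm (Lv (PMul z (L j w)) y)| <= 1 * ( |f y| * |sqrt (D2 w y)| )" by (simp add: f_def D2_nonneg algebra_simps)
  qed simp
  also have "... <= (Z + Z1) * Wd" unfolding Wd_def using nf by (simp add: mult_right_mono)
  finally have "6000 * h^2 * (SI y. ci k y * norm (Lv (PMul z (L j w)) y)) <= 6000 * h^2 * ((Z + Z1) * Wd)" by (intro mult_left_mono) auto
  thus ?thesis using cell_moment[OF k, of j "PMul z (L j w)"] unfolding T2_def q_def a_def by linarith
 qed
 have "|\<integral>y. ci k y * T5 y \<partial>surf| <= h^2 * (nV k (ev z) * nV k (%y. sqrt (D2 w y)))"
 proof (rule cell_ip[OF k sz sqi_D2])
  fix y assume y: "y \<in> voronoi_cell N x k"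
  have n: "norm (y - a) <= h" unfolding a_def by (rule cell_near_unit[OF k y])
  have "q y = cross3 (y - a) a" by (simp add: q_def Cross3.left_diff_distrib)
  hence q: "norm (q y) <= h" using norm_cross_le[of "y - a" a] nx[OF k] n by (simp add: a_def)
  have y1: "norm y = 1" using y cell_sub[OF k] by auto
  have "2 - 2 * (a .* y) = (norm (y - a))^2" using unit_dist_sq[OF y1 nx[OF k]] by (simp add: a_def inner_commute)
  moreover have "(norm (y - a))^2 <= h^2" using n by (rule power_mono) simp
  moreover have "h^2 <= h" using h0 h1 by (simp add: power2_eq_square mult_left_le)
  ultimately have a: "|1 - a .* y| <= h" using zero_le_power2[of "norm (y - a)"] h0 by linarith
  have "|q y .* Lv w y| <= norm (q y) * norm (Lv w y)" by (rule Cauchy_Schwarz_ineq2)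
  also have "... <= h * sqrt (D2 w y)" using q pos by (intro mult_mono D2_ge) auto
  finally have "|1 - a .* y| * |q y .* Lv w y| <= h * (h * sqrt (D2 w y))" using pos a by (intro mult_mono) auto
  thus "|T5 y| <= h^2 * ( |ev z y| * |sqrt (D2 w y)| )"
   unfolding T5_def abs_mult using mult_left_mono[of _ _ "|ev z y|"] by (fastforce simp: power2_eq_square mult_ac D2_nonneg)
 qed simp
 hence b5: "|\<integral>y. ci k y * T5 y \<partial>surf| <= h^2 * (Z * Wd)" by (simp add: Z_def Wd_def)
 have eq: "ev z y * (ev w y - ev w (x k)) = - T1 y - (SUM j:UNIV. T2 j y) + T5 y" for y
 proof -
  have "ev w a - ev w y = taylor_rem a a w y + (a .* y) * (q y .* Lv w y)" by (simp add: taylor_rem_def cross_mult_right q_def)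
  hence 1: "ev w y - ev w (x k) = - taylor_rem a a w y - (a .* y) * (q y .* Lv w y)" by (simp add: a_def)
  have "(SUM j:UNIV. T2 j y) = ev z y * (q y .* Lv w y)" by (simp add: T2_def inner_vec_def sum_distrib_left mult.left_commute)
  thus ?thesis unfolding 1 T1_def T5_def by (simp add: algebra_simps)
 qed
 have "continuous_on S2 T1" "continuous_on S2 T5" "!!j. continuous_on S2 (T2 j)"
  unfolding T1_def T2_def T5_def q_def by (intro continuous_on_cross continuous_intros)+
 note i = this[THEN integrable_continuous_S2, THEN split_cell(2), OF k]
 define P where "P = (%j y. ci k y * T2 j y)"
 have i3: "integrable surf (P j)" for j unfolding P_def by (rule i(3))
 have "(SI y. ci k y * (ev z y * (ev w y - ev w (x k)))) = (SI y. - (ci k y * T1 y) - (SUM j:UNIV. P j y) + ci k y * T5 y)"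
  unfolding eq P_def sum_distrib_left[symmetric] by (simp add: algebra_simps)
 also have "... = - (SI y. ci k y * T1 y) - (SUM j:UNIV. \<integral>y. P j y \<partial>surf) + (SI y. ci k y * T5 y)"
  using i i3 by (simp add: LI_sum)
 finally have e: "(SI y. ci k y * (ev z y * (ev w y - ev w (x k)))) = ..." .
 have b2s: "|SUM j:UNIV. \<integral>y. P j y \<partial>surf| <= 18000 * (h^2 * ((Z + Z1) * Wd))"
  unfolding P_def using sum_mono[of "UNIV :: 3 set", OF b2] by (intro order_trans[OF sum_abs]) auto
 have "h^2 * (Z * Wd) <= h^2 * ((Z + Z1) * Wd)" "0 <= h^2 * (Z * Wd)" using pos by (auto intro!: mult_left_mono mult_right_mono)
 hence "|\<integral>y. ci k y * (ev z y * (ev w y - ev w (x k))) \<partial>surf| <= 20000 * (h^2 * ((Z + Z1) * Wd))"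
  unfolding e using b1 b2s b5 by linarith
 thus ?thesis unfolding Z_def Z1_def Wd_def by (simp add: mult.assoc)
qed

lemma sqi_vh: "sqi surf (vh v)"
 using vh_bounded by (intro surf.sqi_bounded[OF vh_measurable]) auto

text \<open>The cell estimates are summed by Cauchy-Schwarz over the cells, since squared cell norms
  add up to squared global norms.\<close>

lemma cell_sample: "|\<integral>y. ev z y * (ev w y - vh (smp w) y) \<partial>surf| <= 60000 * h^2 * ((nrm surf (ev z) + H1s z) * H2s w)"
proof -
 let ?Z = "%k. nV k (ev z)" and ?Z1 = "%k. nV k (%y. norm (Lv z y))" and ?W = "%k. nV k (%y. sqrt (D2 w y))"
 have "integrable surf (%y. ev z y * (ev w y - vh (smp w) y))" by (intro sqi_mult sqi_diff surf.sqi_ev sqi_vh)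
 hence "(SI y. ev z y * (ev w y - vh (smp w) y)) = (SUM k:I. \<integral>y. ci k y * (ev z y * (ev w y - vh (smp w) y)) \<partial>surf)"
  by (rule split_cell(1))
 also have "... = (SUM k:I. \<integral>y. ci k y * (ev z y * (ev w y - ev w (x k))) \<partial>surf)"
  by (intro sum.cong refl LI_cong) (auto simp: indicator_def vh_eq)
 also have "|...| <= (SUM k:I. 20000 * h^2 * ((?Z k + ?Z1 k) * ?W k))"
  by (rule order_trans[OF sum_abs sum_mono]) (rule cell_term)
 also have "... = 20000 * h^2 * (SUM k:I. |?Z k + ?Z1 k| * |?W k| )" by (simp add: sum_distrib_left)
 also have "... <= 20000 * h^2 * (L2_set (%k. ?Z k + ?Z1 k) I * L2_set ?W I)"
  by (intro mult_left_mono L2_set_mult_ineq) simp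
 also have "... <= 20000 * h^2 * ((nrm surf (ev z) + H1s z) * (3 * H2s w))"
 proof (intro mult_left_mono mult_mono)
  show "L2_set (%k. ?Z k + ?Z1 k) I <= nrm surf (ev z) + H1s z"
   using L2_set_triangle_ineq[of ?Z ?Z1 I] nV_L2_set[OF surf.sqi_ev[of z]] nV_L2_set[OF sqi_norm_Lv[of z]] by (simp add: H1s_def)
  have "L2_set ?W I = sqrt (SI y. D2 w y)" using nV_L2_set[OF sqi_D2, of w] by (simp add: nrm_def D2_nonneg)
  also have "... <= 3 * H2s w" using integrable_D2(2) by (intro real_le_lsqrt) (auto intro: integral_nonneg_AE simp: D2_nonneg)
  finally show "L2_set ?W I <= 3 * H2s w" .
 qed (auto intro: L2_set_nonneg)
 finally show ?thesis by (simp add: mult_ac)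
qed

end

section \<open>The error estimate on fine meshes\<close>

lemma vip_bound:
 fixes F G :: "'a => real^3"
 assumes "F \<in> borel_measurable M" "G \<in> borel_measurable M" "sqi M (%y. norm (F y))" "sqi M (%y. norm (G y))"
  and ab: "nrm M (%y. norm (F y)) <= a" "nrm M (%y. norm (G y)) <= b"
 shows "|\<integral>y. F y .* G y \<partial>M| <= a * b"
 by (rule order_trans[OF vip_le(1)[OF assms(1-4)] mult_mono[OF ab order_trans[OF nrm_nonneg ab(1)] nrm_nonneg]])

lemma ip_bound: "sqi M f ==> sqi M g ==> nrm M f <= a ==> nrm M g <= b ==> |\<integral>y. f y * g y \<partial>M| <= a * b"
 by (rule order_trans[OF ip_le mult_mono]) (auto intro: order_trans[OF nrm_nonneg])

context vd begin

lemma Bh_diff: "Bh (%i. u i - v i) w = Bh u w - Bh v w"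
 unfolding Bh_def by (simp add: right_diff_distrib left_diff_distrib sum_subtractf)

lemma mt_add: "mt t (%i. v i + w i) = mt t v + mt t w"
 by (simp add: mt_def Av_def scaleR_add_left sum.distrib cross_add_left)

lemma LJ_add: "LJ (%i. v i + w i) y = LJ v y + LJ w y"
 by (simp add: LJ_def Lt_def mt_add cross_add_right scaleR_add_right sum.distrib)

lemma sqi_Jf: "sqi surf (Jf v)"
proof (rule surf.sqi_bounded[OF Jf_measurable])
 fix y :: "real^3" assume y: "y \<in> space surf"
 define C where "C = (SUM i:I. |v i| )"
 have "|v i| <= C" if "i \<in> I" for i unfolding C_def using that by (intro member_le_sum) auto
 thus "|Jf v y| <= (SUM i:I. |v i| )" using Jf_bounds[of y "- C" v C] y unfolding C_def[symmetric] by (fastforce simp: abs_le_iff)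
qed

lemma sqi_LJ: "sqi surf (%y. norm (LJ v y))"
 using LJ_bounded by (intro surf.sqi_bounded[of _ "SUM t:\<T>. norm (mt t v) / tc t"] measurable_compose[OF LJ_measurable borel_measurable_norm]) auto

text \<open>The duality argument of \<open>poincare_poly\<close>, with \<open>Jf_parts\<close> as
  integration by parts; the constant is independent of the mesh.\<close>

lemma Jf_poincare:
 assumes "(SI y. Jf v y - c) = 0"
 shows "nrm surf (%y. Jf v y - c) <= 2 * nrm surf (%y. norm (LJ v y))"
proof (rule dual_norm_bound[OF sqi_diff[OF sqi_Jf surf.sqi_const] assms])
 fix p assume p: "(SI y. ev p y) = 0"
 then obtain w where w: "\<forall>y\<in>S2. ev (LB w) y = - ev p y" "H1s w <= 2 * nrm surf (ev p)" using poisson_dual by blast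
 have "(SI y. (Jf v y - c) * ev p y) = (SI y. Jf v y * ev p y - c * ev p y)" by (simp add: left_diff_distrib)
 also have "... = (SI y. Jf v y * ev p y)"
  using p sqi_mult[OF sqi_Jf surf.sqi_ev] surf.sqi_integrable[OF surf.sqi_ev] by simp
 also have "... = - (SI y. Jf v y * ev (LB w) y)"
  unfolding Bochner_Integration.integral_minus[symmetric] using w(1) by (intro LI_cong) auto
 also have "... = (SI y. LJ v y .* Lv w y)" by (simp add: Jf_parts)
 also have "... <= nrm surf (%y. norm (LJ v y)) * H1s w"
  using vip_le(1)[OF LJ_measurable measurable_surf_Lv sqi_LJ sqi_norm_Lv, of v w] by (simp add: H1s_def)
 also have "... <= nrm surf (%y. norm (LJ v y)) * (2 * nrm surf (ev p))" using w(2) by (intro mult_left_mono) auto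
 finally show "(SI y. (Jf v y - c) * ev p y) <= 2 * nrm surf (%y. norm (LJ v y)) * nrm surf (ev p)" by simp
qed simp

end

context fine begin

lemma SN_add: "SN (%i. v i + w i) <= SN v + SN w"
proof -
 have "SN (%i. v i + w i) <= L2_set (%t. sqrt (Dt t) * norm (mt t v) + sqrt (Dt t) * norm (mt t w)) \<T>"
  unfolding SN_def mt_add
 proof (rule L2_set_mono)
  fix t assume t: "t \<in> \<T>"
  show "sqrt (Dt t) * norm (mt t v + mt t w) <= sqrt (Dt t) * norm (mt t v) + sqrt (Dt t) * norm (mt t w)"
   unfolding distrib_left[symmetric] using Dt_pos[OF t] by (intro mult_left_mono norm_triangle_ineq) simp
  show "0 <= sqrt (Dt t) * norm (mt t v + mt t w)" using Dt_pos[OF t] by simp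
 qed
 also have "... <= SN v + SN w" unfolding SN_def by (rule L2_set_triangle_ineq)
 finally show ?thesis .
qed

lemma LJ_SN: "nrm surf (%y. norm (LJ v y)) <= SN v" "SN v <= 2 * nrm surf (%y. norm (LJ v y))"
proof -
 have e: "(nrm surf (%y. norm (LJ v y)))^2 = (SI y. LJ v y .* LJ v y)" by (simp add: nrm_power2 power2_norm_eq_inner)
 show "nrm surf (%y. norm (LJ v y)) <= SN v" by (rule power2_le_imp_le[OF _ SN_nonneg]) (unfold e, rule SN_LJ)
 have "(SN v)^2 <= (2 * nrm surf (%y. norm (LJ v y)))^2" using SN_LJ(1)[of v] unfolding power_mult_distrib e by simp
 thus "SN v <= 2 * nrm surf (%y. norm (LJ v y))" by (rule power2_le_imp_le) simp
qed

lemma nrm_vector_triangle: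
 assumes "sqi surf (%y. norm (F y))" "sqi surf (%y. norm (G y))" "sqi surf (%y. norm (F y + G y))"
 shows "nrm surf (%y. norm (F y + G y)) <= nrm surf (%y. norm (F y)) + nrm surf (%y. norm (G y))"
proof -
 have "nrm surf (%y. norm (F y + G y)) <= nrm surf (%y. norm (F y) + norm (G y))"
  unfolding nrm_def using assms norm_triangle_ineq[of "F _" "G _"]
  by (intro real_sqrt_le_mono integral_mono sqi_power2 sqi_add) (auto intro: power_mono)
 also have "... <= nrm surf (%y. norm (F y)) + nrm surf (%y. norm (G y))" by (rule nrm_triangle[OF assms(1,2)])
 finally show ?thesis .
qed

lemma sqi_LJ_Lv: "sqi surf (%y. norm (LJ v y - Lv w y))"
proof -
 obtain D where D: "\<forall>y\<in>S2. norm (Lv w y) <= D" using Lv_bounded by blast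
 have "(%y. norm (LJ v y - Lv w y)) \<in> borel_measurable surf"
  by (intro measurable_compose[OF _ borel_measurable_norm] borel_measurable_diff LJ_measurable measurable_surf_Lv)
 thus ?thesis
 proof (rule surf.sqi_bounded)
  fix y assume "y \<in> space surf"
  hence "norm (LJ v y) <= (SUM t:\<T>. norm (mt t v) / tc t)" "norm (Lv w y) <= D" using LJ_bounded[of y v] D by auto
  thus "|norm (LJ v y - Lv w y)| <= (SUM t:\<T>. norm (mt t v) / tc t) + D"
   using norm_triangle_ineq4[of "LJ v y" "Lv w y"] by simp
 qed
qed

lemma SN_smp: assumes "15 * (Q * h) <= 1" shows "SN (smp w) <= 404 * H2s w"
proof -
 have "nrm surf (%y. norm ((LJ (smp w) y - Lv w y) + Lv w y)) <= 3000 * Q * h * H2s w + H1s w"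
  using nrm_vector_triangle[OF sqi_LJ_Lv sqi_norm_Lv, of "smp w" w w] interp_H1[of w] sqi_LJ by (simp add: H1s_def)
 \<comment> \<open>3000 / 15 = 200. Adding 2 from \<open>H1s_le_H2s\<close> and doubling by
   \<open>LJ_SN\<close> gives 404.\<close>
 also have "3000 * Q * h * H2s w <= 200 * H2s w" using assms by (intro mult_right_mono) auto
 finally show ?thesis using LJ_SN(2)[of "smp w"] H1s_le_H2s[of w] by simp
qed

text \<open>\<open>KE\<close> bounds the energy error, its factor 4 being that of coercivity. The
  summands of \<open>KS\<close> belong to the sampling error, the consistency of \<open>Bh\<close>,
  the two products of first order errors, and the L^2 interpolation error.\<close>

definition KE :: real where "KE = 4 * (3000 * Q + KC + 24000 * Q ^ 4)"
definition KS :: real where "KS = 540000 + 59 * Q ^ 4 * ((3 * KE + 808) * 404) + (3 * KE + 6000 * Q) * (3000 * Q) + 2000"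

lemma K_nonneg: "0 <= KC" "8 <= KE" "4 * (KC + 2) <= KE" "0 <= KS"
proof -
 show c: "0 <= KC" using Q1 a0 by (simp add: KC_def)
 have q: "0 <= Q ^ 4" using Q1 by simp
 have e: "KE = 12000 * Q + 4 * KC + 96000 * Q ^ 4" "4 * (KC + 2) = 4 * KC + 8" by (simp_all add: KE_def)
 show "8 <= KE" "4 * (KC + 2) <= KE" unfolding e using Q1 q c by linarith+
 thus "0 <= KS" unfolding KS_def using Q1 by (intro add_nonneg_nonneg mult_nonneg_nonneg) auto
qed

text \<open>\<open>U\<close> holds the nodal values of the discrete solution. The two bounds on f
  are those that its H^1 norm, in the role of \<open>F\<close>, provides.\<close>

context
 fixes f :: "real^3 => real" and U :: "nat => real" and F :: real
 assumes f: "sqi surf f" "(SI y. f y) = 0" "nrm surf f <= F"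
  and fd: "!!e. |\<integral>y. f y * ev (LB e) y \<partial>surf| <= 3 * F * H1s e"
  and U: "!!v. Bh U v = (SI y. f y * vh v y)"
  and small: "216 * Q ^ 4 * h^2 <= 1" "15 * (Q * h) <= 1"
begin

lemma F_nonneg: "0 <= F" using f(3) nrm_nonneg[of surf f] by linarith

text \<open>Coercivity is applied to E, the discrete solution minus the samples of the polynomial u
  that solves Poisson's equation for g. For the part g of f, integration by parts cancels the
  leading terms. The rest r = f - g has mean zero, so \<open>Jf E\<close> may be shifted by its mean
  and Poincare's inequality applies.\<close>

lemma discrete_error:
 assumes g: "(SI y. ev g y) = 0" "nrm surf (%y. f y - ev g y) <= ep" and u: "\<forall>y\<in>S2. ev (LB u) y = - ev g y" "H2s u = nrm surf (ev g)" and e: "0 <= ep"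
 shows "SN (%i. U i - ev u (x i)) <= KE * (h * F + 2 * ep)"
proof -
 define E where "E = (%i. U i - ev u (x i))"
 define n where "n = nrm surf (ev g)"
 define r where "r = (%y. f y - ev g y)"
 have r: "sqi surf r" "nrm surf r <= ep" unfolding r_def using g f by (auto intro: sqi_diff surf.sqi_ev)
 have "n <= nrm surf f + nrm surf r"
 proof -
  have "n = nrm surf (%y. f y - r y)" by (simp add: n_def r_def)
  thus ?thesis using nrm_diff[OF f(1) r(1)] by simp
 qed
 hence n: "0 <= n" "n <= F + ep" using f(3) r(2) by (auto simp: n_def)
 define c where "c = (SI y. Jf E y) / area S2"
 have c: "(SI y. Jf E y - c) = 0" using integrable_Jf area_S2_pos by (simp add: c_def)
 have r0: "(SI y. r y) = 0" unfolding r_def using f(2) g(1) surf.sqi_integrable[OF f(1)] surf.sqi_integrable[OF surf.sqi_ev] by simp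
 have d: "sqi surf (%y. vh E y - Jf E y)" by (intro sqi_diff sqi_vh sqi_Jf)
 have 1: "|\<integral>y. r y * (vh E y - Jf E y) \<partial>surf| <= ep * (KC * h * SN E)"
  by (rule ip_bound[OF r(1) d r(2) cell_near])
 have 2: "|\<integral>y. ev g y * (vh E y - Jf E y) \<partial>surf| <= n * (KC * h * SN E)"
  unfolding n_def by (rule ip_bound[OF surf.sqi_ev d order_refl cell_near])
 have "nrm surf (%y. Jf E y - c) <= 2 * SN E" using Jf_poincare[OF c] LJ_SN(1)[of E] by simp
 hence 3: "|\<integral>y. r y * (Jf E y - c) \<partial>surf| <= ep * (2 * SN E)"
  by (rule ip_bound[OF r(1) sqi_diff[OF sqi_Jf surf.sqi_const] r(2)])
 have 4: "|\<integral>y. (LJ (smp u) y - Lv u y) .* LJ E y \<partial>surf| <= (3000 * Q * h * n) * SN E"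
  unfolding n_def u(2)[symmetric]
  by (rule vip_bound[OF borel_measurable_diff[OF LJ_measurable measurable_surf_Lv] LJ_measurable sqi_LJ_Lv sqi_LJ interp_H1 LJ_SN(1)])
 have 5: "|Bh (smp u) E - (SI y. LJ (smp u) y .* LJ E y)| <= 59 * Q ^ 4 * h^2 * (404 * n * SN E)"
 proof (rule order_trans[OF Bh_LJ mult_left_mono])
  show "SN (smp u) * SN E <= 404 * n * SN E" using SN_smp[OF small(2), of u] u(2) by (intro mult_right_mono) (auto simp: n_def)
 qed simp
 have e1: "(SI y. f y * vh E y) = (SI y. r y * (vh E y - Jf E y)) + (SI y. r y * (Jf E y - c))
   + (SI y. ev g y * (vh E y - Jf E y)) + (SI y. ev g y * Jf E y)"
 proof -
  have i: "integrable surf (%y. r y * (vh E y - Jf E y))" "integrable surf (%y. r y * Jf E y)" "integrable surf r"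
   "integrable surf (%y. ev g y * (vh E y - Jf E y))" "integrable surf (%y. ev g y * Jf E y)"
   using r(1) d sqi_Jf surf.sqi_ev by (auto intro: sqi_mult surf.sqi_integrable)
  have "(SI y. f y * vh E y) = (SI y. r y * (vh E y - Jf E y) + r y * Jf E y + ev g y * (vh E y - Jf E y) + ev g y * Jf E y)"
   by (simp add: r_def algebra_simps)
  also have "... = (SI y. r y * (vh E y - Jf E y)) + (SI y. r y * Jf E y) + (SI y. ev g y * (vh E y - Jf E y)) + (SI y. ev g y * Jf E y)"
   using i by simp
  also have "(SI y. r y * Jf E y) = (SI y. r y * (Jf E y - c))"
   using i(2,3) r0 by (simp add: right_diff_distrib)
  finally show ?thesis .
 qed
 have e2: "(SI y. LJ (smp u) y .* LJ E y) = (SI y. (LJ (smp u) y - Lv u y) .* LJ E y) + (SI y. ev g y * Jf E y)"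
 proof -
  have "(SI y. ev g y * Jf E y) = - (SI y. Jf E y * ev (LB u) y)"
   unfolding Bochner_Integration.integral_minus[symmetric] using u(1) by (intro LI_cong) auto
  also have "... = (SI y. LJ E y .* Lv u y)" by (simp add: Jf_parts)
  also have "... = (SI y. Lv u y .* LJ E y)" by (simp add: inner_commute)
  finally have 1: "(SI y. ev g y * Jf E y) = (SI y. Lv u y .* LJ E y)" .
  have "integrable surf (%y. Lv u y .* LJ E y)" by (rule vip_le(2)[OF measurable_surf_Lv LJ_measurable sqi_norm_Lv sqi_LJ])
  thus ?thesis unfolding 1 inner_diff_left using LJ_inner_integrable[of "smp u" E] by simp
 qed
 \<comment> \<open>Once the discrete equation is inserted, the common term (g, Jf E) of
   \<open>e1\<close> and \<open>e2\<close> cancels.\<close>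
 have "Bh E E = (SI y. f y * vh E y) - Bh (smp u) E" unfolding E_def Bh_diff U ..
 hence "Bh E E <= ep * (KC * h * SN E) + ep * (2 * SN E) + n * (KC * h * SN E) + (3000 * Q * h * n) * SN E + 59 * Q ^ 4 * h^2 * (404 * n * SN E)"
  using 1 2 3 4 5 e1 e2 by linarith
 \<comment> \<open>23836 = 59 * 404, rounded up to 24000 in \<open>KE\<close>.\<close>
 also have "... = (ep * (KC * h + 2) + h * n * (KC + 3000 * Q + 23836 * (Q ^ 4 * h))) * SN E" by (simp add: algebra_simps power2_eq_square)
 also have "... <= (ep * (KE / 4) + h * n * (KE / 4)) * SN E"
 proof (intro mult_right_mono add_mono mult_left_mono)
  have "KC * h <= KC * 1" using K_nonneg(1) h1 by (intro mult_left_mono) auto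
  thus "KC * h + 2 <= KE / 4" using K_nonneg(3) by simp
  have "Q ^ 4 * h <= Q ^ 4 * 1" using h1 Q1 by (intro mult_left_mono) auto
  moreover have "0 <= Q ^ 4" using Q1 by simp
  moreover have "KE / 4 = 3000 * Q + KC + 24000 * Q ^ 4" by (simp add: KE_def)
  ultimately show "KC + 3000 * Q + 23836 * (Q ^ 4 * h) <= KE / 4" unfolding mult_1_right by linarith
 qed (use e n h0 in auto)
 finally have "(SN E)^2 <= KE * (ep + h * n) * SN E" using SN_Bh[OF small(1), of E] by (simp add: algebra_simps)
 hence "SN E <= KE * (ep + h * n)"
  by (cases "SN E = 0") (use K_nonneg e n h0 in "auto simp: power2_eq_square order_less_le")
 also have "... <= KE * (h * F + 2 * ep)"
 proof (rule mult_left_mono)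
  have "h * n <= h * F + h * ep" using mult_left_mono[OF n(2), of h] h0 by (simp add: distrib_left)
  also have "h * ep <= 1 * ep" using h1 e by (intro mult_right_mono) auto
  finally show "ep + h * n <= h * F + 2 * ep" by simp
 qed (use K_nonneg in simp)
 finally show ?thesis unfolding E_def .
qed

(* The sampling error w - vh (smp w) is small in the dual of H^1; pairing it with f costs one derivative of f. *)
lemma sample_dual: "|\<integral>y. f y * (ev w y - vh (smp w) y) \<partial>surf| <= 540000 * h^2 * F * H2s w"
proof (rule field_le_epsilon)
 fix \<eta> :: real assume \<eta>: "\<eta> > 0"
 define g where "g = (%y. ev w y - vh (smp w) y)"
 define c where "c = (SI y. g y) / area S2"
 define gc where "gc = (%y. g y - c)"
 have g: "sqi surf g" unfolding g_def by (intro sqi_diff surf.sqi_ev sqi_vh)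
 have gc: "sqi surf gc" "(SI y. gc y) = 0"
  unfolding gc_def using sqi_diff[OF g surf.sqi_const] surf.sqi_integrable[OF g] area_S2_pos by (auto simp: c_def)
 \<comment> \<open>The approximation of gc contributes F de directly and 3 F * 2 de through
   \<open>H1s z\<close>, in all 7 F de.\<close>
 define de where "de = \<eta> / (F + 1) / 7"
 have de: "de > 0" using \<eta> F_nonneg by (simp add: de_def)
 obtain p where p: "(SI y. ev p y) = 0" "nrm surf (%y. gc y - ev p y) < de" using zero_mean_approx[OF gc de] by blast
 \<comment> \<open>Up to the approximation p, z0 represents gc in the dual of H^1, and its seminorm
   is the dual norm to be bounded.\<close>
 obtain z0 where z0: "\<forall>y\<in>S2. ev (LB z0) y = - ev p y" using poisson_dual[OF p(1)] by blast
 \<comment> \<open>The mean is removed so that Poincare's inequality bounds z by its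
   seminorm.\<close>
 define m where "m = (SI y. ev z0 y) / area S2"
 define z where "z = PAdd z0 (PC (- m))"
 have z: "(SI y. ev z y) = 0" using surf.sqi_integrable[OF surf.sqi_ev[of z0]] area_S2_pos by (simp add: z_def m_def)
 have "Lv z y = Lv z0 y" for y by (simp add: z_def vec_eq_iff)
 hence H: "H1s z = H1s z0" by (simp add: H1s_def)
 have nz: "nrm surf (ev z) <= 2 * H1s z" by (rule poincare_poly[OF z])
 have d: "sqi surf (%y. gc y - ev p y)" by (intro sqi_diff gc surf.sqi_ev)
 have zi: "(SI y. ev z y * gc y) = (SI y. ev z y * g y)"
 proof -
  have "(SI y. ev z y * gc y) = (SI y. ev z y * g y - c * ev z y)" by (simp add: gc_def algebra_simps)
  also have "... = (SI y. ev z y * g y)" using z sqi_mult[OF surf.sqi_ev g] surf.sqi_integrable[OF surf.sqi_ev] by simp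
  finally show ?thesis .
 qed
 have "(H1s z)^2 = (H1s z0)^2" by (simp add: H)
 also have "... = - (SI y. ev z0 y * ev (LB z0) y)" by (rule H1s_power2)
 also have "... = (SI y. ev z0 y * ev p y)"
  unfolding Bochner_Integration.integral_minus[symmetric] using z0 by (intro LI_cong) auto
 also have "... = (SI y. ev z y * ev p y)"
 proof -
  have "(SI y. ev z y * ev p y) = (SI y. ev z0 y * ev p y - m * ev p y)" by (simp add: z_def algebra_simps)
  thus ?thesis using p(1) sqi_mult[OF surf.sqi_ev surf.sqi_ev] surf.sqi_integrable[OF surf.sqi_ev] by simp
 qed
 also have "... = (SI y. ev z y * gc y - ev z y * (gc y - ev p y))" by (simp add: algebra_simps)
 also have "... = (SI y. ev z y * g y) - (SI y. ev z y * (gc y - ev p y))"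
  unfolding zi[symmetric] by (intro LI_diff sqi_mult surf.sqi_ev gc d)
 also have "... <= 60000 * h^2 * ((nrm surf (ev z) + H1s z) * H2s w) + nrm surf (ev z) * nrm surf (%y. gc y - ev p y)"
  using cell_sample[of z w] ip_le[OF surf.sqi_ev d, of z] by (simp add: g_def)
 also have "... <= 60000 * h^2 * ((2 * H1s z + H1s z) * H2s w) + (2 * H1s z) * de"
  using nz p(2) by (intro add_mono mult_left_mono mult_right_mono mult_mono) auto
 finally have "(H1s z)^2 <= (180000 * h^2 * H2s w + 2 * de) * H1s z" by (simp add: algebra_simps)
 hence Hz: "H1s z <= 180000 * h^2 * H2s w + 2 * de"
  by (cases "H1s z = 0") (use de H1s_nonneg[of z] in "auto simp: power2_eq_square order_less_le")
 have "(SI y. f y * g y) = (SI y. f y * (gc y - ev p y) + c * f y + - (f y * ev (LB z0) y))"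
  using z0 by (intro LI_cong) (auto simp: gc_def algebra_simps)
 also have "... = (SI y. f y * (gc y - ev p y)) - (SI y. f y * ev (LB z0) y)"
  using sqi_mult[OF f(1) d] sqi_mult[OF f(1) surf.sqi_ev] surf.sqi_integrable[OF f(1)] f(2) by simp
 finally have "|\<integral>y. f y * g y \<partial>surf| <= nrm surf f * nrm surf (%y. gc y - ev p y) + 3 * F * H1s z"
  using ip_le[OF f(1) d] fd[of z0] H by simp
 also have "... <= F * de + 3 * F * (180000 * h^2 * H2s w + 2 * de)"
  using f(3) p(2) Hz F_nonneg by (intro add_mono mult_left_mono mult_mono) auto
 also have "... = 540000 * h^2 * F * H2s w + F * (7 * de)" by (simp add: algebra_simps)
 also have "7 * de = \<eta> / (F + 1)" by (simp add: de_def del: divide_divide_eq_left)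
 also have "F * (\<eta> / (F + 1)) <= \<eta>" using F_nonneg \<eta> by (simp add: divide_le_eq algebra_simps)
 finally show "|\<integral>y. f y * (ev w y - vh (smp w) y) \<partial>surf| <= 540000 * h^2 * F * H2s w + \<eta>" by (simp add: g_def)
qed

text \<open>The difference splits into the sampling error, the consistency error of the form, the
  energy error of \<open>U\<close> and the interpolation error of u, each paired with the
  interpolation error of w, and the pairing of u itself with the latter. An approximation g of f
  within h \<open>G\<close> suffices, as its effect is multiplied by another h.\<close>

lemma error_functional:
 assumes G: "0 < G" "F <= G"
 shows "|(SI y. f y * ev w y) - (SI y. LJ U y .* Lv w y)| <= KS * h^2 * G * H2s w"
proof -
 have hG: "0 < h * G" using h0 G by simp
 obtain g where g: "(SI y. ev g y) = 0" "nrm surf (%y. f y - ev g y) < h * G" using zero_mean_approx[OF f(1,2) hG] by blast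
 obtain u where u: "\<forall>y\<in>S2. ev (LB u) y = - ev g y" "H2s u = nrm surf (ev g)" using poisson_dual[OF g(1)] by blast
 define E n P where "E = (%i. U i - ev u (x i))" and "n = nrm surf (ev g)" and "P = H2s w"
 have P: "0 <= P" and n0: "0 <= n" by (auto simp: P_def n_def)
 have SE: "SN E <= 3 * KE * h * G"
 proof -
  have "SN E <= KE * (h * F + 2 * (h * G))" unfolding E_def by (rule discrete_error[OF g(1) _ u]) (use g(2) hG in auto)
  also have "... <= KE * (h * G + 2 * (h * G))" using G(2) h0 K_nonneg by (intro mult_left_mono add_right_mono) auto
  finally show ?thesis by (simp add: algebra_simps)
 qed
 have n: "n <= 2 * G"
 proof -
  have s: "sqi surf (%y. f y - ev g y)" by (intro sqi_diff f surf.sqi_ev)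
  have "n = nrm surf (%y. f y - (f y - ev g y))" by (simp add: n_def)
  also have "... <= F + h * G" using nrm_diff[OF f(1) s] f(3) g(2) by linarith
  also have "h * G <= 1 * G" using h1 G by (intro mult_right_mono) auto
  finally show ?thesis using G by simp
 qed
 have Ue: "U = (%i. E i + smp u i)" by (simp add: E_def)
 have SU: "SN U <= (3 * KE + 808) * G"
 proof -
  have "SN U <= SN E + SN (smp u)" by (subst Ue) (rule SN_add)
  also have "SN (smp u) <= 404 * n" using SN_smp[OF small(2), of u] u(2) by (simp add: n_def)
  also have "SN E <= 3 * KE * 1 * G" using SE h1 G K_nonneg by (elim order_trans) (intro mult_right_mono mult_left_mono; simp)
  finally show ?thesis using n by (simp add: algebra_simps)
 qed
 have Sw: "SN (smp w) <= 404 * P" unfolding P_def by (rule SN_smp[OF small(2)])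
 let ?D = "%y. LJ (smp w) y - Lv w y" and ?d = "%y. LJ (smp u) y - Lv u y"
 have Dm: "?D \<in> borel_measurable surf" "?d \<in> borel_measurable surf" by (intro borel_measurable_diff LJ_measurable measurable_surf_Lv)+
 have 1: "|\<integral>y. f y * (ev w y - vh (smp w) y) \<partial>surf| <= 540000 * h^2 * G * P"
  using sample_dual[of w] G P by (elim order_trans) (auto intro!: mult_right_mono mult_left_mono simp: P_def)
 have 2: "|Bh U (smp w) - (SI y. LJ U y .* LJ (smp w) y)| <= 59 * Q ^ 4 * h^2 * (((3 * KE + 808) * G) * (404 * P))"
  by (rule order_trans[OF Bh_LJ mult_left_mono]) (use SU Sw G K_nonneg in "auto intro!: mult_mono")
 have Dn: "nrm surf (%y. norm (?D y)) <= 3000 * Q * h * P" unfolding P_def by (rule interp_H1)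
 have 3: "|\<integral>y. LJ E y .* ?D y \<partial>surf| <= (3 * KE * h * G) * (3000 * Q * h * P)"
  by (rule vip_bound[OF LJ_measurable Dm(1) sqi_LJ sqi_LJ_Lv order_trans[OF LJ_SN(1) SE] Dn])
 have "nrm surf (%y. norm (?d y)) <= 3000 * Q * h * (2 * G)"
  using interp_H1[of u] n Q1 h0 unfolding u(2) n_def by (elim order_trans) (intro mult_left_mono; simp)
 hence 4: "|\<integral>y. ?d y .* ?D y \<partial>surf| <= (3000 * Q * h * (2 * G)) * (3000 * Q * h * P)"
  by (rule vip_bound[OF Dm(2,1) sqi_LJ_Lv sqi_LJ_Lv _ Dn])
 \<comment> \<open>A product of norms would give one power of h only. Integration by parts moves the
   derivative off the interpolation error, whose L^2 norm is of order h^2.\<close>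
 have 5: "|\<integral>y. Lv u y .* ?D y \<partial>surf| <= (2 * G) * (1000 * h^2 * P)"
 proof -
  have i: "integrable surf (%y. LJ (smp w) y .* Lv u y)" "integrable surf (%y. Lv w y .* Lv u y)"
   by (rule vip_le(2)[OF LJ_measurable measurable_surf_Lv sqi_LJ sqi_norm_Lv], rule vip_le(2)[OF measurable_surf_Lv measurable_surf_Lv sqi_norm_Lv sqi_norm_Lv])
  have s: "sqi surf (%y. Jf (smp w) y - ev w y)" by (intro sqi_diff sqi_Jf surf.sqi_ev)
  have "(SI y. Lv u y .* ?D y) = (SI y. LJ (smp w) y .* Lv u y) - (SI y. Lv w y .* Lv u y)"
   using i by (simp add: inner_diff_right inner_commute)
  also have "... = - (SI y. Jf (smp w) y * ev (LB u) y) + (SI y. ev w y * ev (LB u) y)"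
   unfolding Jf_parts parts_poly by simp
  also have "... = (SI y. - (Jf (smp w) y * ev (LB u) y) + ev w y * ev (LB u) y)"
   using sqi_mult[OF sqi_Jf surf.sqi_ev] sqi_mult[OF surf.sqi_ev surf.sqi_ev] by simp
  also have "... = (SI y. ev g y * (Jf (smp w) y - ev w y))"
   using u(1) by (intro LI_cong) (auto simp: algebra_simps)
  finally have "|\<integral>y. Lv u y .* ?D y \<partial>surf| <= n * nrm surf (%y. Jf (smp w) y - ev w y)"
   unfolding n_def using ip_le[OF surf.sqi_ev s] by simp
  also have "... <= (2 * G) * (1000 * h^2 * P)" unfolding P_def using interp_L2 n G by (intro mult_mono) auto
  finally show ?thesis .
 qed
 have e: "(SI y. f y * ev w y) - (SI y. LJ U y .* Lv w y) = (SI y. f y * (ev w y - vh (smp w) y))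
  + (Bh U (smp w) - (SI y. LJ U y .* LJ (smp w) y)) + (SI y. LJ E y .* ?D y) + (SI y. ?d y .* ?D y) + (SI y. Lv u y .* ?D y)"
 proof -
  have i: "integrable surf (%y. LJ E y .* ?D y)" "integrable surf (%y. ?d y .* ?D y)" "integrable surf (%y. Lv u y .* ?D y)" "integrable surf (%y. LJ U y .* Lv w y)"
   by (rule vip_le(2)[OF LJ_measurable Dm(1) sqi_LJ sqi_LJ_Lv], rule vip_le(2)[OF Dm(2,1) sqi_LJ_Lv sqi_LJ_Lv],
    rule vip_le(2)[OF measurable_surf_Lv Dm(1) sqi_norm_Lv sqi_LJ_Lv], rule vip_le(2)[OF LJ_measurable measurable_surf_Lv sqi_LJ sqi_norm_Lv])
  have UJ: "LJ U y = LJ E y + LJ (smp u) y" for y by (subst Ue) (rule LJ_add)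
  have "(SI y. LJ U y .* LJ (smp w) y) - (SI y. LJ U y .* Lv w y) = (SI y. LJ U y .* LJ (smp w) y - LJ U y .* Lv w y)"
   using i(4) LJ_inner_integrable by simp
  also have "... = (SI y. LJ E y .* ?D y + ?d y .* ?D y + Lv u y .* ?D y)"
   unfolding UJ by (simp add: inner_diff_left inner_diff_right inner_add_left algebra_simps)
  also have "... = (SI y. LJ E y .* ?D y) + (SI y. ?d y .* ?D y) + (SI y. Lv u y .* ?D y)" using i by simp
  finally have a: "(SI y. LJ U y .* LJ (smp w) y) - (SI y. LJ U y .* Lv w y) = ..." .
  have "(SI y. f y * (ev w y - vh (smp w) y)) = (SI y. f y * ev w y) - Bh U (smp w)"
   unfolding U right_diff_distrib by (intro LI_diff sqi_mult f surf.sqi_ev sqi_vh)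
  thus ?thesis using a by simp
 qed
 have "|(SI y. f y * ev w y) - (SI y. LJ U y .* Lv w y)| <= 540000 * h^2 * G * P + 59 * Q ^ 4 * h^2 * (((3 * KE + 808) * G) * (404 * P))
  + (3 * KE * h * G) * (3000 * Q * h * P) + (3000 * Q * h * (2 * G)) * (3000 * Q * h * P) + (2 * G) * (1000 * h^2 * P)"
  unfolding e using 1 2 3 4 5 by linarith
 also have "... = KS * h^2 * G * P" unfolding KS_def by (simp add: power2_eq_square algebra_simps)
 finally show ?thesis unfolding P_def .
qed

lemma fine_error:
 assumes u: "sqi surf u" "(SI y. u y) = 0" "!!e. (SI y. u y * ev (LB e) y) = - (SI y. f y * ev e y)"
  and J: "(SI y. Jf U y) = 0"
 shows "nrm surf (%y. u y - Jf U y) <= KS * h^2 * F"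
proof (rule field_le_epsilon)
 fix \<eta> :: real assume \<eta>: "\<eta> > 0"
 \<comment> \<open>The excess over \<open>F\<close> keeps \<open>G\<close> positive even if f
   vanishes, and it adds at most \<eta> to the bound.\<close>
 define G where "G = F + \<eta> / (KS * h^2 + 1)"
 have k: "0 <= KS * h^2" using K_nonneg by simp
 have G: "0 < G" "F <= G" using \<eta> k F_nonneg by (auto simp: G_def add_nonneg_pos)
 have s: "sqi surf (%y. u y - Jf U y)" by (intro sqi_diff u sqi_Jf)
 have "nrm surf (%y. u y - Jf U y) <= KS * h^2 * G"
 proof (rule dual_norm_bound[OF s])
  show "(SI y. u y - Jf U y) = 0" using u(2) J surf.sqi_integrable[OF u(1)] integrable_Jf by simp
  show "0 <= KS * h^2 * G" using k G by simp
  fix p assume p: "(SI y. ev p y) = 0"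
  obtain w where w: "\<forall>y\<in>S2. ev (LB w) y = - ev p y" "H2s w = nrm surf (ev p)" using poisson_dual[OF p] by blast
  have "(SI y. (u y - Jf U y) * ev p y) = (SI y. Jf U y * ev (LB w) y - u y * ev (LB w) y)"
   using w(1) by (intro LI_cong) (auto simp: algebra_simps)
  also have "... = (SI y. Jf U y * ev (LB w) y) - (SI y. u y * ev (LB w) y)"
   by (intro LI_diff sqi_mult sqi_Jf surf.sqi_ev u)
  also have "... = (SI y. f y * ev w y) - (SI y. LJ U y .* Lv w y)" by (simp add: Jf_parts u(3))
  also have "... <= KS * h^2 * G * nrm surf (ev p)" using error_functional[OF G, of w] w(2) by simp
  finally show "(SI y. (u y - Jf U y) * ev p y) <= KS * h^2 * G * nrm surf (ev p)" .
 qed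
 also have "... = KS * h^2 * F + (KS * h^2) * (\<eta> / (KS * h^2 + 1))" by (simp add: G_def distrib_left)
 also have "(KS * h^2) * (\<eta> / (KS * h^2 + 1)) <= \<eta>" using k \<eta> by (simp add: divide_le_eq algebra_simps add_nonneg_pos)
 finally show "nrm surf (%y. u y - Jf U y) <= KS * h^2 * F + \<eta>" by simp
qed

end

end

section \<open>Geometry of centroidal decompositions\<close>

text \<open>The chord is 2 sin of half the angle. The mesh size is geodesic, while all estimates use
  chords.\<close>

lemma norm_le_geodist: assumes "norm a = 1" "norm b = 1" shows "norm (b - a) <= geodist a b"
proof -
 define te where "te = arccos (a .* b)"
 have ab: "|a .* b| <= 1" using Cauchy_Schwarz_ineq2[of a b] assms by simp
 hence t: "0 <= te" "cos te = a .* b" by (auto simp: te_def arccos_lbound cos_arccos abs_le_iff)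
 have "(norm (b - a))^2 = 2 - 2 * cos (2 * (te / 2))" using unit_dist_sq[OF assms(2,1)] t by (simp add: inner_commute)
 also have "... = (2 * |sin (te / 2)| )^2" unfolding cos_double_sin by (simp add: power_mult_distrib)
 also have "... <= (2 * |te / 2| )^2" by (intro power_mono mult_left_mono abs_sin_x_le_abs_x) auto
 finally show ?thesis using t(1) by (simp add: geodist_def te_def[symmetric] power2_le_iff_abs_le)
qed

context vd begin

lemma I_nonempty: "I ~= {}"
proof -
 have "axis 1 1 \<in> S2" by (simp add: norm_axis_1)
 from max_pos[OF this] show ?thesis by auto
qed

lemma W_mesh: assumes i: "i \<in> I" and y: "y \<in> W i" shows "norm (y - x i) <= mesh_size N x"
proof -
 have "voronoi_cell N x i <= cball (x i) (mesh_size N x)"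
 proof
  fix z assume z: "z \<in> voronoi_cell N x i"
  hence nz: "norm z = 1" using cell_eq[OF i] by auto
  have "norm (z - x i) <= geodist (x i) z" by (rule norm_le_geodist[OF nx[OF i] nz])
  also have "... <= (SUP y\<in>voronoi_cell N x i. geodist (x i) y)"
  proof (rule cSUP_upper[OF z bdd_aboveI2])
   fix w assume w: "w \<in> voronoi_cell N x i"
   hence "norm w = 1" using cell_eq[OF i] by auto
   hence "|x i .* w| <= 1" using Cauchy_Schwarz_ineq2[of "x i" w] nx[OF i] by simp
   thus "geodist (x i) w <= pi" unfolding geodist_def by (intro arccos_ubound) auto
  qed
  also have "... <= mesh_size N x" unfolding mesh_size_def I_def[symmetric] using i by (intro Max_ge) auto
  finally show "z \<in> cball (x i) (mesh_size N x)" by (simp add: dist_norm norm_minus_commute)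
 qed
 hence "closure (voronoi_cell N x i) <= cball (x i) (mesh_size N x)" by (intro closure_minimal) auto
 thus ?thesis using y unfolding closure_cell[OF i] by (auto simp: dist_norm norm_minus_commute)
qed

lemma mesh_pos: "mesh_size N x > 0"
proof -
 obtain i0 where "i0 \<in> I" using I_nonempty by blast
 then obtain t where t: "t \<in> \<T>" "i0 \<in> t" by (rule vertex_in_T)
 obtain i j where ij: "t = {i, j, i0}" "i ~= j" "i ~= i0" "j ~= i0" by (rule T_triple[OF t])
 have m: "i \<in> t" "j \<in> t" using ij by auto
 have "norm (x i - x j) > 0" using inj_x[OF T_sub[OF t(1) m(1)] T_sub[OF t(1) m(2)]] ij by simp
 moreover have "norm (x i - x j) <= mesh_size N x + mesh_size N x"
  using norm_triangle_ineq4[of "tn t - x j" "tn t - x i"] W_mesh[OF T_sub[OF t(1) m(1)] tn_W[OF t(1) m(1)]] W_mesh[OF T_sub[OF t(1) m(2)] tn_W[OF t(1) m(2)]] by simp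
 ultimately show ?thesis by linarith
qed

text \<open>On the unit sphere the energy is 2 |V| - 2 (z . M) with M the vector moment of the cell.
  A minimiser is aligned with M, so M has no component orthogonal to x_i.\<close>

lemma scvt_centroid:
 assumes s: "scvt N x" and i: "i \<in> I" and e: "e .* x i = 0"
 shows "(SI y. ind (voronoi_cell N x i) y * (e .* y)) = 0"
proof -
 let ?V = "voronoi_cell N x i"
 define M where "M = (SI y. ind ?V y *R y)"
 have int: "integrable surf (%y. ind ?V y *R y)"
 proof (rule surf.integrable_const_bound[of _ 1])
  show "(%y. ind ?V y *R y) \<in> borel_measurable surf"
   using cell_sets(1)[OF i] by (intro borel_measurable_scaleR borel_measurable_indicator measurable_surfI) auto
 qed (auto simp: indicator_def)
 have iV: "integrable surf (%y. ind ?V y * c)" for c :: real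
  using integrable_real_mult_indicator[OF cell_sets(1)[OF i], of "%_. c"] by (simp add: mult.commute)
 have M: "(SI y. ind ?V y * (z .* y)) = z .* M" for z
  unfolding M_def using int by (subst integral_inner_right[symmetric]) auto
 have en: "centroid_energy ?V z = 2 * area ?V - 2 * (z .* M)" if z: "norm z = 1" for z
 proof -
  have "centroid_energy ?V z = (SI y. ind ?V y * 2 - 2 * (ind ?V y * (z .* y)))"
   unfolding centroid_energy_def using unit_dist_sq[OF _ z] cell_eq[OF i]
   by (intro LI_cong) (auto simp: indicator_def inner_commute)
  also have "... = 2 * area ?V - 2 * (z .* M)"
  proof -
   have "integrable surf (%y. ind ?V y * (z .* y))" using integrable_inner_right[of z, OF int] by simp
   moreover have "?V Int S2 = ?V" using cell_eq[OF i] by auto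
   ultimately show ?thesis using iV[of 2] M[of z] cell_sets(1)[OF i] by simp
  qed
  finally show ?thesis .
 qed
 have "M .* x i = norm M"
 proof (cases "M = 0")
  case False
  have "~ centroid_energy ?V (sgn M) < centroid_energy ?V (x i)"
   using s i False unfolding scvt_def I_def[symmetric] is_arg_min_def by (auto simp: norm_sgn)
  hence "sgn M .* M <= x i .* M" using en[of "sgn M"] en[OF nx[OF i]] False by (simp add: norm_sgn)
  moreover have "sgn M .* M = norm M" using False by (simp add: sgn_div_norm dot_square_norm power2_eq_square)
  ultimately show ?thesis using norm_cauchy_schwarz[of M "x i"] nx[OF i] by (simp add: inner_commute)
 qed simp
 hence "norm M *R x i = M" using norm_cauchy_schwarz_eq[of M "x i"] nx[OF i] by simp
 hence "e .* M = norm M * (e .* x i)" by (metis inner_scaleR_right)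
 thus ?thesis using M[of e] e by simp
qed

(* Away from a strip of small area, the function e . y, which has mean zero over the cell, has absolute
 value at least s; so it cannot be bounded above by a much smaller number, which a very close
 neighbour would force. *)
lemma scvt_neighbor_distance:
 assumes s: "scvt N x" and i: "i \<in> I" and j: "j \<in> I" "j ~= i" and C1: "C1 > 0"
  and ar: "(mesh_size N x)^2 / C1 <= area (voronoi_cell N x i)" and h: "mesh_size N x <= C1"
 shows "mesh_size N x / (192 * C1) <= dd i j"
proof (rule ccontr)
 let ?V = "voronoi_cell N x i"
 define h d \<rho> where "h = mesh_size N x" and "d = dd i j" and "\<rho> = x i .* x j"
 assume "~ mesh_size N x / (192 * C1) <= dd i j"
 hence dl: "d < h / (192 * C1)" by (simp add: d_def h_def)
 have h0: "h > 0" using mesh_pos by (simp add: h_def)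
 have d0: "d > 0" unfolding d_def using dd_pos i j by auto
 have "h / (192 * C1) <= C1 / (192 * C1)" using h C1 by (intro divide_right_mono) (auto simp: h_def)
 also have "... = 1 / 192" using C1 by simp
 finally have d1: "d < 1" using dl by simp
 have d2: "d^2 = 2 - 2 * \<rho>" using unit_dist_sq[OF nx[OF j(1)] nx[OF i]] by (simp add: d_def dd_def \<rho>_def inner_commute)
 define p where "p = x j - \<rho> *R x i"
 have pp: "p .* p = 1 - \<rho>^2" unfolding p_def
  by (simp add: inner_diff_left inner_diff_right xx[OF i] xx[OF j(1)] \<rho>_def inner_commute power2_eq_square)
 have px: "p .* x i = 0" unfolding p_def by (simp add: inner_diff_left xx[OF i] \<rho>_def inner_commute[of "x j"])
 have "(d / 2)^2 <= p .* p"
 proof -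
  have r: "\<rho> = 1 - d^2 / 2" unfolding d2 by (simp add: field_simps)
  have "d^2 * d^2 <= 1 * d^2" using d0 d1 by (intro mult_right_mono) (auto simp: power_le_one)
  hence "d^2 * d^2 / 4 <= d^2 / 4" by (simp only: mult_1)
  moreover have "p .* p = d^2 - d^2 * d^2 / 4" unfolding pp r by (simp add: power2_eq_square field_simps)
  moreover have "(d / 2)^2 = d^2 / 4" by (simp add: power_divide)
  ultimately show ?thesis using zero_le_power2[of d] by linarith
 qed
 hence np: "d / 2 <= norm p" unfolding norm_eq_sqrt_inner by (rule real_le_rsqrt)
 define e where "e = sgn p"
 have p0: "norm p > 0" using np d0 by linarith
 have e: "norm e = 1" "e .* x i = 0" using p0 px by (auto simp: e_def norm_sgn sgn_div_norm)
 define g where "g = cross3 (x i) e"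
 note o = orthonormal_expand[OF nx[OF i] e(1) _ g_def, unfolded inner_commute[of "x i" e], OF e(2)]
 have yd: "e .* y <= d" if y: "y \<in> ?V" for y
 proof -
  have y1: "norm y = 1" "x j .* y < x i .* y" using y i j unfolding cell_eq[OF i] by auto
  have "norm p * (e .* y) = p .* y" using p0 by (simp add: e_def sgn_div_norm)
  also have "... <= (1 - \<rho>) * (x i .* y)" using y1 by (simp add: p_def inner_diff_left algebra_simps)
  also have "... <= (1 - \<rho>) * 1" using norm_cauchy_schwarz[of "x i" y] nx[OF i] y1 d2 zero_le_power2[of d] by (intro mult_left_mono) auto
  also have "... = (d / 2) * d" using d2 by (simp add: power2_eq_square)
  also have "... <= norm p * d" using np d0 by (intro mult_right_mono) auto
  finally show ?thesis using p0 by simp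
 qed
 \<comment> \<open>The strip |e . y| <= s then has area at most 24 s h = h^2 / (2 C1), at most half
   of the cell. The conclusion will be s / 2 <= 2 d, and 4 * 48 = 192.\<close>
 define s where "s = h / (48 * C1)"
 have s0: "s > 0" using h0 C1 by (simp add: s_def)
 define B where "B = {y\<in>?V. |e .* y| <= s}"
 have Bb: "B \<in> sets borel"
 proof -
  have "B = ?V Int {y. |e .* y| <= s}" by (auto simp: B_def)
  moreover have "closed {y. |e .* y| <= s}" by (intro closed_Collect_le continuous_intros)
  ultimately show ?thesis using cell_sets(2)[OF i] by simp
 qed
 have VS: "?V Int S2 = ?V" "B Int S2 = B" using cell_eq[OF i] by (auto simp: B_def)
 have "emeasure surf B <= ennreal (6 * (s - - s) * (h - - h))"
 proof (rule emeasure_surf_box[OF e(1) o(1,3) _ _ _ _ Bb])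
  fix y assume y: "y \<in> B"
  have "y \<in> W i" using y closure_subset[of ?V] by (auto simp: B_def closure_cell[OF i])
  hence n: "norm (y - x i) <= h" using W_mesh[OF i] by (simp add: h_def)
  have "g .* y = g .* (y - x i)" using o(2) by (simp add: inner_diff_right inner_commute)
  hence "|g .* y| <= h" using Cauchy_Schwarz_ineq2[of g "y - x i"] o(1) n by simp
  thus "- s <= e .* y & e .* y <= s & - h <= g .* y & g .* y <= h" using y by (auto simp: B_def abs_le_iff)
 qed (use s0 h0 VS in auto)
 hence aB: "area B <= 24 * s * h" unfolding surf.emeasure_eq_measure using s0 h0 by (subst (asm) ennreal_le_iff) auto
 have Bs: "B \<in> sets surf" using Bb VS(2) by (intro sets_surfI) auto
 have iV: "integrable surf (%y. ind A y * c)" if "A \<in> sets surf" for A and c :: real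
  using integrable_real_mult_indicator[OF that, of "%_. c"] by (simp add: mult.commute)
 note iVV = iV[OF cell_sets(1)[OF i]] iV[OF Bs]
 have ie: "integrable surf (%y. ind ?V y * (e .* y))"
 proof -
  have "continuous_on S2 (%y. e .* y)" by (intro continuous_intros)
  then obtain K where "!!y. y \<in> S2 ==> |e .* y| <= K" using continuous_bounded_S2 by blast
  hence "integrable surf (%y. e .* y)" by (intro integrable_surf_bounded measurable_surfI) auto
  thus ?thesis by (rule split_cell(2)[OF _ i])
 qed
 \<comment> \<open>As e . y <= d on the cell, 2 d - e . y is at least |e . y|, which exceeds s off
   the strip.\<close>
 have "(SI y. ind ?V y * s - ind B y * s) <= (SI y. ind ?V y * (2 * d) - ind ?V y * (e .* y))"
 proof (rule integral_mono)
  fix y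
  show "ind ?V y * s - ind B y * s <= ind ?V y * (2 * d) - ind ?V y * (e .* y)"
   using yd[of y] s0 d0 by (auto simp: indicator_def B_def abs_le_iff not_le)
 qed (use iVV ie in auto)
 hence "area ?V * s - area B * s <= area ?V * (2 * d)"
  using iVV ie scvt_centroid[OF assms(1) i e(2)] VS by simp
 moreover have "area B * s <= (24 * s * h) * s" using aB s0 by (intro mult_right_mono) auto
 moreover have "24 * s * h <= area ?V / 2"
 proof -
  have "24 * s * h = (h^2 / C1) / 2" using C1 by (simp add: s_def power2_eq_square field_simps)
  thus ?thesis using ar by (simp add: h_def)
 qed
 hence "(24 * s * h) * s <= (area ?V / 2) * s" using s0 by (intro mult_right_mono) auto
 ultimately have "area ?V * (s / 2) <= area ?V * (2 * d)" by (simp add: algebra_simps)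
 moreover have "area ?V > 0" using ar h0 C1 by (simp add: h_def) (meson divide_pos_pos less_le_trans zero_less_power)
 ultimately have "s / 2 <= 2 * d" by simp
 thus False using dl C1 by (simp add: s_def field_simps)
qed

section \<open>Coarse meshes\<close>

(* The level sets of v below a + k m grow by at least one vertex per step. *)
lemma osc_bound:
 assumes m: "!!i j. i \<in> I ==> j \<in> neighbors N x i ==> |v i - v j| <= m" and a: "a0 \<in> I" "!!i. i \<in> I ==> v a0 <= v i" and i: "i \<in> I"
 shows "v i <= v a0 + real N * m"
proof -
 define A where "A k = {i\<in>I. v i <= v a0 + real k * m}" for k
 \<comment> \<open>m is nonnegative as soon as there is a pair of neighbours, and any triangle
   provides one.\<close>
 have m0: "0 <= m"
 proof (cases "\<exists>i\<in>I. \<exists>j. j \<in> neighbors N x i")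
  case True thus ?thesis using m by (meson abs_ge_zero order_trans)
 next
  case False
  hence "~ (\<exists>t. t \<in> \<T>)" using T_nbr T_card T_sub by (metis card_eq_0_iff card_1_singletonE card_le_Suc0_iff_eq not_less_eq_eq numeral_3_eq_3 order_refl T_finite le_SucI)
  thus ?thesis using vertex_in_T[OF a(1)] by blast
 qed
 have "A k = I \<or> card (A k) >= Suc k" for k
 proof (induction k)
  case 0
  have "a0 \<in> A 0" using a by (simp add: A_def)
  hence "card (A 0) > 0" by (auto simp: card_gt_0_iff A_def)
  thus ?case by simp
 next
  case (Suc k)
  have sub: "A k <= A (Suc k)" using m0 by (auto simp: A_def algebra_simps)
  have AI: "A k <= I" "A (Suc k) <= I" by (auto simp: A_def)
  show ?case
  proof (cases "A k = I")
   case True thus ?thesis using sub AI by auto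
  next
   case False
   have "a0 \<in> A k" using a m0 by (simp add: A_def)
   then obtain p q where pq: "p \<in> A k" "q \<in> I - A k" "q \<in> neighbors N x p"
    using neighbor_graph_connected[OF AI(1) _ False] by blast
   have "v q <= v p + m" using m[of p q] pq AI by (auto simp: abs_le_iff)
   hence "q \<in> A (Suc k)" using pq by (auto simp: A_def algebra_simps)
   hence "card (A k) < card (A (Suc k))" using sub pq AI finite_subset[OF AI(2)] by (intro psubset_card_mono) auto
   thus ?thesis using Suc False by simp
  qed
 qed
 from this[of N] have "A N = I"
 proof
  assume "card (A N) >= Suc N"
  moreover have "card (A N) <= card I" by (intro card_mono) (auto simp: A_def)
  ultimately show ?thesis by (simp add: I_def)
 qed
 thus ?thesis using i by (auto simp: A_def)
qed

text \<open>Testing the system with U minus its minimum bounds the energy by 5 F times the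
  oscillation \<omega> of U, hence each increment along an edge by m. Connectivity gives \<omega> <=
  N m, and m^2 is linear in \<omega>, so \<omega> is bounded. Mean zero places 0 between the extreme
  values of U.\<close>

lemma coarse_bound:
 assumes f: "sqi surf f" "nrm surf f <= F" and U: "!!v. Bh (%i. u (x i)) v = (SI y. f y * vh v y)"
  and J: "(SI y. Jf (%i. u (x i)) y) = 0"
  and C: "C0 > 0" and len: "!!i j. i \<in> I ==> j \<in> neighbors N x i ==> h / C0 <= curve_length (voronoi_edge N x i j)" and h: "h > 0"
 shows "nrm surf (Jf (%i. u (x i))) <= 100 * (real N)^2 * C0 / h * F"
proof -
 define U where "U = (%i. u (x i))"
 have F: "0 <= F" using f(2) nrm_nonneg[of surf f] by linarith
 obtain a b where ab: "a \<in> I" "b \<in> I" "!!i. i \<in> I ==> U a <= U i" "!!i. i \<in> I ==> U i <= U b"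
 proof -
  have "Min (U ` I) \<in> U ` I" "Max (U ` I) \<in> U ` I" using I_nonempty by (auto intro!: Min_in Max_in)
  then obtain a b where "a \<in> I" "b \<in> I" "U a = Min (U ` I)" "U b = Max (U ` I)" by auto
  thus thesis using that[of a b] by simp
 qed
 define \<omega> where "\<omega> = U b - U a"
 have w0: "0 <= \<omega>" using ab by (simp add: \<omega>_def)
 have s24: "sqrt (area S2) <= 5"
 proof -
  have "area S2 <= 5^2" using measure_surf_le[of S2] by simp
  thus ?thesis by (intro real_le_lsqrt) auto
 qed
 define V where "V = (%i. U i - U a)"
 have vb: "|vh V y| <= \<omega>" for y
 proof (cases "\<exists>i\<in>I. y \<in> voronoi_cell N x i")
  case True
  then obtain i where i: "i \<in> I" "y \<in> voronoi_cell N x i" by blast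
  show ?thesis unfolding vh_eq[OF i] V_def \<omega>_def using ab(3,4)[OF i(1)] by simp
 next
  case False
  hence "vh V y = 0" unfolding vh_def by (intro sum.neutral) auto
  thus ?thesis using w0 by simp
 qed
 have sv: "sqi surf (vh V)" by (rule surf.sqi_bounded[OF vh_measurable vb])
 have nv: "nrm surf (vh V) <= \<omega> * 5"
  using surf.nrm_le_bound[OF sv vb w0] mult_left_mono[OF s24 w0] by simp
 have "Bh U U = Bh U V" by (simp add: Bh_def V_def)
 also have "... = (SI y. f y * vh V y)" using U[of V] by (simp add: U_def)
 also have "... <= F * (\<omega> * 5)" using ip_bound[OF f(1) sv f(2) nv] by simp
 finally have B: "Bh U U <= 5 * F * \<omega>" by simp
 define m where "m = sqrt (20 * C0 * F * \<omega> / h)"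
 have cf: "0 <= coef i j" "j \<in> neighbors N x i ==> h / (2 * C0) <= coef i j" if i: "i \<in> I" for i j
 proof -
  have c: "h / (2 * C0) <= coef i j" if j: "j \<in> neighbors N x i"
  proof -
   have jI: "j \<in> I" "j ~= i" using neighbors_I[OF j] by auto
   have d: "dd i j > 0" "dd i j <= 2" using dd_pos i jI norm_triangle_ineq4[of "x j" "x i"] nx by (auto simp: dd_def)
   have "h / (2 * C0) = (h / C0) / 2" by simp
   also have "... <= curve_length (voronoi_edge N x i j) / dd i j" using len[OF i j] d order_trans[OF less_imp_le[OF divide_pos_pos[OF h C]] len[OF i j]] by (intro frac_le) auto
   finally show ?thesis using j by (simp add: coef_def)
  qed
  thus "j \<in> neighbors N x i ==> h / (2 * C0) <= coef i j" .
  have "0 <= h / (2 * C0)" using C h by simp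
  thus "0 <= coef i j" using c by (cases "j \<in> neighbors N x i") (linarith, simp add: coef_def)
 qed
 have dm: "|U i - U j| <= m" if ij: "i \<in> I" "j \<in> neighbors N x i" for i j
 proof -
  have jI: "j \<in> I" using neighbors_I[OF ij(2)] by simp
  have nn: "0 <= coef p q * ((U p - U q) * (U p - U q))" if "p \<in> I" for p q using cf(1)[OF that] by simp
  have "h / (2 * C0) * (U i - U j)^2 <= coef i j * ((U i - U j) * (U i - U j))"
   using mult_right_mono[OF cf(2)[OF ij], of "(U i - U j)^2"] by (simp add: power2_eq_square)
  also have "... <= (SUM q:I. coef i q * ((U i - U q) * (U i - U q)))" using jI nn[OF ij(1)] by (intro member_le_sum) auto
  also have "... <= (SUM p:I. SUM q:I. coef p q * ((U p - U q) * (U p - U q)))"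
   using ij(1) nn by (intro member_le_sum[of i I "%p. SUM q:I. coef p q * ((U p - U q) * (U p - U q))"] sum_nonneg) auto
  also have "... = 2 * Bh U U" using fv_form_Bh[of u u] fv_form_coef[of u u] by (simp add: U_def)
  also have "... <= 10 * F * \<omega>" using B by simp
  finally have "(U i - U j)^2 <= 20 * C0 * F * \<omega> / h" using C h by (simp add: field_simps)
  thus ?thesis unfolding m_def by (intro real_le_rsqrt) simp
 qed
 have "\<omega> <= real N * m" using osc_bound[of U m a b, OF dm ab(1,3,2)] by (simp add: \<omega>_def)
 hence "\<omega>^2 <= (real N * m)^2" using w0 by (rule power_mono)
 also have "... = (20 * (real N)^2 * C0 / h * F) * \<omega>"
  using C h F w0 by (simp add: m_def power_mult_distrib)
 finally have w2: "\<omega>^2 <= (20 * (real N)^2 * C0 / h * F) * \<omega>" .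
 have wb: "\<omega> <= 20 * (real N)^2 * C0 / h * F"
 proof (cases "\<omega> = 0")
  case False
  hence "\<omega> > 0" using w0 by simp
  thus ?thesis using w2 unfolding power2_eq_square[of \<omega>] by (meson mult_right_le_imp_le)
 qed (use C h F in simp)
 have Jab: "U a <= Jf U y" "Jf U y <= U b" if "y \<in> S2" for y
  using Jf_bounds[OF _ ab(3,4), of y] that by force+
 have ci: "integrable surf (%_. c)" "(SI y. c) = area S2 * c" for c :: real by simp_all
 have "(SI y. U a) <= (SI y. Jf U y)" "(SI y. Jf U y) <= (SI y. U b)"
  using Jab by (intro integral_mono integrable_Jf ci; simp)+
 hence "U a <= 0" "0 <= U b" using J area_S2_pos by (auto simp: ci U_def[symmetric] mult_le_0_iff zero_le_mult_iff)
 hence "|Jf U y| <= \<omega>" if "y \<in> S2" for y using Jab[OF that] by (simp add: \<omega>_def abs_le_iff)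
 hence "nrm surf (Jf U) <= \<omega> * sqrt (measure surf (space surf))" using w0 by (intro surf.nrm_le_bound sqi_Jf) auto
 also have "... <= \<omega> * 5" using mult_left_mono[OF s24 w0] by simp
 finally show ?thesis using wb by (simp add: U_def)
qed

lemma card_bound:
 assumes "!!i. i \<in> I ==> c <= area (voronoi_cell N x i)" shows "real N * c <= 24"
proof -
 have "real N * c <= (SUM i:I. area (voronoi_cell N x i))" using sum_mono[of I "%_. c", OF assms] by (simp add: I_def)
 also have "... = area (\<Union>i\<in>I. voronoi_cell N x i)"
  using cell_sets cell_disjoint by (intro surf.finite_measure_finite_Union[symmetric]) (fastforce simp: disjoint_family_on_def)+
 also have "... <= 24" by (rule measure_surf_le)
 finally show ?thesis .
qed

end

theorem theorem5p5:
  fixes C0 C1 :: real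
  assumes "C0 > 0" and "C1 > 0"
  shows "\<exists>C>0. \<forall>(N::nat) (x :: nat \<Rightarrow> real^3) (f :: real^3 \<Rightarrow> real) (u :: real^3 \<Rightarrow> real)
            (uh :: real^3 \<Rightarrow> real).
    voronoi_delaunay N x \<longrightarrow> almost_uniform C0 C1 N x \<longrightarrow> scvt N x \<longrightarrow>
    f \<in> H1_0 \<longrightarrow>
    u \<in> sobolev 2 \<inter> H1_0 \<longrightarrow> (AE y in surf. - laplace_s u y = f y) \<longrightarrow>
    fv_solution N x f uh \<longrightarrow>
    L2_norm (\<lambda>y. u y - uh y) \<le> C * (mesh_size N x)\<^sup>2 * (sobolev_norm 2 u + sobolev_norm 1 f)"
proof -
 define ka where "ka = 1 / (192 * C1)"
 \<comment> \<open>From (ka h)^3 <= 2 h Dt, which holds as sides are at least ka h and circumradii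
   at most h.\<close>
 define Q where "Q = max 1 (4 / ka ^ 3)"
 define a0 where "a0 = 1 / C1"
 \<comment> \<open>Up to 1 / (100 Q^2) both smallness conditions of the error estimate hold;
   \<open>C1\<close> is the limit in \<open>scvt_neighbor_distance\<close>.\<close>
 define h0 where "h0 = min (1 / (100 * Q^2)) C1"
 \<comment> \<open>The bound for coarse meshes, with at most 24 C1 / h0^2 cells.\<close>
 define KB where "KB = 100 * (24 * C1 / h0^2)^2 * C0 / h0"
 \<comment> \<open>\<open>KS\<close> is a function of \<open>Q\<close> and \<open>a0\<close> alone;
   its sign is known inside the locale only, hence the absolute value. On coarse meshes 1 <= h^2 /
   h0^2 supplies the factor h^2.\<close>
 define C where "C = 1 + |fine.KS Q a0| + (1 + KB) / h0^2"
 have k0: "ka > 0" and Q1: "Q >= 1" using assms by (auto simp: ka_def Q_def)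
 have h00: "h0 > 0" using Q1 assms by (simp add: h0_def)
 have KB0: "KB >= 0" using assms h00 by (simp add: KB_def)
 have Cp: "C > 0" and C2: "(1 + KB) / h0^2 <= C" "fine.KS Q a0 <= C"
 proof -
  have "0 <= (1 + KB) / h0^2" using KB0 by simp
  thus "C > 0" "(1 + KB) / h0^2 <= C" "fine.KS Q a0 <= C" unfolding C_def by linarith+
 qed
 show ?thesis
 proof (intro exI[of _ C] conjI Cp allI impI)
  fix N x f u uh
  assume vd: "voronoi_delaunay N x" and au: "almost_uniform C0 C1 N x" and sc: "scvt N x" and f: "f \<in> H1_0"
   and u: "u \<in> sobolev 2 Int H1_0" and lap: "AE y in surf. - laplace_s u y = f y" and sol: "fv_solution N x f uh"
  interpret vd N x by unfold_locales (rule vd)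
  define h F G U where "h = mesh_size N x" and "F = sobolev_norm 1 f" and "G = sobolev_norm 2 u" and "U = (%i. uh (x i))"
  note ff = H1_0_facts[OF f, folded F_def]
  have uH: "u \<in> H1_0" using u by simp
  note uf = H1_0_facts(1,2)[OF uH]
  have wp: "(SI y. u y * ev (LB e) y) = - (SI y. f y * ev e y)" for e
   by (rule weak_poisson[OF u lap surf.sqi_integrable[OF ff(1)]])
  have Ueq: "Bh U v = (SI y. f y * vh v y)" for v unfolding U_def by (rule fv_system[OF sol ff(1,2)])
  have fe: "uh \<in> fe_space N x" using sol by (simp add: fv_solution_def)
  have uhJ: "uh y = Jf U y" if "y \<in> S2" for y using fe_space_Jf[OF fe, of y] that by (simp add: U_def)
  have "(SI y. Jf U y) = (SI y. uh y)" using uhJ by (intro LI_cong) auto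
  hence J0: "(SI y. Jf U y) = 0" using fe by (simp add: fe_space_def zero_mean_def)
  have L: "L2_norm (%y. u y - uh y) = nrm surf (%y. u y - Jf U y)"
   unfolding L2_norm_nrm nrm_def using uhJ by (intro arg_cong[of _ _ sqrt] LI_cong) auto
  have F0: "0 <= F" using ff(3) nrm_nonneg[of surf f] by linarith
  have "0 <= (SUM m:UNIV. (sobolev_norm 1 (%y. grad_s u y $ m))^2)" by (intro sum_nonneg) (rule zero_le_power2)
  hence "nrm surf u <= sobolev_norm (Suc 1) u" unfolding sobolev_norm.simps(2)[of 1] L2_norm_nrm by (intro real_le_rsqrt) simp
  hence G0: "nrm surf u <= G" by (simp add: G_def numeral_2_eq_2)
  hence G00: "0 <= G" using nrm_nonneg[of surf u] by linarith
  have hp: "h > 0" unfolding h_def by (rule mesh_pos)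
  have len: "h / C0 <= curve_length (voronoi_edge N x i j)" if "i \<in> I" "j \<in> neighbors N x i" for i j
   using au that by (auto simp: almost_uniform_def Let_def h_def I_def)
  have ar: "h^2 / C1 <= area (voronoi_cell N x i)" if "i \<in> I" for i
   using au that by (auto simp: almost_uniform_def Let_def h_def I_def)
  have "nrm surf (%y. u y - Jf U y) <= C * h^2 * (G + F)"
  proof (cases "h <= h0")
   case True
   have hC: "h <= C1" "h <= 1 / (100 * Q^2)" using True by (auto simp: h0_def)
   have hQ: "100 * Q^2 * h <= 1" using hC(2) Q1 by (simp add: field_simps)
   have QQ: "Q <= Q^2" "1 <= Q^2" using Q1 by (simp_all add: self_le_power one_le_power)
   have D: "2 * h^2 <= Q * Dt t" if t: "t \<in> delaunay N x" for t
   proof -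
    have "(ka * h) ^ 3 <= 2 * h * Dt t"
    proof (rule Dt_ge[OF t])
     fix i j assume ij: "i \<in> t" "j \<in> t" "i ~= j"
     have "i \<in> I" "j \<in> I" using T_sub[OF t] ij by auto
     thus "ka * h <= dd i j"
      using scvt_neighbor_distance[OF sc, of i j C1] ar hC(1) assms(2) ij(3) by (simp add: ka_def h_def)
    next
     fix i assume "i \<in> t" thus "norm (tn t - x i) <= h" unfolding h_def using W_mesh[OF T_sub[OF t] tn_W[OF t]] by blast
    qed (use k0 hp in simp)
    hence "(ka ^ 3 * h^2) * h <= (2 * Dt t) * h" by (simp add: power_mult_distrib power2_eq_square power3_eq_cube mult_ac)
    hence "ka ^ 3 * h^2 <= 2 * Dt t" using hp by simp
    hence "2 * h^2 <= (4 / ka ^ 3) * Dt t" using k0 by (simp add: field_simps)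
    also have "... <= Q * Dt t" using Dt_pos[OF t] by (intro mult_right_mono) (auto simp: Q_def)
    finally show ?thesis .
   qed
   interpret fine N x h Q a0
   proof unfold_locales
    show "h <= 1 / 100" using mult_right_mono[OF QQ(2), of h] hQ hp unfolding mult.assoc mult_1 by linarith
    show "!!i y. i \<in> I ==> y \<in> W i ==> norm (y - x i) <= h" unfolding h_def by (rule W_mesh)
    show "!!i. i \<in> I ==> a0 * h^2 <= area (voronoi_cell N x i)" using ar by (simp add: a0_def)
    show "0 < a0" using assms by (simp add: a0_def)
   qed (use hp Q1 D scvt_centroid[OF sc] in auto)
   have "216 * Q ^ 4 * h^2 <= (100 * Q^2 * h)^2" by (simp add: power_mult_distrib)
   also have "... <= 1" using hQ hp by (intro power_le_one) auto
   finally have s1: "216 * Q ^ 4 * h^2 <= 1" .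
   have "15 * (Q * h) <= 100 * (Q^2 * h)" using mult_right_mono[OF QQ(1), of h] hp Q1 by simp
   hence s2: "15 * (Q * h) <= 1" using hQ unfolding mult.assoc by linarith
   have "nrm surf (%y. u y - Jf U y) <= KS * h^2 * F"
    by (rule fine_error[OF ff Ueq s1 s2 uf wp J0])
   also have "... <= C * h^2 * (G + F)" using C2(2) Cp F0 G00 by (intro mult_mono) auto
   finally show ?thesis .
  next
   case False
   hence hh: "h0 < h" by simp
   have q: "h0^2 <= h^2" using hh h00 by (intro power_mono) auto
   have "real N * (h^2 / C1) <= 24" by (rule card_bound[OF ar])
   hence "real N <= 24 * C1 / h^2" using hp assms by (simp add: field_simps)
   also have "... <= 24 * C1 / h0^2" using q h00 hp assms by (intro divide_left_mono) auto
   finally have N: "(real N)^2 <= (24 * C1 / h0^2)^2" by (intro power_mono) auto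
   have "nrm surf (Jf U) <= 100 * (real N)^2 * C0 / h * F"
    unfolding U_def by (rule coarse_bound[OF ff(1,3) Ueq[unfolded U_def] J0[unfolded U_def] assms(1) len hp])
   also have "... <= KB * F" unfolding KB_def using N assms hh h00 F0 by (intro mult_right_mono frac_le mult_left_mono) auto
   finally have "nrm surf (%y. u y - Jf U y) <= G + KB * F" using nrm_diff[OF uf(1) sqi_Jf, of U] G0 by linarith
   also have "... <= (1 + KB) * (G + F)" using KB0 G00 F0 by (simp add: algebra_simps)
   also have "... = (1 + KB) * (G + F) * 1" by simp
   also have "... <= (1 + KB) * (G + F) * (h^2 / h0^2)" using q h00 KB0 G00 F0 by (intro mult_left_mono) auto
   also have "... = (1 + KB) / h0^2 * h^2 * (G + F)" by simp
   also have "... <= C * h^2 * (G + F)" using C2(1) G00 F0 by (intro mult_right_mono) auto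
   finally show ?thesis .
  qed
  thus "L2_norm (%y. u y - uh y) <= C * (mesh_size N x)^2 * (sobolev_norm 2 u + sobolev_norm 1 f)"
   unfolding L h_def G_def F_def .
 qed
qed

end
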